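(* Let $(\mathcal{C},J)$ be a site such that the topology $J$ is precanonical. Then there is an equivalence of 2-categories $$\mathbf{St}(\mathcal{C})\simeq\mathbf{Ho}\bigl(\mathbf{PreSt}(\mathcal{C})\bigr),$$ where the homotopy 2-category is formed with respect to the local weak equivalences.
   Context: The Axiom of Choice is assumed. $\mathcal{C}$ is a small category with finite limits and $J$ is a Grothendieck topology on it; a cover of $U$ is a covering sieve $\mathcal{S}=(f_\alpha\colon U_\alpha\to U)_\alpha$ in $J(U)$. Precanonical means that every representable presheaf is a sheaf. $[\mathcal{C}^{\mathrm{op}},\mathbf{Cat}]_{\mathrm{ps}}$ is the 2-category of pseudofunctors $\mathcal{C}^{\mathrm{op}}\to\mathbf{Cat}$, pseudonatural transformations and modifications. For such $F$, $x\in F(U)$ and $f\colon V\to U$, write $x|_V=F(f)(x)$, and $x|_\alpha$ for $x|_{U_\alpha}$. $F$ is a stack if for every $U$ and every cover $\mathcal{S}=(f_\alpha\colon U_\alpha\to U)_\alpha$ of $U$ the canonical functor $F(U)\to\varprojlim_\alpha F(U_\alpha)$ is an equivalence of categories, where $\varprojlim_\alpha$ is the pseudolimit (i.e. the category of descent data for $F$ along $\mathcal{S}$; equivalently the category of pseudonatural transformations $\hat{\mathcal{S}}\to F$, with $\hat{\mathcal{S}}$ the subfunctor of the representable $yU$ given by $\mathcal{S}$). $F$ is a prestack if for all $U$ and $a,b\in F(U)$ the presheaf $(V\to U)\mapsto\mathrm{Hom}_{F(V)}(a|_V,b|_V)$ on $\mathcal{C}/U$ is a sheaf. Every stack is a prestack.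 $\mathbf{St}(\mathcal{C})$ and $\mathbf{PreSt}(\mathcal{C})$ are the full sub-2-categories of $[\mathcal{C}^{\mathrm{op}},\mathbf{Cat}]_{\mathrm{ps}}$ on stacks and prestacks. A map $h\colon A\to B$ of prestacks is a local weak equivalence if each $h_U\colon A(U)\to B(U)$ is full and faithful and, for every $U$ and $b\in B(U)$, there are a cover $(f_\alpha\colon U_\alpha\to U)$ of $U$ and, for each $\alpha$, an object $\tilde b_\alpha\in A(U_\alpha)$ and an isomorphism $h(\tilde b_\alpha)\to b|_\alpha$. Let $\mathfrak{W}$ be the class of local weak equivalences. An object $C$ of $\mathbf{PreSt}(\mathcal{C})$ is fibrant if for all $f\colon A\to B$ in $\mathfrak{W}$ and all $h\colon A\to C$ in $\mathbf{PreSt}(\mathcal{C})$ there exist $l\colon B\to C$ and an invertible 2-cell $h\Rightarrow l\circ f$. $\mathbf{Ho}(\mathbf{PreSt}(\mathcal{C}))$ is the full sub-2-category of $\mathbf{PreSt}(\mathcal{C})$ on the fibrant objects. *)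

theory Defs
  imports "HOL-Library.FuncSet" "HOL-Library.Equipollence"
begin

section \<open>Categories, functors and natural transformations\<close>

text \<open>
  Composition is written in the usual order: \<open>g \<cdot>\<^bsub>A\<^esub> f\<close> is \<open>g\<close> after \<open>f\<close>. The operations of a
  category are only constrained on its objects and (composable) arrows. Functors, natural
  transformations, pseudonatural transformations and modifications know their domain and codomain
  and are extensional, so that the unit and associativity laws below hold as equations. Categories and
  pseudofunctors are not normalised off their carriers, which only adds isomorphic copies.
\<close>

record ('o, 'm) cat =
  Obj :: "'o set"
  Arr :: "'m set"
  Dom :: "'m \<Rightarrow> 'o"
  Cod :: "'m \<Rightarrow> 'o"
  Ident :: "'o \<Rightarrow> 'm"
  Comp :: "'m \<Rightarrow> 'm \<Rightarrow> 'm"  (infixl \<open>\<cdot>\<index>\<close> 70)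

locale category =
  fixes A :: "('o, 'm) cat" (structure)
  assumes Dom_in: "f \<in> Arr A \<Longrightarrow> Dom A f \<in> Obj A"
    and Cod_in: "f \<in> Arr A \<Longrightarrow> Cod A f \<in> Obj A"
    and Ident_in: "x \<in> Obj A \<Longrightarrow> Ident A x \<in> Arr A"
    and Dom_Ident: "x \<in> Obj A \<Longrightarrow> Dom A (Ident A x) = x"
    and Cod_Ident: "x \<in> Obj A \<Longrightarrow> Cod A (Ident A x) = x"
    and Comp_in: "\<lbrakk>f \<in> Arr A; g \<in> Arr A; Cod A f = Dom A g\<rbrakk> \<Longrightarrow> g \<cdot> f \<in> Arr A"
    and Dom_Comp: "\<lbrakk>f \<in> Arr A; g \<in> Arr A; Cod A f = Dom A g\<rbrakk> \<Longrightarrow> Dom A (g \<cdot> f) = Dom A f"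
    and Cod_Comp: "\<lbrakk>f \<in> Arr A; g \<in> Arr A; Cod A f = Dom A g\<rbrakk> \<Longrightarrow> Cod A (g \<cdot> f) = Cod A g"
    and Comp_Ident_left: "f \<in> Arr A \<Longrightarrow> Ident A (Cod A f) \<cdot> f = f"
    and Comp_Ident_right: "f \<in> Arr A \<Longrightarrow> f \<cdot> Ident A (Dom A f) = f"
    and Comp_assoc:
      "\<lbrakk>f \<in> Arr A; g \<in> Arr A; h \<in> Arr A; Cod A f = Dom A g; Cod A g = Dom A h\<rbrakk>
        \<Longrightarrow> (h \<cdot> g) \<cdot> f = h \<cdot> (g \<cdot> f)"

definition hom :: "('o, 'm) cat \<Rightarrow> 'o \<Rightarrow> 'o \<Rightarrow> 'm set" where
  "hom A x y = {f \<in> Arr A. Dom A f = x \<and> Cod A f = y}"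

definition inverse_arrs :: "('o, 'm) cat \<Rightarrow> 'm \<Rightarrow> 'm \<Rightarrow> bool" where
  "inverse_arrs A f g \<longleftrightarrow> f \<in> Arr A \<and> g \<in> hom A (Cod A f) (Dom A f) \<and>
     g \<cdot>\<^bsub>A\<^esub> f = Ident A (Dom A f) \<and> f \<cdot>\<^bsub>A\<^esub> g = Ident A (Cod A f)"

definition iso_arr :: "('o, 'm) cat \<Rightarrow> 'm \<Rightarrow> bool" where
  "iso_arr A f \<longleftrightarrow> (\<exists>g. inverse_arrs A f g)"

definition inv_arr :: "('o, 'm) cat \<Rightarrow> 'm \<Rightarrow> 'm" where
  "inv_arr A f = (THE g. inverse_arrs A f g)"

definition op_cat :: "('o, 'm) cat \<Rightarrow> ('o, 'm) cat" where
  "op_cat A = \<lparr>Obj = Obj A, Arr = Arr A, Dom = Cod A, Cod = Dom A, Ident = Ident A,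
     Comp = (\<lambda>g f. f \<cdot>\<^bsub>A\<^esub> g)\<rparr>"

record ('o, 'm, 'p, 'n) func =
  FDom :: "('o, 'm) cat"
  FCod :: "('p, 'n) cat"
  FObj :: "'o \<Rightarrow> 'p"
  FArr :: "'m \<Rightarrow> 'n"

definition is_functor :: "('o, 'm, 'p, 'n) func \<Rightarrow> bool" where
  "is_functor F \<longleftrightarrow> (let A = FDom F; B = FCod F in
     category A \<and> category B \<and>
     FObj F \<in> Obj A \<rightarrow>\<^sub>E Obj B \<and>
     FArr F \<in> Arr A \<rightarrow>\<^sub>E Arr B \<and>
     (\<forall>f\<in>Arr A. Dom B (FArr F f) = FObj F (Dom A f) \<and> Cod B (FArr F f) = FObj F (Cod A f)) \<and>
     (\<forall>x\<in>Obj A. FArr F (Ident A x) = Ident B (FObj F x)) \<and>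
     (\<forall>f\<in>Arr A. \<forall>g\<in>Arr A. Cod A f = Dom A g \<longrightarrow>
        FArr F (g \<cdot>\<^bsub>A\<^esub> f) = FArr F g \<cdot>\<^bsub>B\<^esub> FArr F f))"

definition id_func :: "('o, 'm) cat \<Rightarrow> ('o, 'm, 'o, 'm) func" where
  "id_func A = \<lparr>FDom = A, FCod = A,
     FObj = restrict (\<lambda>x. x) (Obj A), FArr = restrict (\<lambda>f. f) (Arr A)\<rparr>"

definition comp_func ::
  "('p, 'n, 'q, 'k) func \<Rightarrow> ('o, 'm, 'p, 'n) func \<Rightarrow> ('o, 'm, 'q, 'k) func" where
  "comp_func G F = \<lparr>FDom = FDom F, FCod = FCod G,
     FObj = restrict (\<lambda>x. FObj G (FObj F x)) (Obj (FDom F)),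
     FArr = restrict (\<lambda>f. FArr G (FArr F f)) (Arr (FDom F))\<rparr>"

record ('o, 'm, 'p, 'n) ntrans =
  NDom :: "('o, 'm, 'p, 'n) func"
  NCod :: "('o, 'm, 'p, 'n) func"
  NAt :: "'o \<Rightarrow> 'n"

definition is_ntrans :: "('o, 'm, 'p, 'n) ntrans \<Rightarrow> bool" where
  "is_ntrans \<alpha> \<longleftrightarrow> (let F = NDom \<alpha>; G = NCod \<alpha>; A = FDom F; B = FCod F in
     is_functor F \<and> is_functor G \<and> FDom G = A \<and> FCod G = B \<and>
     NAt \<alpha> \<in> extensional (Obj A) \<and>
     (\<forall>x\<in>Obj A. NAt \<alpha> x \<in> hom B (FObj F x) (FObj G x)) \<and>
     (\<forall>f\<in>Arr A. NAt \<alpha> (Cod A f) \<cdot>\<^bsub>B\<^esub> FArr F f = FArr G f \<cdot>\<^bsub>B\<^esub> NAt \<alpha> (Dom A f)))"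

definition nat_isomorphic :: "('o, 'm, 'p, 'n) func \<Rightarrow> ('o, 'm, 'p, 'n) func \<Rightarrow> bool" where
  "nat_isomorphic F G \<longleftrightarrow> (\<exists>\<alpha>. is_ntrans \<alpha> \<and> NDom \<alpha> = F \<and> NCod \<alpha> = G \<and>
     (\<forall>x\<in>Obj (FDom F). iso_arr (FCod F) (NAt \<alpha> x)))"

definition equivalence_functor :: "('o, 'm, 'p, 'n) func \<Rightarrow> bool" where
  "equivalence_functor F \<longleftrightarrow> is_functor F \<and>
     (\<exists>G. is_functor G \<and> FDom G = FCod F \<and> FCod G = FDom F \<and>
        nat_isomorphic (id_func (FDom F)) (comp_func G F) \<and>
        nat_isomorphic (comp_func F G) (id_func (FCod F)))"

definition fully_faithful :: "('o, 'm, 'p, 'n) func \<Rightarrow> bool" where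
  "fully_faithful F \<longleftrightarrow> is_functor F \<and>
     (\<forall>x\<in>Obj (FDom F). \<forall>y\<in>Obj (FDom F).
        bij_betw (FArr F) (hom (FDom F) x y) (hom (FCod F) (FObj F x) (FObj F y)))"


subsection \<open>Finite limits\<close>

definition is_cone ::
  "('i, 'j, 'o, 'm) func \<Rightarrow> 'o \<Rightarrow> ('i \<Rightarrow> 'm) \<Rightarrow> bool" where
  "is_cone D c p \<longleftrightarrow> c \<in> Obj (FCod D) \<and>
     (\<forall>i\<in>Obj (FDom D). p i \<in> hom (FCod D) c (FObj D i)) \<and>
     (\<forall>u\<in>Arr (FDom D). FArr D u \<cdot>\<^bsub>FCod D\<^esub> p (Dom (FDom D) u) = p (Cod (FDom D) u))"

definition is_limit ::
  "('i, 'j, 'o, 'm) func \<Rightarrow> 'o \<Rightarrow> ('i \<Rightarrow> 'm) \<Rightarrow> bool" where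
  "is_limit D c p \<longleftrightarrow> is_cone D c p \<and>
     (\<forall>c' p'. is_cone D c' p' \<longrightarrow>
        (\<exists>!u. u \<in> hom (FCod D) c' c \<and> (\<forall>i\<in>Obj (FDom D). p i \<cdot>\<^bsub>FCod D\<^esub> u = p' i)))"

text \<open>Every finite category is isomorphic to one whose objects and arrows are natural numbers.\<close>

definition has_finite_limits :: "('o, 'm) cat \<Rightarrow> bool" where
  "has_finite_limits C \<longleftrightarrow> (\<forall>D :: (nat, nat, 'o, 'm) func.
     is_functor D \<and> FCod D = C \<and> finite (Obj (FDom D)) \<and> finite (Arr (FDom D)) \<longrightarrow>
     (\<exists>c p. is_limit D c p))"


section \<open>Strict 2-categories\<close>

record ('o, 'm, 'c) twocat =
  Ob :: "'o set"
  Mor :: "'m set"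
  Cell :: "'c set"
  src :: "'m \<Rightarrow> 'o"
  tgt :: "'m \<Rightarrow> 'o"
  id1 :: "'o \<Rightarrow> 'm"
  comp1 :: "'m \<Rightarrow> 'm \<Rightarrow> 'm"  (infixl \<open>\<odot>\<index>\<close> 70)
  dom2 :: "'c \<Rightarrow> 'm"
  cod2 :: "'c \<Rightarrow> 'm"
  id2 :: "'m \<Rightarrow> 'c"
  vcomp :: "'c \<Rightarrow> 'c \<Rightarrow> 'c"  (infixl \<open>\<bullet>\<index>\<close> 68)
  hcomp :: "'c \<Rightarrow> 'c \<Rightarrow> 'c"  (infixl \<open>\<star>\<index>\<close> 70)

definition cat1 :: "('o, 'm, 'c) twocat \<Rightarrow> ('o, 'm) cat" where
  "cat1 K = \<lparr>Obj = Ob K, Arr = Mor K, Dom = src K, Cod = tgt K, Ident = id1 K, Comp = comp1 K\<rparr>"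

definition vcat :: "('o, 'm, 'c) twocat \<Rightarrow> ('m, 'c) cat" where
  "vcat K = \<lparr>Obj = Mor K, Arr = Cell K, Dom = dom2 K, Cod = cod2 K, Ident = id2 K,
     Comp = vcomp K\<rparr>"

definition hcat :: "('o, 'm, 'c) twocat \<Rightarrow> ('o, 'c) cat" where
  "hcat K = \<lparr>Obj = Ob K, Arr = Cell K, Dom = (\<lambda>\<alpha>. src K (dom2 K \<alpha>)),
     Cod = (\<lambda>\<alpha>. tgt K (dom2 K \<alpha>)), Ident = (\<lambda>x. id2 K (id1 K x)), Comp = hcomp K\<rparr>"

locale two_category =
  fixes K :: "('o, 'm, 'c) twocat" (structure)
  assumes category_cat1: "category (cat1 K)"
    and category_vcat: "category (vcat K)"
    and category_hcat: "category (hcat K)"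
    and src_cod2: "\<alpha> \<in> Cell K \<Longrightarrow> src K (cod2 K \<alpha>) = src K (dom2 K \<alpha>)"
    and tgt_cod2: "\<alpha> \<in> Cell K \<Longrightarrow> tgt K (cod2 K \<alpha>) = tgt K (dom2 K \<alpha>)"
    and dom2_hcomp: "\<lbrakk>\<alpha> \<in> Cell K; \<beta> \<in> Cell K; tgt K (dom2 K \<alpha>) = src K (dom2 K \<beta>)\<rbrakk>
        \<Longrightarrow> dom2 K (\<beta> \<star> \<alpha>) = dom2 K \<beta> \<odot> dom2 K \<alpha>"
    and cod2_hcomp: "\<lbrakk>\<alpha> \<in> Cell K; \<beta> \<in> Cell K; tgt K (dom2 K \<alpha>) = src K (dom2 K \<beta>)\<rbrakk>
        \<Longrightarrow> cod2 K (\<beta> \<star> \<alpha>) = cod2 K \<beta> \<odot> cod2 K \<alpha>"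
    and hcomp_id2: "\<lbrakk>f \<in> Mor K; g \<in> Mor K; tgt K f = src K g\<rbrakk>
        \<Longrightarrow> id2 K g \<star> id2 K f = id2 K (g \<odot> f)"
    and interchange:
      "\<lbrakk>\<alpha> \<in> Cell K; \<alpha>' \<in> Cell K; \<beta> \<in> Cell K; \<beta>' \<in> Cell K;
        cod2 K \<alpha> = dom2 K \<alpha>'; cod2 K \<beta> = dom2 K \<beta>'; tgt K (dom2 K \<alpha>) = src K (dom2 K \<beta>)\<rbrakk>
        \<Longrightarrow> (\<beta>' \<bullet> \<beta>) \<star> (\<alpha>' \<bullet> \<alpha>) = (\<beta>' \<star> \<alpha>') \<bullet> (\<beta> \<star> \<alpha>)"

definition invertible_cell :: "('o, 'm, 'c) twocat \<Rightarrow> 'c \<Rightarrow> bool" where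
  "invertible_cell K \<alpha> \<longleftrightarrow> iso_arr (vcat K) \<alpha>"

definition isomorphic_mors :: "('o, 'm, 'c) twocat \<Rightarrow> 'm \<Rightarrow> 'm \<Rightarrow> bool" where
  "isomorphic_mors K f g \<longleftrightarrow>
     (\<exists>\<alpha>\<in>Cell K. dom2 K \<alpha> = f \<and> cod2 K \<alpha> = g \<and> invertible_cell K \<alpha>)"

definition equivalent_obs :: "('o, 'm, 'c) twocat \<Rightarrow> 'o \<Rightarrow> 'o \<Rightarrow> bool" where
  "equivalent_obs K x y \<longleftrightarrow> (\<exists>f g. f \<in> hom (cat1 K) x y \<and> g \<in> hom (cat1 K) y x \<and>
     isomorphic_mors K (id1 K x) (g \<odot>\<^bsub>K\<^esub> f) \<and> isomorphic_mors K (f \<odot>\<^bsub>K\<^esub> g) (id1 K y))"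

definition full_sub :: "('o, 'm, 'c) twocat \<Rightarrow> 'o set \<Rightarrow> ('o, 'm, 'c) twocat" where
  "full_sub K X = K\<lparr>Ob := Ob K \<inter> X,
     Mor := {f \<in> Mor K. src K f \<in> X \<and> tgt K f \<in> X},
     Cell := {\<alpha> \<in> Cell K. src K (dom2 K \<alpha>) \<in> X \<and> tgt K (dom2 K \<alpha>) \<in> X}\<rparr>"

definition locally_discrete :: "('o, 'm) cat \<Rightarrow> ('o, 'm, 'm) twocat" where
  "locally_discrete A = \<lparr>Ob = Obj A, Mor = Arr A, Cell = Arr A, src = Dom A, tgt = Cod A,
     id1 = Ident A, comp1 = Comp A, dom2 = (\<lambda>f. f), cod2 = (\<lambda>f. f), id2 = (\<lambda>f. f),
     vcomp = (\<lambda>g f. f), hcomp = Comp A\<rparr>"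

text \<open>
  The 2-category of small categories, relative to a notion of smallness for sets of elements of
  the type \<open>'u\<close>. The only closure property required of it is the one below; it holds when every
  set is small, and for the sets of cardinality below a given (for instance inaccessible) cardinal.
\<close>

definition smallness :: "('u set \<Rightarrow> bool) \<Rightarrow> bool" where
  "smallness small \<longleftrightarrow> (\<forall>X Y. small X \<and> Y \<lesssim> X \<longrightarrow> small Y)"

definition small_category :: "('u set \<Rightarrow> bool) \<Rightarrow> ('u, 'u) cat \<Rightarrow> bool" where
  "small_category small A \<longleftrightarrow> category A \<and> small (Obj A) \<and> small (Arr A)"

definition CAT ::
  "('u set \<Rightarrow> bool) \<Rightarrow>
   (('u, 'u) cat, ('u, 'u, 'u, 'u) func, ('u, 'u, 'u, 'u) ntrans) twocat" where
  "CAT small = \<lparr>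
     Ob = {A. small_category small A},
     Mor = {F. is_functor F \<and> small_category small (FDom F) \<and> small_category small (FCod F)},
     Cell = {\<alpha>. is_ntrans \<alpha> \<and> small_category small (FDom (NDom \<alpha>)) \<and>
       small_category small (FCod (NDom \<alpha>))},
     src = FDom, tgt = FCod, id1 = id_func, comp1 = comp_func,
     dom2 = NDom, cod2 = NCod,
     id2 = (\<lambda>F. \<lparr>NDom = F, NCod = F,
       NAt = restrict (\<lambda>x. Ident (FCod F) (FObj F x)) (Obj (FDom F))\<rparr>),
     vcomp = (\<lambda>\<beta> \<alpha>. \<lparr>NDom = NDom \<alpha>, NCod = NCod \<beta>,
       NAt = restrict (\<lambda>x. NAt \<beta> x \<cdot>\<^bsub>FCod (NDom \<alpha>)\<^esub> NAt \<alpha> x) (Obj (FDom (NDom \<alpha>)))\<rparr>),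
     hcomp = (\<lambda>\<beta> \<alpha>. \<lparr>NDom = comp_func (NDom \<beta>) (NDom \<alpha>), NCod = comp_func (NCod \<beta>) (NCod \<alpha>),
       NAt = restrict (\<lambda>x. NAt \<beta> (FObj (NCod \<alpha>) x) \<cdot>\<^bsub>FCod (NDom \<beta>)\<^esub> FArr (NDom \<beta>) (NAt \<alpha> x))
         (Obj (FDom (NDom \<alpha>)))\<rparr>)\<rparr>"


section \<open>Pseudofunctors, pseudonatural transformations, modifications\<close>

text \<open>
  \<open>PComp P g f\<close> is the invertible 2-cell from \<open>P g \<odot> P f\<close> to \<open>P (g \<odot> f)\<close> and \<open>PUnit P x\<close> the one
  from the identity of \<open>P x\<close> to \<open>P (id1 x)\<close>.
\<close>

record ('o, 'm, 'c, 'p, 'n, 'd) psfun =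
  PObj :: "'o \<Rightarrow> 'p"
  PMor :: "'m \<Rightarrow> 'n"
  PCell :: "'c \<Rightarrow> 'd"
  PComp :: "'m \<Rightarrow> 'm \<Rightarrow> 'd"
  PUnit :: "'o \<Rightarrow> 'd"

locale pseudofunctor =
  fixes K :: "('o, 'm, 'c) twocat"
    and L :: "('p, 'n, 'd) twocat"
    and P :: "('o, 'm, 'c, 'p, 'n, 'd) psfun"
  assumes PObj_in: "x \<in> Ob K \<Longrightarrow> PObj P x \<in> Ob L"
    and PMor_in: "f \<in> Mor K \<Longrightarrow> PMor P f \<in> hom (cat1 L) (PObj P (src K f)) (PObj P (tgt K f))"
    and PCell_in: "\<alpha> \<in> Cell K \<Longrightarrow>
        PCell P \<alpha> \<in> hom (vcat L) (PMor P (dom2 K \<alpha>)) (PMor P (cod2 K \<alpha>))"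
    and PCell_id2: "f \<in> Mor K \<Longrightarrow> PCell P (id2 K f) = id2 L (PMor P f)"
    and PCell_vcomp: "\<lbrakk>\<alpha> \<in> Cell K; \<beta> \<in> Cell K; cod2 K \<alpha> = dom2 K \<beta>\<rbrakk>
        \<Longrightarrow> PCell P (\<beta> \<bullet>\<^bsub>K\<^esub> \<alpha>) = PCell P \<beta> \<bullet>\<^bsub>L\<^esub> PCell P \<alpha>"
    and PComp_in: "\<lbrakk>f \<in> Mor K; g \<in> Mor K; tgt K f = src K g\<rbrakk>
        \<Longrightarrow> PComp P g f \<in> hom (vcat L) (PMor P g \<odot>\<^bsub>L\<^esub> PMor P f) (PMor P (g \<odot>\<^bsub>K\<^esub> f))"
    and PComp_invertible: "\<lbrakk>f \<in> Mor K; g \<in> Mor K; tgt K f = src K g\<rbrakk>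
        \<Longrightarrow> invertible_cell L (PComp P g f)"
    and PUnit_in: "x \<in> Ob K \<Longrightarrow>
        PUnit P x \<in> hom (vcat L) (id1 L (PObj P x)) (PMor P (id1 K x))"
    and PUnit_invertible: "x \<in> Ob K \<Longrightarrow> invertible_cell L (PUnit P x)"
    and PComp_natural:
      "\<lbrakk>\<alpha> \<in> Cell K; \<beta> \<in> Cell K; tgt K (dom2 K \<alpha>) = src K (dom2 K \<beta>)\<rbrakk>
        \<Longrightarrow> PComp P (cod2 K \<beta>) (cod2 K \<alpha>) \<bullet>\<^bsub>L\<^esub> (PCell P \<beta> \<star>\<^bsub>L\<^esub> PCell P \<alpha>) =
            PCell P (\<beta> \<star>\<^bsub>K\<^esub> \<alpha>) \<bullet>\<^bsub>L\<^esub> PComp P (dom2 K \<beta>) (dom2 K \<alpha>)"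
    and PComp_assoc:
      "\<lbrakk>f \<in> Mor K; g \<in> Mor K; h \<in> Mor K; tgt K f = src K g; tgt K g = src K h\<rbrakk>
        \<Longrightarrow> PComp P h (g \<odot>\<^bsub>K\<^esub> f) \<bullet>\<^bsub>L\<^esub> (id2 L (PMor P h) \<star>\<^bsub>L\<^esub> PComp P g f) =
            PComp P (h \<odot>\<^bsub>K\<^esub> g) f \<bullet>\<^bsub>L\<^esub> (PComp P h g \<star>\<^bsub>L\<^esub> id2 L (PMor P f))"
    and PComp_unit_right: "f \<in> Mor K \<Longrightarrow>
        PComp P f (id1 K (src K f)) \<bullet>\<^bsub>L\<^esub> (id2 L (PMor P f) \<star>\<^bsub>L\<^esub> PUnit P (src K f)) =
        id2 L (PMor P f)"
    and PComp_unit_left: "f \<in> Mor K \<Longrightarrow>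
        PComp P (id1 K (tgt K f)) f \<bullet>\<^bsub>L\<^esub> (PUnit P (tgt K f) \<star>\<^bsub>L\<^esub> id2 L (PMor P f)) =
        id2 L (PMor P f)"

definition id_psfun :: "('o, 'm, 'c) twocat \<Rightarrow> ('o, 'm, 'c, 'o, 'm, 'c) psfun" where
  "id_psfun K = \<lparr>PObj = (\<lambda>x. x), PMor = (\<lambda>f. f), PCell = (\<lambda>\<alpha>. \<alpha>),
     PComp = (\<lambda>g f. id2 K (g \<odot>\<^bsub>K\<^esub> f)), PUnit = (\<lambda>x. id2 K (id1 K x))\<rparr>"

definition comp_psfun ::
  "('q, 'k, 'e) twocat \<Rightarrow> ('p, 'n, 'd, 'q, 'k, 'e) psfun \<Rightarrow> ('o, 'm, 'c, 'p, 'n, 'd) psfun \<Rightarrow>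
   ('o, 'm, 'c, 'q, 'k, 'e) psfun" where
  "comp_psfun M Q P = \<lparr>
     PObj = (\<lambda>x. PObj Q (PObj P x)),
     PMor = (\<lambda>f. PMor Q (PMor P f)),
     PCell = (\<lambda>\<alpha>. PCell Q (PCell P \<alpha>)),
     PComp = (\<lambda>g f. PCell Q (PComp P g f) \<bullet>\<^bsub>M\<^esub> PComp Q (PMor P g) (PMor P f)),
     PUnit = (\<lambda>x. PCell Q (PUnit P x) \<bullet>\<^bsub>M\<^esub> PUnit Q (PObj P x))\<rparr>"

text \<open>\<open>TCell \<sigma> f\<close> is the invertible 2-cell from \<open>Q f \<odot> \<sigma> x\<close> to \<open>\<sigma> y \<odot> P f\<close>, for \<open>f\<close> from \<open>x\<close> to \<open>y\<close>.\<close>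

record ('o, 'm, 'c, 'p, 'n, 'd) psnat =
  TDom :: "('o, 'm, 'c, 'p, 'n, 'd) psfun"
  TCod :: "('o, 'm, 'c, 'p, 'n, 'd) psfun"
  TAt :: "'o \<Rightarrow> 'n"
  TCell :: "'m \<Rightarrow> 'd"

locale pseudonatural =
  fixes K :: "('o, 'm, 'c) twocat"
    and L :: "('p, 'n, 'd) twocat"
    and \<sigma> :: "('o, 'm, 'c, 'p, 'n, 'd) psnat"
  assumes pseudofunctor_TDom: "pseudofunctor K L (TDom \<sigma>)"
    and pseudofunctor_TCod: "pseudofunctor K L (TCod \<sigma>)"
    and TAt_ext: "TAt \<sigma> \<in> extensional (Ob K)"
    and TCell_ext: "TCell \<sigma> \<in> extensional (Mor K)"
    and TAt_in: "x \<in> Ob K \<Longrightarrow> TAt \<sigma> x \<in> hom (cat1 L) (PObj (TDom \<sigma>) x) (PObj (TCod \<sigma>) x)"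
    and TCell_in: "f \<in> Mor K \<Longrightarrow> TCell \<sigma> f \<in> hom (vcat L)
        (PMor (TCod \<sigma>) f \<odot>\<^bsub>L\<^esub> TAt \<sigma> (src K f)) (TAt \<sigma> (tgt K f) \<odot>\<^bsub>L\<^esub> PMor (TDom \<sigma>) f)"
    and TCell_invertible: "f \<in> Mor K \<Longrightarrow> invertible_cell L (TCell \<sigma> f)"
    and TCell_natural: "\<alpha> \<in> Cell K \<Longrightarrow>
        TCell \<sigma> (cod2 K \<alpha>) \<bullet>\<^bsub>L\<^esub> (PCell (TCod \<sigma>) \<alpha> \<star>\<^bsub>L\<^esub> id2 L (TAt \<sigma> (src K (dom2 K \<alpha>)))) =
        (id2 L (TAt \<sigma> (tgt K (dom2 K \<alpha>))) \<star>\<^bsub>L\<^esub> PCell (TDom \<sigma>) \<alpha>) \<bullet>\<^bsub>L\<^esub> TCell \<sigma> (dom2 K \<alpha>)"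
    and TCell_comp: "\<lbrakk>f \<in> Mor K; g \<in> Mor K; tgt K f = src K g\<rbrakk> \<Longrightarrow>
        TCell \<sigma> (g \<odot>\<^bsub>K\<^esub> f) \<bullet>\<^bsub>L\<^esub> (PComp (TCod \<sigma>) g f \<star>\<^bsub>L\<^esub> id2 L (TAt \<sigma> (src K f))) =
        (id2 L (TAt \<sigma> (tgt K g)) \<star>\<^bsub>L\<^esub> PComp (TDom \<sigma>) g f) \<bullet>\<^bsub>L\<^esub>
        (TCell \<sigma> g \<star>\<^bsub>L\<^esub> id2 L (PMor (TDom \<sigma>) f)) \<bullet>\<^bsub>L\<^esub>
        (id2 L (PMor (TCod \<sigma>) g) \<star>\<^bsub>L\<^esub> TCell \<sigma> f)"
    and TCell_unit: "x \<in> Ob K \<Longrightarrow>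
        TCell \<sigma> (id1 K x) \<bullet>\<^bsub>L\<^esub> (PUnit (TCod \<sigma>) x \<star>\<^bsub>L\<^esub> id2 L (TAt \<sigma> x)) =
        id2 L (TAt \<sigma> x) \<star>\<^bsub>L\<^esub> PUnit (TDom \<sigma>) x"

record ('o, 'm, 'c, 'p, 'n, 'd) modif =
  MDom :: "('o, 'm, 'c, 'p, 'n, 'd) psnat"
  MCod :: "('o, 'm, 'c, 'p, 'n, 'd) psnat"
  MAt :: "'o \<Rightarrow> 'd"

locale modification =
  fixes K :: "('o, 'm, 'c) twocat"
    and L :: "('p, 'n, 'd) twocat"
    and \<Gamma> :: "('o, 'm, 'c, 'p, 'n, 'd) modif"
  assumes pseudonatural_MDom: "pseudonatural K L (MDom \<Gamma>)"
    and pseudonatural_MCod: "pseudonatural K L (MCod \<Gamma>)"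
    and TDom_MCod: "TDom (MCod \<Gamma>) = TDom (MDom \<Gamma>)"
    and TCod_MCod: "TCod (MCod \<Gamma>) = TCod (MDom \<Gamma>)"
    and MAt_ext: "MAt \<Gamma> \<in> extensional (Ob K)"
    and MAt_in: "x \<in> Ob K \<Longrightarrow> MAt \<Gamma> x \<in> hom (vcat L) (TAt (MDom \<Gamma>) x) (TAt (MCod \<Gamma>) x)"
    and MAt_natural: "f \<in> Mor K \<Longrightarrow>
        (MAt \<Gamma> (tgt K f) \<star>\<^bsub>L\<^esub> id2 L (PMor (TDom (MDom \<Gamma>)) f)) \<bullet>\<^bsub>L\<^esub> TCell (MDom \<Gamma>) f =
        TCell (MCod \<Gamma>) f \<bullet>\<^bsub>L\<^esub> (id2 L (PMor (TCod (MDom \<Gamma>)) f) \<star>\<^bsub>L\<^esub> MAt \<Gamma> (src K f))"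

definition id_psnat ::
  "('o, 'm, 'c) twocat \<Rightarrow> ('p, 'n, 'd) twocat \<Rightarrow> ('o, 'm, 'c, 'p, 'n, 'd) psfun \<Rightarrow>
   ('o, 'm, 'c, 'p, 'n, 'd) psnat" where
  "id_psnat K L P = \<lparr>TDom = P, TCod = P,
     TAt = restrict (\<lambda>x. id1 L (PObj P x)) (Ob K),
     TCell = restrict (\<lambda>f. id2 L (PMor P f)) (Mor K)\<rparr>"

definition comp_psnat ::
  "('o, 'm, 'c) twocat \<Rightarrow> ('p, 'n, 'd) twocat \<Rightarrow> ('o, 'm, 'c, 'p, 'n, 'd) psnat \<Rightarrow>
   ('o, 'm, 'c, 'p, 'n, 'd) psnat \<Rightarrow> ('o, 'm, 'c, 'p, 'n, 'd) psnat" where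
  "comp_psnat K L \<tau> \<sigma> = \<lparr>TDom = TDom \<sigma>, TCod = TCod \<tau>,
     TAt = restrict (\<lambda>x. TAt \<tau> x \<odot>\<^bsub>L\<^esub> TAt \<sigma> x) (Ob K),
     TCell = restrict (\<lambda>f. (id2 L (TAt \<tau> (tgt K f)) \<star>\<^bsub>L\<^esub> TCell \<sigma> f) \<bullet>\<^bsub>L\<^esub>
       (TCell \<tau> f \<star>\<^bsub>L\<^esub> id2 L (TAt \<sigma> (src K f)))) (Mor K)\<rparr>"

definition ps_twocat ::
  "('o, 'm, 'c) twocat \<Rightarrow> ('p, 'n, 'd) twocat \<Rightarrow>
   (('o, 'm, 'c, 'p, 'n, 'd) psfun, ('o, 'm, 'c, 'p, 'n, 'd) psnat,
    ('o, 'm, 'c, 'p, 'n, 'd) modif) twocat" where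
  "ps_twocat K L = \<lparr>
     Ob = {P. pseudofunctor K L P}, Mor = {\<sigma>. pseudonatural K L \<sigma>},
     Cell = {\<Gamma>. modification K L \<Gamma>},
     src = TDom, tgt = TCod, id1 = id_psnat K L, comp1 = comp_psnat K L,
     dom2 = MDom, cod2 = MCod,
     id2 = (\<lambda>\<sigma>. \<lparr>MDom = \<sigma>, MCod = \<sigma>, MAt = restrict (\<lambda>x. id2 L (TAt \<sigma> x)) (Ob K)\<rparr>),
     vcomp = (\<lambda>\<Delta> \<Gamma>. \<lparr>MDom = MDom \<Gamma>, MCod = MCod \<Delta>,
       MAt = restrict (\<lambda>x. MAt \<Delta> x \<bullet>\<^bsub>L\<^esub> MAt \<Gamma> x) (Ob K)\<rparr>),
     hcomp = (\<lambda>\<Delta> \<Gamma>. \<lparr>MDom = comp_psnat K L (MDom \<Delta>) (MDom \<Gamma>),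
       MCod = comp_psnat K L (MCod \<Delta>) (MCod \<Gamma>),
       MAt = restrict (\<lambda>x. MAt \<Delta> x \<star>\<^bsub>L\<^esub> MAt \<Gamma> x) (Ob K)\<rparr>)\<rparr>"

text \<open>
  Equivalence of 2-categories is taken in the weak sense (biequivalence): mutually inverse
  pseudofunctors, up to equivalence in the 2-categories of endo-pseudofunctors.
\<close>

definition equivalent_twocats :: "('o, 'm, 'c) twocat \<Rightarrow> ('p, 'n, 'd) twocat \<Rightarrow> bool" where
  "equivalent_twocats K L \<longleftrightarrow> two_category K \<and> two_category L \<and>
     (\<exists>\<Phi> \<Psi>. pseudofunctor K L \<Phi> \<and> pseudofunctor L K \<Psi> \<and>
        equivalent_obs (ps_twocat K K) (id_psfun K) (comp_psfun K \<Psi> \<Phi>) \<and>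
        equivalent_obs (ps_twocat L L) (comp_psfun L \<Phi> \<Psi>) (id_psfun L))"


section \<open>Sites and sheaves\<close>

definition sieve :: "('o, 'm) cat \<Rightarrow> 'o \<Rightarrow> 'm set \<Rightarrow> bool" where
  "sieve C U S \<longleftrightarrow> S \<subseteq> {f \<in> Arr C. Cod C f = U} \<and>
     (\<forall>f\<in>S. \<forall>g\<in>Arr C. Cod C g = Dom C f \<longrightarrow> f \<cdot>\<^bsub>C\<^esub> g \<in> S)"

definition pullback_sieve :: "('o, 'm) cat \<Rightarrow> 'm \<Rightarrow> 'm set \<Rightarrow> 'm set" where
  "pullback_sieve C f S = {g \<in> Arr C. Cod C g = Dom C f \<and> f \<cdot>\<^bsub>C\<^esub> g \<in> S}"

locale grothendieck_topology =
  fixes C :: "('o, 'm) cat" and J :: "'o \<Rightarrow> 'm set set"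
  assumes covers_sieve: "\<lbrakk>U \<in> Obj C; S \<in> J U\<rbrakk> \<Longrightarrow> sieve C U S"
    and covers_maximal: "U \<in> Obj C \<Longrightarrow> {f \<in> Arr C. Cod C f = U} \<in> J U"
    and covers_stable: "\<lbrakk>f \<in> Arr C; S \<in> J (Cod C f)\<rbrakk> \<Longrightarrow> pullback_sieve C f S \<in> J (Dom C f)"
    and covers_local: "\<lbrakk>U \<in> Obj C; S \<in> J U; sieve C U R;
        \<And>f. f \<in> S \<Longrightarrow> pullback_sieve C f R \<in> J (Dom C f)\<rbrakk> \<Longrightarrow> R \<in> J U"

record ('o, 'm, 'x) presheaf =
  Val :: "'o \<Rightarrow> 'x set"
  Res :: "'m \<Rightarrow> 'x \<Rightarrow> 'x"

definition is_presheaf :: "('o, 'm) cat \<Rightarrow> ('o, 'm, 'x) presheaf \<Rightarrow> bool" where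
  "is_presheaf C H \<longleftrightarrow>
     (\<forall>f\<in>Arr C. Res H f \<in> Val H (Cod C f) \<rightarrow> Val H (Dom C f)) \<and>
     (\<forall>U\<in>Obj C. \<forall>s\<in>Val H U. Res H (Ident C U) s = s) \<and>
     (\<forall>f\<in>Arr C. \<forall>g\<in>Arr C. Cod C g = Dom C f \<longrightarrow>
        (\<forall>s\<in>Val H (Cod C f). Res H (f \<cdot>\<^bsub>C\<^esub> g) s = Res H g (Res H f s)))"

definition matching_family ::
  "('o, 'm) cat \<Rightarrow> ('o, 'm, 'x) presheaf \<Rightarrow> 'm set \<Rightarrow> ('m \<Rightarrow> 'x) \<Rightarrow> bool" where
  "matching_family C H S s \<longleftrightarrow> (\<forall>f\<in>S. s f \<in> Val H (Dom C f)) \<and>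
     (\<forall>f\<in>S. \<forall>g\<in>Arr C. Cod C g = Dom C f \<longrightarrow> s (f \<cdot>\<^bsub>C\<^esub> g) = Res H g (s f))"

definition is_sheaf ::
  "('o, 'm) cat \<Rightarrow> ('o \<Rightarrow> 'm set set) \<Rightarrow> ('o, 'm, 'x) presheaf \<Rightarrow> bool" where
  "is_sheaf C J H \<longleftrightarrow> is_presheaf C H \<and>
     (\<forall>U\<in>Obj C. \<forall>S\<in>J U. \<forall>s. matching_family C H S s \<longrightarrow>
        (\<exists>!t. t \<in> Val H U \<and> (\<forall>f\<in>S. Res H f t = s f)))"

definition representable :: "('o, 'm) cat \<Rightarrow> 'o \<Rightarrow> ('o, 'm, 'm) presheaf" where
  "representable C U = \<lparr>Val = (\<lambda>V. hom C V U), Res = (\<lambda>g f. f \<cdot>\<^bsub>C\<^esub> g)\<rparr>"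

definition precanonical :: "('o, 'm) cat \<Rightarrow> ('o \<Rightarrow> 'm set set) \<Rightarrow> bool" where
  "precanonical C J \<longleftrightarrow> (\<forall>U\<in>Obj C. is_sheaf C J (representable C U))"

text \<open>
  An arrow of the slice category over \<open>U\<close> is a pair \<open>(f, g)\<close> of composable arrows with \<open>f\<close> into
  \<open>U\<close>, seen as the arrow \<open>g\<close> from \<open>f \<cdot> g\<close> to \<open>f\<close>. A sieve on \<open>f\<close> in the slice covers when its
  image under the forgetful functor covers the domain of \<open>f\<close>.
\<close>

definition slice :: "('o, 'm) cat \<Rightarrow> 'o \<Rightarrow> ('m, 'm \<times> 'm) cat" where
  "slice C U = \<lparr>Obj = {f \<in> Arr C. Cod C f = U},
     Arr = {(f, g). f \<in> Arr C \<and> g \<in> Arr C \<and> Cod C f = U \<and> Cod C g = Dom C f},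
     Dom = (\<lambda>(f, g). f \<cdot>\<^bsub>C\<^esub> g), Cod = fst, Ident = (\<lambda>f. (f, Ident C (Dom C f))),
     Comp = (\<lambda>(f, g) (f', g'). (f, g \<cdot>\<^bsub>C\<^esub> g'))\<rparr>"

definition slice_topology ::
  "('o, 'm) cat \<Rightarrow> ('o \<Rightarrow> 'm set set) \<Rightarrow> 'o \<Rightarrow> 'm \<Rightarrow> ('m \<times> 'm) set set" where
  "slice_topology C J U f = {T. sieve (slice C U) f T \<and> snd ` T \<in> J (Dom C f)}"


section \<open>Prestacks and stacks\<close>

type_synonym ('o, 'm, 'x, 'y) cat_psfun =
  "('o, 'm, 'm, ('x, 'y) cat, ('x, 'y, 'x, 'y) func, ('x, 'y, 'x, 'y) ntrans) psfun"

type_synonym ('o, 'm, 'x, 'y) cat_psnat =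
  "('o, 'm, 'm, ('x, 'y) cat, ('x, 'y, 'x, 'y) func, ('x, 'y, 'x, 'y) ntrans) psnat"

type_synonym ('o, 'm, 'x, 'y) cat_modif =
  "('o, 'm, 'm, ('x, 'y) cat, ('x, 'y, 'x, 'y) func, ('x, 'y, 'x, 'y) ntrans) modif"

definition ps_presheaves ::
  "('u set \<Rightarrow> bool) \<Rightarrow> ('o, 'm) cat \<Rightarrow>
   (('o, 'm, 'u, 'u) cat_psfun, ('o, 'm, 'u, 'u) cat_psnat, ('o, 'm, 'u, 'u) cat_modif) twocat"
  where "ps_presheaves small C = ps_twocat (locally_discrete (op_cat C)) (CAT small)"

text \<open>For a pseudofunctor \<open>F\<close> on the opposite of \<open>C\<close>, the restrictions of objects and arrows along
  \<open>f\<close>, and the isomorphism from the iterated restriction of \<open>x\<close> along \<open>f\<close> and \<open>g\<close> to the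
  restriction of \<open>x\<close> along \<open>f \<cdot> g\<close>.\<close>

abbreviation res_obj :: "('o, 'm, 'x, 'y) cat_psfun \<Rightarrow> 'm \<Rightarrow> 'x \<Rightarrow> 'x" where
  "res_obj F f x \<equiv> FObj (PMor F f) x"

abbreviation res_arr :: "('o, 'm, 'x, 'y) cat_psfun \<Rightarrow> 'm \<Rightarrow> 'y \<Rightarrow> 'y" where
  "res_arr F f u \<equiv> FArr (PMor F f) u"

abbreviation res_comp :: "('o, 'm, 'x, 'y) cat_psfun \<Rightarrow> 'm \<Rightarrow> 'm \<Rightarrow> 'x \<Rightarrow> 'y" where
  "res_comp F f g x \<equiv> NAt (PComp F g f) x"

abbreviation res_unit :: "('o, 'm, 'x, 'y) cat_psfun \<Rightarrow> 'o \<Rightarrow> 'x \<Rightarrow> 'y" where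
  "res_unit F U x \<equiv> NAt (PUnit F U) x"

definition hom_presheaf ::
  "('o, 'm) cat \<Rightarrow> ('o, 'm, 'x, 'y) cat_psfun \<Rightarrow> 'x \<Rightarrow> 'x \<Rightarrow> ('m, 'm \<times> 'm, 'y) presheaf" where
  "hom_presheaf C F a b = \<lparr>
     Val = (\<lambda>f. hom (PObj F (Dom C f)) (res_obj F f a) (res_obj F f b)),
     Res = (\<lambda>(f, g) u. let A = PObj F (Dom C g) in
       res_comp F f g b \<cdot>\<^bsub>A\<^esub> res_arr F g u \<cdot>\<^bsub>A\<^esub> inv_arr A (res_comp F f g a))\<rparr>"

definition prestack_condition ::
  "('o, 'm) cat \<Rightarrow> ('o \<Rightarrow> 'm set set) \<Rightarrow> ('o, 'm, 'x, 'y) cat_psfun \<Rightarrow> bool" where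
  "prestack_condition C J F \<longleftrightarrow>
     (\<forall>U\<in>Obj C. \<forall>a\<in>Obj (PObj F U). \<forall>b\<in>Obj (PObj F U).
        is_sheaf (slice C U) (slice_topology C J U) (hom_presheaf C F a b))"

text \<open>
  The pseudolimit of \<open>F\<close> over a sieve \<open>S\<close>: an object consists of objects \<open>x f\<close> over the domain of
  each \<open>f\<close> in \<open>S\<close>, and isomorphisms \<open>\<theta> f g\<close> from the restriction of \<open>x f\<close> along \<open>g\<close> to
  \<open>x (f \<cdot> g)\<close>, compatible with composition and identities.
\<close>

record ('m, 'x, 'y) descent =
  DObj :: "'m \<Rightarrow> 'x"
  DIso :: "'m \<Rightarrow> 'm \<Rightarrow> 'y"

definition is_descent ::
  "('o, 'm) cat \<Rightarrow> ('o, 'm, 'x, 'y) cat_psfun \<Rightarrow> 'm set \<Rightarrow> ('m, 'x, 'y) descent \<Rightarrow> bool" where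
  "is_descent C F S d \<longleftrightarrow> (let x = DObj d; \<theta> = DIso d in
     x \<in> extensional S \<and>
     (\<forall>f g. \<not> (f \<in> S \<and> g \<in> Arr C \<and> Cod C g = Dom C f) \<longrightarrow> \<theta> f g = undefined) \<and>
     (\<forall>f\<in>S. x f \<in> Obj (PObj F (Dom C f))) \<and>
     (\<forall>f\<in>S. \<forall>g\<in>Arr C. Cod C g = Dom C f \<longrightarrow>
        \<theta> f g \<in> hom (PObj F (Dom C g)) (res_obj F g (x f)) (x (f \<cdot>\<^bsub>C\<^esub> g)) \<and>
        iso_arr (PObj F (Dom C g)) (\<theta> f g)) \<and>
     (\<forall>f\<in>S. \<forall>g\<in>Arr C. \<forall>h\<in>Arr C. Cod C g = Dom C f \<and> Cod C h = Dom C g \<longrightarrow>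
        \<theta> f (g \<cdot>\<^bsub>C\<^esub> h) \<cdot>\<^bsub>PObj F (Dom C h)\<^esub> res_comp F g h (x f) =
        \<theta> (f \<cdot>\<^bsub>C\<^esub> g) h \<cdot>\<^bsub>PObj F (Dom C h)\<^esub> res_arr F h (\<theta> f g)) \<and>
     (\<forall>f\<in>S. \<theta> f (Ident C (Dom C f)) \<cdot>\<^bsub>PObj F (Dom C f)\<^esub> res_unit F (Dom C f) (x f) =
        Ident (PObj F (Dom C f)) (x f)))"

record ('m, 'x, 'y) descent_mor =
  DDom :: "('m, 'x, 'y) descent"
  DCod :: "('m, 'x, 'y) descent"
  DAt :: "'m \<Rightarrow> 'y"

definition is_descent_mor ::
  "('o, 'm) cat \<Rightarrow> ('o, 'm, 'x, 'y) cat_psfun \<Rightarrow> 'm set \<Rightarrow> ('m, 'x, 'y) descent_mor \<Rightarrow> bool" where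
  "is_descent_mor C F S u \<longleftrightarrow> (let d = DDom u; e = DCod u in
     is_descent C F S d \<and> is_descent C F S e \<and>
     DAt u \<in> extensional S \<and>
     (\<forall>f\<in>S. DAt u f \<in> hom (PObj F (Dom C f)) (DObj d f) (DObj e f)) \<and>
     (\<forall>f\<in>S. \<forall>g\<in>Arr C. Cod C g = Dom C f \<longrightarrow>
        DAt u (f \<cdot>\<^bsub>C\<^esub> g) \<cdot>\<^bsub>PObj F (Dom C g)\<^esub> DIso d f g =
        DIso e f g \<cdot>\<^bsub>PObj F (Dom C g)\<^esub> res_arr F g (DAt u f)))"

definition descent_cat ::
  "('o, 'm) cat \<Rightarrow> ('o, 'm, 'x, 'y) cat_psfun \<Rightarrow> 'm set \<Rightarrow>
   (('m, 'x, 'y) descent, ('m, 'x, 'y) descent_mor) cat" where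
  "descent_cat C F S = \<lparr>Obj = {d. is_descent C F S d}, Arr = {u. is_descent_mor C F S u},
     Dom = DDom, Cod = DCod,
     Ident = (\<lambda>d. \<lparr>DDom = d, DCod = d,
       DAt = restrict (\<lambda>f. Ident (PObj F (Dom C f)) (DObj d f)) S\<rparr>),
     Comp = (\<lambda>v u. \<lparr>DDom = DDom u, DCod = DCod v,
       DAt = restrict (\<lambda>f. DAt v f \<cdot>\<^bsub>PObj F (Dom C f)\<^esub> DAt u f) S\<rparr>)\<rparr>"

definition canonical_descent ::
  "('o, 'm) cat \<Rightarrow> ('o, 'm, 'x, 'y) cat_psfun \<Rightarrow> 'm set \<Rightarrow> 'x \<Rightarrow> ('m, 'x, 'y) descent" where
  "canonical_descent C F S x = \<lparr>DObj = restrict (\<lambda>f. res_obj F f x) S,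
     DIso = (\<lambda>f g. if f \<in> S \<and> g \<in> Arr C \<and> Cod C g = Dom C f then res_comp F f g x else undefined)\<rparr>"

definition canonical_functor ::
  "('o, 'm) cat \<Rightarrow> ('o, 'm, 'x, 'y) cat_psfun \<Rightarrow> 'o \<Rightarrow> 'm set \<Rightarrow>
   ('x, 'y, ('m, 'x, 'y) descent, ('m, 'x, 'y) descent_mor) func" where
  "canonical_functor C F U S = \<lparr>FDom = PObj F U, FCod = descent_cat C F S,
     FObj = restrict (canonical_descent C F S) (Obj (PObj F U)),
     FArr = restrict (\<lambda>u. \<lparr>DDom = canonical_descent C F S (Dom (PObj F U) u),
       DCod = canonical_descent C F S (Cod (PObj F U) u),
       DAt = restrict (\<lambda>f. res_arr F f u) S\<rparr>) (Arr (PObj F U))\<rparr>"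

definition stack_condition ::
  "('o, 'm) cat \<Rightarrow> ('o \<Rightarrow> 'm set set) \<Rightarrow> ('o, 'm, 'x, 'y) cat_psfun \<Rightarrow> bool" where
  "stack_condition C J F \<longleftrightarrow>
     (\<forall>U\<in>Obj C. \<forall>S\<in>J U. equivalence_functor (canonical_functor C F U S))"

definition St ::
  "('u set \<Rightarrow> bool) \<Rightarrow> ('o, 'm) cat \<Rightarrow> ('o \<Rightarrow> 'm set set) \<Rightarrow>
   (('o, 'm, 'u, 'u) cat_psfun, ('o, 'm, 'u, 'u) cat_psnat, ('o, 'm, 'u, 'u) cat_modif) twocat"
  where "St small C J = full_sub (ps_presheaves small C) {F. stack_condition C J F}"

definition PreSt ::
  "('u set \<Rightarrow> bool) \<Rightarrow> ('o, 'm) cat \<Rightarrow> ('o \<Rightarrow> 'm set set) \<Rightarrow>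
   (('o, 'm, 'u, 'u) cat_psfun, ('o, 'm, 'u, 'u) cat_psnat, ('o, 'm, 'u, 'u) cat_modif) twocat"
  where "PreSt small C J = full_sub (ps_presheaves small C) {F. prestack_condition C J F}"


section \<open>Local weak equivalences and the homotopy 2-category\<close>

definition local_weak_equivalences ::
  "('u set \<Rightarrow> bool) \<Rightarrow> ('o, 'm) cat \<Rightarrow> ('o \<Rightarrow> 'm set set) \<Rightarrow> ('o, 'm, 'u, 'u) cat_psnat set" where
  "local_weak_equivalences small C J = {h \<in> Mor (PreSt small C J).
     (\<forall>U\<in>Obj C. fully_faithful (TAt h U)) \<and>
     (\<forall>U\<in>Obj C. \<forall>b\<in>Obj (PObj (TCod h) U). \<exists>S\<in>J U. \<forall>f\<in>S.
        \<exists>a\<in>Obj (PObj (TDom h) (Dom C f)).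
        \<exists>u\<in>hom (PObj (TCod h) (Dom C f)) (FObj (TAt h (Dom C f)) a) (res_obj (TCod h) f b).
          iso_arr (PObj (TCod h) (Dom C f)) u)}"

definition fibrant :: "('o, 'm, 'c) twocat \<Rightarrow> 'm set \<Rightarrow> 'o \<Rightarrow> bool" where
  "fibrant K W z \<longleftrightarrow> z \<in> Ob K \<and>
     (\<forall>f h. f \<in> W \<and> h \<in> hom (cat1 K) (src K f) z \<longrightarrow>
        (\<exists>l\<in>hom (cat1 K) (tgt K f) z. isomorphic_mors K h (l \<odot>\<^bsub>K\<^esub> f)))"

definition Ho :: "('o, 'm, 'c) twocat \<Rightarrow> 'm set \<Rightarrow> ('o, 'm, 'c) twocat" where
  "Ho K W = full_sub K {z. fibrant K W z}"

end

theory Submission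
  imports Defs
begin

text \<open>
  Both 2-categories are full in the 2-category of pseudofunctors, so they are equal once a prestack is
  known to be fibrant iff it is a stack.

  A fibrant prestack \<open>F\<close> is a stack: as the topology is precanonical, a covering sieve \<open>S\<close> on \<open>U\<close> is a
  prestack (of discrete categories), and its inclusion into the representable of \<open>U\<close> is a local weak
  equivalence. A descent datum on \<open>S\<close> is a map from \<open>S\<close> to \<open>F\<close>, and an extension of it to the representable,
  evaluated at the identity of \<open>U\<close>, glues the datum. No stackification is needed.

  Conversely let \<open>F\<close> be a stack, \<open>w: A \<rightarrow> B\<close> a local weak equivalence and \<open>h: A \<rightarrow> F\<close>. Locally an object
  \<open>b\<close> of \<open>B\<close> comes from objects \<open>a f\<close> of \<open>A\<close>. Since \<open>w\<close> is full and faithful the objects \<open>h (a f)\<close> form a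
  descent datum, which has a glueing \<open>l b\<close>, and the action of \<open>l\<close> on arrows is glued likewise. The coherence
  isomorphisms are kept under control by doing this in the Grothendieck constructions, where the datum
  consists of cartesian arrows and \<open>l\<close> is an ordinary functor over the base.
\<close>

text \<open>The obstacle is that nothing in the construction of \<open>l\<close> is strict: the
  local lifts are chosen independently of each other, and restrictions compose only up to
  isomorphism. Over the Grothendieck construction these isomorphisms are replaced by a uniqueness
  principle. A factorisation through a cartesian arrow is unique, so an equation can be checked
  after composing with a cartesian arrow or with a jointly epic family of legs. Coherence is met
  only when a transformation is turned into a functor preserving cartesian arrows, and back. The
  definitions speak of sheaves on slices and of equivalences with categories of descent data. Both
  are reduced to families over a single sieve, \<open>glues\<close> for arrows and
  \<open>effective\<close> for objects. Full faithfulness of the canonical functors is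
  \<open>glues\<close>, the condition that stacks share with prestacks, so a stack is a prestack
  that is also \<open>effective\<close>. A sieve consists of arrows of the small category
  \<open>C\<close>. Its fibres are therefore small, and lie in the same universe as the values of
  \<open>F\<close>, because smallness passes to subsets.\<close>

abbreviation (input) comp_in (\<open>_ \<cdot>[_] _\<close> [70, 0, 71] 70) where "g \<cdot>[A] f \<equiv> Comp A g f"
abbreviation (input) comp1_in (\<open>_ \<odot>[_] _\<close> [70, 0, 71] 70) where "g \<odot>[K] f \<equiv> comp1 K g f"
abbreviation (input) vcomp_in (\<open>_ \<bullet>[_] _\<close> [68, 0, 69] 68) where "\<beta> \<bullet>[K] \<alpha> \<equiv> vcomp K \<beta> \<alpha>"
abbreviation (input) hcomp_in (\<open>_ \<star>[_] _\<close> [70, 0, 71] 70) where "\<beta> \<star>[K] \<alpha> \<equiv> hcomp K \<beta> \<alpha>"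

section \<open>Categories\<close>

lemma homI: "\<lbrakk>f \<in> Arr A; Dom A f = x; Cod A f = y\<rbrakk> \<Longrightarrow> f \<in> hom A x y"
  by (simp add: hom_def)

lemma homD:
  assumes "f \<in> hom A x y"
  shows "f \<in> Arr A" "Dom A f = x" "Cod A f = y"
  using assms by (simp_all add: hom_def)

context category
begin

lemma hom_Obj: "f \<in> hom A x y \<Longrightarrow> x \<in> Obj A \<and> y \<in> Obj A"
  using Dom_in Cod_in by (auto simp: hom_def)

lemma Ident_hom: "x \<in> Obj A \<Longrightarrow> Ident A x \<in> hom A x x"
  by (simp add: hom_def Ident_in Dom_Ident Cod_Ident)

lemma id_left: "\<lbrakk>f \<in> Arr A; Cod A f = y\<rbrakk> \<Longrightarrow> Ident A y \<cdot> f = f"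
  using Comp_Ident_left by blast

lemma id_right: "\<lbrakk>f \<in> Arr A; Dom A f = x\<rbrakk> \<Longrightarrow> f \<cdot> Ident A x = f"
  using Comp_Ident_right by blast

lemma comp_id_left: "f \<in> hom A x y \<Longrightarrow> Ident A y \<cdot> f = f"
  using Comp_Ident_left by (auto simp: hom_def)

lemma comp_id_right: "f \<in> hom A x y \<Longrightarrow> f \<cdot> Ident A x = f"
  using Comp_Ident_right by (auto simp: hom_def)

lemma inverse_arrs_unique:
  assumes "inverse_arrs A f g" "inverse_arrs A f g'"
  shows "g = g'"
proof -
  have f: "f \<in> Arr A" and g: "g \<in> hom A (Cod A f) (Dom A f)" "g' \<in> hom A (Cod A f) (Dom A f)"
    using assms by (auto simp: inverse_arrs_def)
  have "g = (g' \<cdot> f) \<cdot> g"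
    using assms g comp_id_left by (simp add: inverse_arrs_def)
  also have "\<dots> = g' \<cdot> (f \<cdot> g)"
    using f g by (simp add: Comp_assoc hom_def)
  also have "\<dots> = g'"
    using assms g comp_id_right by (simp add: inverse_arrs_def)
  finally show ?thesis .
qed

lemma inv_arr_eq: "inverse_arrs A f g \<Longrightarrow> inv_arr A f = g"
  unfolding inv_arr_def using inverse_arrs_unique by blast

lemma inverse_arrs_inv_arr: "iso_arr A f \<Longrightarrow> inverse_arrs A f (inv_arr A f)"
  unfolding iso_arr_def using inv_arr_eq by auto

lemma inverse_arrs_sym: "inverse_arrs A f g \<Longrightarrow> inverse_arrs A g f"
  by (auto simp: inverse_arrs_def hom_def)

lemma iso_arr_inv_arr: "iso_arr A f \<Longrightarrow> iso_arr A (inv_arr A f)"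
  using inverse_arrs_inv_arr inverse_arrs_sym iso_arr_def by metis

lemma inv_arr_simps:
  assumes "iso_arr A f"
  shows "f \<in> Arr A" "inv_arr A f \<in> Arr A"
    "Dom A (inv_arr A f) = Cod A f" "Cod A (inv_arr A f) = Dom A f"
    "inv_arr A f \<cdot> f = Ident A (Dom A f)" "f \<cdot> inv_arr A f = Ident A (Cod A f)"
  using inverse_arrs_inv_arr[OF assms] by (auto simp: inverse_arrs_def hom_def)

lemma inv_comp_cancel:
  assumes "iso_arr A f" "g \<in> Arr A"
  shows "Cod A g = Dom A f \<Longrightarrow> inv_arr A f \<cdot> (f \<cdot> g) = g"
    and "Cod A g = Cod A f \<Longrightarrow> f \<cdot> (inv_arr A f \<cdot> g) = g"
    and "Dom A g = Dom A f \<Longrightarrow> (g \<cdot> inv_arr A f) \<cdot> f = g"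
    and "Dom A g = Cod A f \<Longrightarrow> (g \<cdot> f) \<cdot> inv_arr A f = g"
  using inv_arr_simps[OF assms(1)] assms(2)
     apply (metis Comp_assoc Comp_Ident_left)
    apply (metis Comp_assoc Comp_Ident_left inv_arr_simps[OF assms(1)] assms(2))
   apply (metis Comp_assoc Comp_Ident_right inv_arr_simps[OF assms(1)] assms(2))
  apply (metis Comp_assoc Comp_Ident_right inv_arr_simps[OF assms(1)] assms(2))
  done

lemma inverse_arrs_comp:
  assumes "inverse_arrs A f f'" "inverse_arrs A g g'" "Cod A f = Dom A g"
  shows "inverse_arrs A (g \<cdot> f) (f' \<cdot> g')"
proof -
  have [simp]: "f \<in> Arr A" "g \<in> Arr A" "f' \<in> Arr A" "g' \<in> Arr A" "Cod A f = Dom A g"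
    "Dom A f' = Dom A g" "Cod A f' = Dom A f" "Dom A g' = Cod A g" "Cod A g' = Dom A g"
    using assms by (auto simp: inverse_arrs_def hom_def)
  have "(f' \<cdot> g') \<cdot> (g \<cdot> f) = f' \<cdot> ((g' \<cdot> g) \<cdot> f)"
    by (simp add: Comp_assoc Comp_in Dom_Comp Cod_Comp)
  also have "\<dots> = Ident A (Dom A f)"
    using assms Comp_Ident_left[of f] by (simp add: inverse_arrs_def)
  finally have 1: "(f' \<cdot> g') \<cdot> (g \<cdot> f) = Ident A (Dom A f)" .
  have "(g \<cdot> f) \<cdot> (f' \<cdot> g') = g \<cdot> ((f \<cdot> f') \<cdot> g')"
    by (simp add: Comp_assoc Comp_in Dom_Comp Cod_Comp)
  also have "\<dots> = Ident A (Cod A g)"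
    using assms Comp_Ident_left[of g'] by (simp add: inverse_arrs_def)
  finally show ?thesis
    using 1 by (simp add: inverse_arrs_def hom_def Comp_in Dom_Comp Cod_Comp)
qed

lemma iso_arr_comp: "\<lbrakk>iso_arr A f; iso_arr A g; Cod A f = Dom A g\<rbrakk> \<Longrightarrow> iso_arr A (g \<cdot> f)"
  using inverse_arrs_comp iso_arr_def by metis

lemma Ident_Comp_Ident: "x \<in> Obj A \<Longrightarrow> Ident A x \<cdot> Ident A x = Ident A x"
  using comp_id_left[OF Ident_hom] .

lemma inverse_arrs_Ident: "x \<in> Obj A \<Longrightarrow> inverse_arrs A (Ident A x) (Ident A x)"
  using Comp_Ident_left[of "Ident A x"]
  by (simp add: inverse_arrs_def hom_def Ident_in Dom_Ident Cod_Ident)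

lemma iso_arr_Ident: "x \<in> Obj A \<Longrightarrow> iso_arr A (Ident A x)"
  using inverse_arrs_Ident iso_arr_def by metis

lemma iso_cancel_left:
  assumes "iso_arr A f" "f \<cdot> g = f \<cdot> h" "g \<in> Arr A" "h \<in> Arr A" "Cod A g = Dom A f" "Cod A h = Dom A f"
  shows "g = h"
  using inv_comp_cancel(1)[OF assms(1)] assms(2-) by metis

lemma iso_cancel_right:
  assumes "iso_arr A f" "g \<cdot> f = h \<cdot> f" "g \<in> Arr A" "h \<in> Arr A" "Dom A g = Cod A f" "Dom A h = Cod A f"
  shows "g = h"
  using inv_comp_cancel(4)[OF assms(1)] assms(2-) by metis

end

section \<open>The 2-category of small categories\<close>

text \<open>The clauses are cited by number below. From 5 on they are typing and preservation rules
  for the simplifier, with preservation of composites last so that it can be left out.\<close>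

lemma is_functorD:
  assumes "is_functor F"
  shows "category (FDom F)" "category (FCod F)"
    "FObj F \<in> extensional (Obj (FDom F))" "FArr F \<in> extensional (Arr (FDom F))"
    "x \<in> Obj (FDom F) \<Longrightarrow> FObj F x \<in> Obj (FCod F)"
    "f \<in> Arr (FDom F) \<Longrightarrow> FArr F f \<in> Arr (FCod F)"
    "f \<in> Arr (FDom F) \<Longrightarrow> Dom (FCod F) (FArr F f) = FObj F (Dom (FDom F) f)"
    "f \<in> Arr (FDom F) \<Longrightarrow> Cod (FCod F) (FArr F f) = FObj F (Cod (FDom F) f)"
    "x \<in> Obj (FDom F) \<Longrightarrow> FArr F (Ident (FDom F) x) = Ident (FCod F) (FObj F x)"
    "\<lbrakk>f \<in> Arr (FDom F); g \<in> Arr (FDom F); Cod (FDom F) f = Dom (FDom F) g\<rbrakk> \<Longrightarrow>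
       FArr F (g \<cdot>[FDom F] f) = FArr F g \<cdot>[FCod F] FArr F f"
  using assms by (auto simp: is_functor_def Let_def PiE_def Pi_def)

lemma is_functorI:
  assumes "category A" "category B" "FDom F = A" "FCod F = B"
    "FObj F \<in> extensional (Obj A)" "FArr F \<in> extensional (Arr A)"
    "\<And>x. x \<in> Obj A \<Longrightarrow> FObj F x \<in> Obj B"
    "\<And>f. f \<in> Arr A \<Longrightarrow> FArr F f \<in> hom B (FObj F (Dom A f)) (FObj F (Cod A f))"
    "\<And>x. x \<in> Obj A \<Longrightarrow> FArr F (Ident A x) = Ident B (FObj F x)"
    "\<And>f g. \<lbrakk>f \<in> Arr A; g \<in> Arr A; Cod A f = Dom A g\<rbrakk> \<Longrightarrow>
       FArr F (g \<cdot>[A] f) = FArr F g \<cdot>[B] FArr F f"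
  shows "is_functor F"
  using assms by (auto simp: is_functor_def Let_def PiE_def Pi_def hom_def)

lemma func_eqI:
  assumes "is_functor F" "is_functor G" "FDom F = FDom G" "FCod F = FCod G"
    "\<And>x. x \<in> Obj (FDom G) \<Longrightarrow> FObj F x = FObj G x"
    "\<And>f. f \<in> Arr (FDom G) \<Longrightarrow> FArr F f = FArr G f"
  shows "F = G"
proof -
  have "FObj F = FObj G" "FArr F = FArr G"
    using is_functorD(3,4)[OF assms(1)] is_functorD(3,4)[OF assms(2)] assms(3-)
    by (auto intro!: extensionalityI)
  then show ?thesis
    using assms by simp
qed

lemma is_functor_id_func: "category A \<Longrightarrow> is_functor (id_func A)"
  by (rule is_functorI[of A A])
    (auto simp: id_func_def hom_def category.Comp_in category.Ident_in category.Dom_in category.Cod_in)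

lemma is_functor_comp_func:
  assumes F: "is_functor F" and G: "is_functor G" and "FCod F = FDom G"
  shows "is_functor (comp_func G F)"
proof -
  interpret category "FDom F" by (rule is_functorD[OF F])
  note [simp] = is_functorD(5-)[OF F] is_functorD(5-)[OF G] assms(3)
    is_functorD(5-)[OF F, unfolded assms(3)]
  show ?thesis
    by (rule is_functorI[of "FDom F" "FCod G"])
      (auto simp: comp_func_def hom_def is_functorD[OF F] is_functorD[OF G] Comp_in Ident_in Dom_in Cod_in)
qed

lemma comp_func_simps:
  "FDom (comp_func G F) = FDom F" "FCod (comp_func G F) = FCod G"
  "x \<in> Obj (FDom F) \<Longrightarrow> FObj (comp_func G F) x = FObj G (FObj F x)"
  "f \<in> Arr (FDom F) \<Longrightarrow> FArr (comp_func G F) f = FArr G (FArr F f)"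
  by (simp_all add: comp_func_def)

lemma id_func_simps:
  "FDom (id_func A) = A" "FCod (id_func A) = A"
  "x \<in> Obj A \<Longrightarrow> FObj (id_func A) x = x"
  "f \<in> Arr A \<Longrightarrow> FArr (id_func A) f = f"
  by (simp_all add: id_func_def)

lemma is_ntransD:
  assumes "is_ntrans \<alpha>"
  shows "is_functor (NDom \<alpha>)" "is_functor (NCod \<alpha>)"
    "FDom (NCod \<alpha>) = FDom (NDom \<alpha>)" "FCod (NCod \<alpha>) = FCod (NDom \<alpha>)"
    "NAt \<alpha> \<in> extensional (Obj (FDom (NDom \<alpha>)))"
    "x \<in> Obj (FDom (NDom \<alpha>)) \<Longrightarrow> NAt \<alpha> x \<in> Arr (FCod (NDom \<alpha>))"
    "x \<in> Obj (FDom (NDom \<alpha>)) \<Longrightarrow> Dom (FCod (NDom \<alpha>)) (NAt \<alpha> x) = FObj (NDom \<alpha>) x"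
    "x \<in> Obj (FDom (NDom \<alpha>)) \<Longrightarrow> Cod (FCod (NDom \<alpha>)) (NAt \<alpha> x) = FObj (NCod \<alpha>) x"
    "f \<in> Arr (FDom (NDom \<alpha>)) \<Longrightarrow>
       NAt \<alpha> (Cod (FDom (NDom \<alpha>)) f) \<cdot>[FCod (NDom \<alpha>)] FArr (NDom \<alpha>) f =
       FArr (NCod \<alpha>) f \<cdot>[FCod (NDom \<alpha>)] NAt \<alpha> (Dom (FDom (NDom \<alpha>)) f)"
  using assms by (auto simp: is_ntrans_def Let_def hom_def)

lemma is_ntransI:
  assumes "is_functor F" "is_functor G" "FDom F = A" "FCod F = B" "FDom G = A" "FCod G = B"
    "NDom \<alpha> = F" "NCod \<alpha> = G" "NAt \<alpha> \<in> extensional (Obj A)"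
    "\<And>x. x \<in> Obj A \<Longrightarrow> NAt \<alpha> x \<in> hom B (FObj F x) (FObj G x)"
    "\<And>f. f \<in> Arr A \<Longrightarrow> NAt \<alpha> (Cod A f) \<cdot>[B] FArr F f = FArr G f \<cdot>[B] NAt \<alpha> (Dom A f)"
  shows "is_ntrans \<alpha>"
  using assms by (auto simp: is_ntrans_def Let_def)

lemma ntrans_eqI:
  assumes "is_ntrans \<alpha>" "is_ntrans \<beta>" "NDom \<alpha> = NDom \<beta>" "NCod \<alpha> = NCod \<beta>"
    "\<And>x. x \<in> Obj (FDom (NDom \<beta>)) \<Longrightarrow> NAt \<alpha> x = NAt \<beta> x"
  shows "\<alpha> = \<beta>"
proof -
  have "NAt \<alpha> = NAt \<beta>"
    using is_ntransD(5)[OF assms(1)] is_ntransD(5)[OF assms(2)] assms(3-)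
    by (auto intro!: extensionalityI)
  then show ?thesis
    using assms by simp
qed

text \<open>\<open>CAT\<close> writes its operations inline. With names for them, the laws of
  natural transformations can be proved for arbitrary categories and types; \<open>CAT_simps\<close>
  identifies the named operations with those of \<open>CAT\<close>.\<close>

definition nt_id :: "('o, 'm, 'p, 'n) func \<Rightarrow> ('o, 'm, 'p, 'n) ntrans" where
  "nt_id F = \<lparr>NDom = F, NCod = F,
     NAt = restrict (\<lambda>x. Ident (FCod F) (FObj F x)) (Obj (FDom F))\<rparr>"

definition nt_vcomp ::
  "('o, 'm, 'p, 'n) ntrans \<Rightarrow> ('o, 'm, 'p, 'n) ntrans \<Rightarrow> ('o, 'm, 'p, 'n) ntrans" where
  "nt_vcomp \<beta> \<alpha> = \<lparr>NDom = NDom \<alpha>, NCod = NCod \<beta>,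
     NAt = restrict (\<lambda>x. NAt \<beta> x \<cdot>[FCod (NDom \<alpha>)] NAt \<alpha> x) (Obj (FDom (NDom \<alpha>)))\<rparr>"

definition nt_hcomp ::
  "('p, 'n, 'q, 'k) ntrans \<Rightarrow> ('o, 'm, 'p, 'n) ntrans \<Rightarrow> ('o, 'm, 'q, 'k) ntrans" where
  "nt_hcomp \<beta> \<alpha> = \<lparr>NDom = comp_func (NDom \<beta>) (NDom \<alpha>), NCod = comp_func (NCod \<beta>) (NCod \<alpha>),
     NAt = restrict (\<lambda>x. NAt \<beta> (FObj (NCod \<alpha>) x) \<cdot>[FCod (NDom \<beta>)] FArr (NDom \<beta>) (NAt \<alpha> x))
       (Obj (FDom (NDom \<alpha>)))\<rparr>"

lemma CAT_simps:
  "Ob (CAT small) = {A. small_category small A}"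
  "Mor (CAT small) =
    {F. is_functor F \<and> small_category small (FDom F) \<and> small_category small (FCod F)}"
  "Cell (CAT small) = {\<alpha>. is_ntrans \<alpha> \<and> small_category small (FDom (NDom \<alpha>)) \<and>
     small_category small (FCod (NDom \<alpha>))}"
  "src (CAT small) = FDom" "tgt (CAT small) = FCod" "id1 (CAT small) = id_func"
  "comp1 (CAT small) = comp_func" "dom2 (CAT small) = NDom" "cod2 (CAT small) = NCod"
  "id2 (CAT small) = nt_id" "vcomp (CAT small) = nt_vcomp" "hcomp (CAT small) = nt_hcomp"
  by (auto simp: CAT_def nt_id_def nt_vcomp_def nt_hcomp_def fun_eq_iff)

lemma nt_id_simps:
  "NDom (nt_id F) = F" "NCod (nt_id F) = F"
  "x \<in> Obj (FDom F) \<Longrightarrow> NAt (nt_id F) x = Ident (FCod F) (FObj F x)"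
  by (simp_all add: nt_id_def)

lemma nt_vcomp_simps:
  "NDom (nt_vcomp \<beta> \<alpha>) = NDom \<alpha>" "NCod (nt_vcomp \<beta> \<alpha>) = NCod \<beta>"
  "x \<in> Obj (FDom (NDom \<alpha>)) \<Longrightarrow> NAt (nt_vcomp \<beta> \<alpha>) x = NAt \<beta> x \<cdot>[FCod (NDom \<alpha>)] NAt \<alpha> x"
  by (simp_all add: nt_vcomp_def)

lemma nt_hcomp_simps:
  "NDom (nt_hcomp \<beta> \<alpha>) = comp_func (NDom \<beta>) (NDom \<alpha>)"
  "NCod (nt_hcomp \<beta> \<alpha>) = comp_func (NCod \<beta>) (NCod \<alpha>)"
  "x \<in> Obj (FDom (NDom \<alpha>)) \<Longrightarrow> NAt (nt_hcomp \<beta> \<alpha>) x =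
     NAt \<beta> (FObj (NCod \<alpha>) x) \<cdot>[FCod (NDom \<beta>)] FArr (NDom \<beta>) (NAt \<alpha> x)"
  by (simp_all add: nt_hcomp_def)

lemma is_ntrans_nt_id:
  assumes "is_functor F" shows "is_ntrans (nt_id F)"
proof -
  interpret A: category "FDom F" by (rule is_functorD[OF assms])
  interpret B: category "FCod F" by (rule is_functorD[OF assms])
  show ?thesis
  proof (rule is_ntransI[of F F "FDom F" "FCod F"])
    fix f assume f: "f \<in> Arr (FDom F)"
    show "NAt (nt_id F) (Cod (FDom F) f) \<cdot>[FCod F] FArr F f = FArr F f \<cdot>[FCod F] NAt (nt_id F) (Dom (FDom F) f)"
      using f B.Comp_Ident_left[of "FArr F f"] B.Comp_Ident_right[of "FArr F f"]
      by (simp add: nt_id_simps A.Dom_in A.Cod_in is_functorD[OF assms])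
  qed (use assms in \<open>auto simp: nt_id_def hom_def is_functorD[OF assms] B.Ident_in B.Dom_Ident B.Cod_Ident\<close>)
qed

lemma is_ntrans_nt_vcomp:
  assumes \<alpha>: "is_ntrans \<alpha>" and \<beta>: "is_ntrans \<beta>" and e: "NCod \<alpha> = NDom \<beta>"
  shows "is_ntrans (nt_vcomp \<beta> \<alpha>)"
proof -
  let ?F = "NDom \<alpha>" and ?G = "NDom \<beta>" and ?H = "NCod \<beta>"
  note F = is_ntransD(1)[OF \<alpha>] and G = is_ntransD(1)[OF \<beta>] and H = is_ntransD(2)[OF \<beta>]
  have eqs [simp]: "FDom ?G = FDom ?F" "FCod ?G = FCod ?F" "FDom ?H = FDom ?F" "FCod ?H = FCod ?F"
    using is_ntransD[OF \<alpha>] is_ntransD[OF \<beta>] e by auto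
  interpret A: category "FDom ?F" by (rule is_functorD[OF F])
  interpret B: category "FCod ?F" by (rule is_functorD[OF F])
  note [simp] = is_functorD(5-9)[OF F] is_functorD(5-9)[OF G, simplified] is_functorD(5-9)[OF H, simplified]
    is_ntransD(6-8)[OF \<alpha>] is_ntransD(6-8)[OF \<beta>, simplified] e B.Comp_in B.Dom_Comp B.Cod_Comp A.Dom_in A.Cod_in
  show ?thesis
  proof (rule is_ntransI[of ?F ?H "FDom ?F" "FCod ?F"])
    fix f assume f: "f \<in> Arr (FDom ?F)"
    have "(NAt \<beta> (Cod (FDom ?F) f) \<cdot>[FCod ?F] NAt \<alpha> (Cod (FDom ?F) f)) \<cdot>[FCod ?F] FArr ?F f
       = NAt \<beta> (Cod (FDom ?F) f) \<cdot>[FCod ?F] (FArr ?G f \<cdot>[FCod ?F] NAt \<alpha> (Dom (FDom ?F) f))"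
      using f is_ntransD(9)[OF \<alpha> f] by (simp add: B.Comp_assoc)
    also have "\<dots> = (FArr ?H f \<cdot>[FCod ?F] NAt \<beta> (Dom (FDom ?F) f)) \<cdot>[FCod ?F] NAt \<alpha> (Dom (FDom ?F) f)"
      using f is_ntransD(9)[OF \<beta>, of f] by (simp flip: B.Comp_assoc)
    finally show "NAt (nt_vcomp \<beta> \<alpha>) (Cod (FDom ?F) f) \<cdot>[FCod ?F] FArr ?F f =
       FArr ?H f \<cdot>[FCod ?F] NAt (nt_vcomp \<beta> \<alpha>) (Dom (FDom ?F) f)"
      using f by (simp add: nt_vcomp_simps B.Comp_assoc)
  qed (auto simp: nt_vcomp_def hom_def F H)
qed

text \<open>The square at f is the image of the square of \<alpha> under the domain functor of
  \<beta>, followed by the square of \<beta> at the image of f.\<close>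

lemma is_ntrans_nt_hcomp:
  assumes \<alpha>: "is_ntrans \<alpha>" and \<beta>: "is_ntrans \<beta>" and e: "FCod (NDom \<alpha>) = FDom (NDom \<beta>)"
  shows "is_ntrans (nt_hcomp \<beta> \<alpha>)"
proof -
  let ?F = "NDom \<alpha>" and ?F' = "NCod \<alpha>" and ?G = "NDom \<beta>" and ?G' = "NCod \<beta>"
  note F = is_ntransD(1)[OF \<alpha>] and F' = is_ntransD(2)[OF \<alpha>]
    and G = is_ntransD(1)[OF \<beta>] and G' = is_ntransD(2)[OF \<beta>]
  let ?A = "FDom ?F" and ?B = "FDom ?G" and ?D = "FCod ?G"
  have eqs [simp]: "FDom ?F' = ?A" "FCod ?F = ?B" "FCod ?F' = ?B" "FDom ?G' = ?B" "FCod ?G' = ?D"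
    using is_ntransD[OF \<alpha>] is_ntransD[OF \<beta>] e by auto
  interpret A: category ?A by (rule is_functorD[OF F])
  interpret B: category ?B by (rule is_functorD[OF G])
  interpret D: category ?D by (rule is_functorD[OF G])
  note [simp] = is_functorD(5-10)[OF F, simplified] is_functorD(5-10)[OF F', simplified]
    is_functorD(5-9)[OF G, simplified] is_functorD(5-9)[OF G', simplified]
    is_ntransD(6-8)[OF \<alpha>, simplified] is_ntransD(6-8)[OF \<beta>, simplified]
    D.Comp_in D.Dom_Comp D.Cod_Comp A.Dom_in A.Cod_in B.Dom_in B.Cod_in
    B.Comp_in B.Dom_Comp B.Cod_Comp
  show ?thesis
  proof (rule is_ntransI[of "comp_func ?G ?F" "comp_func ?G' ?F'" ?A ?D])
    fix f assume f: "f \<in> Arr ?A"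
    let ?x = "Dom ?A f" and ?y = "Cod ?A f"
    have "(NAt \<beta> (FObj ?F' ?y) \<cdot>[?D] FArr ?G (NAt \<alpha> ?y)) \<cdot>[?D] FArr ?G (FArr ?F f)
       = NAt \<beta> (FObj ?F' ?y) \<cdot>[?D] FArr ?G (NAt \<alpha> ?y \<cdot>[?B] FArr ?F f)"
      using f by (simp add: D.Comp_assoc is_functorD(10)[OF G])
    also have "\<dots> = (NAt \<beta> (FObj ?F' ?y) \<cdot>[?D] FArr ?G (FArr ?F' f)) \<cdot>[?D] FArr ?G (NAt \<alpha> ?x)"
      using f is_ntransD(9)[OF \<alpha>, simplified, of f] by (simp add: D.Comp_assoc is_functorD(10)[OF G])
    also have "\<dots> = (FArr ?G' (FArr ?F' f) \<cdot>[?D] NAt \<beta> (FObj ?F' ?x)) \<cdot>[?D] FArr ?G (NAt \<alpha> ?x)"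
      using f is_ntransD(9)[OF \<beta>, simplified, of "FArr ?F' f"] by simp
    finally show "NAt (nt_hcomp \<beta> \<alpha>) ?y \<cdot>[?D] FArr (comp_func ?G ?F) f =
       FArr (comp_func ?G' ?F') f \<cdot>[?D] NAt (nt_hcomp \<beta> \<alpha>) ?x"
      using f by (simp add: nt_hcomp_simps comp_func_simps D.Comp_assoc)
  qed (auto simp: nt_hcomp_def hom_def comp_func_simps intro!: is_functor_comp_func F F' G G')
qed

text \<open>Functors are extensional, so this and the next two laws are equations and not mere
  isomorphisms; strictness of the 2-category \<open>CAT\<close> depends on it.\<close>

lemma comp_func_id_left: "is_functor F \<Longrightarrow> comp_func (id_func (FCod F)) F = F"
  by (rule func_eqI)
    (auto intro!: is_functor_comp_func is_functor_id_func
      simp: comp_func_simps id_func_simps is_functorD)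

lemma comp_func_id_right: "is_functor F \<Longrightarrow> comp_func F (id_func (FDom F)) = F"
  by (rule func_eqI)
    (auto intro!: is_functor_comp_func is_functor_id_func
      simp: comp_func_simps id_func_simps is_functorD)

lemma comp_func_assoc:
  assumes "is_functor F" "is_functor G" "is_functor H" "FCod F = FDom G" "FCod G = FDom H"
  shows "comp_func (comp_func H G) F = comp_func H (comp_func G F)"
proof -
  have "FObj F x \<in> Obj (FDom G)" if "x \<in> Obj (FDom F)" for x
    using that is_functorD(5)[OF assms(1)] assms by simp
  moreover have "FArr F x \<in> Arr (FDom G)" if "x \<in> Arr (FDom F)" for x
    using that is_functorD(6)[OF assms(1)] assms by simp
  ultimately show ?thesis
    using assms by (intro func_eqI is_functor_comp_func) (simp_all add: comp_func_simps)
qed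

lemma category_cat1_CAT: "category (cat1 (CAT small))"
proof (unfold_locales, goal_cases)
qed (auto simp: cat1_def CAT_simps comp_func_simps id_func_simps small_category_def
   comp_func_id_left comp_func_id_right comp_func_assoc
   intro!: is_functor_comp_func is_functor_id_func)

lemma category_vcat_CAT: "category (vcat (CAT small))"
proof (unfold_locales, goal_cases)
  case (9 \<alpha>)
  then show ?case
    apply (auto simp: vcat_def CAT_simps intro!: ntrans_eqI is_ntrans_nt_vcomp is_ntrans_nt_id
      simp: nt_vcomp_simps nt_id_simps is_ntransD)
    by (metis category.Comp_Ident_left is_ntransD(6,8,1) is_functorD(2))
next
  case (10 \<alpha>)
  then show ?case
    apply (auto simp: vcat_def CAT_simps intro!: ntrans_eqI is_ntrans_nt_vcomp is_ntrans_nt_id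
      simp: nt_vcomp_simps nt_id_simps is_ntransD)
    by (metis category.Comp_Ident_right is_ntransD(6,7,1) is_functorD(2))
next
  case (11 f g h)
  then have *: "is_ntrans f" "is_ntrans g" "is_ntrans h" "NCod f = NDom g" "NCod g = NDom h"
    by (auto simp: vcat_def CAT_simps)
  note [simp] = is_ntransD(3,4)[OF *(1), simplified *(4)] is_ntransD(3,4)[OF *(2), simplified *(5)]
  show ?case
    using * is_functorD(2)[OF is_ntransD(1)[OF *(1)]]
      is_ntransD(6-8)[OF *(1)] is_ntransD(6-8)[OF *(2)] is_ntransD(6-8)[OF *(3)]
    by (auto simp: vcat_def CAT_simps intro!: ntrans_eqI is_ntrans_nt_vcomp
      simp: nt_vcomp_simps category.Comp_assoc)
qed (auto simp: vcat_def CAT_simps nt_vcomp_simps nt_id_simps is_ntransD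
   intro!: is_ntrans_nt_vcomp is_ntrans_nt_id)

lemma category_hcat_CAT: "category (hcat (CAT small))"
proof (unfold_locales, goal_cases)
  case (9 \<alpha>)
  then have *: "is_ntrans \<alpha>" by (simp add: hcat_def CAT_simps)
  note D = is_ntransD[OF *]
  have [simp]: "comp_func (id_func (FCod (NDom \<alpha>))) (NDom \<alpha>) = NDom \<alpha>"
      "comp_func (id_func (FCod (NDom \<alpha>))) (NCod \<alpha>) = NCod \<alpha>"
    using comp_func_id_left[OF D(1)] comp_func_id_left[OF D(2)] D(4) by simp_all
  interpret B: category "FCod (NDom \<alpha>)" by (rule is_functorD[OF D(1)])
  have [simp]: "FObj (NCod \<alpha>) x \<in> Obj (FCod (NDom \<alpha>))" if "x \<in> Obj (FDom (NDom \<alpha>))" for x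
    using is_functorD(5)[OF D(2)] D(3,4) that by simp
  have "nt_hcomp (nt_id (id_func (FCod (NDom \<alpha>)))) \<alpha> = \<alpha>"
    using B.Comp_Ident_left[OF D(6)] D(6,8)
    by (intro ntrans_eqI is_ntrans_nt_hcomp is_ntrans_nt_id is_functor_id_func *)
      (simp_all add: nt_hcomp_simps nt_id_simps id_func_simps is_functorD[OF D(1)])
  with * show ?case
    by (simp add: hcat_def CAT_simps)
next
  case (10 \<alpha>)
  then have *: "is_ntrans \<alpha>" by (simp add: hcat_def CAT_simps)
  note D = is_ntransD[OF *]
  have [simp]: "comp_func (NDom \<alpha>) (id_func (FDom (NDom \<alpha>))) = NDom \<alpha>"
      "comp_func (NCod \<alpha>) (id_func (FDom (NDom \<alpha>))) = NCod \<alpha>"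
    using comp_func_id_right[OF D(1)] comp_func_id_right[OF D(2)] D(3) by simp_all
  interpret B: category "FCod (NDom \<alpha>)" by (rule is_functorD[OF D(1)])
  have "nt_hcomp \<alpha> (nt_id (id_func (FDom (NDom \<alpha>)))) = \<alpha>"
    using B.Comp_Ident_right[OF D(6)] D(6,7)
    by (intro ntrans_eqI is_ntrans_nt_hcomp is_ntrans_nt_id is_functor_id_func *)
      (simp_all add: nt_hcomp_simps nt_id_simps id_func_simps is_functorD[OF D(1)])
  with * show ?case
    by (simp add: hcat_def CAT_simps)
next
  case (11 f g h)
  then have *: "is_ntrans f" "is_ntrans g" "is_ntrans h"
     and e: "FCod (NDom f) = FDom (NDom g)" "FCod (NDom g) = FDom (NDom h)"
    by (auto simp: hcat_def CAT_simps)
  note D = is_ntransD[OF *(1)] is_ntransD[OF *(2)] is_ntransD[OF *(3)]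
  have [simp]: "comp_func (comp_func (NDom h) (NDom g)) (NDom f) = comp_func (NDom h) (comp_func (NDom g) (NDom
    f))"
    "comp_func (comp_func (NCod h) (NCod g)) (NCod f) = comp_func (NCod h) (comp_func (NCod g) (NCod f))"
    using D e by (simp_all add: comp_func_assoc)
  interpret B: category "FCod (NDom f)" by (rule is_functorD[OF D(1)])
  interpret B': category "FCod (NDom g)" by (rule is_functorD[OF is_ntransD(1)[OF *(2)]])
  interpret B'': category "FCod (NDom h)" by (rule is_functorD[OF is_ntransD(1)[OF *(3)]])
  note F = is_functorD(5-)[OF is_ntransD(1)[OF *(1)]] is_functorD(5-)[OF is_ntransD(2)[OF *(1)]]
    is_functorD(5-)[OF is_ntransD(1)[OF *(2)]] is_functorD(5-)[OF is_ntransD(2)[OF *(2)]]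
    is_functorD(5-)[OF is_ntransD(1)[OF *(3)]] is_functorD(5-)[OF is_ntransD(2)[OF *(3)]]
  show ?case
    unfolding hcat_def CAT_simps cat.simps
    apply (rule ntrans_eqI)
        apply (intro is_ntrans_nt_hcomp *; simp add: nt_hcomp_simps comp_func_simps e)
       apply (intro is_ntrans_nt_hcomp *; simp add: nt_hcomp_simps comp_func_simps e)
      apply (simp add: nt_hcomp_simps)
     apply (simp add: nt_hcomp_simps)
    apply (simp add: nt_hcomp_simps comp_func_simps e D)
    subgoal for x
      using F D e by (simp add: nt_hcomp_simps comp_func_simps B''.Comp_assoc)
    done
qed (auto simp: hcat_def CAT_simps nt_hcomp_simps nt_id_simps id_func_simps comp_func_simps is_ntransD
  small_category_def
   intro!: is_ntrans_nt_hcomp is_ntrans_nt_id is_functor_id_func)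

text \<open>One step has content: the naturality square of \<beta> at a component of \<alpha>'
  exchanges the two middle arrows.\<close>

lemma nt_interchange:
  assumes "is_ntrans \<alpha>" "is_ntrans \<alpha>'" "is_ntrans \<beta>" "is_ntrans \<beta>'"
    "NCod \<alpha> = NDom \<alpha>'" "NCod \<beta> = NDom \<beta>'" "FCod (NDom \<alpha>) = FDom (NDom \<beta>)"
  shows "nt_hcomp (nt_vcomp \<beta>' \<beta>) (nt_vcomp \<alpha>' \<alpha>) = nt_vcomp (nt_hcomp \<beta>' \<alpha>') (nt_hcomp \<beta> \<alpha>)"
proof -
  note D = is_ntransD[OF assms(1)]
  note D' = is_ntransD[OF assms(2)] and E = is_ntransD[OF assms(3)] and E' = is_ntransD[OF assms(4)]
  interpret D: category "FCod (NDom \<beta>)" by (rule is_functorD[OF E(1)])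
  interpret B: category "FDom (NDom \<beta>)" by (rule is_functorD[OF E(1)])
  have eqs: "FDom (NDom \<alpha>') = FDom (NDom \<alpha>)" "FCod (NDom \<alpha>') = FDom (NDom \<beta>)"
    "FDom (NDom \<beta>') = FDom (NDom \<beta>)" "FCod (NDom \<beta>') = FCod (NDom \<beta>)"
    using assms D E by auto
  note F = is_functorD(5-)[OF D(1)] is_functorD(5-)[OF D'(1), unfolded eqs] is_functorD(5-)[OF D'(2), unfolded
    eqs]
    is_functorD(5-)[OF E(1)] is_functorD(5-)[OF E'(1), unfolded eqs]
  show ?thesis
  proof (rule ntrans_eqI)
    show "is_ntrans (nt_hcomp (nt_vcomp \<beta>' \<beta>) (nt_vcomp \<alpha>' \<alpha>))"
      "is_ntrans (nt_vcomp (nt_hcomp \<beta>' \<alpha>') (nt_hcomp \<beta> \<alpha>))"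
      using assms eqs by (auto intro!: is_ntrans_nt_hcomp is_ntrans_nt_vcomp simp: nt_vcomp_simps
        nt_hcomp_simps)
    fix x assume "x \<in> Obj (FDom (NDom (nt_vcomp (nt_hcomp \<beta>' \<alpha>') (nt_hcomp \<beta> \<alpha>))))"
    then have x [simp]: "x \<in> Obj (FDom (NDom \<alpha>))" by (simp add: nt_vcomp_simps nt_hcomp_simps comp_func_simps)
    let ?a = "NAt \<alpha> x" and ?a' = "NAt \<alpha>' x"
    have e2: "NDom \<alpha>' = NCod \<alpha>" "FDom (NCod \<alpha>) = FDom (NDom \<alpha>)" "FDom (NCod \<alpha>') = FDom (NDom \<alpha>)"
      "FCod (NCod \<alpha>) = FDom (NDom \<beta>)" "FCod (NCod \<alpha>') = FDom (NDom \<beta>)"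
      "x \<in> Obj (FDom (NDom \<alpha>'))"
      using D(3,4) D'(3,4) assms eqs x by simp_all
    have a: "?a \<in> Arr (FDom (NDom \<beta>))" "?a' \<in> Arr (FDom (NDom \<beta>))" "Cod (FDom (NDom \<beta>)) ?a = FObj (NDom \<alpha>') x"
      "Dom (FDom (NDom \<beta>)) ?a' = FObj (NDom \<alpha>') x" "Cod (FDom (NDom \<beta>)) ?a' = FObj (NCod \<alpha>') x"
      "FObj (NDom \<alpha>') x \<in> Obj (FDom (NDom \<beta>))" "FObj (NCod \<alpha>') x \<in> Obj (FDom (NDom \<beta>))"
      using D(6,8)[OF x] D'(6,7,8)[OF e2(6)] is_functorD(5)[OF D(2)] is_functorD(5)[OF D'(2)] e2
        assms(7) by simp_all
    have nat: "NAt \<beta> (FObj (NCod \<alpha>') x) \<cdot>[FCod (NDom \<beta>)] FArr (NDom \<beta>) ?a' =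
        FArr (NDom \<beta>') ?a' \<cdot>[FCod (NDom \<beta>)] NAt \<beta> (FObj (NDom \<alpha>') x)"
      using E(9)[of ?a'] a assms by simp
    have "NAt (nt_hcomp (nt_vcomp \<beta>' \<beta>) (nt_vcomp \<alpha>' \<alpha>)) x =
       NAt \<beta>' (FObj (NCod \<alpha>') x) \<cdot>[FCod (NDom \<beta>)]
        ((NAt \<beta> (FObj (NCod \<alpha>') x) \<cdot>[FCod (NDom \<beta>)] FArr (NDom \<beta>) ?a') \<cdot>[FCod (NDom \<beta>)] FArr (NDom \<beta>) ?a)"
      using a F E E' assms eqs
      by (simp add: nt_hcomp_simps nt_vcomp_simps D.Comp_assoc D.Comp_in D.Dom_Comp D.Cod_Comp B.Comp_in)
    also have "\<dots> = NAt (nt_vcomp (nt_hcomp \<beta>' \<alpha>') (nt_hcomp \<beta> \<alpha>)) x"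
      unfolding nat using a F E E' assms eqs
      by (simp add: nt_hcomp_simps nt_vcomp_simps comp_func_simps D.Comp_assoc D.Comp_in D.Dom_Comp D.Cod_Comp)
    finally show "NAt (nt_hcomp (nt_vcomp \<beta>' \<beta>) (nt_vcomp \<alpha>' \<alpha>)) x =
      NAt (nt_vcomp (nt_hcomp \<beta>' \<alpha>') (nt_hcomp \<beta> \<alpha>)) x" .
  qed (simp_all add: nt_vcomp_simps nt_hcomp_simps)
qed

lemma nt_hcomp_id:
  assumes "is_functor F" "is_functor G" "FCod F = FDom G"
  shows "nt_hcomp (nt_id G) (nt_id F) = nt_id (comp_func G F)"
proof -
  interpret D: category "FCod G" by (rule is_functorD[OF assms(2)])
  have [simp]: "FObj F x \<in> Obj (FDom G)" if "x \<in> Obj (FDom F)" for x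
    using is_functorD(5)[OF assms(1) that] assms by simp
  show ?thesis
    using assms
    by (intro ntrans_eqI is_ntrans_nt_hcomp is_ntrans_nt_id is_functor_comp_func)
      (simp_all add: nt_hcomp_simps nt_id_simps comp_func_simps is_functorD D.Ident_Comp_Ident)
qed

lemma two_category_CAT: "two_category (CAT small)"
  by (rule two_category.intro)
    (auto simp: category_cat1_CAT category_vcat_CAT category_hcat_CAT CAT_simps is_ntransD
      nt_hcomp_simps nt_hcomp_id nt_interchange)

section \<open>Strict 2-categories\<close>

context two_category
begin

lemmas cat1_facts = category.Dom_in[OF category_cat1] category.Cod_in[OF category_cat1]
  category.Ident_in[OF category_cat1] category.Dom_Ident[OF category_cat1]
  category.Cod_Ident[OF category_cat1] category.Comp_in[OF category_cat1]
  category.Dom_Comp[OF category_cat1] category.Cod_Comp[OF category_cat1]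
  category.Comp_Ident_left[OF category_cat1] category.Comp_Ident_right[OF category_cat1]
  category.Comp_assoc[OF category_cat1]

lemmas vcat_facts = category.Dom_in[OF category_vcat] category.Cod_in[OF category_vcat]
  category.Ident_in[OF category_vcat] category.Dom_Ident[OF category_vcat]
  category.Cod_Ident[OF category_vcat] category.Comp_in[OF category_vcat]
  category.Dom_Comp[OF category_vcat] category.Cod_Comp[OF category_vcat]
  category.Comp_Ident_left[OF category_vcat] category.Comp_Ident_right[OF category_vcat]
  category.Comp_assoc[OF category_vcat]

text \<open>The unit laws are cited by number: 9 and 10 for 1-cells, 20 and 21 for vertical, 24 and
  25 for horizontal composition. They mention the source or target of the other factor, and no
  longer match once the simplifier has evaluated it; hence the explicit instances below.\<close>

lemmas two_cat_simps = cat1_facts[unfolded cat1_def cat.simps] vcat_facts[unfolded vcat_def cat.simps]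
  category.Comp_in[OF category_hcat, unfolded hcat_def cat.simps]
  category.Comp_Ident_left[OF category_hcat, unfolded hcat_def cat.simps]
  category.Comp_Ident_right[OF category_hcat, unfolded hcat_def cat.simps]
  category.Comp_assoc[OF category_hcat, unfolded hcat_def cat.simps]
  dom2_hcomp cod2_hcomp hcomp_id2 src_cod2 tgt_cod2

lemma hcomp_id2_assoc:
  "\<lbrakk>\<alpha> \<in> Cell K; f \<in> Mor K; g \<in> Mor K; tgt K (dom2 K \<alpha>) = src K f; tgt K f = src K g\<rbrakk>
    \<Longrightarrow> id2 K g \<star> (id2 K f \<star> \<alpha>) = id2 K (g \<odot> f) \<star> \<alpha>"
  using category.Comp_assoc[OF category_hcat, unfolded hcat_def cat.simps, of \<alpha> "id2 K f" "id2 K g"]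
  by (simp add: two_cat_simps)

lemma whisker_left_vcomp:
  assumes "\<alpha> \<in> Cell K" "\<beta> \<in> Cell K" "cod2 K \<alpha> = dom2 K \<beta>" "h \<in> Mor K" "tgt K (dom2 K \<alpha>) = src K h"
  shows "id2 K h \<star> (\<beta> \<bullet> \<alpha>) = (id2 K h \<star> \<beta>) \<bullet> (id2 K h \<star> \<alpha>)"
  using interchange[of \<alpha> \<beta> "id2 K h" "id2 K h"] assms vcat_facts(9)[unfolded vcat_def cat.simps, of "id2 K h"]
  by (simp add: two_cat_simps)

lemma whisker_right_vcomp:
  assumes "\<alpha> \<in> Cell K" "\<beta> \<in> Cell K" "cod2 K \<alpha> = dom2 K \<beta>" "h \<in> Mor K" "src K (dom2 K \<alpha>) = tgt K h"
  shows "(\<beta> \<bullet> \<alpha>) \<star> id2 K h = (\<beta> \<star> id2 K h) \<bullet> (\<alpha> \<star> id2 K h)"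
  using interchange[of "id2 K h" "id2 K h" \<alpha> \<beta>] assms vcat_facts(9)[unfolded vcat_def cat.simps, of "id2 K h"]
  by (simp add: two_cat_simps)

text \<open>Interchange against identity cells. Taken together, the two equations let whiskerings in
  different variables slide past each other.\<close>

lemma hcomp_eq_vcomp:
  assumes "\<alpha> \<in> Cell K" "\<beta> \<in> Cell K" "tgt K (dom2 K \<alpha>) = src K (dom2 K \<beta>)"
  shows "(id2 K (cod2 K \<beta>) \<star> \<alpha>) \<bullet> (\<beta> \<star> id2 K (dom2 K \<alpha>)) = \<beta> \<star> \<alpha>"
    and "(\<beta> \<star> id2 K (cod2 K \<alpha>)) \<bullet> (id2 K (dom2 K \<beta>) \<star> \<alpha>) = \<beta> \<star> \<alpha>"
  using interchange[of "id2 K (dom2 K \<alpha>)" \<alpha> \<beta> "id2 K (cod2 K \<beta>)"]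
    interchange[of \<alpha> "id2 K (cod2 K \<alpha>)" "id2 K (dom2 K \<beta>)" \<beta>] assms
  by (simp_all add: two_cat_simps)

lemma invertible_cell_iff:
  "invertible_cell K \<alpha> \<longleftrightarrow> \<alpha> \<in> Cell K \<and> (\<exists>\<beta>\<in>Cell K. dom2 K \<beta> = cod2 K \<alpha> \<and> cod2 K \<beta> = dom2 K \<alpha> \<and>
     \<beta> \<bullet> \<alpha> = id2 K (dom2 K \<alpha>) \<and> \<alpha> \<bullet> \<beta> = id2 K (cod2 K \<alpha>))"
  by (auto simp: invertible_cell_def iso_arr_def inverse_arrs_def vcat_def hom_def)

lemma invertible_id2: "f \<in> Mor K \<Longrightarrow> invertible_cell K (id2 K f)"
  using category.iso_arr_Ident[OF category_vcat, of f] by (simp add: invertible_cell_def vcat_def)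

lemma invertible_vcomp:
  "\<lbrakk>invertible_cell K \<alpha>; invertible_cell K \<beta>; cod2 K \<alpha> = dom2 K \<beta>\<rbrakk> \<Longrightarrow> invertible_cell K (\<beta> \<bullet> \<alpha>)"
  using category.iso_arr_comp[OF category_vcat, of \<alpha> \<beta>] by (simp add: invertible_cell_def vcat_def)

lemma invertible_hcomp:
  assumes "invertible_cell K \<alpha>" "invertible_cell K \<beta>" "tgt K (dom2 K \<alpha>) = src K (dom2 K \<beta>)"
  shows "invertible_cell K (\<beta> \<star> \<alpha>)"
proof -
  obtain \<alpha>' where a: "\<alpha> \<in> Cell K" "\<alpha>' \<in> Cell K" "dom2 K \<alpha>' = cod2 K \<alpha>" "cod2 K \<alpha>' = dom2 K \<alpha>"
    "\<alpha>' \<bullet> \<alpha> = id2 K (dom2 K \<alpha>)" "\<alpha> \<bullet> \<alpha>' = id2 K (cod2 K \<alpha>)"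
    using assms(1) unfolding invertible_cell_iff by blast
  obtain \<beta>' where b: "\<beta> \<in> Cell K" "\<beta>' \<in> Cell K" "dom2 K \<beta>' = cod2 K \<beta>" "cod2 K \<beta>' = dom2 K \<beta>"
    "\<beta>' \<bullet> \<beta> = id2 K (dom2 K \<beta>)" "\<beta> \<bullet> \<beta>' = id2 K (cod2 K \<beta>)"
    using assms(2) unfolding invertible_cell_iff by blast
  show ?thesis
    unfolding invertible_cell_iff using a b assms(3)
      interchange[of \<alpha> \<alpha>' \<beta> \<beta>'] interchange[of \<alpha>' \<alpha> \<beta>' \<beta>]
    by (intro conjI bexI[of _ "\<beta>' \<star> \<alpha>'"]) (simp_all add: two_cat_simps)
qed

end

lemma two_category_full_sub:
  assumes "two_category K" shows "two_category (full_sub K X)"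
proof -
  interpret two_category K by (rule assms)
  show ?thesis
    by (unfold_locales, simp_all add: full_sub_def cat1_def vcat_def hcat_def)
      (auto simp: two_cat_simps interchange)
qed

lemma category_op_cat: "category A \<Longrightarrow> category (op_cat A)"
  by (rule category.intro) (auto simp: op_cat_def category.Dom_in category.Cod_in category.Ident_in
      category.Dom_Ident category.Cod_Ident category.Comp_in category.Dom_Comp category.Cod_Comp
      category.Comp_Ident_left category.Comp_Ident_right category.Comp_assoc)

lemma two_category_locally_discrete:
  assumes "category A" shows "two_category (locally_discrete A)"
proof -
  interpret category A by (rule assms)
  show ?thesis
    by (unfold_locales, simp_all add: locally_discrete_def cat1_def vcat_def hcat_def)
      (auto simp: Dom_in Cod_in Ident_in Dom_Ident Cod_Ident Comp_in Dom_Comp Cod_Comp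
       Comp_Ident_left Comp_Ident_right Comp_assoc)
qed

section \<open>The 2-category of pseudofunctors\<close>

lemma psnat_eqI:
  assumes "pseudonatural K L \<sigma>" "pseudonatural K L \<tau>" "TDom \<sigma> = TDom \<tau>" "TCod \<sigma> = TCod \<tau>"
    "\<And>x. x \<in> Ob K \<Longrightarrow> TAt \<sigma> x = TAt \<tau> x" "\<And>f. f \<in> Mor K \<Longrightarrow> TCell \<sigma> f = TCell \<tau> f"
  shows "\<sigma> = \<tau>"
proof -
  have "TAt \<sigma> = TAt \<tau>" "TCell \<sigma> = TCell \<tau>"
    using assms by (auto intro!: extensionalityI pseudonatural.TAt_ext pseudonatural.TCell_ext)
  then show ?thesis using assms by simp
qed

lemma modif_eqI:
  assumes "modification K L \<Gamma>" "modification K L \<Delta>" "MDom \<Gamma> = MDom \<Delta>" "MCod \<Gamma> = MCod \<Delta>"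
    "\<And>x. x \<in> Ob K \<Longrightarrow> MAt \<Gamma> x = MAt \<Delta> x"
  shows "\<Gamma> = \<Delta>"
proof -
  have "MAt \<Gamma> = MAt \<Delta>"
    using assms by (auto intro!: extensionalityI modification.MAt_ext)
  then show ?thesis using assms by simp
qed

text \<open>Pseudofunctors are treated for arbitrary strict 2-categories by calculating with cells;
  the case of \<open>base C\<close> and \<open>CAT\<close> is an instance.\<close>

locale two_category_pair = K: two_category K + L: two_category L
  for K :: "('o, 'm, 'c) twocat" and L :: "('p, 'n, 'd) twocat"
begin

lemma psfun_simps:
  assumes "pseudofunctor K L P"
  shows "x \<in> Ob K \<Longrightarrow> PObj P x \<in> Ob L"
    "f \<in> Mor K \<Longrightarrow> PMor P f \<in> Mor L"
    "f \<in> Mor K \<Longrightarrow> src L (PMor P f) = PObj P (src K f)"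
    "f \<in> Mor K \<Longrightarrow> tgt L (PMor P f) = PObj P (tgt K f)"
    "\<alpha> \<in> Cell K \<Longrightarrow> PCell P \<alpha> \<in> Cell L"
    "\<alpha> \<in> Cell K \<Longrightarrow> dom2 L (PCell P \<alpha>) = PMor P (dom2 K \<alpha>)"
    "\<alpha> \<in> Cell K \<Longrightarrow> cod2 L (PCell P \<alpha>) = PMor P (cod2 K \<alpha>)"
    "\<lbrakk>f \<in> Mor K; g \<in> Mor K; tgt K f = src K g\<rbrakk> \<Longrightarrow> PComp P g f \<in> Cell L"
    "\<lbrakk>f \<in> Mor K; g \<in> Mor K; tgt K f = src K g\<rbrakk> \<Longrightarrow> dom2 L (PComp P g f) = PMor P g \<odot>[L] PMor P f"
    "\<lbrakk>f \<in> Mor K; g \<in> Mor K; tgt K f = src K g\<rbrakk> \<Longrightarrow> cod2 L (PComp P g f) = PMor P (g \<odot>[K] f)"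
    "x \<in> Ob K \<Longrightarrow> PUnit P x \<in> Cell L"
    "x \<in> Ob K \<Longrightarrow> dom2 L (PUnit P x) = id1 L (PObj P x)"
    "x \<in> Ob K \<Longrightarrow> cod2 L (PUnit P x) = PMor P (id1 K x)"
proof -
  interpret pseudofunctor K L P by (rule assms)
  show "x \<in> Ob K \<Longrightarrow> PObj P x \<in> Ob L"
    "f \<in> Mor K \<Longrightarrow> PMor P f \<in> Mor L"
    "f \<in> Mor K \<Longrightarrow> src L (PMor P f) = PObj P (src K f)"
    "f \<in> Mor K \<Longrightarrow> tgt L (PMor P f) = PObj P (tgt K f)"
    "\<alpha> \<in> Cell K \<Longrightarrow> PCell P \<alpha> \<in> Cell L"
    "\<alpha> \<in> Cell K \<Longrightarrow> dom2 L (PCell P \<alpha>) = PMor P (dom2 K \<alpha>)"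
    "\<alpha> \<in> Cell K \<Longrightarrow> cod2 L (PCell P \<alpha>) = PMor P (cod2 K \<alpha>)"
    "\<lbrakk>f \<in> Mor K; g \<in> Mor K; tgt K f = src K g\<rbrakk> \<Longrightarrow> PComp P g f \<in> Cell L"
    "\<lbrakk>f \<in> Mor K; g \<in> Mor K; tgt K f = src K g\<rbrakk> \<Longrightarrow> dom2 L (PComp P g f) = PMor P g \<odot>[L] PMor P f"
    "\<lbrakk>f \<in> Mor K; g \<in> Mor K; tgt K f = src K g\<rbrakk> \<Longrightarrow> cod2 L (PComp P g f) = PMor P (g \<odot>[K] f)"
    "x \<in> Ob K \<Longrightarrow> PUnit P x \<in> Cell L"
    "x \<in> Ob K \<Longrightarrow> dom2 L (PUnit P x) = id1 L (PObj P x)"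
    "x \<in> Ob K \<Longrightarrow> cod2 L (PUnit P x) = PMor P (id1 K x)"
    using PObj_in[of x] PMor_in[of f] PCell_in[of \<alpha>] PComp_in[of f g] PUnit_in[of x]
    by (auto simp: hom_def cat1_def vcat_def)
qed

lemma psnat_simps:
  assumes "pseudonatural K L \<sigma>"
  shows "pseudofunctor K L (TDom \<sigma>)" "pseudofunctor K L (TCod \<sigma>)"
    "x \<in> Ob K \<Longrightarrow> TAt \<sigma> x \<in> Mor L"
    "x \<in> Ob K \<Longrightarrow> src L (TAt \<sigma> x) = PObj (TDom \<sigma>) x"
    "x \<in> Ob K \<Longrightarrow> tgt L (TAt \<sigma> x) = PObj (TCod \<sigma>) x"
    "f \<in> Mor K \<Longrightarrow> TCell \<sigma> f \<in> Cell L"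
    "f \<in> Mor K \<Longrightarrow> dom2 L (TCell \<sigma> f) = PMor (TCod \<sigma>) f \<odot>[L] TAt \<sigma> (src K f)"
    "f \<in> Mor K \<Longrightarrow> cod2 L (TCell \<sigma> f) = TAt \<sigma> (tgt K f) \<odot>[L] PMor (TDom \<sigma>) f"
proof -
  interpret pseudonatural K L \<sigma> by (rule assms)
  show "pseudofunctor K L (TDom \<sigma>)" "pseudofunctor K L (TCod \<sigma>)"
    by (rule pseudofunctor_TDom pseudofunctor_TCod)+
  show "x \<in> Ob K \<Longrightarrow> TAt \<sigma> x \<in> Mor L"
    "x \<in> Ob K \<Longrightarrow> src L (TAt \<sigma> x) = PObj (TDom \<sigma>) x"
    "x \<in> Ob K \<Longrightarrow> tgt L (TAt \<sigma> x) = PObj (TCod \<sigma>) x"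
    "f \<in> Mor K \<Longrightarrow> TCell \<sigma> f \<in> Cell L"
    "f \<in> Mor K \<Longrightarrow> dom2 L (TCell \<sigma> f) = PMor (TCod \<sigma>) f \<odot>[L] TAt \<sigma> (src K f)"
    "f \<in> Mor K \<Longrightarrow> cod2 L (TCell \<sigma> f) = TAt \<sigma> (tgt K f) \<odot>[L] PMor (TDom \<sigma>) f"
    using TAt_in[of x] TCell_in[of f] by (auto simp: hom_def cat1_def vcat_def)
qed

lemma modif_simps:
  assumes "modification K L \<Gamma>"
  shows "pseudonatural K L (MDom \<Gamma>)" "pseudonatural K L (MCod \<Gamma>)"
    "TDom (MCod \<Gamma>) = TDom (MDom \<Gamma>)" "TCod (MCod \<Gamma>) = TCod (MDom \<Gamma>)"
    "x \<in> Ob K \<Longrightarrow> MAt \<Gamma> x \<in> Cell L"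
    "x \<in> Ob K \<Longrightarrow> dom2 L (MAt \<Gamma> x) = TAt (MDom \<Gamma>) x"
    "x \<in> Ob K \<Longrightarrow> cod2 L (MAt \<Gamma> x) = TAt (MCod \<Gamma>) x"
proof -
  interpret modification K L \<Gamma> by (rule assms)
  show "pseudonatural K L (MDom \<Gamma>)" "pseudonatural K L (MCod \<Gamma>)"
    "TDom (MCod \<Gamma>) = TDom (MDom \<Gamma>)" "TCod (MCod \<Gamma>) = TCod (MDom \<Gamma>)"
    by (rule pseudonatural_MDom pseudonatural_MCod TDom_MCod TCod_MCod)+
  show "x \<in> Ob K \<Longrightarrow> MAt \<Gamma> x \<in> Cell L"
    "x \<in> Ob K \<Longrightarrow> dom2 L (MAt \<Gamma> x) = TAt (MDom \<Gamma>) x"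
    "x \<in> Ob K \<Longrightarrow> cod2 L (MAt \<Gamma> x) = TAt (MCod \<Gamma>) x"
    using MAt_in[of x] by (auto simp: hom_def vcat_def)
qed

text \<open>A normal form for pastings: whiskerings are distributed over vertical composites, nested
  whiskerings are merged and vertical composites are associated to the right. What remains of a
  pasting equation is the rewriting with the given squares.\<close>

lemmas whisker_simps = L.two_cat_simps L.whisker_left_vcomp L.whisker_right_vcomp L.hcomp_id2_assoc

text \<open>Every axiom reduces to unit laws of L. They are restated at the objects
  \<open>PObj P x\<close>, because the general forms mention \<open>src L\<close> and
  \<open>tgt L\<close>, which are already evaluated.\<close>

lemma pseudonatural_id_psnat:
  assumes P: "pseudofunctor K L P"
  shows "pseudonatural K L (id_psnat K L P)"
proof -
  interpret pseudofunctor K L P by (rule P)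
  note [simp] = psfun_simps[OF P] K.two_cat_simps
  have [simp]: "PCell P \<alpha> \<star>[L] id2 L (id1 L (PObj P (src K (dom2 K \<alpha>)))) = PCell P \<alpha>"
    "id2 L (id1 L (PObj P (tgt K (dom2 K \<alpha>)))) \<star>[L] PCell P \<alpha> = PCell P \<alpha>" if "\<alpha> \<in> Cell K" for \<alpha>
    using L.two_cat_simps(24,25)[of "PCell P \<alpha>"] that by simp_all
  have [simp]: "PComp P g f \<star>[L] id2 L (id1 L (PObj P (src K f))) = PComp P g f"
    "id2 L (id1 L (PObj P (tgt K g))) \<star>[L] PComp P g f = PComp P g f"
     if "f \<in> Mor K" "g \<in> Mor K" "tgt K f = src K g" for f g
    using L.two_cat_simps(24,25)[of "PComp P g f"] that by (simp_all add: L.two_cat_simps)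
  have [simp]: "PUnit P x \<star>[L] id2 L (id1 L (PObj P x)) = PUnit P x"
    "id2 L (id1 L (PObj P x)) \<star>[L] PUnit P x = PUnit P x" if "x \<in> Ob K" for x
    using L.two_cat_simps(24,25)[of "PUnit P x"] that by (simp_all add: L.two_cat_simps)
  have [simp]: "PMor P f \<odot>[L] id1 L (PObj P (src K f)) = PMor P f"
    "id1 L (PObj P (tgt K f)) \<odot>[L] PMor P f = PMor P f"
    if "f \<in> Mor K" for f using L.two_cat_simps(9,10)[of "PMor P f"] that by simp_all
  have [simp]: "id2 L (PMor P (cod2 K \<alpha>)) \<bullet>[L] PCell P \<alpha> = PCell P \<alpha> \<bullet>[L] id2 L (PMor P (dom2 K \<alpha>))"
    if "\<alpha> \<in> Cell K" for \<alpha>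
    using L.two_cat_simps(20,21)[of "PCell P \<alpha>"] that by simp
  have [simp]: "id2 L (PMor P (g \<odot>[K] f)) \<bullet>[L] PComp P g f = PComp P g f"
    "PComp P g f \<bullet>[L] id2 L (PMor P g \<odot>[L] PMor P f) = PComp P g f"
    if "f \<in> Mor K" "g \<in> Mor K" "tgt K f = src K g" for f g
    using L.two_cat_simps(20,21)[of "PComp P g f"] that by simp_all
  have [simp]: "id2 L (PMor P (id1 K x)) \<bullet>[L] PUnit P x = PUnit P x" if "x \<in> Ob K" for x
    using L.two_cat_simps(20)[of "PUnit P x"] that by simp
  show ?thesis
    by (rule pseudonatural.intro)
      (simp_all add: id_psnat_def P hom_def cat1_def vcat_def L.two_cat_simps L.invertible_id2)
qed

text \<open>Pasting: each law follows from the law for \<tau> whiskered with the components of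
  \<sigma>, and the law for \<sigma> whiskered with the components of \<tau>.\<close>

lemma pseudonatural_comp_psnat:
  assumes \<sigma>: "pseudonatural K L \<sigma>" and \<tau>: "pseudonatural K L \<tau>" and e: "TCod \<sigma> = TDom \<tau>"
  shows "pseudonatural K L (comp_psnat K L \<tau> \<sigma>)"
proof -
  interpret s: pseudonatural K L \<sigma> by (rule \<sigma>)
  interpret t: pseudonatural K L \<tau> by (rule \<tau>)
  let ?P = "TDom \<sigma>" and ?Q = "TDom \<tau>" and ?R = "TCod \<tau>"
  note P = psnat_simps(1)[OF \<sigma>] and Q = psnat_simps(1)[OF \<tau>] and R = psnat_simps(2)[OF \<tau>]
  note [simp] = psfun_simps[OF P] psfun_simps[OF Q] psfun_simps[OF R] psnat_simps(3-)[OF \<sigma>]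
    psnat_simps(3-)[OF \<tau>] K.two_cat_simps e
  let ?i = "id2 L"
  show ?thesis
  proof (rule pseudonatural.intro)
    show "pseudofunctor K L (TDom (comp_psnat K L \<tau> \<sigma>))" "pseudofunctor K L (TCod (comp_psnat K L \<tau> \<sigma>))"
      by (simp_all add: comp_psnat_def P R)
    show "TAt (comp_psnat K L \<tau> \<sigma>) \<in> extensional (Ob K)" "TCell (comp_psnat K L \<tau> \<sigma>) \<in> extensional (Mor K)"
      by (simp_all add: comp_psnat_def)
    show "TAt (comp_psnat K L \<tau> \<sigma>) x \<in> hom (cat1 L) (PObj (TDom (comp_psnat K L \<tau> \<sigma>)) x)
       (PObj (TCod (comp_psnat K L \<tau> \<sigma>)) x)" if "x \<in> Ob K" for x
      using that by (simp add: comp_psnat_def hom_def cat1_def L.two_cat_simps)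
    show "TCell (comp_psnat K L \<tau> \<sigma>) f \<in> hom (vcat L)
       (PMor (TCod (comp_psnat K L \<tau> \<sigma>)) f \<odot>[L] TAt (comp_psnat K L \<tau> \<sigma>) (src K f))
       (TAt (comp_psnat K L \<tau> \<sigma>) (tgt K f) \<odot>[L] PMor (TDom (comp_psnat K L \<tau> \<sigma>)) f)"
      if "f \<in> Mor K" for f
      using that by (simp add: comp_psnat_def hom_def vcat_def L.two_cat_simps)
    show "invertible_cell L (TCell (comp_psnat K L \<tau> \<sigma>) f)" if "f \<in> Mor K" for f
      using that by (simp add: comp_psnat_def L.invertible_vcomp L.invertible_hcomp L.invertible_id2
         s.TCell_invertible t.TCell_invertible L.two_cat_simps)
  next
    fix \<alpha> assume a: "\<alpha> \<in> Cell K"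
    let ?x = "src K (dom2 K \<alpha>)" and ?y = "tgt K (dom2 K \<alpha>)" and ?f = "dom2 K \<alpha>" and ?g = "cod2 K \<alpha>"
    have "((?i (TAt \<tau> ?y) \<star>[L] TCell \<sigma> ?g) \<bullet>[L] (TCell \<tau> ?g \<star>[L] ?i (TAt \<sigma> ?x))) \<bullet>[L] (PCell ?R \<alpha> \<star>[L] ?i (TAt \<tau>
      ?x \<odot>[L] TAt \<sigma> ?x))
      = (?i (TAt \<tau> ?y) \<star>[L] TCell \<sigma> ?g) \<bullet>[L] ((TCell \<tau> ?g \<bullet>[L] (PCell ?R \<alpha> \<star>[L] ?i (TAt \<tau> ?x))) \<star>[L] ?i (TAt \<sigma>
        ?x))"
      using a by (simp add: whisker_simps)
    also have "\<dots> = (?i (TAt \<tau> ?y) \<star>[L] (TCell \<sigma> ?g \<bullet>[L] (PCell ?Q \<alpha> \<star>[L] ?i (TAt \<sigma> ?x)))) \<bullet>[L] (TCell \<tau> ?f \<star>[L]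
      ?i (TAt \<sigma> ?x))"
      unfolding t.TCell_natural[OF a] using a by (simp add: whisker_simps)
    also have "\<dots> = (?i (TAt \<tau> ?y \<odot>[L] TAt \<sigma> ?y) \<star>[L] PCell ?P \<alpha>) \<bullet>[L] ((?i (TAt \<tau> ?y) \<star>[L] TCell \<sigma> ?f) \<bullet>[L]
      (TCell \<tau> ?f \<star>[L] ?i (TAt \<sigma> ?x)))"
      unfolding s.TCell_natural[OF a, unfolded e] using a by (simp add: whisker_simps)
    finally show "TCell (comp_psnat K L \<tau> \<sigma>) ?g \<bullet>[L] (PCell (TCod (comp_psnat K L \<tau> \<sigma>)) \<alpha> \<star>[L] ?i (TAt
      (comp_psnat K L \<tau> \<sigma>) ?x)) =
      (?i (TAt (comp_psnat K L \<tau> \<sigma>) ?y) \<star>[L] PCell (TDom (comp_psnat K L \<tau> \<sigma>)) \<alpha>) \<bullet>[L] TCell (comp_psnat K L \<tau>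
        \<sigma>) ?f"
      using a by (simp add: comp_psnat_def)
  next
    fix f g assume fg: "f \<in> Mor K" "g \<in> Mor K" "tgt K f = src K g"
    let ?x = "src K f" and ?y = "src K g" and ?z = "tgt K g" and ?h = "g \<odot>[K] f"
    let ?s = "TCell \<sigma>" and ?t = "TCell \<tau>"
    have ct: "?t ?h \<bullet>[L] (PComp ?R g f \<star>[L] ?i (TAt \<tau> ?x)) = (?i (TAt \<tau> ?z) \<star>[L] PComp ?Q g f) \<bullet>[L]
        (?t g \<star>[L] ?i (PMor ?Q f)) \<bullet>[L] (?i (PMor ?R g) \<star>[L] ?t f)"
      by (rule t.TCell_comp[OF fg])
    have cs: "?s ?h \<bullet>[L] (PComp ?Q g f \<star>[L] ?i (TAt \<sigma> ?x)) = (?i (TAt \<sigma> ?z) \<star>[L] PComp ?P g f) \<bullet>[L]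
        (?s g \<star>[L] ?i (PMor ?P f)) \<bullet>[L] (?i (PMor ?Q g) \<star>[L] ?s f)"
      using s.TCell_comp[OF fg] by simp
    \<comment> \<open>The cells of \<sigma> at f and of \<tau> at g act in different places and
      commute by interchange. This regroups the four cells into one block over g and one over
      f.\<close>
    have ex: "(?i (TAt \<tau> ?z \<odot>[L] PMor ?Q g) \<star>[L] ?s f) \<bullet>[L] (?t g \<star>[L] ?i (PMor ?Q f \<odot>[L] TAt \<sigma> ?x)) =
       (?t g \<star>[L] ?i (TAt \<sigma> ?y \<odot>[L] PMor ?P f)) \<bullet>[L] (?i (PMor ?R g \<odot>[L] TAt \<tau> ?y) \<star>[L] ?s f)"
      using L.hcomp_eq_vcomp[of "?s f" "?t g"] fg by (simp add: L.two_cat_simps)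
    have "((?i (TAt \<tau> ?z) \<star>[L] ?s ?h) \<bullet>[L] (?t ?h \<star>[L] ?i (TAt \<sigma> ?x))) \<bullet>[L] (PComp ?R g f \<star>[L] ?i (TAt \<tau> ?x \<odot>[L]
      TAt \<sigma> ?x))
      = (?i (TAt \<tau> ?z) \<star>[L] ?s ?h) \<bullet>[L] ((?t ?h \<bullet>[L] (PComp ?R g f \<star>[L] ?i (TAt \<tau> ?x))) \<star>[L] ?i (TAt \<sigma> ?x))"
      using fg by (simp add: whisker_simps)
    also have "\<dots> = (?i (TAt \<tau> ?z) \<star>[L] (?s ?h \<bullet>[L] (PComp ?Q g f \<star>[L] ?i (TAt \<sigma> ?x)))) \<bullet>[L]
        ((?t g \<star>[L] ?i (PMor ?Q f \<odot>[L] TAt \<sigma> ?x)) \<bullet>[L] (?i (PMor ?R g) \<star>[L] (?t f \<star>[L] ?i (TAt \<sigma> ?x))))"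
      unfolding ct using fg by (simp add: whisker_simps)
    also have "\<dots> = (?i (TAt \<tau> ?z \<odot>[L] TAt \<sigma> ?z) \<star>[L] PComp ?P g f) \<bullet>[L]
        ((?i (TAt \<tau> ?z) \<star>[L] (?s g \<star>[L] ?i (PMor ?P f))) \<bullet>[L]
        (((?i (TAt \<tau> ?z \<odot>[L] PMor ?Q g) \<star>[L] ?s f) \<bullet>[L] (?t g \<star>[L] ?i (PMor ?Q f \<odot>[L] TAt \<sigma> ?x))) \<bullet>[L]
         (?i (PMor ?R g) \<star>[L] (?t f \<star>[L] ?i (TAt \<sigma> ?x)))))"
      unfolding cs using fg by (simp add: whisker_simps)
    also have "\<dots> = (?i (TAt \<tau> ?z \<odot>[L] TAt \<sigma> ?z) \<star>[L] PComp ?P g f) \<bullet>[L]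
      (((?i (TAt \<tau> ?z) \<star>[L] ?s g) \<bullet>[L] (?t g \<star>[L] ?i (TAt \<sigma> ?y))) \<star>[L] ?i (PMor ?P f)) \<bullet>[L]
      (?i (PMor ?R g) \<star>[L] ((?i (TAt \<tau> ?y) \<star>[L] ?s f) \<bullet>[L] (?t f \<star>[L] ?i (TAt \<sigma> ?x))))"
      unfolding ex using fg by (simp add: whisker_simps)
    finally show "TCell (comp_psnat K L \<tau> \<sigma>) ?h \<bullet>[L] (PComp (TCod (comp_psnat K L \<tau> \<sigma>)) g f \<star>[L] ?i (TAt
      (comp_psnat K L \<tau> \<sigma>) ?x)) =
      (?i (TAt (comp_psnat K L \<tau> \<sigma>) (tgt K g)) \<star>[L] PComp (TDom (comp_psnat K L \<tau> \<sigma>)) g f) \<bullet>[L]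
      (TCell (comp_psnat K L \<tau> \<sigma>) g \<star>[L] ?i (PMor (TDom (comp_psnat K L \<tau> \<sigma>)) f)) \<bullet>[L]
      (?i (PMor (TCod (comp_psnat K L \<tau> \<sigma>)) g) \<star>[L] TCell (comp_psnat K L \<tau> \<sigma>) f)"
      using fg by (simp add: comp_psnat_def)
  next
    fix x assume x: "x \<in> Ob K"
    let ?o = "id1 K x"
    have "((?i (TAt \<tau> x) \<star>[L] TCell \<sigma> ?o) \<bullet>[L] (TCell \<tau> ?o \<star>[L] ?i (TAt \<sigma> x))) \<bullet>[L] (PUnit ?R x \<star>[L] ?i (TAt \<tau> x
      \<odot>[L] TAt \<sigma> x))
      = (?i (TAt \<tau> x) \<star>[L] TCell \<sigma> ?o) \<bullet>[L] ((TCell \<tau> ?o \<bullet>[L] (PUnit ?R x \<star>[L] ?i (TAt \<tau> x))) \<star>[L] ?i (TAt \<sigma>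
        x))"
      using x by (simp add: whisker_simps)
    also have "\<dots> = (?i (TAt \<tau> x) \<star>[L] (TCell \<sigma> ?o \<bullet>[L] (PUnit ?Q x \<star>[L] ?i (TAt \<sigma> x))))"
      unfolding t.TCell_unit[OF x] using x by (simp add: whisker_simps)
    also have "\<dots> = ?i (TAt \<tau> x \<odot>[L] TAt \<sigma> x) \<star>[L] PUnit ?P x"
      unfolding s.TCell_unit[OF x, unfolded e] using x by (simp add: whisker_simps)
    finally show "TCell (comp_psnat K L \<tau> \<sigma>) ?o \<bullet>[L] (PUnit (TCod (comp_psnat K L \<tau> \<sigma>)) x \<star>[L] ?i (TAt
      (comp_psnat K L \<tau> \<sigma>) x)) =
      ?i (TAt (comp_psnat K L \<tau> \<sigma>) x) \<star>[L] PUnit (TDom (comp_psnat K L \<tau> \<sigma>)) x"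
      using x by (simp add: comp_psnat_def)
  qed
qed

lemma comp_psnat_simps:
  "TDom (comp_psnat K L \<tau> \<sigma>) = TDom \<sigma>" "TCod (comp_psnat K L \<tau> \<sigma>) = TCod \<tau>"
  "x \<in> Ob K \<Longrightarrow> TAt (comp_psnat K L \<tau> \<sigma>) x = TAt \<tau> x \<odot>[L] TAt \<sigma> x"
  "f \<in> Mor K \<Longrightarrow> TCell (comp_psnat K L \<tau> \<sigma>) f = (id2 L (TAt \<tau> (tgt K f)) \<star>[L] TCell \<sigma> f) \<bullet>[L]
       (TCell \<tau> f \<star>[L] id2 L (TAt \<sigma> (src K f)))"
  by (simp_all add: comp_psnat_def)

lemma id_psnat_simps:
  "TDom (id_psnat K L P) = P" "TCod (id_psnat K L P) = P"
  "x \<in> Ob K \<Longrightarrow> TAt (id_psnat K L P) x = id1 L (PObj P x)"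
  "f \<in> Mor K \<Longrightarrow> TCell (id_psnat K L P) f = id2 L (PMor P f)"
  by (simp_all add: id_psnat_def)

lemma comp_psnat_id_left:
  assumes \<sigma>: "pseudonatural K L \<sigma>"
  shows "comp_psnat K L (id_psnat K L (TCod \<sigma>)) \<sigma> = \<sigma>"
proof (rule psnat_eqI)
  note P = psnat_simps(1)[OF \<sigma>] and Q = psnat_simps(2)[OF \<sigma>]
  note [simp] = psfun_simps[OF P] psfun_simps[OF Q] psnat_simps(3-)[OF \<sigma>] K.two_cat_simps
  show "pseudonatural K L (comp_psnat K L (id_psnat K L (TCod \<sigma>)) \<sigma>)" "pseudonatural K L \<sigma>"
    using \<sigma> Q by (auto intro: pseudonatural_comp_psnat pseudonatural_id_psnat simp: id_psnat_simps)
  show "TAt (comp_psnat K L (id_psnat K L (TCod \<sigma>)) \<sigma>) x = TAt \<sigma> x" if "x \<in> Ob K" for x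
    using that L.two_cat_simps(9)[of "TAt \<sigma> x"] by (simp add: comp_psnat_simps id_psnat_simps)
  show "TCell (comp_psnat K L (id_psnat K L (TCod \<sigma>)) \<sigma>) f = TCell \<sigma> f" if "f \<in> Mor K" for f
    using that L.two_cat_simps(24)[of "TCell \<sigma> f"] L.two_cat_simps(21)[of "TCell \<sigma> f"]
    by (simp add: comp_psnat_simps id_psnat_simps L.two_cat_simps)
qed (simp_all add: comp_psnat_simps id_psnat_simps)

lemma comp_psnat_id_right:
  assumes \<sigma>: "pseudonatural K L \<sigma>"
  shows "comp_psnat K L \<sigma> (id_psnat K L (TDom \<sigma>)) = \<sigma>"
proof (rule psnat_eqI)
  note P = psnat_simps(1)[OF \<sigma>] and Q = psnat_simps(2)[OF \<sigma>]
  note [simp] = psfun_simps[OF P] psfun_simps[OF Q] psnat_simps(3-)[OF \<sigma>] K.two_cat_simps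
  show "pseudonatural K L (comp_psnat K L \<sigma> (id_psnat K L (TDom \<sigma>)))" "pseudonatural K L \<sigma>"
    using \<sigma> P by (auto intro: pseudonatural_comp_psnat pseudonatural_id_psnat simp: id_psnat_simps)
  show "TAt (comp_psnat K L \<sigma> (id_psnat K L (TDom \<sigma>))) x = TAt \<sigma> x" if "x \<in> Ob K" for x
    using that L.two_cat_simps(10)[of "TAt \<sigma> x"] by (simp add: comp_psnat_simps id_psnat_simps)
  show "TCell (comp_psnat K L \<sigma> (id_psnat K L (TDom \<sigma>))) f = TCell \<sigma> f" if "f \<in> Mor K" for f
    using that L.two_cat_simps(25)[of "TCell \<sigma> f"] L.two_cat_simps(20)[of "TCell \<sigma> f"]
    by (simp add: comp_psnat_simps id_psnat_simps L.two_cat_simps)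
qed (simp_all add: comp_psnat_simps id_psnat_simps)

lemma comp_psnat_assoc:
  assumes \<rho>: "pseudonatural K L \<rho>" and \<sigma>: "pseudonatural K L \<sigma>" and \<tau>: "pseudonatural K L \<tau>"
    and e: "TCod \<rho> = TDom \<sigma>" "TCod \<sigma> = TDom \<tau>"
  shows "comp_psnat K L (comp_psnat K L \<tau> \<sigma>) \<rho> = comp_psnat K L \<tau> (comp_psnat K L \<sigma> \<rho>)"
proof (rule psnat_eqI)
  note [simp] = psfun_simps[OF psnat_simps(1)[OF \<rho>]] psfun_simps[OF psnat_simps(1)[OF \<sigma>]]
    psfun_simps[OF psnat_simps(1)[OF \<tau>]] psfun_simps[OF psnat_simps(2)[OF \<tau>]]
    psnat_simps(3-)[OF \<rho>] psnat_simps(3-)[OF \<sigma>] psnat_simps(3-)[OF \<tau>] e K.two_cat_simps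
  show "pseudonatural K L (comp_psnat K L (comp_psnat K L \<tau> \<sigma>) \<rho>)"
    "pseudonatural K L (comp_psnat K L \<tau> (comp_psnat K L \<sigma> \<rho>))"
    by (intro pseudonatural_comp_psnat assms; simp add: comp_psnat_simps)+
  show "TAt (comp_psnat K L (comp_psnat K L \<tau> \<sigma>) \<rho>) x = TAt (comp_psnat K L \<tau> (comp_psnat K L \<sigma> \<rho>)) x"
    if "x \<in> Ob K" for x
    using that by (simp add: comp_psnat_simps L.two_cat_simps)
  show "TCell (comp_psnat K L (comp_psnat K L \<tau> \<sigma>) \<rho>) f = TCell (comp_psnat K L \<tau> (comp_psnat K L \<sigma> \<rho>)) f"
    if "f \<in> Mor K" for f
    using that by (simp add: comp_psnat_simps whisker_simps)
qed (simp_all add: comp_psnat_simps)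

abbreviation "ps \<equiv> ps_twocat K L"

lemma ps_simps:
  "Ob ps = {P. pseudofunctor K L P}" "Mor ps = {\<sigma>. pseudonatural K L \<sigma>}"
  "Cell ps = {\<Gamma>. modification K L \<Gamma>}" "src ps = TDom" "tgt ps = TCod"
  "id1 ps = id_psnat K L" "comp1 ps = comp_psnat K L" "dom2 ps = MDom" "cod2 ps = MCod"
  "MDom (id2 ps \<sigma>) = \<sigma>" "MCod (id2 ps \<sigma>) = \<sigma>" "x \<in> Ob K \<Longrightarrow> MAt (id2 ps \<sigma>) x = id2 L (TAt \<sigma> x)"
  "MAt (id2 ps \<sigma>) \<in> extensional (Ob K)"
  "MDom (\<Delta> \<bullet>[ps] \<Gamma>) = MDom \<Gamma>" "MCod (\<Delta> \<bullet>[ps] \<Gamma>) = MCod \<Delta>"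
  "x \<in> Ob K \<Longrightarrow> MAt (\<Delta> \<bullet>[ps] \<Gamma>) x = MAt \<Delta> x \<bullet>[L] MAt \<Gamma> x" "MAt (\<Delta> \<bullet>[ps] \<Gamma>) \<in> extensional (Ob K)"
  "MDom (\<Delta> \<star>[ps] \<Gamma>) = comp_psnat K L (MDom \<Delta>) (MDom \<Gamma>)"
  "MCod (\<Delta> \<star>[ps] \<Gamma>) = comp_psnat K L (MCod \<Delta>) (MCod \<Gamma>)"
  "x \<in> Ob K \<Longrightarrow> MAt (\<Delta> \<star>[ps] \<Gamma>) x = MAt \<Delta> x \<star>[L] MAt \<Gamma> x" "MAt (\<Delta> \<star>[ps] \<Gamma>) \<in> extensional (Ob K)"
  by (simp_all add: ps_twocat_def)

lemma modification_id2:
  assumes \<sigma>: "pseudonatural K L \<sigma>" shows "modification K L (id2 ps \<sigma>)"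
proof -
  note [simp] = psfun_simps[OF psnat_simps(1)[OF \<sigma>]] psfun_simps[OF psnat_simps(2)[OF \<sigma>]]
    psnat_simps(3-)[OF \<sigma>] K.two_cat_simps
  show ?thesis
  proof (rule modification.intro)
    fix f assume f: "f \<in> Mor K"
    then show "(MAt (id2 ps \<sigma>) (tgt K f) \<star>[L] id2 L (PMor (TDom (MDom (id2 ps \<sigma>))) f)) \<bullet>[L] TCell (MDom (id2 ps
      \<sigma>)) f =
      TCell (MCod (id2 ps \<sigma>)) f \<bullet>[L] (id2 L (PMor (TCod (MDom (id2 ps \<sigma>))) f) \<star>[L] MAt (id2 ps \<sigma>) (src K f))"
      using L.two_cat_simps(20,21)[of "TCell \<sigma> f"] by (simp add: ps_simps L.two_cat_simps)
  qed (use \<sigma> in \<open>simp_all add: ps_simps hom_def vcat_def L.two_cat_simps\<close>)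
qed

lemma modification_vcomp:
  assumes \<Gamma>: "modification K L \<Gamma>" and \<Delta>: "modification K L \<Delta>" and e: "MCod \<Gamma> = MDom \<Delta>"
  shows "modification K L (\<Delta> \<bullet>[ps] \<Gamma>)"
proof -
  have eqs [simp]: "TDom (MDom \<Delta>) = TDom (MDom \<Gamma>)" "TCod (MDom \<Delta>) = TCod (MDom \<Gamma>)"
    using modif_simps[OF \<Gamma>] e by simp_all
  note [simp] = psfun_simps[OF psnat_simps(1)[OF modif_simps(1)[OF \<Gamma>]]] psfun_simps[OF psnat_simps(2)[OF
    modif_simps(1)[OF \<Gamma>]]]
    psnat_simps(3-)[OF modif_simps(1)[OF \<Gamma>]] psnat_simps(3-)[OF modif_simps(1)[OF \<Delta>], simplified]
    psnat_simps(3-)[OF modif_simps(2)[OF \<Delta>]]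
    modif_simps(3-)[OF \<Gamma>] modif_simps(3-)[OF \<Delta>] K.two_cat_simps e
  show ?thesis
  proof (rule modification.intro)
    fix f assume f: "f \<in> Mor K"
    let ?i = "id2 L" and ?P = "PMor (TDom (MDom \<Gamma>)) f" and ?Q = "PMor (TCod (MDom \<Gamma>)) f" and ?x = "src K f" and
      ?y = "tgt K f"
    have "((MAt \<Delta> ?y \<bullet>[L] MAt \<Gamma> ?y) \<star>[L] ?i ?P) \<bullet>[L] TCell (MDom \<Gamma>) f =
      (MAt \<Delta> ?y \<star>[L] ?i ?P) \<bullet>[L] ((MAt \<Gamma> ?y \<star>[L] ?i ?P) \<bullet>[L] TCell (MDom \<Gamma>) f)"
      using f by (simp add: whisker_simps)
    also have "\<dots> = ((MAt \<Delta> ?y \<star>[L] ?i ?P) \<bullet>[L] TCell (MDom \<Delta>) f) \<bullet>[L] (?i ?Q \<star>[L] MAt \<Gamma> ?x)"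
      using f modification.MAt_natural[OF \<Gamma> f] by (simp add: whisker_simps)
    also have "\<dots> = TCell (MCod \<Delta>) f \<bullet>[L] (?i ?Q \<star>[L] (MAt \<Delta> ?x \<bullet>[L] MAt \<Gamma> ?x))"
      using f modification.MAt_natural[OF \<Delta> f] by (simp add: whisker_simps)
    finally show "(MAt (\<Delta> \<bullet>[ps] \<Gamma>) ?y \<star>[L] ?i (PMor (TDom (MDom (\<Delta> \<bullet>[ps] \<Gamma>))) f)) \<bullet>[L] TCell (MDom (\<Delta> \<bullet>[ps] \<Gamma>))
      f =
      TCell (MCod (\<Delta> \<bullet>[ps] \<Gamma>)) f \<bullet>[L] (?i (PMor (TCod (MDom (\<Delta> \<bullet>[ps] \<Gamma>))) f) \<star>[L] MAt (\<Delta> \<bullet>[ps] \<Gamma>) ?x)"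
      using f by (simp add: ps_simps)
  qed (use modif_simps(1,2)[OF \<Gamma>] modif_simps(1,2)[OF \<Delta>] in \<open>simp_all add: ps_simps hom_def vcat_def
    L.two_cat_simps\<close>)
qed

lemma modification_hcomp:
  assumes \<Gamma>: "modification K L \<Gamma>" and \<Delta>: "modification K L \<Delta>" and e: "TCod (MDom \<Gamma>) = TDom (MDom \<Delta>)"
  shows "modification K L (\<Delta> \<star>[ps] \<Gamma>)"
proof -
  note [simp] = psfun_simps[OF psnat_simps(1)[OF modif_simps(1)[OF \<Gamma>]]] psfun_simps[OF psnat_simps(1)[OF
    modif_simps(1)[OF \<Delta>]]]
    psfun_simps[OF psnat_simps(2)[OF modif_simps(1)[OF \<Delta>]]]
    psnat_simps(3-)[OF modif_simps(1)[OF \<Gamma>]] psnat_simps(3-)[OF modif_simps(1)[OF \<Delta>]]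
    psnat_simps(3-)[OF modif_simps(2)[OF \<Gamma>]] psnat_simps(3-)[OF modif_simps(2)[OF \<Delta>]]
    modif_simps(3-)[OF \<Gamma>] modif_simps(3-)[OF \<Delta>] K.two_cat_simps e
  show ?thesis
  proof (rule modification.intro)
    fix f assume f: "f \<in> Mor K"
    let ?i = "id2 L" and ?P = "PMor (TDom (MDom \<Gamma>)) f" and ?Q = "PMor (TDom (MDom \<Delta>)) f"
      and ?R = "PMor (TCod (MDom \<Delta>)) f" and ?x = "src K f" and ?y = "tgt K f"
      and ?s = "MDom \<Gamma>" and ?t = "MDom \<Delta>" and ?s' = "MCod \<Gamma>" and ?t' = "MCod \<Delta>"
    have n1: "(MAt \<Gamma> ?y \<star>[L] ?i ?P) \<bullet>[L] TCell ?s f = TCell ?s' f \<bullet>[L] (?i ?Q \<star>[L] MAt \<Gamma> ?x)"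
      using modification.MAt_natural[OF \<Gamma> f] by simp
    have n2: "(MAt \<Delta> ?y \<star>[L] ?i ?Q) \<bullet>[L] TCell ?t f = TCell ?t' f \<bullet>[L] (?i ?R \<star>[L] MAt \<Delta> ?x)"
      using modification.MAt_natural[OF \<Delta> f] by simp
    have e1: "MAt \<Delta> ?y \<star>[L] MAt \<Gamma> ?y = (MAt \<Delta> ?y \<star>[L] ?i (TAt ?s' ?y)) \<bullet>[L] (?i (TAt ?t ?y) \<star>[L] MAt \<Gamma> ?y)"
      using L.hcomp_eq_vcomp(2)[of "MAt \<Gamma> ?y" "MAt \<Delta> ?y"] f by simp
    have e2: "MAt \<Delta> ?x \<star>[L] MAt \<Gamma> ?x = (?i (TAt ?t' ?x) \<star>[L] MAt \<Gamma> ?x) \<bullet>[L] (MAt \<Delta> ?x \<star>[L] ?i (TAt ?s ?x))"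
      using L.hcomp_eq_vcomp(1)[of "MAt \<Gamma> ?x" "MAt \<Delta> ?x"] f by simp
    \<comment> \<open>In \<open>e3\<close> a component of \<Delta> passes the cell of the target of
      \<Gamma>, in \<open>e4\<close> a component of \<Gamma> passes the cell of the source of
      \<Delta>. After that each naturality law applies inside one block.\<close>
    have e3: "(MAt \<Delta> ?y \<star>[L] ?i (TAt ?s' ?y \<odot>[L] ?P)) \<bullet>[L] (?i (TAt ?t ?y) \<star>[L] TCell ?s' f) =
       (?i (TAt ?t' ?y) \<star>[L] TCell ?s' f) \<bullet>[L] (MAt \<Delta> ?y \<star>[L] ?i (?Q \<odot>[L] TAt ?s' ?x))"
      using L.hcomp_eq_vcomp[of "TCell ?s' f" "MAt \<Delta> ?y"] f by (simp add: L.two_cat_simps)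
    have e4: "(?i (TAt ?t ?y \<odot>[L] ?Q) \<star>[L] MAt \<Gamma> ?x) \<bullet>[L] (TCell ?t f \<star>[L] ?i (TAt ?s ?x)) =
       (TCell ?t f \<star>[L] ?i (TAt ?s' ?x)) \<bullet>[L] (?i (?R \<odot>[L] TAt ?t ?x) \<star>[L] MAt \<Gamma> ?x)"
      using L.hcomp_eq_vcomp[of "MAt \<Gamma> ?x" "TCell ?t f"] f by (simp add: L.two_cat_simps)
    have e5: "(MAt \<Delta> ?x \<star>[L] ?i (TAt ?s' ?x)) \<bullet>[L] (?i (TAt ?t ?x) \<star>[L] MAt \<Gamma> ?x) =
      (?i (TAt ?t' ?x) \<star>[L] MAt \<Gamma> ?x) \<bullet>[L] (MAt \<Delta> ?x \<star>[L] ?i (TAt ?s ?x))"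
      using L.hcomp_eq_vcomp[of "MAt \<Gamma> ?x" "MAt \<Delta> ?x"] f by simp
    have "((MAt \<Delta> ?y \<star>[L] MAt \<Gamma> ?y) \<star>[L] ?i ?P) \<bullet>[L] ((?i (TAt ?t ?y) \<star>[L] TCell ?s f) \<bullet>[L] (TCell ?t f \<star>[L] ?i
      (TAt ?s ?x)))
      = (MAt \<Delta> ?y \<star>[L] ?i (TAt ?s' ?y \<odot>[L] ?P)) \<bullet>[L] ((?i (TAt ?t ?y) \<star>[L] ((MAt \<Gamma> ?y \<star>[L] ?i ?P) \<bullet>[L] TCell ?s
        f)) \<bullet>[L] (TCell ?t f \<star>[L] ?i (TAt ?s ?x)))"
      unfolding e1 using f by (simp add: whisker_simps)
    also have "\<dots> = ((MAt \<Delta> ?y \<star>[L] ?i (TAt ?s' ?y \<odot>[L] ?P)) \<bullet>[L] (?i (TAt ?t ?y) \<star>[L] TCell ?s' f)) \<bullet>[L]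
        ((?i (TAt ?t ?y \<odot>[L] ?Q) \<star>[L] MAt \<Gamma> ?x) \<bullet>[L] (TCell ?t f \<star>[L] ?i (TAt ?s ?x)))"
      unfolding n1 using f by (simp add: whisker_simps)
    also have "\<dots> = (?i (TAt ?t' ?y) \<star>[L] TCell ?s' f) \<bullet>[L] ((((MAt \<Delta> ?y \<star>[L] ?i ?Q) \<bullet>[L] TCell ?t f) \<star>[L] ?i
      (TAt ?s' ?x)) \<bullet>[L]
        (?i (?R \<odot>[L] TAt ?t ?x) \<star>[L] MAt \<Gamma> ?x))"
      unfolding e3 e4 using f by (simp add: whisker_simps)
    also have "\<dots> = ((?i (TAt ?t' ?y) \<star>[L] TCell ?s' f) \<bullet>[L] (TCell ?t' f \<star>[L] ?i (TAt ?s' ?x))) \<bullet>[L]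
        (?i ?R \<star>[L] ((MAt \<Delta> ?x \<star>[L] ?i (TAt ?s' ?x)) \<bullet>[L] (?i (TAt ?t ?x) \<star>[L] MAt \<Gamma> ?x)))"
      unfolding n2 using f by (simp add: whisker_simps)
    also have "\<dots> = ((?i (TAt ?t' ?y) \<star>[L] TCell ?s' f) \<bullet>[L] (TCell ?t' f \<star>[L] ?i (TAt ?s' ?x))) \<bullet>[L]
        (?i ?R \<star>[L] (MAt \<Delta> ?x \<star>[L] MAt \<Gamma> ?x))"
      unfolding e5 e2 ..
    finally show "(MAt (\<Delta> \<star>[ps] \<Gamma>) ?y \<star>[L] ?i (PMor (TDom (MDom (\<Delta> \<star>[ps] \<Gamma>))) f)) \<bullet>[L] TCell (MDom (\<Delta> \<star>[ps] \<Gamma>))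
      f =
      TCell (MCod (\<Delta> \<star>[ps] \<Gamma>)) f \<bullet>[L] (?i (PMor (TCod (MDom (\<Delta> \<star>[ps] \<Gamma>))) f) \<star>[L] MAt (\<Delta> \<star>[ps] \<Gamma>) ?x)"
      using f by (simp add: ps_simps comp_psnat_simps)
  qed (use modif_simps(1,2)[OF \<Gamma>] modif_simps(1,2)[OF \<Delta>] in
    \<open>simp_all add: ps_simps comp_psnat_simps hom_def vcat_def L.two_cat_simps pseudonatural_comp_psnat\<close>)
qed

text \<open>A modification is determined by its components, and identities and composites are
  computed componentwise, so the laws for cells are those of L at each object.\<close>

lemma two_category_ps: "two_category ps"
proof (rule two_category.intro)
  show "category (cat1 ps)"
    by (rule category.intro)
      (auto simp: cat1_def ps_simps comp_psnat_simps id_psnat_simps psnat_simps pseudonatural_id_psnat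
        pseudonatural_comp_psnat comp_psnat_id_left comp_psnat_id_right comp_psnat_assoc)
  show "category (vcat ps)"
  proof (rule category.intro, goal_cases)
    case (9 \<Gamma>)
    then have m: "modification K L \<Gamma>" by (simp add: vcat_def ps_simps)
    note [simp] = modif_simps[OF m] psnat_simps[OF modif_simps(2)[OF m]]
    have [simp]: "id2 L (TAt (MCod \<Gamma>) x) \<bullet>[L] MAt \<Gamma> x = MAt \<Gamma> x" if "x \<in> Ob K" for x
      using L.two_cat_simps(20)[of "MAt \<Gamma> x"] that by simp
    have "id2 ps (MCod \<Gamma>) \<bullet>[ps] \<Gamma> = \<Gamma>"
      by (intro modif_eqI[where K=K and L=L] modification_vcomp modification_id2 m; simp add: ps_simps)
    then show ?case by (simp add: vcat_def ps_simps)
  next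
    case (10 \<Gamma>)
    then have m: "modification K L \<Gamma>" by (simp add: vcat_def ps_simps)
    note [simp] = modif_simps[OF m] psnat_simps[OF modif_simps(1)[OF m]]
    have [simp]: "MAt \<Gamma> x \<bullet>[L] id2 L (TAt (MDom \<Gamma>) x) = MAt \<Gamma> x" if "x \<in> Ob K" for x
      using L.two_cat_simps(21)[of "MAt \<Gamma> x"] that by simp
    have "\<Gamma> \<bullet>[ps] id2 ps (MDom \<Gamma>) = \<Gamma>"
      by (intro modif_eqI[where K=K and L=L] modification_vcomp modification_id2 m; simp add: ps_simps)
    then show ?case by (simp add: vcat_def ps_simps)
  next
    case (11 f g h)
    then have m: "modification K L f" "modification K L g" "modification K L h" "MCod f = MDom g" "MCod g =
      MDom h"
      by (simp_all add: vcat_def ps_simps)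
    note [simp] = modif_simps[OF m(1)] modif_simps[OF m(2)] modif_simps[OF m(3)] m(4,5)
    have "(h \<bullet>[ps] g) \<bullet>[ps] f = h \<bullet>[ps] (g \<bullet>[ps] f)"
      by (intro modif_eqI[where K=K and L=L] modification_vcomp m; simp add: ps_simps m L.two_cat_simps)
    then show ?case by (simp add: vcat_def)
  qed (auto simp: vcat_def ps_simps modif_simps modification_id2 modification_vcomp)
  show "category (hcat ps)"
  proof (rule category.intro, goal_cases)
    case (9 \<Gamma>)
    then have m: "modification K L \<Gamma>" by (simp add: hcat_def ps_simps)
    note [simp] = modif_simps[OF m] psnat_simps[OF modif_simps(1)[OF m]]
    have [simp]: "id2 L (id1 L (PObj (TCod (MDom \<Gamma>)) x)) \<star>[L] MAt \<Gamma> x = MAt \<Gamma> x" if "x \<in> Ob K" for x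
      using L.two_cat_simps(24)[of "MAt \<Gamma> x"] that by simp
    have "id2 ps (id_psnat K L (TCod (MDom \<Gamma>))) \<star>[ps] \<Gamma> = \<Gamma>"
      using comp_psnat_id_left[of "MCod \<Gamma>"]
      by (intro modif_eqI[where K=K and L=L] modification_hcomp modification_id2 pseudonatural_id_psnat m;
          simp add: ps_simps id_psnat_simps comp_psnat_id_left)
    then show ?case by (simp add: hcat_def ps_simps)
  next
    case (10 \<Gamma>)
    then have m: "modification K L \<Gamma>" by (simp add: hcat_def ps_simps)
    note [simp] = modif_simps[OF m] psnat_simps[OF modif_simps(1)[OF m]]
    have [simp]: "MAt \<Gamma> x \<star>[L] id2 L (id1 L (PObj (TDom (MDom \<Gamma>)) x)) = MAt \<Gamma> x" if "x \<in> Ob K" for x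
      using L.two_cat_simps(25)[of "MAt \<Gamma> x"] that by simp
    have "\<Gamma> \<star>[ps] id2 ps (id_psnat K L (TDom (MDom \<Gamma>))) = \<Gamma>"
      using comp_psnat_id_right[of "MCod \<Gamma>"]
      by (intro modif_eqI[where K=K and L=L] modification_hcomp modification_id2 pseudonatural_id_psnat m;
          simp add: ps_simps id_psnat_simps comp_psnat_id_right)
    then show ?case by (simp add: hcat_def ps_simps)
  next
    case (11 f g h)
    then have m: "modification K L f" "modification K L g" "modification K L h"
      "TCod (MDom f) = TDom (MDom g)" "TCod (MDom g) = TDom (MDom h)"
      by (simp_all add: hcat_def ps_simps)
    note [simp] = modif_simps[OF m(1)] modif_simps[OF m(2)] modif_simps[OF m(3)] m(4,5)
      psnat_simps[OF modif_simps(1)[OF m(1)]] psnat_simps[OF modif_simps(1)[OF m(2)]] psnat_simps[OF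
        modif_simps(1)[OF m(3)]]
    have "(h \<star>[ps] g) \<star>[ps] f = h \<star>[ps] (g \<star>[ps] f)"
      by (intro modif_eqI[where K=K and L=L] modification_hcomp m; simp add: ps_simps comp_psnat_simps
        comp_psnat_assoc m L.two_cat_simps)
    then show ?case by (simp add: hcat_def)
  qed (auto simp: hcat_def ps_simps modif_simps psnat_simps modification_id2 modification_hcomp
    pseudonatural_id_psnat
      comp_psnat_simps id_psnat_simps)
  show "id2 ps g \<star>[ps] id2 ps f = id2 ps (g \<odot>[ps] f)"
    if "f \<in> Mor ps" "g \<in> Mor ps" "tgt ps f = src ps g" for f g
  proof -
    from that have m: "pseudonatural K L f" "pseudonatural K L g" "TCod f = TDom g" by (simp_all add: ps_simps)
    note [simp] = psnat_simps[OF m(1)] psnat_simps[OF m(2)] m(3)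
    show ?thesis
      by (intro modif_eqI[where K=K and L=L] modification_hcomp modification_id2 m;
        simp add: ps_simps comp_psnat_simps pseudonatural_comp_psnat modification_id2 m L.two_cat_simps)
  qed
  show "(\<beta>' \<bullet>[ps] \<beta>) \<star>[ps] (\<alpha>' \<bullet>[ps] \<alpha>) = (\<beta>' \<star>[ps] \<alpha>') \<bullet>[ps] (\<beta> \<star>[ps] \<alpha>)"
    if "\<alpha> \<in> Cell ps" "\<alpha>' \<in> Cell ps" "\<beta> \<in> Cell ps" "\<beta>' \<in> Cell ps"
      "cod2 ps \<alpha> = dom2 ps \<alpha>'" "cod2 ps \<beta> = dom2 ps \<beta>'" "tgt ps (dom2 ps \<alpha>) = src ps (dom2 ps \<beta>)" for \<alpha> \<alpha>' \<beta> \<beta>'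
  proof -
    from that have m: "modification K L \<alpha>" "modification K L \<alpha>'" "modification K L \<beta>" "modification K L \<beta>'"
      "MCod \<alpha> = MDom \<alpha>'" "MCod \<beta> = MDom \<beta>'" "TCod (MDom \<alpha>) = TDom (MDom \<beta>)" by (simp_all add: ps_simps)
    have eqs [simp]: "TDom (MDom \<alpha>') = TDom (MDom \<alpha>)" "TCod (MDom \<alpha>') = TCod (MDom \<alpha>)"
      "TDom (MDom \<beta>') = TCod (MDom \<alpha>)" "TCod (MDom \<beta>') = TCod (MDom \<beta>)"
      using modif_simps[OF m(1)] modif_simps[OF m(3)] m by simp_all
    note [simp] = modif_simps(3-)[OF m(1)] modif_simps(3-)[OF m(2)] modif_simps(3-)[OF m(3)] modif_simps(3-)[OF
      m(4)] m(5,6) m(7)[symmetric]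
      psnat_simps[OF modif_simps(1)[OF m(1)]] psnat_simps[OF modif_simps(1)[OF m(3)]]
    show ?thesis
      by (intro modif_eqI[where K=K and L=L] modification_hcomp modification_vcomp m; simp add: ps_simps
        L.interchange)
  qed
qed (auto simp: ps_simps modif_simps)

text \<open>Pseudofunctors are not normalised off their domain, so two of them may have the same
  effect on K and still be different records. This happens for the identity and its composite with
  itself, whose \<open>PComp\<close> is specified only at composable pairs.\<close>

definition psfun_agree ::
  "('o, 'm, 'c, 'p, 'n, 'd) psfun \<Rightarrow> ('o, 'm, 'c, 'p, 'n, 'd) psfun \<Rightarrow> bool" where
  "psfun_agree P Q \<longleftrightarrow> (\<forall>x\<in>Ob K. PObj Q x = PObj P x \<and> PUnit Q x = PUnit P x) \<and>
     (\<forall>f\<in>Mor K. PMor Q f = PMor P f) \<and> (\<forall>\<alpha>\<in>Cell K. PCell Q \<alpha> = PCell P \<alpha>) \<and>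
     (\<forall>f\<in>Mor K. \<forall>g\<in>Mor K. tgt K f = src K g \<longrightarrow> PComp Q g f = PComp P g f)"

lemma pseudofunctor_agree:
  assumes P: "pseudofunctor K L P" and a: "psfun_agree P Q"
  shows "pseudofunctor K L Q"
proof -
  interpret pseudofunctor K L P by (rule P)
  show ?thesis
    by (rule pseudofunctor.intro, use a in \<open>simp_all add: psfun_agree_def K.two_cat_simps\<close>)
     (simp_all add: PObj_in PMor_in PCell_in PCell_id2 PCell_vcomp PComp_in PComp_invertible PUnit_in
        PUnit_invertible PComp_natural PComp_assoc PComp_unit_left PComp_unit_right)
qed

text \<open>The data are those of the identity of P. They involve P only on K, where P and Q
  coincide, so either end may be replaced.\<close>

lemma pseudonatural_agree:
  assumes P: "pseudofunctor K L P" and a: "psfun_agree P Q"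
  shows "pseudonatural K L ((id_psnat K L P)\<lparr>TCod := Q\<rparr>)" "pseudonatural K L ((id_psnat K L P)\<lparr>TDom := Q\<rparr>)"
proof -
  note Q = pseudofunctor_agree[OF P a]
  note i = pseudonatural_id_psnat[OF P]
  note I = pseudonatural.TAt_ext[OF i] pseudonatural.TCell_ext[OF i] pseudonatural.TAt_in[OF i]
    pseudonatural.TCell_in[OF i] pseudonatural.TCell_invertible[OF i] pseudonatural.TCell_natural[OF i]
    pseudonatural.TCell_comp[OF i] pseudonatural.TCell_unit[OF i]
  show "pseudonatural K L ((id_psnat K L P)\<lparr>TCod := Q\<rparr>)"
    by (rule pseudonatural.intro, use a P Q I in \<open>simp_all add: id_psnat_simps psfun_agree_def K.two_cat_simps\<close>)
  show "pseudonatural K L ((id_psnat K L P)\<lparr>TDom := Q\<rparr>)"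
    by (rule pseudonatural.intro, use a P Q I in \<open>simp_all add: id_psnat_simps psfun_agree_def K.two_cat_simps\<close>)
qed

lemma equivalent_obs_agree:
  assumes P: "pseudofunctor K L P" and a: "psfun_agree P Q"
  shows "equivalent_obs ps P Q" "equivalent_obs ps Q P"
proof -
  let ?f = "(id_psnat K L P)\<lparr>TCod := Q\<rparr>" and ?g = "(id_psnat K L P)\<lparr>TDom := Q\<rparr>"
  note Q = pseudofunctor_agree[OF P a]
  note f = pseudonatural_agree(1)[OF P a] and g = pseudonatural_agree(2)[OF P a]
  note [simp] = psfun_simps[OF P] K.two_cat_simps id_psnat_simps
  have id [simp]: "id1 L (PObj P x) \<odot>[L] id1 L (PObj P x) = id1 L (PObj P x)" if "x \<in> Ob K" for x
    using L.two_cat_simps(9)[of "id1 L (PObj P x)"] that by (simp add: L.two_cat_simps)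
  have c [simp]: "(id2 L (id1 L (PObj P (tgt K f))) \<star>[L] id2 L (PMor P f)) \<bullet>[L]
    (id2 L (PMor P f) \<star>[L] id2 L (id1 L (PObj P (src K f)))) = id2 L (PMor P f)" if "f \<in> Mor K" for f
    using L.two_cat_simps(24,25,20)[of "id2 L (PMor P f)"] that by (simp add: L.two_cat_simps del: L.hcomp_id2)
  have gf: "comp_psnat K L ?g ?f = id_psnat K L P"
    by (rule psnat_eqI[where K=K and L=L])
      (simp_all add: comp_psnat_simps pseudonatural_comp_psnat f g P pseudonatural_id_psnat)
  have fg: "comp_psnat K L ?f ?g = id_psnat K L Q"
    using a by (intro psnat_eqI[where K=K and L=L])
      (simp_all add: comp_psnat_simps pseudonatural_comp_psnat f g Q pseudonatural_id_psnat psfun_agree_def)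
  interpret ps: two_category ps by (rule two_category_ps)
  have iso: "isomorphic_mors ps h h" if "pseudonatural K L h" for h
    unfolding isomorphic_mors_def using that ps.invertible_id2[of h]
    by (intro bexI[of _ "id2 ps h"]) (simp_all add: ps_simps modification_id2)
  show "equivalent_obs ps P Q"
    unfolding equivalent_obs_def using iso f g gf fg P Q
    by (intro exI[of _ ?f] exI[of _ ?g]) (simp add: hom_def cat1_def ps_simps pseudonatural_id_psnat)
  show "equivalent_obs ps Q P"
    unfolding equivalent_obs_def using iso f g gf fg P Q
    by (intro exI[of _ ?g] exI[of _ ?f]) (simp add: hom_def cat1_def ps_simps pseudonatural_id_psnat)
qed

end

text \<open>Both pseudofunctors are the identity. Their composite agrees with the identity on K
  without being the same record, so the two units of the equivalence come from
  \<open>equivalent_obs_agree\<close>.\<close>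

lemma equivalent_twocats_refl:
  assumes "two_category K" shows "equivalent_twocats K K"
proof -
  interpret K: two_category K by (rule assms)
  interpret two_category_pair K K ..
  have [simp]: "id2 K h \<bullet>[K] id2 K h = id2 K h" if "h \<in> Mor K" for h
    using K.two_cat_simps(20)[of "id2 K h"] that by (simp add: K.two_cat_simps)
  have i: "pseudofunctor K K (id_psfun K)"
  proof (rule pseudofunctor.intro, goal_cases)
    case (12 f)
    then show ?case using K.two_cat_simps(9,10)[of f] by (simp add: id_psfun_def K.two_cat_simps)
  next
    case (13 f)
    then show ?case using K.two_cat_simps(9,10)[of f] by (simp add: id_psfun_def K.two_cat_simps)
  next
    case (10 \<alpha> \<beta>)
    then show ?case using K.two_cat_simps(20,21)[of "\<beta> \<star>[K] \<alpha>"] by (simp add: id_psfun_def K.two_cat_simps)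
  qed (simp_all add: id_psfun_def hom_def cat1_def vcat_def K.two_cat_simps K.invertible_id2)
  have a: "psfun_agree (id_psfun K) (comp_psfun K (id_psfun K) (id_psfun K))"
    by (auto simp: psfun_agree_def comp_psfun_def id_psfun_def K.two_cat_simps)
  show ?thesis
    unfolding equivalent_twocats_def using assms i equivalent_obs_agree[OF i a] by blast
qed

lemma full_sub_full_sub: "full_sub (full_sub K X) Y = full_sub K (X \<inter> Y)"
  by (simp add: full_sub_def Int_assoc conj_ac)

text \<open>Morphisms and cells are selected by their source and target objects, and these always
  lie in \<open>Ob K\<close>.\<close>

lemma full_sub_cong:
  assumes "two_category K" "Ob K \<inter> X = Ob K \<inter> Y"
  shows "full_sub K X = full_sub K Y"
proof -
  interpret two_category K by (rule assms)
  have "x \<in> X \<longleftrightarrow> x \<in> Y" if "x \<in> Ob K" for x using assms(2) that by blast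
  moreover have "src K f \<in> Ob K" "tgt K f \<in> Ob K" if "f \<in> Mor K" for f
    using two_cat_simps(1,2) that by auto
  moreover have "dom2 K \<alpha> \<in> Mor K" if "\<alpha> \<in> Cell K" for \<alpha> using two_cat_simps(12) that by auto
  ultimately have "{f \<in> Mor K. src K f \<in> X \<and> tgt K f \<in> X} = {f \<in> Mor K. src K f \<in> Y \<and> tgt K f \<in> Y}"
    "{\<alpha> \<in> Cell K. src K (dom2 K \<alpha>) \<in> X \<and> tgt K (dom2 K \<alpha>) \<in> X} =
      {\<alpha> \<in> Cell K. src K (dom2 K \<alpha>) \<in> Y \<and> tgt K (dom2 K \<alpha>) \<in> Y}"
    by auto
  then show ?thesis using assms(2) by (simp only: full_sub_def)
qed

section \<open>Indexed categories\<close>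

text \<open>A morphism of \<open>base C\<close> from U to V is an arrow of \<open>C\<close> from V
  to U, so \<open>g \<odot> f\<close> in \<open>base C\<close> is \<open>f \<cdot> g\<close> in
  \<open>C\<close>. This explains the order of the arguments of \<open>PComp F g f\<close> below.
  The cells are identities, represented by the arrows themselves.\<close>

abbreviation base :: "('o, 'm) cat \<Rightarrow> ('o, 'm, 'm) twocat" where
  "base C \<equiv> locally_discrete (op_cat C)"

lemma base_simps:
  "Ob (base C) = Obj C" "Mor (base C) = Arr C" "Cell (base C) = Arr C" "src (base C) = Cod C"
  "tgt (base C) = Dom C" "id1 (base C) = Ident C" "g \<odot>[base C] f = f \<cdot>[C] g" "dom2 (base C) f = f"
  "cod2 (base C) f = f" "id2 (base C) f = f" "\<beta> \<bullet>[base C] \<alpha> = \<alpha>" "\<beta> \<star>[base C] \<alpha> = \<alpha> \<cdot>[C] \<beta>"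
  by (simp_all add: locally_discrete_def op_cat_def)

text \<open>A naturality square with invertible sides can be reversed, so the pointwise inverses
  form a natural transformation.\<close>

lemma invertible_cell_CAT:
  "invertible_cell (CAT small) \<alpha> \<longleftrightarrow> \<alpha> \<in> Cell (CAT small) \<and>
    (\<forall>x\<in>Obj (FDom (NDom \<alpha>)). iso_arr (FCod (NDom \<alpha>)) (NAt \<alpha> x))"
  (is "?L \<longleftrightarrow> ?R")
proof
  interpret two_category "CAT small" by (rule two_category_CAT)
  assume ?L
  then obtain \<beta> where a: "\<alpha> \<in> Cell (CAT small)" and b: "\<beta> \<in> Cell (CAT small)" "NDom \<beta> = NCod \<alpha>"
    "NCod \<beta> = NDom \<alpha>" "nt_vcomp \<beta> \<alpha> = nt_id (NDom \<alpha>)" "nt_vcomp \<alpha> \<beta> = nt_id (NCod \<alpha>)"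
    unfolding invertible_cell_iff by (auto simp: CAT_simps)
  then have nt: "is_ntrans \<alpha>" "is_ntrans \<beta>" by (simp_all add: CAT_simps)
  note D = is_ntransD[OF nt(1)]
  note E = is_ntransD[OF nt(2), unfolded b(2,3) D(3,4)]
  have "iso_arr (FCod (NDom \<alpha>)) (NAt \<alpha> x)" if x: "x \<in> Obj (FDom (NDom \<alpha>))" for x
  proof -
    have "NAt \<beta> x \<cdot>[FCod (NDom \<alpha>)] NAt \<alpha> x = Ident (FCod (NDom \<alpha>)) (FObj (NDom \<alpha>) x)"
      using arg_cong[OF b(4), of "\<lambda>\<gamma>. NAt \<gamma> x"] x by (simp add: nt_vcomp_simps nt_id_simps)
    moreover have "NAt \<alpha> x \<cdot>[FCod (NDom \<alpha>)] NAt \<beta> x = Ident (FCod (NDom \<alpha>)) (FObj (NCod \<alpha>) x)"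
      using arg_cong[OF b(5), of "\<lambda>\<gamma>. NAt \<gamma> x"] x b(2) D(3,4) by (simp add: nt_vcomp_simps nt_id_simps)
    ultimately show ?thesis
      using D(6-8)[OF x] E(6-8)[OF x] unfolding iso_arr_def inverse_arrs_def hom_def by auto
  qed
  then show ?R using a by blast
next
  interpret two_category "CAT small" by (rule two_category_CAT)
  assume R: ?R
  then have a: "is_ntrans \<alpha>" and iso: "\<And>x. x \<in> Obj (FDom (NDom \<alpha>)) \<Longrightarrow> iso_arr (FCod (NDom \<alpha>)) (NAt \<alpha> x)"
    by (auto simp: CAT_simps)
  note D = is_ntransD[OF a]
  let ?A = "FDom (NDom \<alpha>)" and ?B = "FCod (NDom \<alpha>)"
  interpret A: category ?A by (rule is_functorD[OF D(1)])
  interpret B: category ?B by (rule is_functorD[OF D(1)])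
  let ?b = "\<lparr>NDom = NCod \<alpha>, NCod = NDom \<alpha>, NAt = restrict (\<lambda>x. inv_arr ?B (NAt \<alpha> x)) (Obj ?A)\<rparr>"
  note F = is_functorD(5-8)[OF D(1)] is_functorD(5-8)[OF D(2), unfolded D(3,4)]
  have b: "is_ntrans ?b"
  proof (rule is_ntransI[of "NCod \<alpha>" "NDom \<alpha>" ?A ?B])
    show "NAt ?b x \<in> hom ?B (FObj (NCod \<alpha>) x) (FObj (NDom \<alpha>) x)" if "x \<in> Obj ?A" for x
      using B.inv_arr_simps[OF iso[OF that]] D(6-8)[OF that] that by (simp add: hom_def)
    fix f assume f: "f \<in> Arr ?A"
    note ob = A.Dom_in[OF f] A.Cod_in[OF f]
    note i = B.inv_arr_simps[OF iso[OF ob(1)]] B.inv_arr_simps[OF iso[OF ob(2)]]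
    note facts = F f D(6-8)[OF ob(1)] D(6-8)[OF ob(2)] i B.Comp_in B.Dom_Comp B.Cod_Comp
    have "inv_arr ?B (NAt \<alpha> (Cod ?A f)) \<cdot>[?B] FArr (NCod \<alpha>) f =
       inv_arr ?B (NAt \<alpha> (Cod ?A f)) \<cdot>[?B] ((FArr (NCod \<alpha>) f \<cdot>[?B] NAt \<alpha> (Dom ?A f)) \<cdot>[?B] inv_arr ?B (NAt \<alpha>
         (Dom ?A f)))"
      using B.inv_comp_cancel(4)[OF iso[OF ob(1)], of "FArr (NCod \<alpha>) f"] by (simp add: facts)
    also have "\<dots> = FArr (NDom \<alpha>) f \<cdot>[?B] inv_arr ?B (NAt \<alpha> (Dom ?A f))"
      unfolding D(9)[OF f, symmetric]
      using B.inv_comp_cancel(1)[OF iso[OF ob(2)], of "FArr (NDom \<alpha>) f \<cdot>[?B] inv_arr ?B (NAt \<alpha> (Dom ?A f))"] by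
        (simp add: facts B.Comp_assoc)
    finally show "NAt ?b (Cod ?A f) \<cdot>[?B] FArr (NCod \<alpha>) f = FArr (NDom \<alpha>) f \<cdot>[?B] NAt ?b (Dom ?A f)"
      using ob by simp
  qed (simp_all add: D)
  have "nt_vcomp ?b \<alpha> = nt_id (NDom \<alpha>)"
    by (rule ntrans_eqI) (use a b D iso in \<open>auto intro: is_ntrans_nt_vcomp is_ntrans_nt_id
      simp: nt_vcomp_simps nt_id_simps B.inv_arr_simps\<close>)
  moreover have "nt_vcomp \<alpha> ?b = nt_id (NCod \<alpha>)"
    by (rule ntrans_eqI) (use a b D iso in \<open>auto intro: is_ntrans_nt_vcomp is_ntrans_nt_id
      simp: nt_vcomp_simps nt_id_simps B.inv_arr_simps\<close>)
  ultimately show ?L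
    unfolding invertible_cell_iff using a b R D(3,4)
    by (intro conjI bexI[of _ ?b]) (simp_all add: CAT_simps)
qed

text \<open>Translates a pseudofunctor on \<open>base C\<close> into restriction functors and
  comparison isomorphisms. Calculations inside the fibres rest on the elementary laws derived here,
  which no longer mention cells of \<open>CAT\<close>.\<close>

locale indexed_category = C: category C
  for C :: "('o, 'm) cat" +
  fixes small :: "'u set \<Rightarrow> bool" and F :: "('o, 'm, 'u, 'u) cat_psfun"
  assumes psfun: "pseudofunctor (base C) (CAT small) F"
begin

sublocale P: pseudofunctor "base C" "CAT small" F
  by (rule psfun)

lemma small_category_PObj: "U \<in> Obj C \<Longrightarrow> small_category small (PObj F U)"
  using P.PObj_in[of U] by (simp add: base_simps CAT_simps)

lemma category_PObj: "U \<in> Obj C \<Longrightarrow> category (PObj F U)"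
  using small_category_PObj by (simp add: small_category_def)

lemma PMor_facts:
  assumes "f \<in> Arr C"
  shows "is_functor (PMor F f)" "FDom (PMor F f) = PObj F (Cod C f)" "FCod (PMor F f) = PObj F (Dom C f)"
  using P.PMor_in[of f] assms by (simp_all add: base_simps CAT_simps hom_def cat1_def)

text \<open>The fibre is named by a variable that a premise ties to \<open>Dom C f\<close> or
  \<open>Cod C f\<close>. The rules then still apply after the domain of a composite has been
  simplified.\<close>

lemma res_simps:
  assumes "f \<in> Arr C"
  shows "\<lbrakk>Dom C f = V; x \<in> Obj (PObj F (Cod C f))\<rbrakk> \<Longrightarrow> res_obj F f x \<in> Obj (PObj F V)"
    "\<lbrakk>Dom C f = V; u \<in> Arr (PObj F (Cod C f))\<rbrakk> \<Longrightarrow> res_arr F f u \<in> Arr (PObj F V)"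
    "\<lbrakk>Dom C f = V; u \<in> Arr (PObj F (Cod C f))\<rbrakk> \<Longrightarrow>
      Dom (PObj F V) (res_arr F f u) = res_obj F f (Dom (PObj F (Cod C f)) u)"
    "\<lbrakk>Dom C f = V; u \<in> Arr (PObj F (Cod C f))\<rbrakk> \<Longrightarrow>
      Cod (PObj F V) (res_arr F f u) = res_obj F f (Cod (PObj F (Cod C f)) u)"
    "\<lbrakk>Cod C f = U; x \<in> Obj (PObj F U)\<rbrakk> \<Longrightarrow>
      res_arr F f (Ident (PObj F U) x) = Ident (PObj F (Dom C f)) (res_obj F f x)"
    "\<lbrakk>Cod C f = U; u \<in> Arr (PObj F U); v \<in> Arr (PObj F U); Cod (PObj F U) u = Dom (PObj F U) v\<rbrakk> \<Longrightarrow>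
      res_arr F f (v \<cdot>[PObj F U] u) = res_arr F f v \<cdot>[PObj F (Dom C f)] res_arr F f u"
  using is_functorD(5-)[OF PMor_facts(1)[OF assms], unfolded PMor_facts(2,3)[OF assms]] by blast+

lemma PCell_eq: "f \<in> Arr C \<Longrightarrow> PCell F f = nt_id (PMor F f)"
  using P.PCell_id2[of f] by (simp add: base_simps CAT_simps)

lemma PComp_facts:
  assumes "f \<in> Arr C" "g \<in> Arr C" "Cod C g = Dom C f"
  shows "is_ntrans (PComp F g f)" "NDom (PComp F g f) = comp_func (PMor F g) (PMor F f)"
    "NCod (PComp F g f) = PMor F (f \<cdot>[C] g)"
    "\<And>x. x \<in> Obj (PObj F (Cod C f)) \<Longrightarrow> iso_arr (PObj F (Dom C g)) (res_comp F f g x)"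
  using P.PComp_in[of f g] P.PComp_invertible[of f g] assms
  by (simp_all add: base_simps CAT_simps hom_def vcat_def invertible_cell_CAT comp_func_simps PMor_facts)

lemma PUnit_facts:
  assumes "U \<in> Obj C"
  shows "is_ntrans (PUnit F U)" "NDom (PUnit F U) = id_func (PObj F U)" "NCod (PUnit F U) = PMor F (Ident C U)"
    "\<And>x. x \<in> Obj (PObj F U) \<Longrightarrow> iso_arr (PObj F U) (res_unit F U x)"
  using P.PUnit_in[of U] P.PUnit_invertible[of U] assms
  by (simp_all add: base_simps CAT_simps hom_def vcat_def invertible_cell_CAT id_func_simps)

lemma res_comp_simps:
  assumes "f \<in> Arr C" "g \<in> Arr C" "Cod C g = Dom C f" "Dom C g = V" "x \<in> Obj (PObj F (Cod C f))"
  shows "res_comp F f g x \<in> Arr (PObj F V)"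
    "Dom (PObj F V) (res_comp F f g x) = res_obj F g (res_obj F f x)"
    "Cod (PObj F V) (res_comp F f g x) = res_obj F (f \<cdot>[C] g) x"
    "iso_arr (PObj F V) (res_comp F f g x)"
  using is_ntransD(6-8)[OF PComp_facts(1)[OF assms(1-3)]] PComp_facts[OF assms(1-3)] assms
  by (simp_all add: comp_func_simps PMor_facts)

lemma res_comp_natural:
  assumes "f \<in> Arr C" "g \<in> Arr C" "Cod C g = Dom C f" "u \<in> Arr (PObj F (Cod C f))"
  shows "res_comp F f g (Cod (PObj F (Cod C f)) u) \<cdot>[PObj F (Dom C g)] res_arr F g (res_arr F f u) =
    res_arr F (f \<cdot>[C] g) u \<cdot>[PObj F (Dom C g)] res_comp F f g (Dom (PObj F (Cod C f)) u)"
  using is_ntransD(9)[OF PComp_facts(1)[OF assms(1-3)]] PComp_facts[OF assms(1-3)] assms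
  by (simp add: comp_func_simps PMor_facts)

lemma res_unit_simps:
  assumes "U \<in> Obj C" "x \<in> Obj (PObj F U)"
  shows "res_unit F U x \<in> Arr (PObj F U)"
    "Dom (PObj F U) (res_unit F U x) = x"
    "Cod (PObj F U) (res_unit F U x) = res_obj F (Ident C U) x"
    "iso_arr (PObj F U) (res_unit F U x)"
  using is_ntransD(6-8)[OF PUnit_facts(1)[OF assms(1)]] PUnit_facts[OF assms(1)] assms
  by (simp_all add: id_func_simps)

lemma res_unit_natural:
  assumes "U \<in> Obj C" "u \<in> Arr (PObj F U)"
  shows "res_unit F U (Cod (PObj F U) u) \<cdot>[PObj F U] u =
    res_arr F (Ident C U) u \<cdot>[PObj F U] res_unit F U (Dom (PObj F U) u)"
  using is_ntransD(9)[OF PUnit_facts(1)[OF assms(1)]] PUnit_facts[OF assms(1)] assms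
  by (simp add: id_func_simps)

text \<open>The associativity coherence evaluated at x; the whiskered identities become identity
  arrows of the fibre and drop out.\<close>

lemma res_comp_assoc:
  assumes "f \<in> Arr C" "g \<in> Arr C" "h \<in> Arr C" "Cod C g = Dom C f" "Cod C h = Dom C g"
    "x \<in> Obj (PObj F (Cod C f))"
  shows "res_comp F (f \<cdot>[C] g) h x \<cdot>[PObj F (Dom C h)] res_arr F h (res_comp F f g x) =
    res_comp F f (g \<cdot>[C] h) x \<cdot>[PObj F (Dom C h)] res_comp F g h (res_obj F f x)"
proof -
  interpret D: category "PObj F (Dom C h)" using assms C.Dom_in category_PObj by blast
  have fg: "f \<cdot>[C] g \<in> Arr C" "Cod C (f \<cdot>[C] g) = Cod C f" "Dom C (f \<cdot>[C] g) = Dom C g"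
    "g \<cdot>[C] h \<in> Arr C" "Cod C (g \<cdot>[C] h) = Cod C g" "Dom C (g \<cdot>[C] h) = Dom C h"
    using assms by (simp_all add: C.Comp_in C.Cod_Comp C.Dom_Comp)
  have [simp]: "h \<in> Arr C \<Longrightarrow> res_arr F h (Ident (PObj F (Dom C g)) (res_obj F g (res_obj F f x))) =
     Ident (PObj F (Dom C h)) (res_obj F h (res_obj F g (res_obj F f x)))"
    using assms by (simp add: res_simps)
  have "NAt (PComp F h (f \<cdot>[C] g) \<bullet>[CAT small] (id2 (CAT small) (PMor F h) \<star>[CAT small] PComp F g f)) x
    = NAt (PComp F (g \<cdot>[C] h) f \<bullet>[CAT small] (PComp F h g \<star>[CAT small] id2 (CAT small) (PMor F f))) x"
    using P.PComp_assoc[of f g h] assms by (simp add: base_simps)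
  then show ?thesis
    using assms fg D.comp_id_left[of "res_arr F h (res_comp F f g x)"] D.comp_id_right[of
      "res_comp F g h (res_obj F f x)"]
    by (simp add: CAT_simps nt_vcomp_simps nt_hcomp_simps nt_id_simps comp_func_simps PMor_facts PComp_facts
      res_simps res_comp_simps hom_def category.Ident_in[OF category_PObj] C.Dom_in)
qed

text \<open>Composition in \<open>base C\<close> is reversed, so the right unit law of the
  pseudofunctor governs an identity to the left of f in \<open>C\<close>, and the left unit law one
  to the right.\<close>

lemma res_unit_left:
  assumes "f \<in> Arr C" "x \<in> Obj (PObj F (Cod C f))"
  shows "res_comp F (Ident C (Cod C f)) f x \<cdot>[PObj F (Dom C f)] res_arr F f (res_unit F (Cod C f) x) =
    Ident (PObj F (Dom C f)) (res_obj F f x)"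
proof -
  interpret D: category "PObj F (Dom C f)" using assms C.Dom_in category_PObj by blast
  have U: "Cod C f \<in> Obj C" using assms C.Cod_in by blast
  have "NAt (PComp F f (Ident C (Cod C f)) \<bullet>[CAT small] (id2 (CAT small) (PMor F f) \<star>[CAT small] PUnit F (Cod C
    f))) x
    = NAt (id2 (CAT small) (PMor F f)) x"
    using P.PComp_unit_right[of f] assms by (simp add: base_simps)
  then show ?thesis
    using assms U D.comp_id_left[of "res_arr F f (res_unit F (Cod C f) x)"]
    by (simp add: CAT_simps nt_vcomp_simps nt_hcomp_simps nt_id_simps comp_func_simps id_func_simps PMor_facts
      PUnit_facts
      res_simps res_unit_simps hom_def C.Ident_in C.Dom_Ident C.Cod_Ident)
qed

lemma res_unit_right:
  assumes "f \<in> Arr C" "x \<in> Obj (PObj F (Cod C f))"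
  shows "res_comp F f (Ident C (Dom C f)) x \<cdot>[PObj F (Dom C f)] res_unit F (Dom C f) (res_obj F f x) =
    Ident (PObj F (Dom C f)) (res_obj F f x)"
proof -
  interpret D: category "PObj F (Dom C f)" using assms C.Dom_in category_PObj by blast
  have U: "Dom C f \<in> Obj C" using assms C.Dom_in by blast
  have "NAt (PComp F (Ident C (Dom C f)) f \<bullet>[CAT small] (PUnit F (Dom C f) \<star>[CAT small] id2 (CAT small) (PMor F
    f))) x
    = NAt (id2 (CAT small) (PMor F f)) x"
    using P.PComp_unit_left[of f] assms by (simp add: base_simps)
  then show ?thesis
    using assms U D.comp_id_right[of "res_unit F (Dom C f) (res_obj F f x)"]
    by (simp add: CAT_simps nt_vcomp_simps nt_hcomp_simps nt_id_simps comp_func_simps id_func_simps PMor_facts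
      PUnit_facts
      res_simps res_unit_simps hom_def C.Ident_in C.Dom_Ident C.Cod_Ident category.Ident_in[OF category_PObj])
qed

lemmas fibre_simps = category.Dom_in[OF category_PObj] category.Cod_in[OF category_PObj]
  category.Ident_in[OF category_PObj] category.Dom_Ident[OF category_PObj]
  category.Cod_Ident[OF category_PObj] category.Comp_in[OF category_PObj]
  category.Dom_Comp[OF category_PObj] category.Cod_Comp[OF category_PObj]

lemmas base_cat_simps = C.Dom_in C.Cod_in C.Ident_in C.Dom_Ident C.Cod_Ident C.Comp_in C.Dom_Comp C.Cod_Comp

lemmas idx_simps = fibre_simps base_cat_simps res_simps res_comp_simps res_unit_simps

text \<open>The Grothendieck construction. An arrow \<open>(g, \<beta>, y)\<close> over \<open>g\<close> ends at \<open>y\<close> and consists of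
  an arrow \<open>\<beta>\<close> into the restriction of \<open>y\<close> along \<open>g\<close>.\<close>

definition total :: "('o \<times> 'u, 'm \<times> 'u \<times> 'u) cat" where
  "total = \<lparr>Obj = {(U, x). U \<in> Obj C \<and> x \<in> Obj (PObj F U)},
     Arr = {(g, b, y). g \<in> Arr C \<and> y \<in> Obj (PObj F (Cod C g)) \<and> b \<in> Arr (PObj F (Dom C g)) \<and>
       Cod (PObj F (Dom C g)) b = res_obj F g y},
     Dom = (\<lambda>(g, b, y). (Dom C g, Dom (PObj F (Dom C g)) b)),
     Cod = (\<lambda>(g, b, y). (Cod C g, y)),
     Ident = (\<lambda>(U, x). (Ident C U, res_unit F U x, x)),
     Comp = (\<lambda>(g', b', y') (g, b, y). (g' \<cdot>[C] g,
       res_comp F g' g y' \<cdot>[PObj F (Dom C g)] (res_arr F g b' \<cdot>[PObj F (Dom C g)] b), y'))\<rparr>"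

lemma total_simps:
  "(U, x) \<in> Obj total \<longleftrightarrow> U \<in> Obj C \<and> x \<in> Obj (PObj F U)"
  "(g, b, y) \<in> Arr total \<longleftrightarrow> g \<in> Arr C \<and> y \<in> Obj (PObj F (Cod C g)) \<and> b \<in> Arr (PObj F (Dom C g)) \<and>
       Cod (PObj F (Dom C g)) b = res_obj F g y"
  "Dom total (g, b, y) = (Dom C g, Dom (PObj F (Dom C g)) b)"
  "Cod total (g, b, y) = (Cod C g, y)"
  "Ident total (U, x) = (Ident C U, res_unit F U x, x)"
  "(g', b', y') \<cdot>[total] (g, b, y) = (g' \<cdot>[C] g,
       res_comp F g' g y' \<cdot>[PObj F (Dom C g)] (res_arr F g b' \<cdot>[PObj F (Dom C g)] b), y')"
  by (simp_all add: total_def)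

text \<open>This is where the coherence of F is used: its unit laws give the identities, and
  associativity follows from \<open>res_comp_assoc\<close> and naturality of
  \<open>res_comp\<close>.\<close>

lemma category_total: "category total"
proof (rule category.intro)
  fix f assume f: "f \<in> Arr total"
  obtain g b y where [simp]: "f = (g, b, y)" by (cases f)
  have [simp]: "g \<in> Arr C" "y \<in> Obj (PObj F (Cod C g))" "b \<in> Arr (PObj F (Dom C g))" "Cod (PObj F (Dom C g)) b =
    res_obj F g y"
    using f by (simp_all add: total_simps)
  show "Dom total f \<in> Obj total" "Cod total f \<in> Obj total"
    by (simp_all add: total_simps idx_simps)
  interpret D: category "PObj F (Dom C g)" by (simp add: category_PObj idx_simps)
  have "res_comp F (Ident C (Cod C g)) g y \<cdot>[PObj F (Dom C g)] (res_arr F g (res_unit F (Cod C g) y) \<cdot>[PObj F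
    (Dom C g)] b) = b"
    using res_unit_left[of g y] D.Comp_Ident_left[of b] by (simp add: idx_simps flip: D.Comp_assoc)
  then show "Ident total (Cod total f) \<cdot>[total] f = f"
    by (simp add: total_simps C.Comp_Ident_left)
  let ?x = "Dom (PObj F (Dom C g)) b" and ?V = "Dom C g"
  have "res_comp F g (Ident C ?V) y \<cdot>[PObj F ?V] (res_arr F (Ident C ?V) b \<cdot>[PObj F ?V] res_unit F ?V ?x) =
    (res_comp F g (Ident C ?V) y \<cdot>[PObj F ?V] res_unit F ?V (res_obj F g y)) \<cdot>[PObj F ?V] b"
    using res_unit_natural[of ?V b] by (simp add: idx_simps D.Comp_assoc)
  also have "\<dots> = b" using res_unit_right[of g y] D.Comp_Ident_left[of b] by simp
  finally show "f \<cdot>[total] Ident total (Dom total f) = f"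
    by (simp add: total_simps idx_simps C.Comp_Ident_right)
next
  fix x assume "x \<in> Obj total"
  then show "Ident total x \<in> Arr total" "Dom total (Ident total x) = x" "Cod total (Ident total x) = x"
    by (cases x; simp add: total_simps idx_simps)+
next
  fix f f' assume f: "f \<in> Arr total" "f' \<in> Arr total" "Cod total f = Dom total f'"
  then show "f' \<cdot>[total] f \<in> Arr total"
    "Dom total (f' \<cdot>[total] f) = Dom total f" "Cod total (f' \<cdot>[total] f) = Cod total f'"
    by (cases f; cases f'; simp add: total_simps idx_simps)+
next
  fix f0 f1 f2 assume f: "f0 \<in> Arr total" "f1 \<in> Arr total" "f2 \<in> Arr total" "Cod total f0 = Dom total f1"
    "Cod total f1 = Dom total f2"
  obtain g0 b0 x g1 b1 y g2 b2 z where e [simp]: "f0 = (g0, b0, x)" "f1 = (g1, b1, y)" "f2 = (g2, b2, z)"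
    by (cases f0, cases f1, cases f2)
  note [simp] = f[unfolded e total_simps, simplified]
  let ?V = "Dom C g0"
  interpret D: category "PObj F ?V" by (simp add: category_PObj idx_simps)
  let ?r = "res_arr F g0 b1 \<cdot>[PObj F ?V] b0" and ?b2 = "res_arr F g0 (res_arr F g1 b2)"
  have "res_comp F (g2 \<cdot>[C] g1) g0 z \<cdot>[PObj F ?V] (res_arr F g0 (res_comp F g2 g1 z \<cdot>[PObj F (Dom C g1)]
    (res_arr F g1 b2 \<cdot>[PObj F (Dom C g1)] b1)) \<cdot>[PObj F ?V] b0)
    = (res_comp F (g2 \<cdot>[C] g1) g0 z \<cdot>[PObj F ?V] res_arr F g0 (res_comp F g2 g1 z)) \<cdot>[PObj F ?V] (?b2 \<cdot>[PObj F
      ?V] ?r)"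
    by (simp add: idx_simps D.Comp_assoc)
  also have "\<dots> = res_comp F g2 (g1 \<cdot>[C] g0) z \<cdot>[PObj F ?V] ((res_comp F g1 g0 (res_obj F g2 z) \<cdot>[PObj F ?V]
    ?b2) \<cdot>[PObj F ?V] ?r)"
    using res_comp_assoc[of g2 g1 g0 z] by (simp add: idx_simps D.Comp_assoc)
  also have "res_comp F g1 g0 (res_obj F g2 z) \<cdot>[PObj F ?V] ?b2 = res_arr F (g1 \<cdot>[C] g0) b2 \<cdot>[PObj F ?V]
    res_comp F g1 g0 y"
    using res_comp_natural[of g1 g0 b2] by simp
  finally show "(f2 \<cdot>[total] f1) \<cdot>[total] f0 = f2 \<cdot>[total] (f1 \<cdot>[total] f0)"
    by (simp add: total_simps idx_simps D.Comp_assoc C.Comp_assoc)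
qed

text \<open>A fibre arrow seen as an arrow over the identity. The unit isomorphism is inserted
  because restriction along an identity is only isomorphic to the identity functor.\<close>

definition vertical :: "'o \<Rightarrow> 'u \<Rightarrow> 'm \<times> 'u \<times> 'u" where
  "vertical U m = (Ident C U, res_unit F U (Cod (PObj F U) m) \<cdot>[PObj F U] m, Cod (PObj F U) m)"

lemma vertical_simps:
  assumes "U \<in> Obj C" "m \<in> Arr (PObj F U)"
  shows "vertical U m \<in> Arr total" "Dom total (vertical U m) = (U, Dom (PObj F U) m)"
    "Cod total (vertical U m) = (U, Cod (PObj F U) m)" "fst (vertical U m) = Ident C U"
  using assms by (simp_all add: vertical_def total_simps idx_simps)

text \<open>The unit isomorphism inside \<open>vertical\<close> cancels against the comparison
  \<open>res_comp\<close> at an identity, so only composition in the fibre is left.\<close>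

lemma vertical_comp:
  assumes "(g, b, y) \<in> Arr total" "m \<in> Arr (PObj F (Dom C g))" "Cod (PObj F (Dom C g)) m =
    Dom (PObj F (Dom C g)) b"
  shows "(g, b, y) \<cdot>[total] vertical (Dom C g) m = (g, b \<cdot>[PObj F (Dom C g)] m, y)"
proof -
  note [simp] = assms[unfolded total_simps, simplified]
  let ?V = "Dom C g"
  interpret D: category "PObj F ?V" by (simp add: category_PObj idx_simps)
  let ?x = "Dom (PObj F ?V) b"
  have "res_comp F g (Ident C ?V) y \<cdot>[PObj F ?V] (res_arr F (Ident C ?V) b \<cdot>[PObj F ?V] (res_unit F ?V ?x \<cdot>[PObj
    F ?V] m)) =
    (res_comp F g (Ident C ?V) y \<cdot>[PObj F ?V] (res_arr F (Ident C ?V) b \<cdot>[PObj F ?V] res_unit F ?V ?x)) \<cdot>[PObj F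
      ?V] m"
    by (simp add: idx_simps D.Comp_assoc)
  also have "\<dots> = ((res_comp F g (Ident C ?V) y \<cdot>[PObj F ?V] res_unit F ?V (res_obj F g y)) \<cdot>[PObj F ?V]
    b) \<cdot>[PObj F ?V] m"
    using res_unit_natural[of ?V b] by (simp add: idx_simps D.Comp_assoc)
  also have "\<dots> = b \<cdot>[PObj F ?V] m" using res_unit_right[of g y] D.Comp_Ident_left[of b] by simp
  finally show ?thesis
    by (simp add: total_simps vertical_def idx_simps C.Comp_Ident_right)
qed

lemma vertical_vertical:
  assumes "U \<in> Obj C" "m \<in> Arr (PObj F U)" "n \<in> Arr (PObj F U)" "Cod (PObj F U) m = Dom (PObj F U) n"
  shows "vertical U n \<cdot>[total] vertical U m = vertical U (n \<cdot>[PObj F U] m)"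
proof -
  interpret D: category "PObj F U" using assms by (simp add: category_PObj)
  show ?thesis
    using vertical_comp[of "Ident C U" "res_unit F U (Cod (PObj F U) n) \<cdot>[PObj F U] n" "Cod (PObj F U) n" m]
      assms
      vertical_simps[of U n]
    by (simp add: vertical_def[of U n] idx_simps D.Comp_assoc total_simps) (simp add: vertical_def idx_simps)
qed

lemma vertical_Ident: "U \<in> Obj C \<Longrightarrow> x \<in> Obj (PObj F U) \<Longrightarrow> vertical U (Ident (PObj F U) x) = Ident total (U, x)"
  using category.Comp_Ident_right[OF category_PObj, of U "res_unit F U x"]
  by (simp add: vertical_def total_simps idx_simps)

lemma vertical_inject:
  assumes "U \<in> Obj C" "m \<in> Arr (PObj F U)" "n \<in> Arr (PObj F U)" "vertical U m = vertical U n"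
  shows "m = n"
proof -
  interpret D: category "PObj F U" using assms by (simp add: category_PObj)
  have c: "Cod (PObj F U) n = Cod (PObj F U) m"
    and e: "res_unit F U (Cod (PObj F U) m) \<cdot>[PObj F U] m = res_unit F U (Cod (PObj F U) m) \<cdot>[PObj F U] n"
    using assms(4) by (auto simp: vertical_def)
  show ?thesis
    by (rule D.iso_cancel_left[OF _ e]) (use assms(1-3) c in \<open>simp_all add: idx_simps\<close>)
qed

text \<open>The fibre arrow is recovered by removing the unit isomorphism. With
  \<open>vertical_inject\<close> and \<open>vertical_vertical\<close> this identifies each fibre
  with the arrows over an identity.\<close>

lemma vertical_exists:
  assumes "U \<in> Obj C" "u \<in> Arr total" "fst u = Ident C U"
  shows "\<exists>m\<in>Arr (PObj F U). u = vertical U m"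
proof -
  interpret D: category "PObj F U" using assms by (simp add: category_PObj)
  obtain b y where u: "u = (Ident C U, b, y)" using assms by (cases u) auto
  note [simp] = assms(1) assms(2)[unfolded u total_simps, simplified]
  have "u = vertical U (inv_arr (PObj F U) (res_unit F U y) \<cdot>[PObj F U] b)"
    using assms D.inv_comp_cancel(2)[of "res_unit F U y" b] D.inv_arr_simps[of "res_unit F U y"]
    by (simp add: vertical_def u idx_simps total_simps)
  moreover have "inv_arr (PObj F U) (res_unit F U y) \<cdot>[PObj F U] b \<in> Arr (PObj F U)"
    using D.inv_arr_simps[of "res_unit F U y"] assms by (simp add: u idx_simps total_simps)
  ultimately show ?thesis by blast
qed

text \<open>The cleavage given by the restriction functors: the chosen cartesian arrow over g that
  ends at y.\<close>

definition lift :: "'m \<Rightarrow> 'u \<Rightarrow> 'm \<times> 'u \<times> 'u" where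
  "lift g y = (g, Ident (PObj F (Dom C g)) (res_obj F g y), y)"

lemma lift_simps:
  assumes "g \<in> Arr C" "y \<in> Obj (PObj F (Cod C g))"
  shows "lift g y \<in> Arr total" "Dom total (lift g y) = (Dom C g, res_obj F g y)"
    "Cod total (lift g y) = (Cod C g, y)" "fst (lift g y) = g"
  using assms by (simp_all add: lift_def total_simps idx_simps)

text \<open>The factorisation of an arrow into a vertical one followed by a chosen lift; its
  vertical part is the fibre component itself.\<close>

lemma lift_vertical:
  assumes "(g, b, y) \<in> Arr total"
  shows "lift g y \<cdot>[total] vertical (Dom C g) b = (g, b, y)"
proof -
  note [simp] = assms[unfolded total_simps, simplified]
  interpret D: category "PObj F (Dom C g)" by (simp add: category_PObj idx_simps)
  show ?thesis
    using vertical_comp[of g "Ident (PObj F (Dom C g)) (res_obj F g y)" y b] D.Comp_Ident_left[of b]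
    by (simp add: total_simps idx_simps lift_def)
qed

end

text \<open>Categories over \<open>C\<close> are categories whose objects and arrows carry their projection as first
  component.\<close>

definition cartesian :: "('o, 'm) cat \<Rightarrow> ('o \<times> 'x, 'm \<times> 'y) cat \<Rightarrow> 'm \<times> 'y \<Rightarrow> bool" where
  "cartesian C T u \<longleftrightarrow> u \<in> Arr T \<and> (\<forall>v\<in>Arr T. \<forall>k\<in>Arr C.
     Cod T v = Cod T u \<and> Dom C k = fst (Dom T v) \<and> Cod C k = fst (Dom T u) \<and> fst v = fst u \<cdot>[C] k \<longrightarrow>
     (\<exists>!t. t \<in> hom T (Dom T v) (Dom T u) \<and> fst t = k \<and> u \<cdot>[T] t = v))"

section \<open>Cartesian arrows in a category over the base\<close>

locale category_over = C: category C + T: category T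
  for C :: "('o, 'm) cat" and T :: "('o \<times> 'x, 'm \<times> 'y) cat" +
  assumes fst_Obj: "x \<in> Obj T \<Longrightarrow> fst x \<in> Obj C"
    and fst_Arr: "u \<in> Arr T \<Longrightarrow> fst u \<in> Arr C"
    and fst_Dom: "u \<in> Arr T \<Longrightarrow> fst (Dom T u) = Dom C (fst u)"
    and fst_Cod: "u \<in> Arr T \<Longrightarrow> fst (Cod T u) = Cod C (fst u)"
    and fst_Ident: "x \<in> Obj T \<Longrightarrow> fst (Ident T x) = Ident C (fst x)"
    and fst_Comp: "\<lbrakk>u \<in> Arr T; v \<in> Arr T; Cod T u = Dom T v\<rbrakk> \<Longrightarrow> fst (v \<cdot>[T] u) = fst v \<cdot>[C] fst u"
begin

lemma cartesianD:
  assumes "cartesian C T u" "v \<in> Arr T" "Cod T v = Cod T u" "k \<in> Arr C" "Cod C k = Dom C (fst u)"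
    "fst v = fst u \<cdot>[C] k"
  obtains t where "t \<in> Arr T" "Dom T t = Dom T v" "Cod T t = Dom T u" "fst t = k" "u \<cdot>[T] t = v"
proof -
  have u: "u \<in> Arr T" using assms by (simp add: cartesian_def)
  have "Dom C k = fst (Dom T v)"
    using assms u by (simp add: fst_Dom C.Dom_Comp fst_Arr)
  then have "\<exists>!t. t \<in> hom T (Dom T v) (Dom T u) \<and> fst t = k \<and> u \<cdot>[T] t = v"
    using assms u unfolding cartesian_def by (simp add: fst_Dom)
  then show ?thesis using that by (auto simp: hom_def)
qed

text \<open>Uniqueness of factorisations. That t and t' lie over the same base arrow is a premise,
  since base arrows are not assumed to be monic.\<close>

lemma cartesian_cancel:
  assumes "cartesian C T u" "u \<cdot>[T] t = u \<cdot>[T] t'" "t \<in> Arr T" "t' \<in> Arr T" "Cod T t = Dom T u" "Cod T t' =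
    Dom T u"
    "fst t = fst t'"
  shows "t = t'"
proof -
  have u: "u \<in> Arr T" using assms by (simp add: cartesian_def)
  have d: "Dom T t' = Dom T t" using assms u T.Dom_Comp by metis
  have "\<exists>!s. s \<in> hom T (Dom T (u \<cdot>[T] t)) (Dom T u) \<and> fst s = fst t \<and> u \<cdot>[T] s = u \<cdot>[T] t"
    using assms(1)[unfolded cartesian_def, THEN conjunct2, rule_format, of "u \<cdot>[T] t" "fst t"] assms u
    by (simp add: T.Comp_in T.Cod_Comp T.Dom_Comp fst_Arr fst_Comp fst_Dom fst_Cod[symmetric])
  then show ?thesis
    using assms u d by (auto simp: hom_def T.Dom_Comp)
qed

lemma cartesianI:
  assumes "u \<in> Arr T"
    "\<And>v k. \<lbrakk>v \<in> Arr T; Cod T v = Cod T u; k \<in> Arr C; Cod C k = Dom C (fst u); fst v = fst u \<cdot>[C] k; Dom C k =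
      fst (Dom T v)\<rbrakk> \<Longrightarrow>
      \<exists>t\<in>Arr T. Dom T t = Dom T v \<and> Cod T t = Dom T u \<and> fst t = k \<and> u \<cdot>[T] t = v"
    "\<And>t t'. \<lbrakk>t \<in> Arr T; t' \<in> Arr T; Cod T t = Dom T u; Cod T t' = Dom T u; Dom T t = Dom T t'; fst t = fst t';
       u \<cdot>[T] t = u \<cdot>[T] t'\<rbrakk> \<Longrightarrow> t = t'"
  shows "cartesian C T u"
  unfolding cartesian_def
proof (intro conjI ballI impI assms(1))
  fix v k assume v: "v \<in> Arr T" "k \<in> Arr C"
    and e: "Cod T v = Cod T u \<and> Dom C k = fst (Dom T v) \<and> Cod C k = fst (Dom T u) \<and> fst v = fst u \<cdot>[C] k"
  obtain t where t: "t \<in> Arr T" "Dom T t = Dom T v" "Cod T t = Dom T u" "fst t = k" "u \<cdot>[T] t = v"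
    using assms(2)[OF v(1) _ v(2)] e assms(1) by (auto simp: fst_Dom)
  show "\<exists>!t. t \<in> hom T (Dom T v) (Dom T u) \<and> fst t = k \<and> u \<cdot>[T] t = v"
  proof (rule ex1I)
    show "t \<in> hom T (Dom T v) (Dom T u) \<and> fst t = k \<and> u \<cdot>[T] t = v" using t by (simp add: hom_def)
    fix s assume "s \<in> hom T (Dom T v) (Dom T u) \<and> fst s = k \<and> u \<cdot>[T] s = v"
    with t show "s = t" by - (rule assms(3), simp_all add: hom_def)
  qed
qed

lemma cartesian_Comp:
  assumes "cartesian C T u" "cartesian C T v" "Cod T u = Dom T v"
  shows "cartesian C T (v \<cdot>[T] u)"
proof -
  have [simp]: "u \<in> Arr T" "v \<in> Arr T" "Cod T u = Dom T v" using assms by (auto simp: cartesian_def)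
  have fc: "Cod C (fst u) = Dom C (fst v)" using fst_Dom[of v] fst_Cod[of u] by simp
  show ?thesis
  proof (rule cartesianI)
    fix w k assume w: "w \<in> Arr T" "Cod T w = Cod T (v \<cdot>[T] u)" "k \<in> Arr C"
      "Cod C k = Dom C (fst (v \<cdot>[T] u))" "fst w = fst (v \<cdot>[T] u) \<cdot>[C] k"
    have k: "Cod C k = Dom C (fst u)" using w(4) fc by (simp add: fst_Comp C.Dom_Comp fst_Arr)
    obtain s where s: "s \<in> Arr T" "Dom T s = Dom T w" "Cod T s = Dom T v" "fst s = fst u \<cdot>[C] k" "v \<cdot>[T] s = w"
      using w k fc by (rule_tac cartesianD[OF assms(2) w(1), of "fst u \<cdot>[C] k"])
        (auto simp: T.Cod_Comp fst_Comp C.Comp_assoc C.Comp_in C.Cod_Comp fst_Arr)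
    obtain t where t: "t \<in> Arr T" "Dom T t = Dom T s" "Cod T t = Dom T u" "fst t = k" "u \<cdot>[T] t = s"
      using s w k by (rule_tac cartesianD[OF assms(1) s(1), of k]) auto
    show "\<exists>t\<in>Arr T. Dom T t = Dom T w \<and> Cod T t = Dom T (v \<cdot>[T] u) \<and> fst t = k \<and> (v \<cdot>[T] u) \<cdot>[T] t = w"
      using s t by (intro bexI[of _ t]) (simp_all add: T.Dom_Comp T.Comp_assoc)
  next
    fix t t' assume t: "t \<in> Arr T" "t' \<in> Arr T" "Cod T t = Dom T (v \<cdot>[T] u)" "Cod T t' = Dom T (v \<cdot>[T] u)"
      "fst t = fst t'" "(v \<cdot>[T] u) \<cdot>[T] t = (v \<cdot>[T] u) \<cdot>[T] t'"
    then have "u \<cdot>[T] t = u \<cdot>[T] t'"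
      by - (rule cartesian_cancel[OF assms(2)], simp_all add: T.Comp_assoc T.Comp_in T.Cod_Comp T.Dom_Comp
        fst_Comp)
    then show "t = t'"
      using t by - (rule cartesian_cancel[OF assms(1)], simp_all add: T.Dom_Comp)
  qed (simp add: T.Comp_in)
qed

text \<open>To factor w through u, factor \<open>v \<cdot> w\<close> through the cartesian composite
  and then cancel v.\<close>

lemma cartesian_Comp_cancel:
  assumes "cartesian C T v" "cartesian C T (v \<cdot>[T] u)" "u \<in> Arr T" "Cod T u = Dom T v"
  shows "cartesian C T u"
proof -
  have [simp]: "u \<in> Arr T" "v \<in> Arr T" "Cod T u = Dom T v" using assms by (auto simp: cartesian_def)
  have fc: "Cod C (fst u) = Dom C (fst v)" using fst_Dom[of v] fst_Cod[of u] by simp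
  show ?thesis
  proof (rule cartesianI)
    fix w k assume w: "w \<in> Arr T" "Cod T w = Cod T u" "k \<in> Arr C" "Cod C k = Dom C (fst u)" "fst w =
      fst u \<cdot>[C] k"
    obtain t where t: "t \<in> Arr T" "Dom T t = Dom T (v \<cdot>[T] w)" "Cod T t = Dom T (v \<cdot>[T] u)" "fst t = k"
       "(v \<cdot>[T] u) \<cdot>[T] t = v \<cdot>[T] w"
      using w fc by (rule_tac cartesianD[OF assms(2), of "v \<cdot>[T] w" k])
        (auto simp: T.Cod_Comp T.Comp_in fst_Comp C.Comp_assoc C.Dom_Comp fst_Arr)
    then have "u \<cdot>[T] t = w"
      using w by - (rule cartesian_cancel[OF assms(1)], simp_all add: T.Comp_assoc T.Comp_in T.Cod_Comp
        T.Dom_Comp fst_Comp)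
    then show "\<exists>t\<in>Arr T. Dom T t = Dom T w \<and> Cod T t = Dom T u \<and> fst t = k \<and> u \<cdot>[T] t = w"
      using t w by (intro bexI[of _ t]) (simp_all add: T.Dom_Comp)
  next
    fix t t' assume t: "t \<in> Arr T" "t' \<in> Arr T" "Cod T t = Dom T u" "Cod T t' = Dom T u"
      "fst t = fst t'" "u \<cdot>[T] t = u \<cdot>[T] t'"
    then show "t = t'"
      by - (rule cartesian_cancel[OF assms(2)], simp_all add: T.Dom_Comp T.Comp_assoc)
  qed simp
qed

lemma cartesian_Ident: "x \<in> Obj T \<Longrightarrow> cartesian C T (Ident T x)"
proof (rule cartesianI, goal_cases)
  case (2 v k)
  have "fst (Ident T x) \<cdot>[C] k = k"
    using C.Comp_Ident_left[of k] 2 by (simp add: fst_Ident C.Dom_Ident fst_Obj)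
  then have "fst v = k" using 2 by simp
  with 2(1-3) show ?case
    using T.Comp_Ident_left[of v] by (intro bexI[of _ v]) (simp_all add: T.Dom_Ident T.Cod_Ident)
next
  case (3 t t')
  then show ?case using T.Comp_Ident_left[of t] T.Comp_Ident_left[of t'] by (simp add: T.Dom_Ident)
qed (simp add: T.Ident_in)

lemma cartesian_inverse:
  assumes "inverse_arrs T u v"
  shows "cartesian C T u"
proof (rule cartesianI)
  note u = assms[unfolded inverse_arrs_def hom_def, simplified]
  then have [simp]: "u \<in> Arr T" "v \<in> Arr T" "Dom T v = Cod T u" "Cod T v = Dom T u" by auto
  show "u \<in> Arr T" by simp
  fix w k assume w: "w \<in> Arr T" "Cod T w = Cod T u" "k \<in> Arr C" "Cod C k = Dom C (fst u)" "fst w = fst u \<cdot>[C] k"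
  have "fst v \<cdot>[C] fst u = Ident C (Dom C (fst u))"
    using u by (simp add: fst_Comp[symmetric] fst_Ident T.Dom_in fst_Dom)
  moreover have "Cod C (fst u) = Dom C (fst v)" using fst_Dom[of v] fst_Cod[of u] by simp
  ultimately have "fst v \<cdot>[C] (fst u \<cdot>[C] k) = k"
    using w C.Comp_Ident_left[of k] C.Comp_assoc[of k "fst u" "fst v"] by (simp add: fst_Arr)
  moreover have "u \<cdot>[T] (v \<cdot>[T] w) = w"
    using u w T.Comp_Ident_left[of w] by (simp flip: T.Comp_assoc)
  ultimately show "\<exists>t\<in>Arr T. Dom T t = Dom T w \<and> Cod T t = Dom T u \<and> fst t = k \<and> u \<cdot>[T] t = w"
    using w by (intro bexI[of _ "v \<cdot>[T] w"]) (simp_all add: T.Comp_in T.Dom_Comp T.Cod_Comp fst_Comp)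
next
  note u = assms[unfolded inverse_arrs_def hom_def, simplified]
  then have [simp]: "u \<in> Arr T" "v \<in> Arr T" "Dom T v = Cod T u" "Cod T v = Dom T u" by auto
  fix t t' assume t: "t \<in> Arr T" "t' \<in> Arr T" "Cod T t = Dom T u" "Cod T t' = Dom T u" "u \<cdot>[T] t = u \<cdot>[T] t'"
  then have "(v \<cdot>[T] u) \<cdot>[T] t = (v \<cdot>[T] u) \<cdot>[T] t'" by (simp add: T.Comp_assoc)
  then show "t = t'"
    using u t T.Comp_Ident_left[of t] T.Comp_Ident_left[of t'] by simp
qed

text \<open>v is the factorisation of the identity of \<open>Cod T u\<close> through u. Then
  \<open>u \<cdot> (v \<cdot> u)\<close> equals u, and cancelling the cartesian arrow u gives the
  other equation.\<close>

lemma cartesian_vertical_inverse: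
  assumes "cartesian C T u" "U \<in> Obj C" "fst u = Ident C U"
  obtains v where "inverse_arrs T u v" "fst v = Ident C U"
proof -
  have [simp]: "u \<in> Arr T" using assms by (simp add: cartesian_def)
  have fd: "fst (Cod T u) = U" "fst (Dom T u) = U" using assms by (simp_all add: fst_Cod fst_Dom C.Cod_Ident
    C.Dom_Ident)
  obtain v where v: "v \<in> Arr T" "Dom T v = Cod T u" "Cod T v = Dom T u" "fst v = Ident C U" "u \<cdot>[T] v =
    Ident T (Cod T u)"
    by (rule cartesianD[OF assms(1), of "Ident T (Cod T u)" "Ident C U"])
      (use assms fd in \<open>auto simp: T.Ident_in T.Cod_in T.Cod_Ident T.Dom_Ident C.Ident_in C.Cod_Ident
        C.Dom_Ident fst_Ident C.Ident_Comp_Ident\<close>)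
  have "v \<cdot>[T] u = Ident T (Dom T u)"
  proof (rule cartesian_cancel[OF assms(1)])
    have "u \<cdot>[T] (v \<cdot>[T] u) = Ident T (Cod T u) \<cdot>[T] u" using v by (simp flip: T.Comp_assoc)
    then show "u \<cdot>[T] (v \<cdot>[T] u) = u \<cdot>[T] Ident T (Dom T u)"
      by (simp add: T.Comp_Ident_left T.Comp_Ident_right)
  qed (use v assms fd in \<open>auto simp: T.Comp_in T.Ident_in T.Dom_in T.Cod_Comp T.Cod_Ident fst_Comp fst_Ident
    C.Ident_Comp_Ident\<close>)
  with v show ?thesis by (intro that[of v]) (auto simp: inverse_arrs_def hom_def)
qed

end

section \<open>Cartesian arrows of the Grothendieck construction\<close>

context indexed_category
begin

sublocale total: category_over C total
proof -
  interpret T: category total by (rule category_total)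
  show "category_over C total"
    by unfold_locales (auto simp: total_def)
qed

text \<open>Composing with the lift composes the fibre component with \<open>res_comp g k y\<close>.
  As this arrow is invertible, factorisations exist and are unique.\<close>

lemma cartesian_lift:
  assumes "g \<in> Arr C" "y \<in> Obj (PObj F (Cod C g))"
  shows "cartesian C total (lift g y)"
proof (rule total.cartesianI)
  note [simp] = assms
  show "lift g y \<in> Arr total" by (simp add: lift_simps)
  let ?A = "\<lambda>k. PObj F (Dom C k)"
  have key: "lift g y \<cdot>[total] (k, d, res_obj F g y) = (g \<cdot>[C] k, res_comp F g k y \<cdot>[?A k] d, y)"
    if "(k, d, res_obj F g y) \<in> Arr total" "Cod C k = Dom C g" for k d
    using that category.Comp_Ident_left[OF category_PObj, of "Dom C k" d]
    by (auto simp: lift_def total_simps idx_simps)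
  fix v k assume v: "v \<in> Arr total" "Cod total v = Cod total (lift g y)" "k \<in> Arr C"
      "Cod C k = Dom C (fst (lift g y))" "fst v = fst (lift g y) \<cdot>[C] k"
  then obtain c where v': "v = (g \<cdot>[C] k, c, y)" and k [simp]: "Cod C k = Dom C g" "k \<in> Arr C"
    by (cases v) (auto simp: lift_simps total_simps)
  have c [simp]: "c \<in> Arr (?A k)" "Cod (?A k) c = res_obj F (g \<cdot>[C] k) y"
    using v(1) unfolding v' by (auto simp: total_simps idx_simps)
  interpret D: category "?A k" by (simp add: category_PObj idx_simps)
  let ?i = "res_comp F g k y" and ?d = "inv_arr (?A k) (res_comp F g k y) \<cdot>[?A k] c"
  have i: "iso_arr (?A k) ?i" by (simp add: idx_simps)
  have d: "?d \<in> Arr (?A k)" "Dom (?A k) ?d = Dom (?A k) c" "Cod (?A k) ?d = res_obj F k (res_obj F g y)"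
     "?i \<cdot>[?A k] ?d = c"
    using D.inv_arr_simps[OF i] D.inv_comp_cancel(2)[OF i, of c] by (simp_all add: idx_simps)
  then have T: "(k, ?d, res_obj F g y) \<in> Arr total" by (simp add: total_simps idx_simps)
  then show "\<exists>t\<in>Arr total. Dom total t = Dom total v \<and> Cod total t = Dom total (lift g y) \<and> fst t = k \<and>
    lift g y \<cdot>[total] t = v"
    using d key[OF T] by (intro bexI[of _ "(k, ?d, res_obj F g y)"]) (simp_all add: total_simps lift_simps v'
      idx_simps)
next
  note [simp] = assms
  fix t t' assume t: "t \<in> Arr total" "t' \<in> Arr total" "Cod total t = Dom total (lift g y)"
    "Cod total t' = Dom total (lift g y)" "fst t = fst t'" "lift g y \<cdot>[total] t = lift g y \<cdot>[total] t'"
  obtain k d d' where e: "t = (k, d, res_obj F g y)" "t' = (k, d', res_obj F g y)" and k [simp]: "Cod C k =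
    Dom C g" "k \<in> Arr C"
    using t(1-5) by (cases t; cases t') (auto simp: lift_simps total_simps)
  have d [simp]: "d \<in> Arr (PObj F (Dom C k))" "d' \<in> Arr (PObj F (Dom C k))"
    "Cod (PObj F (Dom C k)) d = res_obj F k (res_obj F g y)" "Cod (PObj F (Dom C k)) d' =
      res_obj F k (res_obj F g y)"
    using t(1,2) by (auto simp: e total_simps)
  interpret D: category "PObj F (Dom C k)" by (simp add: category_PObj idx_simps)
  have "res_comp F g k y \<cdot>[PObj F (Dom C k)] d = res_comp F g k y \<cdot>[PObj F (Dom C k)] d'"
    using t(6) D.Comp_Ident_left[of d] D.Comp_Ident_left[of d'] by (simp add: e lift_def total_simps idx_simps)
  then have "d = d'" by (rule D.iso_cancel_left[rotated]) (simp_all add: idx_simps)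
  then show "t = t'" by (simp add: e)
qed

lemma inverse_arrs_vertical:
  assumes "U \<in> Obj C" "m \<in> Arr (PObj F U)" "n \<in> Arr (PObj F U)"
  shows "inverse_arrs total (vertical U m) (vertical U n) \<longleftrightarrow> inverse_arrs (PObj F U) m n"
proof -
  interpret D: category "PObj F U" using assms by (simp add: category_PObj)
  have 1: "vertical U n \<cdot>[total] vertical U m = Ident total (U, Dom (PObj F U) m) \<longleftrightarrow> n \<cdot>[PObj F U] m =
    Ident (PObj F U) (Dom (PObj F U) m)"
    if "Cod (PObj F U) m = Dom (PObj F U) n"
    using assms that vertical_vertical[of U m n] vertical_inject[of U "n \<cdot>[PObj F U] m"
      "Ident (PObj F U) (Dom (PObj F U) m)"]
    by (auto simp: vertical_Ident[symmetric] idx_simps)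
  have 2: "vertical U m \<cdot>[total] vertical U n = Ident total (U, Cod (PObj F U) m) \<longleftrightarrow> m \<cdot>[PObj F U] n =
    Ident (PObj F U) (Cod (PObj F U) m)"
    if "Cod (PObj F U) n = Dom (PObj F U) m"
    using assms that vertical_vertical[of U n m] vertical_inject[of U "m \<cdot>[PObj F U] n"
      "Ident (PObj F U) (Cod (PObj F U) m)"]
    by (auto simp: vertical_Ident[symmetric] idx_simps)
  show ?thesis using 1 2 assms by (auto simp: inverse_arrs_def hom_def vertical_simps)
qed

lemma cartesian_vertical_iff:
  assumes "U \<in> Obj C" "m \<in> Arr (PObj F U)"
  shows "cartesian C total (vertical U m) \<longleftrightarrow> iso_arr (PObj F U) m"
proof
  assume "cartesian C total (vertical U m)"
  then obtain v where v: "inverse_arrs total (vertical U m) v" "fst v = Ident C U"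
    using total.cartesian_vertical_inverse[of "vertical U m" U] assms by (auto simp: vertical_simps)
  moreover have "v \<in> Arr total" using v by (simp add: inverse_arrs_def hom_def)
  ultimately obtain n where "n \<in> Arr (PObj F U)" "v = vertical U n" using vertical_exists[of U v] assms by blast
  then show "iso_arr (PObj F U) m" using v inverse_arrs_vertical assms by (auto simp: iso_arr_def)
next
  assume "iso_arr (PObj F U) m"
  then obtain n where "inverse_arrs (PObj F U) m n" "n \<in> Arr (PObj F U)" by (auto simp: iso_arr_def
    inverse_arrs_def hom_def)
  then show "cartesian C total (vertical U m)"
    using inverse_arrs_vertical[of U m n] assms total.cartesian_inverse by blast
qed

text \<open>The arrow is a chosen lift after the vertical arrow of b. Since the lift is cartesian,
  the composite is cartesian exactly when its vertical part is, and for vertical arrows this is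
  invertibility in the fibre.\<close>

lemma cartesian_iff:
  assumes "(g, b, y) \<in> Arr total"
  shows "cartesian C total (g, b, y) \<longleftrightarrow> iso_arr (PObj F (Dom C g)) b"
proof -
  note [simp] = assms[unfolded total_simps, simplified]
  have V: "Dom C g \<in> Obj C" by (simp add: idx_simps)
  have l: "cartesian C total (lift g y)" by (simp add: cartesian_lift)
  have c: "Cod total (vertical (Dom C g) b) = Dom total (lift g y)" by (simp add: vertical_simps lift_simps V)
  have "cartesian C total (g, b, y) \<longleftrightarrow> cartesian C total (vertical (Dom C g) b)"
    unfolding lift_vertical[OF assms, symmetric]
    using total.cartesian_Comp[OF _ l c] total.cartesian_Comp_cancel[OF l _ _ c] vertical_simps(1)[OF V, of b]
      by auto
  then show ?thesis using cartesian_vertical_iff[OF V, of b] by simp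
qed

end

section \<open>Indexed functors\<close>

text \<open>Separates the typing of a transformation from its coherence. The component formulas are
  then available both where coherence is given (\<open>indexed_functor\<close>) and where it is to
  be proved (\<open>pseudonaturalI\<close>).\<close>

locale indexed_functor_data = P: indexed_category C small "TDom \<sigma>" + Q: indexed_category C small "TCod \<sigma>"
  for C :: "('o, 'm) cat" and small :: "'u set \<Rightarrow> bool" and \<sigma> :: "('o, 'm, 'u, 'u) cat_psnat" +
  assumes TAt_in: "U \<in> Obj C \<Longrightarrow> is_functor (TAt \<sigma> U) \<and> FDom (TAt \<sigma> U) = PObj (TDom \<sigma>) U \<and>
      FCod (TAt \<sigma> U) = PObj (TCod \<sigma>) U"
    and TCell_in: "f \<in> Arr C \<Longrightarrow> is_ntrans (TCell \<sigma> f) \<and>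
      NDom (TCell \<sigma> f) = comp_func (PMor (TCod \<sigma>) f) (TAt \<sigma> (Cod C f)) \<and>
      NCod (TCell \<sigma> f) = comp_func (TAt \<sigma> (Dom C f)) (PMor (TDom \<sigma>) f)"
begin

abbreviation P where "P \<equiv> PObj (TDom \<sigma>)"
abbreviation Q where "Q \<equiv> PObj (TCod \<sigma>)"
abbreviation app where "app U x \<equiv> FObj (TAt \<sigma> U) x"
abbreviation app_arr where "app_arr U u \<equiv> FArr (TAt \<sigma> U) u"
abbreviation tcell where "tcell f x \<equiv> NAt (TCell \<sigma> f) x"

lemma TAt_facts:
  assumes "U \<in> Obj C"
  shows "is_functor (TAt \<sigma> U)" "FDom (TAt \<sigma> U) = P U" "FCod (TAt \<sigma> U) = Q U"
  using TAt_in[OF assms] by blast+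

lemma app_simps:
  assumes "U \<in> Obj C"
  shows "x \<in> Obj (P U) \<Longrightarrow> app U x \<in> Obj (Q U)"
    "u \<in> Arr (P U) \<Longrightarrow> app_arr U u \<in> Arr (Q U)"
    "u \<in> Arr (P U) \<Longrightarrow> Dom (Q U) (app_arr U u) = app U (Dom (P U) u)"
    "u \<in> Arr (P U) \<Longrightarrow> Cod (Q U) (app_arr U u) = app U (Cod (P U) u)"
    "x \<in> Obj (P U) \<Longrightarrow> app_arr U (Ident (P U) x) = Ident (Q U) (app U x)"
    "\<lbrakk>u \<in> Arr (P U); v \<in> Arr (P U); Cod (P U) u = Dom (P U) v\<rbrakk> \<Longrightarrow>
      app_arr U (v \<cdot>[P U] u) = app_arr U v \<cdot>[Q U] app_arr U u"
  using is_functorD(5-)[OF TAt_facts(1)[OF assms], unfolded TAt_facts(2,3)[OF assms]] by blast+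

lemma iso_app_arr:
  assumes "U \<in> Obj C" "iso_arr (P U) u"
  shows "iso_arr (Q U) (app_arr U u)"
proof -
  obtain v where v: "u \<in> Arr (P U)" "v \<in> hom (P U) (Cod (P U) u) (Dom (P U) u)"
    "v \<cdot>[P U] u = Ident (P U) (Dom (P U) u)" "u \<cdot>[P U] v = Ident (P U) (Cod (P U) u)"
    using assms unfolding iso_arr_def inverse_arrs_def by blast
  then show ?thesis
    using assms app_simps(6)[OF assms(1), of u v] app_simps(6)[OF assms(1), of v u]
    unfolding iso_arr_def inverse_arrs_def
    by (intro exI[of _ "app_arr U v"]) (auto simp: hom_def app_simps P.idx_simps)
qed

lemma TCell_facts:
  assumes "f \<in> Arr C"
  shows "is_ntrans (TCell \<sigma> f)" "NDom (TCell \<sigma> f) = comp_func (PMor (TCod \<sigma>) f) (TAt \<sigma> (Cod C f))"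
    "NCod (TCell \<sigma> f) = comp_func (TAt \<sigma> (Dom C f)) (PMor (TDom \<sigma>) f)"
  using TCell_in[OF assms] by blast+

lemma tcell_simps:
  assumes "f \<in> Arr C" "Dom C f = V" "x \<in> Obj (P (Cod C f))"
  shows "tcell f x \<in> Arr (Q V)"
    "Dom (Q V) (tcell f x) = res_obj (TCod \<sigma>) f (app (Cod C f) x)"
    "Cod (Q V) (tcell f x) = app V (res_obj (TDom \<sigma>) f x)"
  using is_ntransD(6-8)[OF TCell_facts(1)[OF assms(1)]] TCell_facts[OF assms(1)] assms
  by (simp_all add: comp_func_simps P.PMor_facts Q.PMor_facts TAt_facts P.C.Cod_in)

lemma tcell_natural:
  assumes "f \<in> Arr C" "u \<in> Arr (P (Cod C f))"
  shows "tcell f (Cod (P (Cod C f)) u) \<cdot>[Q (Dom C f)] res_arr (TCod \<sigma>) f (app_arr (Cod C f) u) =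
    app_arr (Dom C f) (res_arr (TDom \<sigma>) f u) \<cdot>[Q (Dom C f)] tcell f (Dom (P (Cod C f)) u)"
  using is_ntransD(9)[OF TCell_facts(1)[OF assms(1)]] TCell_facts[OF assms(1)] assms
  by (simp add: comp_func_simps P.PMor_facts Q.PMor_facts TAt_facts P.C.Cod_in)

lemmas ifun_simps = P.idx_simps Q.fibre_simps Q.res_simps Q.res_comp_simps Q.res_unit_simps app_simps
  tcell_simps

text \<open>This and the next three lemmas evaluate the two sides of the coherence laws at an
  object. They serve in both directions: to prove the laws, and to read them off.\<close>

lemma comp_lhs:
  assumes "f \<in> Arr C" "g \<in> Arr C" "Cod C g = Dom C f" "x \<in> Obj (P (Cod C f))"
  shows "NAt (TCell \<sigma> (f \<cdot>[C] g) \<bullet>[CAT small] (PComp (TCod \<sigma>) g f \<star>[CAT small] id2 (CAT small) (TAt \<sigma> (Cod C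
    f)))) x =
     tcell (f \<cdot>[C] g) x \<cdot>[Q (Dom C g)] res_comp (TCod \<sigma>) f g (app (Cod C f) x)"
proof -
  let ?W = "Dom C g" and ?a = "app (Cod C f) x" and ?Q = "TCod \<sigma>"
  interpret D: category "Q ?W" using assms P.C.Dom_in Q.category_PObj by blast
  have [simp]: "FArr (comp_func (PMor ?Q g) (PMor ?Q f)) (Ident (Q (Cod C f)) ?a) =
    Ident (Q ?W) (res_obj ?Q g (res_obj ?Q f ?a))"
    using assms by (simp add: comp_func_simps Q.PMor_facts ifun_simps)
  show ?thesis
    using assms D.comp_id_right[of "res_comp ?Q f g ?a"]
    by (simp add: CAT_simps nt_vcomp_simps nt_hcomp_simps nt_id_simps comp_func_simps P.PMor_facts Q.PMor_facts
      TAt_facts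
    Q.PComp_facts ifun_simps hom_def)
qed

lemma comp_rhs:
  assumes "f \<in> Arr C" "g \<in> Arr C" "Cod C g = Dom C f" "x \<in> Obj (P (Cod C f))"
  shows "NAt ((id2 (CAT small) (TAt \<sigma> (Dom C g)) \<star>[CAT small] PComp (TDom \<sigma>) g f) \<bullet>[CAT small]
        (TCell \<sigma> g \<star>[CAT small] id2 (CAT small) (PMor (TDom \<sigma>) f)) \<bullet>[CAT small]
        (id2 (CAT small) (PMor (TCod \<sigma>) g) \<star>[CAT small] TCell \<sigma> f)) x =
    app_arr (Dom C g) (res_comp (TDom \<sigma>) f g x) \<cdot>[Q (Dom C g)]
      (tcell g (res_obj (TDom \<sigma>) f x) \<cdot>[Q (Dom C g)] res_arr (TCod \<sigma>) g (tcell f x))"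
proof -
  let ?W = "Dom C g" and ?a = "app (Cod C f) x" and ?Q = "TCod \<sigma>" and ?P = "TDom \<sigma>"
  interpret D: category "Q ?W" using assms P.C.Dom_in Q.category_PObj by blast
  have [simp]: "FArr (comp_func (PMor ?Q g) (TAt \<sigma> (Dom C f))) (Ident (P (Dom C f)) (res_obj ?P f x)) =
    Ident (Q ?W) (res_obj ?Q g (app (Dom C f) (res_obj ?P f x)))"
    using assms by (simp add: comp_func_simps P.PMor_facts Q.PMor_facts TAt_facts ifun_simps)
  show ?thesis
    using assms D.comp_id_right[of "tcell g (res_obj ?P f x)"]
     D.comp_id_left[of "res_arr ?Q g (tcell f x)"] D.comp_id_left[of "app_arr ?W (res_comp ?P f g x)"]
    by (simp add: CAT_simps nt_vcomp_simps nt_hcomp_simps nt_id_simps comp_func_simps P.PMor_facts Q.PMor_facts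
      TAt_facts
    P.PComp_facts TCell_facts ifun_simps hom_def D.Comp_assoc)
qed

lemma unit_lhs:
  assumes "U \<in> Obj C" "x \<in> Obj (P U)"
  shows "NAt (TCell \<sigma> (Ident C U) \<bullet>[CAT small] (PUnit (TCod \<sigma>) U \<star>[CAT small] id2 (CAT small) (TAt \<sigma> U))) x =
     tcell (Ident C U) x \<cdot>[Q U] res_unit (TCod \<sigma>) U (app U x)"
proof -
  let ?Q = "TCod \<sigma>" and ?P = "TDom \<sigma>"
  interpret D: category "Q U" using assms Q.category_PObj by blast
  show ?thesis
    using assms D.comp_id_right[of "res_unit ?Q U (app U x)"]
    by (simp add: CAT_simps nt_vcomp_simps nt_hcomp_simps nt_id_simps comp_func_simps id_func_simps TAt_facts
      Q.PMor_facts
        Q.PUnit_facts ifun_simps hom_def)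
qed

lemma unit_rhs:
  assumes "U \<in> Obj C" "x \<in> Obj (P U)"
  shows "NAt (id2 (CAT small) (TAt \<sigma> U) \<star>[CAT small] PUnit (TDom \<sigma>) U) x = app_arr U (res_unit (TDom \<sigma>) U x)"
proof -
  let ?Q = "TCod \<sigma>" and ?P = "TDom \<sigma>"
  interpret D: category "Q U" using assms Q.category_PObj by blast
  show ?thesis
    using assms D.comp_id_left[of "app_arr U (res_unit ?P U x)"]
    by (simp add: CAT_simps nt_vcomp_simps nt_hcomp_simps nt_id_simps comp_func_simps id_func_simps TAt_facts
      P.PMor_facts
        P.PUnit_facts ifun_simps hom_def)
qed

text \<open>Cells of \<open>CAT\<close> with the same boundary are equal as soon as their components
  are, so pseudonaturality becomes a set of equations in the fibres.\<close>

lemma pseudonaturalI: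
  assumes ext: "TAt \<sigma> \<in> extensional (Obj C)" "TCell \<sigma> \<in> extensional (Arr C)"
    and iso: "\<And>f x. \<lbrakk>f \<in> Arr C; x \<in> Obj (P (Cod C f))\<rbrakk> \<Longrightarrow> iso_arr (Q (Dom C f)) (tcell f x)"
    and comp: "\<And>f g x. \<lbrakk>f \<in> Arr C; g \<in> Arr C; Cod C g = Dom C f; x \<in> Obj (P (Cod C f))\<rbrakk> \<Longrightarrow>
      tcell (f \<cdot>[C] g) x \<cdot>[Q (Dom C g)] res_comp (TCod \<sigma>) f g (app (Cod C f) x) =
      app_arr (Dom C g) (res_comp (TDom \<sigma>) f g x) \<cdot>[Q (Dom C g)]
      (tcell g (res_obj (TDom \<sigma>) f x) \<cdot>[Q (Dom C g)] res_arr (TCod \<sigma>) g (tcell f x))"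
    and unit: "\<And>U x. \<lbrakk>U \<in> Obj C; x \<in> Obj (P U)\<rbrakk> \<Longrightarrow>
      tcell (Ident C U) x \<cdot>[Q U] res_unit (TCod \<sigma>) U (app U x) = app_arr U (res_unit (TDom \<sigma>) U x)"
  shows "pseudonatural (base C) (CAT small) \<sigma>"
proof -
  interpret K: two_category "base C"
    using two_category_locally_discrete category_op_cat P.C.category_axioms by blast
  interpret L: two_category "CAT small" by (rule two_category_CAT)
  interpret KL: two_category_pair "base C" "CAT small" ..
  note [simp] = KL.psfun_simps[OF P.psfun, unfolded base_simps] KL.psfun_simps[OF Q.psfun, unfolded base_simps]
  have [simp]: "TAt \<sigma> U \<in> Mor (CAT small)" "src (CAT small) (TAt \<sigma> U) = P U" "tgt (CAT small) (TAt \<sigma> U) = Q U"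
    if "U \<in> Obj C" for U
    using TAt_facts[OF that] P.small_category_PObj Q.small_category_PObj that by (simp_all add: CAT_simps)
  have [simp]: "TCell \<sigma> f \<in> Cell (CAT small)" "dom2 (CAT small) (TCell \<sigma> f) = PMor (TCod \<sigma>) f \<odot>[CAT small] TAt \<sigma>
    (Cod C f)"
    "cod2 (CAT small) (TCell \<sigma> f) = TAt \<sigma> (Dom C f) \<odot>[CAT small] PMor (TDom \<sigma>) f" if "f \<in> Arr C" for f
    using TCell_facts[OF that] P.small_category_PObj Q.small_category_PObj that P.C.Dom_in P.C.Cod_in
    by (simp_all add: CAT_simps comp_func_simps TAt_facts Q.PMor_facts)
  have cell_eq: "\<alpha> = \<beta>" if "\<alpha> \<in> Cell (CAT small)" "\<beta> \<in> Cell (CAT small)" "dom2 (CAT small) \<alpha> =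
    dom2 (CAT small) \<beta>"
    "cod2 (CAT small) \<alpha> = cod2 (CAT small) \<beta>" "\<And>x. x \<in> Obj (FDom (dom2 (CAT small) \<beta>)) \<Longrightarrow> NAt \<alpha> x = NAt \<beta> x" for
      \<alpha> \<beta>
    using that by (intro ntrans_eqI) (simp_all add: CAT_simps)
  note [simp] = P.base_cat_simps
  show ?thesis
  proof (rule pseudonatural.intro, unfold base_simps)
    fix f g assume fg: "f \<in> Arr C" "g \<in> Arr C" "Dom C f = Cod C g"
    show "TCell \<sigma> (f \<cdot>[C] g) \<bullet>[CAT small] (PComp (TCod \<sigma>) g f \<star>[CAT small] id2 (CAT small) (TAt \<sigma> (Cod C f))) =
      (id2 (CAT small) (TAt \<sigma> (Dom C g)) \<star>[CAT small] PComp (TDom \<sigma>) g f) \<bullet>[CAT small]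
        (TCell \<sigma> g \<star>[CAT small] id2 (CAT small) (PMor (TDom \<sigma>) f)) \<bullet>[CAT small]
        (id2 (CAT small) (PMor (TCod \<sigma>) g) \<star>[CAT small] TCell \<sigma> f)" (is "?l = ?r")
    proof (rule cell_eq)
      have d: "dom2 (CAT small) ?r = PMor (TCod \<sigma>) g \<odot>[CAT small] (PMor (TCod \<sigma>) f \<odot>[CAT small] TAt \<sigma> (Cod C
        f))"
        using fg by (simp add: L.two_cat_simps)
      then have "FDom (dom2 (CAT small) ?r) = P (Cod C f)"
        using fg by (simp add: CAT_simps comp_func_simps TAt_facts)
      then show "NAt ?l x = NAt ?r x" if "x \<in> Obj (FDom (dom2 (CAT small) ?r))" for x
        using comp_lhs[of f g x] comp_rhs[of f g x] comp[of f g x] fg that by simp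
    qed (use fg in \<open>simp_all add: L.two_cat_simps\<close>)
  next
    fix U assume U: "U \<in> Obj C"
    show "TCell \<sigma> (Ident C U) \<bullet>[CAT small] (PUnit (TCod \<sigma>) U \<star>[CAT small] id2 (CAT small) (TAt \<sigma> U)) =
       id2 (CAT small) (TAt \<sigma> U) \<star>[CAT small] PUnit (TDom \<sigma>) U" (is "?l = ?r")
    proof (rule cell_eq)
      have d: "dom2 (CAT small) ?r = TAt \<sigma> U \<odot>[CAT small] id1 (CAT small) (P U)"
        using U by (simp add: L.two_cat_simps)
      then have "FDom (dom2 (CAT small) ?r) = P U"
        using U by (simp add: CAT_simps comp_func_simps id_func_simps)
      then show "NAt ?l x = NAt ?r x" if "x \<in> Obj (FDom (dom2 (CAT small) ?r))" for x
        using unit_lhs[of U x] unit_rhs[of U x] unit[of U x] U that by simp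
      show "dom2 (CAT small) ?l = dom2 (CAT small) ?r"
        using U L.two_cat_simps(9,10)[of "TAt \<sigma> U"] by (simp add: L.two_cat_simps)
    qed (use U in \<open>simp_all add: L.two_cat_simps\<close>)
  next
    fix f assume f: "f \<in> Arr C"
    show "invertible_cell (CAT small) (TCell \<sigma> f)"
      unfolding invertible_cell_CAT using f iso[of f] TCell_facts[OF f]
      by (auto simp: comp_func_simps TAt_facts Q.PMor_facts)
    \<comment> \<open>The cells of \<open>base C\<close> are identities, so naturality with respect
      to cells comes down to unit laws.\<close>
    have "PCell (TCod \<sigma>) f = id2 (CAT small) (PMor (TCod \<sigma>) f)" "PCell (TDom \<sigma>) f =
      id2 (CAT small) (PMor (TDom \<sigma>) f)"
      using f P.PCell_eq Q.PCell_eq by (simp_all add: CAT_simps)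
    then show "TCell \<sigma> f \<bullet>[CAT small] (PCell (TCod \<sigma>) f \<star>[CAT small] id2 (CAT small) (TAt \<sigma> (Cod C f))) =
       (id2 (CAT small) (TAt \<sigma> (Dom C f)) \<star>[CAT small] PCell (TDom \<sigma>) f) \<bullet>[CAT small] TCell \<sigma> f"
      using f L.two_cat_simps(20,21)[of "TCell \<sigma> f"] by (simp add: L.two_cat_simps)
  qed (use P.psfun Q.psfun ext in \<open>simp_all add: hom_def cat1_def vcat_def\<close>)
qed

end

locale indexed_functor = C: category C
  for C :: "('o, 'm) cat" +
  fixes small :: "'u set \<Rightarrow> bool" and \<sigma> :: "('o, 'm, 'u, 'u) cat_psnat"
  assumes psnat: "pseudonatural (base C) (CAT small) \<sigma>"
begin

sublocale N: pseudonatural "base C" "CAT small" \<sigma>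
  by (rule psnat)

sublocale indexed_functor_data C small \<sigma>
proof (intro indexed_functor_data.intro indexed_functor_data_axioms.intro)
  show P: "indexed_category C small (TDom \<sigma>)" and Q: "indexed_category C small (TCod \<sigma>)"
    using C.category_axioms N.pseudofunctor_TDom N.pseudofunctor_TCod
    by (simp_all add: indexed_category_def indexed_category_axioms_def)
  show "is_functor (TAt \<sigma> U) \<and> FDom (TAt \<sigma> U) = PObj (TDom \<sigma>) U \<and> FCod (TAt \<sigma> U) = PObj (TCod \<sigma>) U"
    if "U \<in> Obj C" for U
    using N.TAt_in[of U] that by (simp add: base_simps CAT_simps hom_def cat1_def)
  show "is_ntrans (TCell \<sigma> f) \<and> NDom (TCell \<sigma> f) = comp_func (PMor (TCod \<sigma>) f) (TAt \<sigma> (Cod C f)) \<and>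
      NCod (TCell \<sigma> f) = comp_func (TAt \<sigma> (Dom C f)) (PMor (TDom \<sigma>) f)" if "f \<in> Arr C" for f
    using N.TCell_in[of f] that by (simp add: base_simps CAT_simps hom_def vcat_def)
qed

lemma iso_tcell:
  assumes "f \<in> Arr C" "Dom C f = V" "x \<in> Obj (P (Cod C f))"
  shows "iso_arr (Q V) (tcell f x)"
  using N.TCell_invertible[of f] assms TCell_facts[OF assms(1)]
  by (auto simp: base_simps invertible_cell_CAT comp_func_simps Q.PMor_facts TAt_facts C.Cod_in)

lemmas ifun_simps = ifun_simps iso_tcell

lemma tcell_comp:
  assumes "f \<in> Arr C" "g \<in> Arr C" "Cod C g = Dom C f" "x \<in> Obj (P (Cod C f))"
  shows "tcell (f \<cdot>[C] g) x \<cdot>[Q (Dom C g)] res_comp (TCod \<sigma>) f g (app (Cod C f) x) =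
    app_arr (Dom C g) (res_comp (TDom \<sigma>) f g x) \<cdot>[Q (Dom C g)]
      (tcell g (res_obj (TDom \<sigma>) f x) \<cdot>[Q (Dom C g)] res_arr (TCod \<sigma>) g (tcell f x))"
  using comp_lhs[OF assms] comp_rhs[OF assms] N.TCell_comp[of f g] assms by (simp add: base_simps)

lemma tcell_unit:
  assumes "U \<in> Obj C" "x \<in> Obj (P U)"
  shows "tcell (Ident C U) x \<cdot>[Q U] res_unit (TCod \<sigma>) U (app U x) = app_arr U (res_unit (TDom \<sigma>) U x)"
  using unit_lhs[OF assms] unit_rhs[OF assms] N.TCell_unit[of U] assms by (simp add: base_simps)

section \<open>The functor of total categories induced by a transformation\<close>

definition tot_obj :: "'o \<times> 'u \<Rightarrow> 'o \<times> 'u" where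
  "tot_obj = (\<lambda>(U, x). (U, app U x))"

text \<open>The image of b ends at \<open>app\<close> of a restriction, while an arrow of the total
  category has to end at a restriction of \<open>app y\<close>. The cell points from the second to
  the first, hence the inverse.\<close>

definition tot_arr :: "'m \<times> 'u \<times> 'u \<Rightarrow> 'm \<times> 'u \<times> 'u" where
  "tot_arr = (\<lambda>(g, b, y). (g, inv_arr (Q (Dom C g)) (tcell g y) \<cdot>[Q (Dom C g)] app_arr (Dom C g) b,
     app (Cod C g) y))"

lemma tot_obj_simps: "tot_obj (U, x) = (U, app U x)" "fst (tot_obj a) = fst a"
  by (simp_all add: tot_obj_def split: prod.split)

text \<open>Replaces the inverse in \<open>tot_arr\<close> by the equation
  \<open>tcell g y \<cdot> d = app_arr b\<close> for the fibre component d; images are computed by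
  this equation from here on.\<close>

lemma tot_arr_char:
  assumes "(g, b, y) \<in> Arr P.total"
  shows "tot_arr (g, b, y) = (g, d, app (Cod C g) y) \<longleftrightarrow>
    d = inv_arr (Q (Dom C g)) (tcell g y) \<cdot>[Q (Dom C g)] app_arr (Dom C g) b"
    "\<lbrakk>d \<in> Arr (Q (Dom C g)); Cod (Q (Dom C g)) d = res_obj (TCod \<sigma>) g (app (Cod C g) y);
      tcell g y \<cdot>[Q (Dom C g)] d = app_arr (Dom C g) b\<rbrakk> \<Longrightarrow> tot_arr (g, b, y) = (g, d, app (Cod C g) y)"
    and "\<exists>d. d \<in> Arr (Q (Dom C g)) \<and> Dom (Q (Dom C g)) d = app (Dom C g) (Dom (P (Dom C g)) b) \<and>
      Cod (Q (Dom C g)) d = res_obj (TCod \<sigma>) g (app (Cod C g) y) \<and>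
      tcell g y \<cdot>[Q (Dom C g)] d = app_arr (Dom C g) b \<and> tot_arr (g, b, y) = (g, d, app (Cod C g) y) \<and>
      (iso_arr (P (Dom C g)) b \<longrightarrow> iso_arr (Q (Dom C g)) d)"
proof -
  note [simp] = assms[unfolded P.total_simps, simplified]
  have V: "Dom C g \<in> Obj C" by (simp add: P.idx_simps)
  interpret D: category "Q (Dom C g)" using V Q.category_PObj by blast
  show 1: "tot_arr (g, b, y) = (g, d, app (Cod C g) y) \<longleftrightarrow>
    d = inv_arr (Q (Dom C g)) (tcell g y) \<cdot>[Q (Dom C g)] app_arr (Dom C g) b" for d
    by (auto simp: tot_arr_def)
  have i: "iso_arr (Q (Dom C g)) (tcell g y)" by (simp add: ifun_simps)
  note ii = D.inv_arr_simps[OF i] D.inv_comp_cancel[OF i]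
  show "tot_arr (g, b, y) = (g, d, app (Cod C g) y)"
    if "d \<in> Arr (Q (Dom C g))" "Cod (Q (Dom C g)) d = res_obj (TCod \<sigma>) g (app (Cod C g) y)"
      "tcell g y \<cdot>[Q (Dom C g)] d = app_arr (Dom C g) b"
    using that ii(7)[of d] unfolding 1 by (simp add: ifun_simps)
  show "\<exists>d. d \<in> Arr (Q (Dom C g)) \<and> Dom (Q (Dom C g)) d = app (Dom C g) (Dom (P (Dom C g)) b) \<and>
      Cod (Q (Dom C g)) d = res_obj (TCod \<sigma>) g (app (Cod C g) y) \<and>
      tcell g y \<cdot>[Q (Dom C g)] d = app_arr (Dom C g) b \<and> tot_arr (g, b, y) = (g, d, app (Cod C g) y) \<and>
      (iso_arr (P (Dom C g)) b \<longrightarrow> iso_arr (Q (Dom C g)) d)"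
    unfolding 1
    using ii(8)[of "app_arr (Dom C g) b"] iso_app_arr[OF V, of b] D.iso_arr_inv_arr[OF i]
    by (intro exI[of _ "inv_arr (Q (Dom C g)) (tcell g y) \<cdot>[Q (Dom C g)] app_arr (Dom C g) b"])
      (simp add: ifun_simps ii D.iso_arr_comp)
qed

lemma tot_arr_simps:
  assumes "u \<in> Arr P.total"
  shows "tot_arr u \<in> Arr Q.total" "Dom Q.total (tot_arr u) = tot_obj (Dom P.total u)"
    "Cod Q.total (tot_arr u) = tot_obj (Cod P.total u)" "fst (tot_arr u) = fst u"
    "cartesian C P.total u \<Longrightarrow> cartesian C Q.total (tot_arr u)"
proof -
  obtain g b y where e: "u = (g, b, y)" by (cases u)
  note a = assms[unfolded e]
  note [simp] = a[unfolded P.total_simps, simplified]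
  obtain d where d: "d \<in> Arr (Q (Dom C g))" "Dom (Q (Dom C g)) d = app (Dom C g) (Dom (P (Dom C g)) b)"
      "Cod (Q (Dom C g)) d = res_obj (TCod \<sigma>) g (app (Cod C g) y)" "tot_arr u = (g, d, app (Cod C g) y)"
      "iso_arr (P (Dom C g)) b \<longrightarrow> iso_arr (Q (Dom C g)) d"
    using tot_arr_char(3)[OF a] e by blast
  show 1: "tot_arr u \<in> Arr Q.total" and "Dom Q.total (tot_arr u) = tot_obj (Dom P.total u)"
    "Cod Q.total (tot_arr u) = tot_obj (Cod P.total u)" "fst (tot_arr u) = fst u"
    using d by (simp_all add: e P.total_simps Q.total_simps ifun_simps tot_obj_simps)
  assume "cartesian C P.total u"
  then show "cartesian C Q.total (tot_arr u)"
    using d 1 P.cartesian_iff[OF a] Q.cartesian_iff[of g d] by (simp add: e)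
qed

lemma tot_obj_in: "x \<in> Obj P.total \<Longrightarrow> tot_obj x \<in> Obj Q.total"
  by (cases x) (simp add: tot_obj_simps P.total_simps Q.total_simps app_simps)

text \<open>By \<open>tcell_unit\<close> the cell at an identity is absorbed by the two unit
  isomorphisms.\<close>

lemma tot_arr_vertical:
  assumes "U \<in> Obj C" "m \<in> Arr (P U)"
  shows "tot_arr (P.vertical U m) = Q.vertical U (app_arr U m)"
proof -
  interpret D: category "Q U" using assms Q.category_PObj by blast
  let ?y = "Cod (P U) m"
  have "tot_arr (Ident C U, res_unit (TDom \<sigma>) U ?y \<cdot>[P U] m, ?y) =
    (Ident C U, res_unit (TCod \<sigma>) U (app U ?y) \<cdot>[Q U] app_arr U m, app (Cod C (Ident C U)) ?y)"
    by (rule tot_arr_char)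
      (use assms tcell_unit[of U ?y] in \<open>simp_all add: P.total_simps ifun_simps D.Comp_assoc[symmetric]\<close>)
  then show ?thesis
    using assms by (simp add: P.vertical_def Q.vertical_def ifun_simps)
qed

text \<open>The image of a chosen lift is cartesian but in general not the chosen lift of the image;
  the cells of \<sigma> are the vertical comparison between the two.\<close>

lemma tot_arr_lift:
  assumes "g \<in> Arr C" "y \<in> Obj (P (Cod C g))"
  shows "Q.lift g (app (Cod C g) y) = tot_arr (P.lift g y) \<cdot>[Q.total] Q.vertical (Dom C g) (tcell g y)"
proof -
  let ?V = "Dom C g"
  have V: "?V \<in> Obj C" using assms C.Dom_in by blast
  interpret D: category "Q ?V" using V Q.category_PObj by blast
  note [simp] = assms
  have l: "P.lift g y \<in> Arr P.total" by (simp add: P.lift_simps)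
  obtain d where d [simp]: "d \<in> Arr (Q (Dom C g))" "Dom (Q (Dom C g)) d = app (Dom C g) (res_obj (TDom \<sigma>) g y)"
      "Cod (Q (Dom C g)) d = res_obj (TCod \<sigma>) g (app (Cod C g) y)" "tot_arr (P.lift g y) =
        (g, d, app (Cod C g) y)"
      "tcell g y \<cdot>[Q (Dom C g)] d = app_arr ?V (Ident (P ?V) (res_obj (TDom \<sigma>) g y))"
    using tot_arr_char(3)[OF l[unfolded P.lift_def]] by (auto simp: P.lift_def ifun_simps)
  have "tot_arr (P.lift g y) \<cdot>[Q.total] Q.vertical ?V (tcell g y) = (g, d \<cdot>[Q ?V] tcell g y, app (Cod C g) y)"
    using tot_arr_simps(1)[OF l] by (simp add: Q.vertical_comp ifun_simps)
  moreover have "d \<cdot>[Q ?V] tcell g y = Ident (Q ?V) (res_obj (TCod \<sigma>) g (app (Cod C g) y))"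
  proof (rule D.iso_cancel_left[of "tcell g y"])
    show "tcell g y \<cdot>[Q ?V] (d \<cdot>[Q ?V] tcell g y) = tcell g y \<cdot>[Q ?V] Ident (Q ?V) (res_obj (TCod \<sigma>) g (app (Cod
      C g) y))"
      using D.comp_id_left[of "tcell g y"] D.comp_id_right[of "tcell g y"]
      by (simp add: ifun_simps D.Comp_assoc[symmetric] hom_def)
  qed (simp_all add: ifun_simps)
  ultimately show ?thesis by (simp add: Q.lift_def)
qed

lemma tot_arr_Ident: "x \<in> Obj P.total \<Longrightarrow> tot_arr (Ident P.total x) = Ident Q.total (tot_obj x)"
  using tot_arr_vertical[of "fst x" "Ident (P (fst x)) (snd x)"]
  by (cases x) (simp add: tot_obj_simps P.vertical_Ident Q.vertical_Ident P.total_simps(1) ifun_simps)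

text \<open>After composing with \<open>tcell (g' \<cdot> g) z\<close>, this is the composition law
  \<open>tcell_comp\<close> followed by naturality of \<open>tcell g\<close> at b'.\<close>

lemma tot_arr_Comp:
  assumes "u \<in> Arr P.total" "v \<in> Arr P.total" "Cod P.total u = Dom P.total v"
  shows "tot_arr (v \<cdot>[P.total] u) = tot_arr v \<cdot>[Q.total] tot_arr u"
proof -
  obtain g b y g' b' z where e: "u = (g, b, y)" "v = (g', b', z)" by (cases u, cases v)
  note a = assms[unfolded e]
  have [simp]: "g \<in> Arr C" "g' \<in> Arr C" "Cod C g = Dom C g'" "z \<in> Obj (P (Cod C g'))" "y \<in> Obj (P (Dom C g'))"
    "b \<in> Arr (P (Dom C g))" "b' \<in> Arr (P (Dom C g'))" "Cod (P (Dom C g)) b = res_obj (TDom \<sigma>) g y"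
    "Cod (P (Dom C g')) b' = res_obj (TDom \<sigma>) g' z" "Dom (P (Dom C g')) b' = y"
    using a by (auto simp: P.total_simps)
  let ?W = "Dom C g" and ?V = "Dom C g'" and ?Q = "TCod \<sigma>" and ?P = "TDom \<sigma>"
  have V: "?W \<in> Obj C" "?V \<in> Obj C" by (simp_all add: P.idx_simps)
  interpret D: category "Q ?W" using V Q.category_PObj by blast
  obtain d where d [simp]: "d \<in> Arr (Q ?W)" "Dom (Q ?W) d = app ?W (Dom (P ?W) b)"
      "Cod (Q ?W) d = res_obj ?Q g (app (Cod C g) y)" "tot_arr u = (g, d, app (Cod C g) y)"
      "tcell g y \<cdot>[Q ?W] d = app_arr ?W b"
    using tot_arr_char(3)[OF a(1)] e by auto
  obtain d' where d' [simp]: "d' \<in> Arr (Q ?V)" "Dom (Q ?V) d' = app ?V y"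
      "Cod (Q ?V) d' = res_obj ?Q g' (app (Cod C g') z)" "tot_arr v = (g', d', app (Cod C g') z)"
      "tcell g' z \<cdot>[Q ?V] d' = app_arr ?V b'"
    using tot_arr_char(3)[OF a(2)] e by auto
  let ?r = "res_arr ?Q g d' \<cdot>[Q ?W] d"
  have "tcell (g' \<cdot>[C] g) z \<cdot>[Q ?W] (res_comp ?Q g' g (app (Cod C g') z) \<cdot>[Q ?W] ?r)
    = (tcell (g' \<cdot>[C] g) z \<cdot>[Q ?W] res_comp ?Q g' g (app (Cod C g') z)) \<cdot>[Q ?W] ?r"
    by (simp add: ifun_simps D.Comp_assoc)
  also have "\<dots> = app_arr ?W (res_comp ?P g' g z) \<cdot>[Q ?W] (tcell g (res_obj ?P g' z) \<cdot>[Q ?W]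
     ((res_arr ?Q g (tcell g' z) \<cdot>[Q ?W] res_arr ?Q g d') \<cdot>[Q ?W] d))"
    by (simp add: tcell_comp ifun_simps D.Comp_assoc)
  also have "res_arr ?Q g (tcell g' z) \<cdot>[Q ?W] res_arr ?Q g d' = res_arr ?Q g (app_arr ?V b')"
    by (simp add: Q.res_simps(6)[symmetric] ifun_simps)
  also have "tcell g (res_obj ?P g' z) \<cdot>[Q ?W] (res_arr ?Q g (app_arr ?V b') \<cdot>[Q ?W] d) =
     (tcell g (res_obj ?P g' z) \<cdot>[Q ?W] res_arr ?Q g (app_arr ?V b')) \<cdot>[Q ?W] d"
    by (simp add: ifun_simps D.Comp_assoc)
  also have "\<dots> = app_arr ?W (res_arr ?P g b') \<cdot>[Q ?W] app_arr ?W b"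
    using tcell_natural[of g b'] by (simp add: ifun_simps D.Comp_assoc)
  finally have *: "tcell (g' \<cdot>[C] g) z \<cdot>[Q ?W] (res_comp ?Q g' g (app (Cod C g') z) \<cdot>[Q ?W] ?r) =
     app_arr ?W (res_comp ?P g' g z \<cdot>[P ?W] (res_arr ?P g b' \<cdot>[P ?W] b))"
    by (simp add: ifun_simps)
  have "tot_arr (g' \<cdot>[C] g, res_comp ?P g' g z \<cdot>[P ?W] (res_arr ?P g b' \<cdot>[P ?W] b), z) =
    (g' \<cdot>[C] g, res_comp ?Q g' g (app (Cod C g') z) \<cdot>[Q ?W] ?r, app (Cod C (g' \<cdot>[C] g)) z)"
    by (rule tot_arr_char) (use * in \<open>simp_all add: P.total_simps ifun_simps\<close>)
  then show ?thesis
    by (simp add: e[symmetric] Q.total_simps ifun_simps) (simp add: e P.total_simps)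
qed

text \<open>Over a fixed base arrow g both hom-sets are hom-sets of one fibre, and there
  \<open>tot_arr\<close> is \<open>app_arr\<close> followed by composition with the inverse of
  \<open>tcell g y\<close>.\<close>

lemma tot_arr_full_faithful:
  assumes ff: "\<And>U. U \<in> Obj C \<Longrightarrow> fully_faithful (TAt \<sigma> U)"
    and "a \<in> Obj P.total" "a' \<in> Obj P.total" "v \<in> hom Q.total (tot_obj a) (tot_obj a')"
  shows "\<exists>!u. u \<in> hom P.total a a' \<and> tot_arr u = v"
proof -
  obtain U x U' y where e: "a = (U, x)" "a' = (U', y)" by (cases a, cases a')
  obtain g d where v: "v = (g, d, app U' y)" and g: "g \<in> Arr C" "Dom C g = U" "Cod C g = U'"
    and d: "d \<in> hom (Q U) (app U x) (res_obj (TCod \<sigma>) g (app U' y))"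
    using assms(4) by (cases v) (auto simp: hom_def e tot_obj_simps Q.total_simps)
  have x: "x \<in> Obj (P U)" "y \<in> Obj (P U')" "U \<in> Obj C" "U' \<in> Obj C" using assms by (auto simp: e P.total_simps)
  interpret D: category "Q U" using x Q.category_PObj by blast
  note [simp] = x g homD[OF d]
  have bij: "bij_betw (FArr (TAt \<sigma> U)) (hom (P U) x (res_obj (TDom \<sigma>) g y)) (hom (Q U) (app U x) (app U (res_obj
    (TDom \<sigma>) g y)))"
    using ff[of U] unfolding fully_faithful_def by (simp add: TAt_facts ifun_simps)
  have "tcell g y \<cdot>[Q U] d \<in> hom (Q U) (app U x) (app U (res_obj (TDom \<sigma>) g y))"
    by (simp add: hom_def ifun_simps)
  then obtain b where b: "b \<in> hom (P U) x (res_obj (TDom \<sigma>) g y)" "app_arr U b = tcell g y \<cdot>[Q U] d"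
    using bij unfolding bij_betw_def by (metis (no_types, lifting) image_iff)
  note [simp] = homD[OF b(1)]
  have arr: "(g, b, y) \<in> Arr P.total" by (simp add: P.total_simps)
  have "tot_arr (g, b, y) = (g, d, app (Cod C g) y)"
    by (rule tot_arr_char[OF arr]) (use b(2) in simp_all)
  moreover have "u = (g, b, y)" if u: "u \<in> hom P.total a a'" "tot_arr u = v" for u
  proof -
    obtain c where c: "u = (g, c, y)" "c \<in> hom (P U) x (res_obj (TDom \<sigma>) g y)"
      using u tot_arr_simps(4)[of u] by (cases u) (auto simp: hom_def e v P.total_simps)
    have "u \<in> Arr P.total" using u by (simp add: hom_def)
    then have "tcell g y \<cdot>[Q U] d = app_arr U c"
      using tot_arr_char(3)[of g c y] u(2) c v by auto
    then have "app_arr U c = app_arr U b" using b by simp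
    then have "c = b" using bij b(1) c(2) unfolding bij_betw_def inj_on_def by blast
    then show ?thesis using c by simp
  qed
  ultimately show ?thesis using arr v by (intro ex1I[of _ "(g, b, y)"]) (auto simp: hom_def e P.total_simps)
qed

end

section \<open>Extension along a dense inclusion\<close>

text \<open>Preservation of cartesian arrows is the condition that makes the cells of the associated
  transformation invertible.\<close>

locale functor_over = S: category_over C S + T: category_over C T
  for C :: "('o, 'm) cat" and S :: "('o \<times> 'x, 'm \<times> 'y) cat" and T :: "('o \<times> 'p, 'm \<times> 'q) cat"
    and FO :: "'o \<times> 'x \<Rightarrow> 'o \<times> 'p" and FA :: "'m \<times> 'y \<Rightarrow> 'm \<times> 'q" +
  assumes map_Obj: "x \<in> Obj S \<Longrightarrow> FO x \<in> Obj T"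
    and fst_map_Obj: "x \<in> Obj S \<Longrightarrow> fst (FO x) = fst x"
    and map_Arr: "u \<in> Arr S \<Longrightarrow> FA u \<in> Arr T"
    and Dom_map: "u \<in> Arr S \<Longrightarrow> Dom T (FA u) = FO (Dom S u)"
    and Cod_map: "u \<in> Arr S \<Longrightarrow> Cod T (FA u) = FO (Cod S u)"
    and fst_map: "u \<in> Arr S \<Longrightarrow> fst (FA u) = fst u"
    and map_Ident: "x \<in> Obj S \<Longrightarrow> FA (Ident S x) = Ident T (FO x)"
    and map_Comp: "\<lbrakk>u \<in> Arr S; v \<in> Arr S; Cod S u = Dom S v\<rbrakk> \<Longrightarrow> FA (v \<cdot>[S] u) = FA v \<cdot>[T] FA u"
    and map_cartesian: "cartesian C S u \<Longrightarrow> cartesian C T (FA u)"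
begin

lemmas map_simps = map_Obj fst_map_Obj map_Arr Dom_map Cod_map fst_map

end

lemma (in indexed_functor) functor_over: "functor_over C P.total Q.total tot_obj tot_arr"
  by unfold_locales (auto simp: tot_obj_in tot_obj_simps tot_arr_simps tot_arr_Ident tot_arr_Comp
      intro: tot_arr_simps(5)[of u for u] simp: cartesian_def[of C P.total])

context category_over
begin

lemmas over_simps = C.Dom_in C.Cod_in C.Ident_in C.Dom_Ident C.Cod_Ident C.Comp_in C.Dom_Comp C.Cod_Comp
  T.Dom_in T.Cod_in T.Ident_in T.Dom_Ident T.Cod_Ident T.Comp_in T.Dom_Comp T.Cod_Comp
  fst_Obj fst_Arr fst_Dom fst_Cod fst_Ident fst_Comp

lemma cartesian_Arr: "cartesian C T u \<Longrightarrow> u \<in> Arr T"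
  by (simp add: cartesian_def)

end

section \<open>Covering sieves\<close>

locale site = C: category C + J: grothendieck_topology C J
  for C :: "('o, 'm) cat" and J :: "'o \<Rightarrow> 'm set set"
begin

lemma sieveD:
  assumes "sieve C U S" "f \<in> S"
  shows "f \<in> Arr C" "Cod C f = U" "\<lbrakk>e \<in> Arr C; Cod C e = Dom C f\<rbrakk> \<Longrightarrow> f \<cdot>[C] e \<in> S"
  using assms by (auto simp: sieve_def)

text \<open>Local character: pulled back along an element of S, the larger sieve R becomes
  maximal.\<close>

lemma covers_superset:
  assumes "U \<in> Obj C" "S \<in> J U" "sieve C U R" "S \<subseteq> R"
  shows "R \<in> J U"
proof (rule J.covers_local[OF assms(1,2,3)])
  fix f assume f: "f \<in> S"
  note S = sieveD[OF J.covers_sieve[OF assms(1,2)] f]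
  have "pullback_sieve C f R = {g \<in> Arr C. Cod C g = Dom C f}"
    using S(3) assms(4) by (auto simp: pullback_sieve_def)
  then show "pullback_sieve C f R \<in> J (Dom C f)" using J.covers_maximal[of "Dom C f"] S(1) C.Dom_in by simp
qed

text \<open>Local character along S: at an element of S, the sieves \<open>S \<inter> R\<close> and
  R have the same pullback.\<close>

lemma covers_Int:
  assumes "U \<in> Obj C" "S \<in> J U" "R \<in> J U"
  shows "S \<inter> R \<in> J U"
proof (rule J.covers_local[OF assms(1,2)])
  note S = sieveD[OF J.covers_sieve[OF assms(1,2)]] and R = sieveD[OF J.covers_sieve[OF assms(1,3)]]
  show "sieve C U (S \<inter> R)"
    using S R by (auto simp: sieve_def)
  fix f assume f: "f \<in> S"
  have "pullback_sieve C f (S \<inter> R) = pullback_sieve C f R"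
    using S(3)[OF f] by (auto simp: pullback_sieve_def)
  then show "pullback_sieve C f (S \<inter> R) \<in> J (Dom C f)" using J.covers_stable[of f R] S(1,2)[OF f] assms by simp
qed

end

text \<open>The extension problem for functors over \<open>C\<close>, without indexed categories.
  \<open>glue\<close> and \<open>descent\<close> express the stack property of \<open>TZ\<close>
  through cartesian arrows: c is a cartesian family of legs, k records the transitions between the
  legs, and the comparison isomorphisms are hidden in the composition of \<open>TZ\<close>.\<close>

locale dense_extension = site C J +
  A: category_over C TA + B: category_over C TB + Z: category_over C TZ +
  w: functor_over C TA TB wO wA + h: functor_over C TA TZ hO hA
  for C :: "('o, 'm) cat" and J :: "'o \<Rightarrow> 'm set set"
    and TA :: "('o \<times> 'a, 'm \<times> 'b) cat" and TB :: "('o \<times> 'c, 'm \<times> 'd) cat" and TZ :: "('o \<times> 'e, 'm \<times> 'f) cat"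
    and wO wA hO hA +
  assumes full_faithful: "\<lbrakk>a \<in> Obj TA; a' \<in> Obj TA; v \<in> hom TB (wO a) (wO a')\<rbrakk> \<Longrightarrow>
      \<exists>!u. u \<in> hom TA a a' \<and> wA u = v"
    and A_lift: "\<lbrakk>a \<in> Obj TA; g \<in> Arr C; Cod C g = fst a\<rbrakk> \<Longrightarrow>
      \<exists>u. cartesian C TA u \<and> Cod TA u = a \<and> fst u = g"
    and Z_lift: "\<lbrakk>z \<in> Obj TZ; g \<in> Arr C; Cod C g = fst z\<rbrakk> \<Longrightarrow>
      \<exists>u. cartesian C TZ u \<and> Cod TZ u = z \<and> fst u = g"
    and dense: "b \<in> Obj TB \<Longrightarrow> \<exists>S\<in>J (fst b). \<forall>f\<in>S. \<exists>a\<in>Obj TA. \<exists>u.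
      cartesian C TB u \<and> Dom TB u = wO a \<and> Cod TB u = b \<and> fst u = f"
    and glue: "\<lbrakk>z \<in> Obj TZ; z' \<in> Obj TZ; S \<in> J (fst z); g \<in> hom C (fst z) (fst z');
       \<And>f. f \<in> S \<Longrightarrow> cartesian C TZ (c f) \<and> Cod TZ (c f) = z \<and> fst (c f) = f;
       \<And>f. f \<in> S \<Longrightarrow> s f \<in> hom TZ (Dom TZ (c f)) z' \<and> fst (s f) = g \<cdot>[C] f;
       \<And>f e. \<lbrakk>f \<in> S; e \<in> Arr C; Cod C e = Dom C f\<rbrakk> \<Longrightarrow>
         k f e \<in> hom TZ (Dom TZ (c (f \<cdot>[C] e))) (Dom TZ (c f)) \<and> fst (k f e) = e \<and>
         c f \<cdot>[TZ] k f e = c (f \<cdot>[C] e) \<and> s f \<cdot>[TZ] k f e = s (f \<cdot>[C] e)\<rbrakk> \<Longrightarrow>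
       \<exists>!t. t \<in> hom TZ z z' \<and> fst t = g \<and> (\<forall>f\<in>S. t \<cdot>[TZ] c f = s f)"
    and descent: "\<lbrakk>U \<in> Obj C; S \<in> J U;
       \<And>f. f \<in> S \<Longrightarrow> y f \<in> Obj TZ \<and> fst (y f) = Dom C f;
       \<And>f e. \<lbrakk>f \<in> S; e \<in> Arr C; Cod C e = Dom C f\<rbrakk> \<Longrightarrow>
         cartesian C TZ (k f e) \<and> k f e \<in> hom TZ (y (f \<cdot>[C] e)) (y f) \<and> fst (k f e) = e;
       \<And>f e e'. \<lbrakk>f \<in> S; e \<in> Arr C; Cod C e = Dom C f; e' \<in> Arr C; Cod C e' = Dom C e\<rbrakk> \<Longrightarrow>
         k f (e \<cdot>[C] e') = k f e \<cdot>[TZ] k (f \<cdot>[C] e) e'\<rbrakk> \<Longrightarrow>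
       \<exists>z c. z \<in> Obj TZ \<and> fst z = U \<and>
         (\<forall>f\<in>S. cartesian C TZ (c f) \<and> c f \<in> hom TZ (y f) z \<and> fst (c f) = f \<and>
           (\<forall>e\<in>Arr C. Cod C e = Dom C f \<longrightarrow> c f \<cdot>[TZ] k f e = c (f \<cdot>[C] e)))"
begin

lemma w_inj:
  assumes "\<alpha> \<in> Arr TA" "\<alpha>' \<in> Arr TA" "Dom TA \<alpha> = Dom TA \<alpha>'" "Cod TA \<alpha> = Cod TA \<alpha>'" "wA \<alpha> = wA \<alpha>'"
  shows "\<alpha> = \<alpha>'"
proof -
  have "\<exists>!u. u \<in> hom TA (Dom TA \<alpha>) (Cod TA \<alpha>) \<and> wA u = wA \<alpha>"
    using assms by (intro full_faithful) (simp_all add: A.over_simps hom_def w.map_simps)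
  then show ?thesis using assms by (auto simp: hom_def)
qed

lemma w_surj:
  assumes "a \<in> Obj TA" "a' \<in> Obj TA" "v \<in> Arr TB" "Dom TB v = wO a" "Cod TB v = wO a'"
  obtains \<alpha> where "\<alpha> \<in> Arr TA" "Dom TA \<alpha> = a" "Cod TA \<alpha> = a'" "wA \<alpha> = v" "fst \<alpha> = fst v"
proof -
  obtain \<alpha> where "\<alpha> \<in> hom TA a a'" "wA \<alpha> = v"
    using full_faithful[of a a' v] assms by (auto simp: hom_def)
  then show ?thesis using that[of \<alpha>] w.fst_map[of \<alpha>] by (auto simp: hom_def)
qed

text \<open>The factorisation required in \<open>TA\<close> exists in \<open>TB\<close>; its ends
  come from \<open>TA\<close>, so fullness brings it back and faithfulness gives the
  equations.\<close>

lemma w_reflects_cartesian: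
  assumes \<alpha> [simp]: "\<alpha> \<in> Arr TA" and c: "cartesian C TB (wA \<alpha>)"
  shows "cartesian C TA \<alpha>"
proof (rule A.cartesianI[OF \<alpha>])
  fix v k assume v [simp]: "v \<in> Arr TA" "Cod TA v = Cod TA \<alpha>" and k: "k \<in> Arr C" "Cod C k = Dom C (fst \<alpha>)"
    "fst v = fst \<alpha> \<cdot>[C] k"
  obtain t where t: "t \<in> Arr TB" "Dom TB t = Dom TB (wA v)" "Cod TB t = Dom TB (wA \<alpha>)" "fst t = k"
    "wA \<alpha> \<cdot>[TB] t = wA v"
    by (rule B.cartesianD[OF c, of "wA v" k]) (use k in \<open>auto simp: w.map_simps\<close>)
  obtain \<tau> where [simp]: "\<tau> \<in> Arr TA" "Dom TA \<tau> = Dom TA v" "Cod TA \<tau> = Dom TA \<alpha>" "wA \<tau> = t" "fst \<tau> = fst t"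
    by (rule w_surj[of "Dom TA v" "Dom TA \<alpha>" t]) (use t in \<open>auto simp: w.map_simps A.over_simps\<close>)
  have "\<alpha> \<cdot>[TA] \<tau> = v"
    by (rule w_inj) (use t in \<open>simp_all add: A.over_simps w.map_Comp\<close>)
  then show "\<exists>t\<in>Arr TA. Dom TA t = Dom TA v \<and> Cod TA t = Dom TA \<alpha> \<and> fst t = k \<and> \<alpha> \<cdot>[TA] t = v"
    using t by (intro bexI[of _ \<tau>]) simp_all
next
  fix t t' assume t: "t \<in> Arr TA" "t' \<in> Arr TA" "Cod TA t = Dom TA \<alpha>" "Cod TA t' = Dom TA \<alpha>" "Dom TA t =
    Dom TA t'"
    "fst t = fst t'" "\<alpha> \<cdot>[TA] t = \<alpha> \<cdot>[TA] t'"
  have "wA \<alpha> \<cdot>[TB] wA t = wA \<alpha> \<cdot>[TB] wA t'"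
    using w.map_Comp[OF t(1) \<alpha> t(3)] w.map_Comp[OF t(2) \<alpha> t(4)] t(7) by simp
  then have "wA t = wA t'"
    by (rule B.cartesian_cancel[OF c]) (use t in \<open>simp_all add: w.map_simps\<close>)
  then show "t = t'" using t by (intro w_inj) simp_all
qed

text \<open>The sieve of all \<open>f\<close> along which the restriction of \<open>b\<close> comes from \<open>TA\<close>, up to isomorphism. Working
  with the largest such sieve makes it canonical, so that only the lifts have to be chosen.\<close>

definition Cov where
  "Cov b = {f \<in> Arr C. \<exists>a\<in>Obj TA. \<exists>u. cartesian C TB u \<and> Dom TB u = wO a \<and> Cod TB u = b \<and> fst u = f}"

lemma CovI: "\<lbrakk>cartesian C TB u; a \<in> Obj TA; Dom TB u = wO a; Cod TB u = b; fst u = f\<rbrakk> \<Longrightarrow> f \<in> Cov b"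
  unfolding Cov_def using B.fst_Arr[OF B.cartesian_Arr, of u] by blast

text \<open>\<open>dense\<close> provides a covering sieve inside \<open>Cov b\<close>. Closure
  under precomposition with g holds because g has a cartesian lift in \<open>TA\<close>, whose image
  under w is cartesian and composes with the given arrow.\<close>

lemma Cov_cover:
  assumes b: "b \<in> Obj TB"
  shows "Cov b \<in> J (fst b)"
proof -
  obtain S where S: "S \<in> J (fst b)" "\<And>f. f \<in> S \<Longrightarrow> \<exists>a\<in>Obj TA. \<exists>u.
      cartesian C TB u \<and> Dom TB u = wO a \<and> Cod TB u = b \<and> fst u = f"
    using dense[OF b] by blast
  show ?thesis
  proof (rule covers_superset[OF _ S(1)])
    show "sieve C (fst b) (Cov b)"
      unfolding sieve_def
    proof (intro conjI subsetI ballI impI)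
      fix f assume f: "f \<in> Cov b"
      then obtain a u where u: "a \<in> Obj TA" "cartesian C TB u" "Dom TB u = wO a" "Cod TB u = b" "fst u = f"
        "f \<in> Arr C"
        by (auto simp: Cov_def)
      then have U: "u \<in> Arr TB" by (simp add: cartesian_def)
      then show "f \<in> {f \<in> Arr C. Cod C f = fst b}" using u B.fst_Cod[of u] by simp
      fix g assume g: "g \<in> Arr C" "Cod C g = Dom C f"
      have a: "fst a = Dom C f" using B.fst_Dom[OF U] u w.fst_map_Obj[of a] by simp
      obtain l where l: "cartesian C TA l" "Cod TA l = a" "fst l = g" using A_lift[of a g] g a u by auto
      have lA: "l \<in> Arr TA" using l by (simp add: cartesian_def)
      have "cartesian C TB (u \<cdot>[TB] wA l)"
        using u l lA by (intro B.cartesian_Comp w.map_cartesian) (simp_all add: w.map_simps)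
      then show "f \<cdot>[C] g \<in> Cov b"
        by (rule CovI[where a = "Dom TA l"])
          (use u l lA U g in \<open>simp_all add: B.over_simps A.over_simps w.map_simps\<close>)
    qed
    show "S \<subseteq> Cov b" using S(2) sieveD(1)[OF J.covers_sieve[OF _ S(1)]] b by (auto simp: Cov_def B.over_simps)
    show "fst b \<in> Obj C" using b by (simp add: B.over_simps)
  qed
qed

lemma Cov_facts:
  assumes "b \<in> Obj TB" "f \<in> Cov b"
  shows "f \<in> Arr C" "Cod C f = fst b" "\<lbrakk>e \<in> Arr C; Cod C e = Dom C f\<rbrakk> \<Longrightarrow> f \<cdot>[C] e \<in> Cov b"
  using sieveD[OF J.covers_sieve[OF _ Cov_cover[OF assms(1)]] assms(2)] assms(1) by (auto simp: B.over_simps)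

text \<open>A cartesian lift of f in \<open>TA\<close> is carried by w to a witness in
  \<open>TB\<close>.\<close>

lemma Cov_image: "a \<in> Obj TA \<Longrightarrow> f \<in> Arr C \<Longrightarrow> Cod C f = fst a \<Longrightarrow> f \<in> Cov (wO a)"
proof -
  assume a: "a \<in> Obj TA" "f \<in> Arr C" "Cod C f = fst a"
  then obtain l where l: "cartesian C TA l" "Cod TA l = a" "fst l = f" using A_lift by blast
  then have "l \<in> Arr TA" by (simp add: cartesian_def)
  then show ?thesis
    by (intro CovI[OF w.map_cartesian[OF l(1)], of "Dom TA l"]) (use a l in \<open>simp_all add: w.map_simps
      A.over_simps\<close>)
qed

text \<open>The choices for different f are unrelated. Their discrepancies are the arrows
  \<open>al\<close> below, and uniqueness of factorisations makes these coherent.\<close>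

definition pick where
  "pick b f = (SOME (a, u). a \<in> Obj TA \<and> cartesian C TB u \<and> Dom TB u = wO a \<and> Cod TB u = b \<and> fst u = f)"

definition pa where "pa b f = fst (pick b f)"
definition pu where "pu b f = snd (pick b f)"

lemma pick_facts:
  assumes "f \<in> Cov b"
  shows "pa b f \<in> Obj TA" "cartesian C TB (pu b f)" "Dom TB (pu b f) = wO (pa b f)" "Cod TB (pu b f) = b"
    "fst (pu b f) = f" "pu b f \<in> Arr TB" "fst (pa b f) = Dom C f"
proof -
  have "\<exists>p. case p of (a, u) \<Rightarrow> a \<in> Obj TA \<and> cartesian C TB u \<and> Dom TB u = wO a \<and> Cod TB u = b \<and> fst u = f"
    using assms by (auto simp: Cov_def)
  from someI_ex[OF this]
  show 1: "pa b f \<in> Obj TA" "cartesian C TB (pu b f)" "Dom TB (pu b f) = wO (pa b f)" "Cod TB (pu b f) = b"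
    "fst (pu b f) = f"
    unfolding pa_def pu_def pick_def by (auto split: prod.splits)
  then show 2: "pu b f \<in> Arr TB" by (simp add: cartesian_def)
  show "fst (pa b f) = Dom C f" using B.fst_Dom[OF 2] 1 w.fst_map_Obj[of "pa b f"] by simp
qed

text \<open>u factors through the cartesian arrow \<open>pu b f\<close> in \<open>TB\<close>; both
  ends of the factor come from \<open>TA\<close>, so it lifts by fullness.\<close>

lemma factor:
  assumes "b \<in> Obj TB" "f \<in> Cov b" "a \<in> Obj TA" "u \<in> Arr TB" "Dom TB u = wO a" "Cod TB u = b"
    "e \<in> Arr C" "Cod C e = Dom C f" "fst u = f \<cdot>[C] e"
  obtains \<alpha> where "\<alpha> \<in> Arr TA" "Dom TA \<alpha> = a" "Cod TA \<alpha> = pa b f" "fst \<alpha> = e" "pu b f \<cdot>[TB] wA \<alpha> = u"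
    "cartesian C TB u \<Longrightarrow> cartesian C TA \<alpha>"
proof -
  note p = pick_facts[OF assms(2)]
  obtain t where t: "t \<in> Arr TB" "Dom TB t = Dom TB u" "Cod TB t = Dom TB (pu b f)" "fst t = e"
    "pu b f \<cdot>[TB] t = u"
    by (rule B.cartesianD[OF p(2), of u e]) (use assms p in auto)
  obtain \<alpha> where \<alpha>: "\<alpha> \<in> Arr TA" "Dom TA \<alpha> = a" "Cod TA \<alpha> = pa b f" "wA \<alpha> = t" "fst \<alpha> = fst t"
    by (rule w_surj[of a "pa b f" t]) (use t p assms in auto)
  have "cartesian C TA \<alpha>" if "cartesian C TB u"
    using \<alpha> t p that B.cartesian_Comp_cancel[OF p(2), of t] by (intro w_reflects_cartesian) simp_all
  then show ?thesis using that \<alpha> t by blast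
qed

lemma factor_unique:
  assumes "b \<in> Obj TB" "f \<in> Cov b" "\<alpha> \<in> Arr TA" "\<alpha>' \<in> Arr TA" "Dom TA \<alpha> = Dom TA \<alpha>'" "Cod TA \<alpha> = pa b f"
    "Cod TA \<alpha>' = pa b f"
    "fst \<alpha> = fst \<alpha>'" "pu b f \<cdot>[TB] wA \<alpha> = pu b f \<cdot>[TB] wA \<alpha>'"
  shows "\<alpha> = \<alpha>'"
proof (rule w_inj)
  note p = pick_facts[OF assms(2)]
  show "wA \<alpha> = wA \<alpha>'"
    by (rule B.cartesian_cancel[OF p(2) assms(9)]) (use assms p in \<open>auto simp: w.map_simps\<close>)
qed (use assms in auto)

text \<open>The transition arrows of the chosen lifts. They exist because \<open>w\<close> is full and faithful.\<close>

definition al where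
  "al b f e = (SOME \<alpha>. \<alpha> \<in> Arr TA \<and> Dom TA \<alpha> = pa b (f \<cdot>[C] e) \<and> Cod TA \<alpha> = pa b f \<and> fst \<alpha> = e \<and>
     pu b f \<cdot>[TB] wA \<alpha> = pu b (f \<cdot>[C] e) \<and> cartesian C TA \<alpha>)"

lemma al_facts:
  assumes "b \<in> Obj TB" "f \<in> Cov b" "e \<in> Arr C" "Cod C e = Dom C f"
  shows "al b f e \<in> Arr TA" "Dom TA (al b f e) = pa b (f \<cdot>[C] e)" "Cod TA (al b f e) = pa b f" "fst (al b f e) =
    e"
     "pu b f \<cdot>[TB] wA (al b f e) = pu b (f \<cdot>[C] e)" "cartesian C TA (al b f e)"
proof -
  note p = pick_facts[OF Cov_facts(3)[OF assms]]
  have "\<exists>\<alpha>. \<alpha> \<in> Arr TA \<and> Dom TA \<alpha> = pa b (f \<cdot>[C] e) \<and> Cod TA \<alpha> = pa b f \<and> fst \<alpha> = e \<and>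
     pu b f \<cdot>[TB] wA \<alpha> = pu b (f \<cdot>[C] e) \<and> cartesian C TA \<alpha>"
    by (rule factor[OF assms(1,2) p(1,6,3,4) assms(3,4) p(5)]) (use p(2) in blast)
  from someI_ex[OF this]
  show "al b f e \<in> Arr TA" "Dom TA (al b f e) = pa b (f \<cdot>[C] e)" "Cod TA (al b f e) = pa b f" "fst (al b f e) =
    e"
     "pu b f \<cdot>[TB] wA (al b f e) = pu b (f \<cdot>[C] e)" "cartesian C TA (al b f e)"
    unfolding al_def by auto
qed

text \<open>The cocycle law. Both sides become equal after applying w and composing with
  \<open>pu b f\<close>, which determines an arrow of \<open>TA\<close> by
  \<open>factor_unique\<close>.\<close>

lemma al_comp:
  assumes "b \<in> Obj TB" "f \<in> Cov b" "e \<in> Arr C" "Cod C e = Dom C f" "e' \<in> Arr C" "Cod C e' = Dom C e"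
  shows "al b f (e \<cdot>[C] e') = al b f e \<cdot>[TA] al b (f \<cdot>[C] e) e'"
proof -
  have f: "f \<in> Arr C" using Cov_facts assms by blast
  have f': "f \<cdot>[C] e \<in> Cov b" "Cod C e' = Dom C (f \<cdot>[C] e)" using Cov_facts(3)[OF assms(1-4)] assms f by
    (simp_all add: B.over_simps)
  have ee: "e \<cdot>[C] e' \<in> Arr C" "Cod C (e \<cdot>[C] e') = Dom C f" using assms by (simp_all add: B.over_simps)
  note a = al_facts[OF assms(1-4)] and a' = al_facts[OF assms(1) f'(1) assms(5) f'(2)] and a'' = al_facts[OF
    assms(1,2) ee]
  have "pu b f \<cdot>[TB] wA (al b f e \<cdot>[TA] al b (f \<cdot>[C] e) e') = (pu b f \<cdot>[TB] wA (al b f e)) \<cdot>[TB] wA (al b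
    (f \<cdot>[C] e) e')"
    using a(1-3) a'(1-3) pick_facts[OF assms(2)] by (simp add: w.map_simps w.map_Comp B.T.Comp_assoc)
  also have "\<dots> = pu b (f \<cdot>[C] (e \<cdot>[C] e'))"
    unfolding a(5) a'(5) using assms f by (simp add: C.Comp_assoc)
  finally show ?thesis
    using a a' a'' assms f by (intro factor_unique[OF assms(1,2)]) (simp_all add: A.over_simps C.Comp_assoc)
qed

text \<open>h preserves composites and cartesian arrows, so the cocycle law \<open>al_comp\<close>
  is mapped to the hypothesis of \<open>descent\<close>. The object and its legs form one pair so
  that a single choice fixes both.\<close>

lemma ext_ex:
  assumes b: "b \<in> Obj TB"
  shows "\<exists>p. fst p \<in> Obj TZ \<and> fst (fst p) = fst b \<and> (\<forall>f\<in>Cov b. cartesian C TZ (snd p f) \<and>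
    snd p f \<in> hom TZ (hO (pa b f)) (fst p) \<and> fst (snd p f) = f \<and>
    (\<forall>e\<in>Arr C. Cod C e = Dom C f \<longrightarrow> snd p f \<cdot>[TZ] hA (al b f e) = snd p (f \<cdot>[C] e)))"
proof -
  have "\<exists>z c. z \<in> Obj TZ \<and> fst z = fst b \<and>
         (\<forall>f\<in>Cov b. cartesian C TZ (c f) \<and> c f \<in> hom TZ (hO (pa b f)) z \<and> fst (c f) = f \<and>
           (\<forall>e\<in>Arr C. Cod C e = Dom C f \<longrightarrow> c f \<cdot>[TZ] hA (al b f e) = c (f \<cdot>[C] e)))"
  proof (rule descent)
    show "fst b \<in> Obj C" "Cov b \<in> J (fst b)" using b Cov_cover by (auto simp: B.over_simps)
    show "hO (pa b f) \<in> Obj TZ \<and> fst (hO (pa b f)) = Dom C f" if "f \<in> Cov b" for f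
      using pick_facts[OF that] by (simp add: h.map_simps)
    fix f e assume f: "f \<in> Cov b" "e \<in> Arr C" "Cod C e = Dom C f"
    note a = al_facts[OF b f]
    show "cartesian C TZ (hA (al b f e)) \<and> hA (al b f e) \<in> hom TZ (hO (pa b (f \<cdot>[C] e))) (hO (pa b f)) \<and>
      fst (hA (al b f e)) = e"
      using a by (simp add: h.map_simps h.map_cartesian hom_def)
    fix e' assume e': "e' \<in> Arr C" "Cod C e' = Dom C e"
    have f': "f \<cdot>[C] e \<in> Cov b" "Cod C e' = Dom C (f \<cdot>[C] e)" using Cov_facts[OF b f(1)] f e' by (simp_all add:
      B.over_simps)
    note a' = al_facts[OF b f'(1) e'(1) f'(2)]
    show "hA (al b f (e \<cdot>[C] e')) = hA (al b f e) \<cdot>[TZ] hA (al b (f \<cdot>[C] e) e')"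
      using al_comp[OF b f e'] a a' by (simp add: h.map_Comp)
  qed
  then obtain z c where "z \<in> Obj TZ \<and> fst z = fst b \<and>
         (\<forall>f\<in>Cov b. cartesian C TZ (c f) \<and> c f \<in> hom TZ (hO (pa b f)) z \<and> fst (c f) = f \<and>
           (\<forall>e\<in>Arr C. Cod C e = Dom C f \<longrightarrow> c f \<cdot>[TZ] hA (al b f e) = c (f \<cdot>[C] e)))" by blast
  then show ?thesis by (intro exI[of _ "(z, c)"]) simp
qed

text \<open>\<open>lz b\<close> glues the images under \<open>h\<close> of the chosen lifts, and \<open>lc b f\<close> is its cartesian leg over \<open>f\<close>.\<close>

definition ext where
  "ext b = (SOME p. fst p \<in> Obj TZ \<and> fst (fst p) = fst b \<and> (\<forall>f\<in>Cov b. cartesian C TZ (snd p f) \<and>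
    snd p f \<in> hom TZ (hO (pa b f)) (fst p) \<and> fst (snd p f) = f \<and>
    (\<forall>e\<in>Arr C. Cod C e = Dom C f \<longrightarrow> snd p f \<cdot>[TZ] hA (al b f e) = snd p (f \<cdot>[C] e))))"

definition lz where "lz b = fst (ext b)"
definition lc where "lc b = snd (ext b)"

lemma ext_facts:
  assumes "b \<in> Obj TB"
  shows "lz b \<in> Obj TZ" "fst (lz b) = fst b"
    "f \<in> Cov b \<Longrightarrow> cartesian C TZ (lc b f)" "f \<in> Cov b \<Longrightarrow> lc b f \<in> Arr TZ"
    "f \<in> Cov b \<Longrightarrow> Dom TZ (lc b f) = hO (pa b f)" "f \<in> Cov b \<Longrightarrow> Cod TZ (lc b f) = lz b"
    "f \<in> Cov b \<Longrightarrow> fst (lc b f) = f"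
    "\<lbrakk>f \<in> Cov b; e \<in> Arr C; Cod C e = Dom C f\<rbrakk> \<Longrightarrow> lc b f \<cdot>[TZ] hA (al b f e) = lc b (f \<cdot>[C] e)"
  using someI_ex[OF ext_ex[OF assms], folded ext_def] unfolding lz_def lc_def hom_def by auto

text \<open>\<open>glue\<close> for the legs of \<open>lz b\<close>, over any covering sieve
  contained in \<open>Cov b\<close>. The freedom to shrink the sieve matters, because
  \<open>lam\<close> will be prescribed only over \<open>dom_cov\<close>.\<close>

lemma glue_lc:
  assumes b: "b \<in> Obj TB" and z': "z' \<in> Obj TZ" and S: "S \<in> J (fst b)" "S \<subseteq> Cov b" and g:
    "g \<in> hom C (fst b) (fst z')"
    and s: "\<And>f. f \<in> S \<Longrightarrow> s f \<in> hom TZ (hO (pa b f)) z' \<and> fst (s f) = g \<cdot>[C] f"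
    and c: "\<And>f e. \<lbrakk>f \<in> S; e \<in> Arr C; Cod C e = Dom C f\<rbrakk> \<Longrightarrow> s f \<cdot>[TZ] hA (al b f e) = s (f \<cdot>[C] e)"
  shows "\<exists>!t. t \<in> hom TZ (lz b) z' \<and> fst t = g \<and> (\<forall>f\<in>S. t \<cdot>[TZ] lc b f = s f)"
proof (rule glue[where k = "\<lambda>f e. hA (al b f e)"])
  fix f assume f: "f \<in> S"
  then have f': "f \<in> Cov b" using S by blast
  show "cartesian C TZ (lc b f) \<and> Cod TZ (lc b f) = lz b \<and> fst (lc b f) = f" using ext_facts[OF b] f' by simp
  show "s f \<in> hom TZ (Dom TZ (lc b f)) z' \<and> fst (s f) = g \<cdot>[C] f" using ext_facts[OF b] f' s[OF f] by simp
  fix e assume e: "e \<in> Arr C" "Cod C e = Dom C f"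
  then show "hA (al b f e) \<in> hom TZ (Dom TZ (lc b (f \<cdot>[C] e))) (Dom TZ (lc b f)) \<and> fst (hA (al b f e)) = e \<and>
         lc b f \<cdot>[TZ] hA (al b f e) = lc b (f \<cdot>[C] e) \<and> s f \<cdot>[TZ] hA (al b f e) = s (f \<cdot>[C] e)"
    using ext_facts[OF b] f' c[OF f e] Cov_facts(3)[OF b f' e] al_facts[OF b f' e] by (simp add: h.map_simps
      hom_def)
qed (use assms ext_facts[OF b] in auto)

text \<open>The uniqueness part of \<open>glue_lc\<close>, for the family of composites of t with
  the legs. It is the means by which equations between arrows out of \<open>lz b\<close> are
  proved.\<close>

lemma lc_jointly_epic:
  assumes b: "b \<in> Obj TB" and S: "S \<in> J (fst b)" "S \<subseteq> Cov b"
    and t: "t \<in> Arr TZ" "t' \<in> Arr TZ" "Dom TZ t = lz b" "Dom TZ t' = lz b" "Cod TZ t = Cod TZ t'" "fst t =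
      fst t'"
    and e: "\<And>f. f \<in> S \<Longrightarrow> t \<cdot>[TZ] lc b f = t' \<cdot>[TZ] lc b f"
  shows "t = t'"
proof -
  have "\<exists>!s. s \<in> hom TZ (lz b) (Cod TZ t) \<and> fst s = fst t \<and> (\<forall>f\<in>S. s \<cdot>[TZ] lc b f = t \<cdot>[TZ] lc b f)"
  proof (rule glue_lc[OF b _ S])
    show "Cod TZ t \<in> Obj TZ" "fst t \<in> hom C (fst b) (fst (Cod TZ t))"
      using t Z.fst_Dom[OF t(1)] ext_facts[OF b] by (auto simp: Z.over_simps hom_def)
    fix f assume "f \<in> S"
    then have f: "f \<in> Cov b" using S by blast
    then show "t \<cdot>[TZ] lc b f \<in> hom TZ (hO (pa b f)) (Cod TZ t) \<and> fst (t \<cdot>[TZ] lc b f) = fst t \<cdot>[C] f"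
      using t ext_facts[OF b] by (simp add: Z.over_simps hom_def)
    fix e assume e: "e \<in> Arr C" "Cod C e = Dom C f"
    then show "(t \<cdot>[TZ] lc b f) \<cdot>[TZ] hA (al b f e) = t \<cdot>[TZ] lc b (f \<cdot>[C] e)"
      using t f ext_facts[OF b] al_facts[OF b f e] by (simp add: h.map_simps Z.T.Comp_assoc)
  qed
  moreover have "t \<in> hom TZ (lz b) (Cod TZ t)" "t' \<in> hom TZ (lz b) (Cod TZ t)" using t by (simp_all add:
    hom_def)
  moreover have "\<forall>f\<in>S. t' \<cdot>[TZ] lc b f = t \<cdot>[TZ] lc b f" using e by simp
  ultimately show ?thesis using t(6) by (metis (no_types, lifting))
qed

text \<open>\<open>psi b a u\<close> extends the legs \<open>lc\<close> from the chosen lifts to all arrows \<open>u\<close> from \<open>w a\<close> to \<open>b\<close> over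
  \<open>Cov b\<close>; its compatibility with composition is what determines \<open>lam\<close> on arrows.\<close>

definition fac where
  "fac b a u = (SOME \<alpha>. \<alpha> \<in> Arr TA \<and> Dom TA \<alpha> = a \<and> Cod TA \<alpha> = pa b (fst u) \<and> fst \<alpha> = Ident C (fst a) \<and>
     pu b (fst u) \<cdot>[TB] wA \<alpha> = u \<and> (cartesian C TB u \<longrightarrow> cartesian C TA \<alpha>))"

definition psi where
  "psi b a u = lc b (fst u) \<cdot>[TZ] hA (fac b a u)"

lemma fac_facts:
  assumes b: "b \<in> Obj TB" and "a \<in> Obj TA" "u \<in> hom TB (wO a) b" "fst u \<in> Cov b"
  shows "fac b a u \<in> Arr TA" "Dom TA (fac b a u) = a" "Cod TA (fac b a u) = pa b (fst u)" "fst (fac b a u) =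
    Ident C (fst a)"
     "pu b (fst u) \<cdot>[TB] wA (fac b a u) = u" "cartesian C TB u \<Longrightarrow> cartesian C TA (fac b a u)"
proof -
  note u = homD[OF assms(3)]
  have fa: "fst a = Dom C (fst u)" using B.fst_Dom[OF u(1)] u assms w.fst_map_Obj[of a] by simp
  have "\<exists>\<alpha>. \<alpha> \<in> Arr TA \<and> Dom TA \<alpha> = a \<and> Cod TA \<alpha> = pa b (fst u) \<and> fst \<alpha> = Ident C (fst a) \<and>
     pu b (fst u) \<cdot>[TB] wA \<alpha> = u \<and> (cartesian C TB u \<longrightarrow> cartesian C TA \<alpha>)"
    by (rule factor[OF b assms(4) assms(2) u, of "Ident C (fst a)"])
      (use u fa in \<open>auto simp: B.over_simps C.Comp_Ident_right\<close>)
  from someI_ex[OF this, folded fac_def]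
  show "fac b a u \<in> Arr TA" "Dom TA (fac b a u) = a" "Cod TA (fac b a u) = pa b (fst u)" "fst (fac b a u) =
    Ident C (fst a)"
     "pu b (fst u) \<cdot>[TB] wA (fac b a u) = u" "cartesian C TB u \<Longrightarrow> cartesian C TA (fac b a u)"
    by auto
qed

lemma psi_facts:
  assumes b: "b \<in> Obj TB" and "a \<in> Obj TA" "u \<in> hom TB (wO a) b" "fst u \<in> Cov b"
  shows "psi b a u \<in> Arr TZ" "Dom TZ (psi b a u) = hO a" "Cod TZ (psi b a u) = lz b" "fst (psi b a u) = fst u"
    "cartesian C TB u \<Longrightarrow> cartesian C TZ (psi b a u)"
proof -
  note f = fac_facts[OF assms] and e = ext_facts[OF b] and u = homD[OF assms(3)]
  have fa: "fst a = Dom C (fst u)" using B.fst_Dom[OF u(1)] u assms w.fst_map_Obj[of a] by simp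
  show "psi b a u \<in> Arr TZ" "Dom TZ (psi b a u) = hO a" "Cod TZ (psi b a u) = lz b" "fst (psi b a u) = fst u"
    using f e assms(4) Cov_facts[OF b assms(4)] fa C.Comp_Ident_right[of "fst u"] by (simp_all add: psi_def
      h.map_simps Z.over_simps)
  show "cartesian C TZ (psi b a u)" if "cartesian C TB u"
    unfolding psi_def using f e assms(4) that by (intro Z.cartesian_Comp h.map_cartesian) (simp_all add:
      h.map_simps)
qed

text \<open>The value of \<open>psi\<close> does not depend on the factorisation of u through a
  chosen lift. \<alpha> factors through the transition arrow \<open>al b f (fst \<alpha>)\<close>,
  and the legs \<open>lc\<close> absorb transition arrows.\<close>

lemma psi_char:
  assumes b: "b \<in> Obj TB" and f: "f \<in> Cov b" and \<alpha>: "\<alpha> \<in> Arr TA" "Cod TA \<alpha> = pa b f"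
  shows "psi b (Dom TA \<alpha>) (pu b f \<cdot>[TB] wA \<alpha>) = lc b f \<cdot>[TZ] hA \<alpha>"
proof -
  let ?e = "fst \<alpha>" and ?u = "pu b f \<cdot>[TB] wA \<alpha>" and ?a = "Dom TA \<alpha>"
  note p = pick_facts[OF f]
  have e: "?e \<in> Arr C" "Cod C ?e = Dom C f" using A.fst_Cod[OF \<alpha>(1)] \<alpha> p by (simp_all add: A.over_simps)
  note f' = Cov_facts(3)[OF b f e]
  have a: "?a \<in> Obj TA" using \<alpha> by (simp add: A.over_simps)
  have u: "?u \<in> hom TB (wO ?a) b" "fst ?u = f \<cdot>[C] ?e" using p \<alpha> by (simp_all add: hom_def B.over_simps
    w.map_simps)
  note c = fac_facts[OF b a u(1), unfolded u(2), OF f'] and al = al_facts[OF b f e]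
  have fa: "fst ?a = Dom C ?e" using A.fst_Dom[OF \<alpha>(1)] .
  have "al b f ?e \<cdot>[TA] fac b ?a ?u = \<alpha>"
  proof (rule factor_unique[OF b f])
    have "pu b f \<cdot>[TB] wA (al b f ?e \<cdot>[TA] fac b ?a ?u) = (pu b f \<cdot>[TB] wA (al b f ?e)) \<cdot>[TB] wA (fac b ?a ?u)"
      using c(1-3) al(1-3) p by (simp add: w.map_simps w.map_Comp B.T.Comp_assoc)
    then show "pu b f \<cdot>[TB] wA (al b f ?e \<cdot>[TA] fac b ?a ?u) = ?u" using c al by simp
  qed (use c al \<alpha> e fa in \<open>simp_all add: A.over_simps C.Comp_Ident_right\<close>)
  then have "lc b f \<cdot>[TZ] hA \<alpha> = lc b f \<cdot>[TZ] (hA (al b f ?e) \<cdot>[TZ] hA (fac b ?a ?u))"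
    using c al by (metis h.map_Comp)
  also have "\<dots> = psi b ?a ?u"
    unfolding psi_def u(2) using ext_facts[OF b] f e c al by (simp add: h.map_simps flip: Z.T.Comp_assoc)
  finally show ?thesis by simp
qed

text \<open>Precomposing the factorisation of u with \<alpha> gives a factorisation of the
  composite, to which \<open>psi_char\<close> applies.\<close>

lemma psi_natural:
  assumes b: "b \<in> Obj TB" and u: "u \<in> hom TB (wO a) b" "fst u \<in> Cov b" and \<alpha>: "\<alpha> \<in> Arr TA" "Cod TA \<alpha> = a"
  shows "psi b (Dom TA \<alpha>) (u \<cdot>[TB] wA \<alpha>) = psi b a u \<cdot>[TZ] hA \<alpha>"
proof -
  have a: "a \<in> Obj TA" using \<alpha> by (auto simp: A.over_simps)
  note c = fac_facts[OF b a u] and p = pick_facts[OF u(2)]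
  have "u \<cdot>[TB] wA \<alpha> = (pu b (fst u) \<cdot>[TB] wA (fac b a u)) \<cdot>[TB] wA \<alpha>" using c by simp
  also have "\<dots> = pu b (fst u) \<cdot>[TB] wA (fac b a u \<cdot>[TA] \<alpha>)"
    using c(1-3) \<alpha> p by (simp add: w.map_simps w.map_Comp B.T.Comp_assoc)
  finally have e: "u \<cdot>[TB] wA \<alpha> = pu b (fst u) \<cdot>[TB] wA (fac b a u \<cdot>[TA] \<alpha>)" .
  show ?thesis
    unfolding e psi_def[of b a u]
    using psi_char[OF b u(2), of "fac b a u \<cdot>[TA] \<alpha>"] c(1-3) \<alpha> ext_facts[OF b] u(2)
    by (simp add: A.over_simps h.map_Comp h.map_simps Z.T.Comp_assoc)
qed

lemma psi_pu:
  assumes b: "b \<in> Obj TB" and f: "f \<in> Cov b"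
  shows "psi b (pa b f) (pu b f) = lc b f"
  using psi_char[OF b f, of "Ident TA (pa b f)"] pick_facts[OF f] ext_facts[OF b] f
    B.T.Comp_Ident_right[of "pu b f"] Z.T.Comp_Ident_right[of "lc b f"]
  by (simp add: A.over_simps w.map_Ident h.map_Ident)

text \<open>\<beta> is not assumed cartesian, so a cartesian arrow into its domain may have a
  composite with \<beta> that is not cartesian. Membership of \<open>fst \<beta> \<cdot> f\<close>
  in the sieve of the codomain is therefore a condition of its own.\<close>

definition dom_cov where
  "dom_cov \<beta> = {f \<in> Cov (Dom TB \<beta>). fst \<beta> \<cdot>[C] f \<in> Cov (Cod TB \<beta>)}"

lemma dom_cov_cover:
  assumes "\<beta> \<in> Arr TB" shows "dom_cov \<beta> \<in> J (fst (Dom TB \<beta>))"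
proof -
  have "dom_cov \<beta> = Cov (Dom TB \<beta>) \<inter> pullback_sieve C (fst \<beta>) (Cov (Cod TB \<beta>))"
    using Cov_facts[of "Dom TB \<beta>"] assms by (auto simp: dom_cov_def pullback_sieve_def B.over_simps)
  also have "\<dots> \<in> J (fst (Dom TB \<beta>))"
    using assms Cov_cover[of "Dom TB \<beta>"] J.covers_stable[of "fst \<beta>" "Cov (Cod TB \<beta>)"] Cov_cover[of "Cod TB \<beta>"]
    by (intro covers_Int) (simp_all add: B.over_simps)
  finally show ?thesis .
qed

text \<open>On the leg over f the value is forced to be \<open>psi\<close> of
  \<open>\<beta> \<cdot> pu f\<close>; \<open>psi_natural\<close>, applied to the transition arrows,
  makes these values a family that can be glued.\<close>

lemma lam_ex1:
  assumes \<beta>: "\<beta> \<in> Arr TB"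
  shows "\<exists>!t. t \<in> hom TZ (lz (Dom TB \<beta>)) (lz (Cod TB \<beta>)) \<and> fst t = fst \<beta> \<and>
    (\<forall>f\<in>dom_cov \<beta>. t \<cdot>[TZ] lc (Dom TB \<beta>) f = psi (Cod TB \<beta>) (pa (Dom TB \<beta>) f) (\<beta> \<cdot>[TB] pu (Dom TB \<beta>) f))"
proof -
  let ?b = "Dom TB \<beta>" and ?b' = "Cod TB \<beta>"
  have b: "?b \<in> Obj TB" and b': "?b' \<in> Obj TB" using \<beta> by (simp_all add: B.over_simps)
  show ?thesis
  proof (rule glue_lc[OF b])
    show "lz ?b' \<in> Obj TZ" "dom_cov \<beta> \<in> J (fst ?b)" "dom_cov \<beta> \<subseteq> Cov ?b" "fst \<beta> \<in> hom C (fst ?b) (fst (lz ?b'))"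
      using ext_facts[OF b'] dom_cov_cover[OF \<beta>] \<beta> by (auto simp: dom_cov_def hom_def B.over_simps)
    fix f assume f: "f \<in> dom_cov \<beta>"
    then have f': "f \<in> Cov ?b" "fst \<beta> \<cdot>[C] f \<in> Cov ?b'" by (auto simp: dom_cov_def)
    note p = pick_facts[OF f'(1)]
    have u: "\<beta> \<cdot>[TB] pu ?b f \<in> hom TB (wO (pa ?b f)) ?b'" "fst (\<beta> \<cdot>[TB] pu ?b f) \<in> Cov ?b'"
      using p \<beta> f' by (simp_all add: hom_def B.over_simps)
    show "psi ?b' (pa ?b f) (\<beta> \<cdot>[TB] pu ?b f) \<in> hom TZ (hO (pa ?b f)) (lz ?b') \<and>
       fst (psi ?b' (pa ?b f) (\<beta> \<cdot>[TB] pu ?b f)) = fst \<beta> \<cdot>[C] f"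
      using psi_facts[OF b' p(1) u] p \<beta> by (simp add: hom_def B.over_simps)
    fix e assume e: "e \<in> Arr C" "Cod C e = Dom C f"
    note a = al_facts[OF b f'(1) e]
    show "psi ?b' (pa ?b f) (\<beta> \<cdot>[TB] pu ?b f) \<cdot>[TZ] hA (al ?b f e) = psi ?b' (pa ?b (f \<cdot>[C] e)) (\<beta> \<cdot>[TB] pu ?b
      (f \<cdot>[C] e))"
      using psi_natural[OF b' u a(1,3)] a(1-3) a(5)[symmetric] p \<beta> by (simp add: w.map_simps B.T.Comp_assoc)
  qed
qed

definition lam where
  "lam \<beta> = (THE t. t \<in> hom TZ (lz (Dom TB \<beta>)) (lz (Cod TB \<beta>)) \<and> fst t = fst \<beta> \<and>
    (\<forall>f\<in>dom_cov \<beta>. t \<cdot>[TZ] lc (Dom TB \<beta>) f = psi (Cod TB \<beta>) (pa (Dom TB \<beta>) f) (\<beta> \<cdot>[TB] pu (Dom TB \<beta>) f)))"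

lemma lam_facts:
  assumes "\<beta> \<in> Arr TB"
  shows "lam \<beta> \<in> Arr TZ" "Dom TZ (lam \<beta>) = lz (Dom TB \<beta>)" "Cod TZ (lam \<beta>) = lz (Cod TB \<beta>)" "fst (lam \<beta>) = fst \<beta>"
    "\<lbrakk>f \<in> Cov (Dom TB \<beta>); fst \<beta> \<cdot>[C] f \<in> Cov (Cod TB \<beta>)\<rbrakk> \<Longrightarrow>
      lam \<beta> \<cdot>[TZ] lc (Dom TB \<beta>) f = psi (Cod TB \<beta>) (pa (Dom TB \<beta>) f) (\<beta> \<cdot>[TB] pu (Dom TB \<beta>) f)"
  using theI'[OF lam_ex1[OF assms], folded lam_def] by (auto simp: hom_def dom_cov_def)

text \<open>Extends the defining property of \<open>lam\<close> from chosen lifts to all arrows u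
  from the image of w. Functoriality needs this form, since \<open>\<beta> \<cdot> pu f\<close> is
  in general not a chosen lift.\<close>

lemma lam_psi:
  assumes \<beta>: "\<beta> \<in> Arr TB" and a: "a \<in> Obj TA" and u: "u \<in> hom TB (wO a) (Dom TB \<beta>)" "fst u \<in> Cov (Dom TB \<beta>)"
    and f': "fst \<beta> \<cdot>[C] fst u \<in> Cov (Cod TB \<beta>)"
  shows "lam \<beta> \<cdot>[TZ] psi (Dom TB \<beta>) a u = psi (Cod TB \<beta>) a (\<beta> \<cdot>[TB] u)"
proof -
  let ?b = "Dom TB \<beta>" and ?b' = "Cod TB \<beta>" and ?f = "fst u"
  have b: "?b \<in> Obj TB" and b': "?b' \<in> Obj TB" using \<beta> by (simp_all add: B.over_simps)
  note c = fac_facts[OF b a u] and p = pick_facts[OF u(2)] and l = lam_facts[OF \<beta>] and e = ext_facts[OF b]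
  have v: "\<beta> \<cdot>[TB] pu ?b ?f \<in> hom TB (wO (pa ?b ?f)) ?b'" "fst (\<beta> \<cdot>[TB] pu ?b ?f) \<in> Cov ?b'"
      using p \<beta> f' by (simp_all add: hom_def B.over_simps)
  have "lam \<beta> \<cdot>[TZ] psi ?b a u = (lam \<beta> \<cdot>[TZ] lc ?b ?f) \<cdot>[TZ] hA (fac ?b a u)"
    unfolding psi_def using c l e u by (simp add: h.map_simps Z.T.Comp_assoc)
  also have "\<dots> = psi ?b' a ((\<beta> \<cdot>[TB] pu ?b ?f) \<cdot>[TB] wA (fac ?b a u))"
    unfolding l(5)[OF u(2) f'] using psi_natural[OF b' v c(1,3)] c by simp
  also have "(\<beta> \<cdot>[TB] pu ?b ?f) \<cdot>[TB] wA (fac ?b a u) = \<beta> \<cdot>[TB] u"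
    using c(1-3) c(5)[symmetric] p \<beta> by (simp add: w.map_simps B.T.Comp_assoc)
  finally show ?thesis .
qed

lemma lam_Ident:
  assumes b: "b \<in> Obj TB"
  shows "lam (Ident TB b) = Ident TZ (lz b)"
proof (rule lc_jointly_epic[OF b Cov_cover[OF b] subset_refl])
  have i: "Ident TB b \<in> Arr TB" "Dom TB (Ident TB b) = b" "Cod TB (Ident TB b) = b" "fst (Ident TB b) =
    Ident C (fst b)"
    using b by (simp_all add: B.over_simps)
  note l = lam_facts[OF i(1), unfolded i] and e = ext_facts[OF b]
  show "lam (Ident TB b) \<in> Arr TZ" "Ident TZ (lz b) \<in> Arr TZ" "Dom TZ (lam (Ident TB b)) = lz b"
    "Dom TZ (Ident TZ (lz b)) = lz b"
    "Cod TZ (lam (Ident TB b)) = Cod TZ (Ident TZ (lz b))" "fst (lam (Ident TB b)) = fst (Ident TZ (lz b))"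
    using l e by (simp_all add: Z.over_simps)
  fix f assume f: "f \<in> Cov b"
  show "lam (Ident TB b) \<cdot>[TZ] lc b f = Ident TZ (lz b) \<cdot>[TZ] lc b f"
    using l(5)[OF f] f Cov_facts[OF b f] C.Comp_Ident_left[of f] pick_facts[OF f] B.T.Comp_Ident_left[of
      "pu b f"] psi_pu[OF b f]
      e Z.T.Comp_Ident_left[of "lc b f"] by simp
qed

text \<open>The two sides are compared on legs over the intersection of two covering sieves. There
  \<open>lam_psi\<close> evaluates \<open>lam \<beta>'\<close> on the arrow that
  \<open>lam \<beta>\<close> produces.\<close>

lemma lam_Comp:
  assumes \<beta>: "\<beta> \<in> Arr TB" "\<beta>' \<in> Arr TB" "Cod TB \<beta> = Dom TB \<beta>'"
  shows "lam (\<beta>' \<cdot>[TB] \<beta>) = lam \<beta>' \<cdot>[TZ] lam \<beta>"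
proof -
  let ?b = "Dom TB \<beta>" and ?g = "\<beta>' \<cdot>[TB] \<beta>"
  have b: "?b \<in> Obj TB" using \<beta> by (simp add: B.over_simps)
  have g: "?g \<in> Arr TB" "Dom TB ?g = ?b" "Cod TB ?g = Cod TB \<beta>'" "fst ?g = fst \<beta>' \<cdot>[C] fst \<beta>"
    using \<beta> by (simp_all add: B.over_simps)
  note l = lam_facts[OF \<beta>(1)] and l' = lam_facts[OF \<beta>(2)] and lg = lam_facts[OF g(1), unfolded g]
  have dc: "dom_cov ?g \<in> J (fst ?b)" "dom_cov \<beta> \<in> J (fst ?b)" using dom_cov_cover[OF g(1)] dom_cov_cover[OF
    \<beta>(1)] g by simp_all
  show ?thesis
  proof (rule lc_jointly_epic[OF b])
    show "dom_cov ?g \<inter> dom_cov \<beta> \<in> J (fst ?b)" "dom_cov ?g \<inter> dom_cov \<beta> \<subseteq> Cov ?b"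
      using covers_Int[OF _ dc] b by (auto simp: B.over_simps dom_cov_def)
    fix f assume f: "f \<in> dom_cov ?g \<inter> dom_cov \<beta>"
    then have f': "f \<in> Cov ?b" "fst \<beta> \<cdot>[C] f \<in> Cov (Cod TB \<beta>)" "fst \<beta>' \<cdot>[C] fst \<beta> \<cdot>[C] f \<in> Cov (Cod TB \<beta>')"
      by (auto simp: dom_cov_def g)
    note p = pick_facts[OF f'(1)]
    have fb: "fst \<beta>' \<cdot>[C] (fst \<beta> \<cdot>[C] f) \<in> Cov (Cod TB \<beta>')"
      using f' \<beta> Cov_facts[OF b f'(1)] B.fst_Cod[OF \<beta>(1)] B.fst_Dom[OF \<beta>(2)] by (simp add: B.over_simps
        C.Comp_assoc)
    have v: "\<beta> \<cdot>[TB] pu ?b f \<in> hom TB (wO (pa ?b f)) (Dom TB \<beta>')" "fst (\<beta> \<cdot>[TB] pu ?b f) = fst \<beta> \<cdot>[C] f"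
      using p \<beta> f' by (simp_all add: hom_def B.over_simps)
    have "lam \<beta>' \<cdot>[TZ] (lam \<beta> \<cdot>[TZ] lc ?b f) = psi (Cod TB \<beta>') (pa ?b f) (\<beta>' \<cdot>[TB] (\<beta> \<cdot>[TB] pu ?b f))"
      unfolding l(5)[OF f'(1,2)] using lam_psi[OF \<beta>(2) p(1) v(1)] v(2) f' fb \<beta>(3) by simp
    also have "\<dots> = lam ?g \<cdot>[TZ] lc ?b f"
      using lg(5)[OF f'(1,3)] p \<beta> by (simp add: B.T.Comp_assoc)
    finally show "lam ?g \<cdot>[TZ] lc ?b f = (lam \<beta>' \<cdot>[TZ] lam \<beta>) \<cdot>[TZ] lc ?b f"
      using l l' f' \<beta> ext_facts[OF b] by (simp add: Z.T.Comp_assoc)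
  qed (use l l' lg \<beta> in \<open>simp_all add: Z.over_simps\<close>)
qed

text \<open>\<open>lam \<beta>\<close> is compared with a cartesian arrow c over the same base
  arrow. It factors as \<open>c \<cdot> m\<close> with m over an identity, and m turns out to be
  invertible because the legs of \<open>lz\<close> remain cartesian after composition with
  m.\<close>

lemma lam_cartesian:
  assumes \<beta>: "cartesian C TB \<beta>"
  shows "cartesian C TZ (lam \<beta>)"
proof -
  let ?b = "Dom TB \<beta>" and ?b' = "Cod TB \<beta>" and ?g = "fst \<beta>" and ?R = "dom_cov \<beta>"
  have \<beta>A: "\<beta> \<in> Arr TB" using \<beta> by (simp add: cartesian_def)
  have b: "?b \<in> Obj TB" and b': "?b' \<in> Obj TB" using \<beta>A by (simp_all add: B.over_simps)
  note l = lam_facts[OF \<beta>A] and e = ext_facts[OF b] and e' = ext_facts[OF b']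
  have g: "?g \<in> Arr C" "Dom C ?g = fst ?b" "Cod C ?g = fst (lz ?b')" using \<beta>A e' by (simp_all add: B.over_simps)
  obtain c where c: "cartesian C TZ c" "Cod TZ c = lz ?b'" "fst c = ?g" using Z_lift[OF e'(1) g(1,3)] by blast
  have cA: "c \<in> Arr TZ" using c by (simp add: cartesian_def)
  obtain m where m: "m \<in> Arr TZ" "Dom TZ m = lz ?b" "Cod TZ m = Dom TZ c" "fst m = Ident C (fst ?b)"
    "c \<cdot>[TZ] m = lam \<beta>"
    by (rule Z.cartesianD[OF c(1), of "lam \<beta>" "Ident C (fst ?b)"])
      (use c l g C.Comp_Ident_right[of ?g] b in \<open>auto simp: B.over_simps\<close>)
  have R: "?R \<in> J (fst ?b)" by (rule dom_cov_cover[OF \<beta>A])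
  have Rf: "f \<in> Cov ?b" "?g \<cdot>[C] f \<in> Cov ?b'" if "f \<in> ?R" for f using that by (auto simp: dom_cov_def)
  have fU: "fst (Dom TZ c) = fst ?b" using cA c g by (simp add: Z.over_simps)
  have Uo: "fst ?b \<in> Obj C" using b by (simp add: B.over_simps)
  \<comment> \<open>c after \<open>m \<cdot> lc f\<close> is a value of \<open>psi\<close> at a
    cartesian arrow, hence cartesian; cancelling c shows that \<open>m \<cdot> lc f\<close> is
    cartesian.\<close>
  have mc: "cartesian C TZ (m \<cdot>[TZ] lc ?b f) \<and> Cod TZ (m \<cdot>[TZ] lc ?b f) = Dom TZ c \<and> fst (m \<cdot>[TZ] lc ?b f) = f \<and>
      Dom TZ (m \<cdot>[TZ] lc ?b f) = hO (pa ?b f) \<and> m \<cdot>[TZ] lc ?b f \<in> Arr TZ" if f: "f \<in> ?R" for f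
  proof -
    note f' = Rf[OF f] and p = pick_facts[OF Rf(1)[OF f]]
    have v: "\<beta> \<cdot>[TB] pu ?b f \<in> hom TB (wO (pa ?b f)) ?b'" "fst (\<beta> \<cdot>[TB] pu ?b f) \<in> Cov ?b'"
      using p \<beta>A f' by (simp_all add: hom_def B.over_simps)
    have "c \<cdot>[TZ] (m \<cdot>[TZ] lc ?b f) = psi ?b' (pa ?b f) (\<beta> \<cdot>[TB] pu ?b f)"
      using l(5)[OF f'] m cA f' e by (simp flip: Z.T.Comp_assoc)
    moreover have "cartesian C TZ (psi ?b' (pa ?b f) (\<beta> \<cdot>[TB] pu ?b f))"
      using p \<beta> by (intro psi_facts(5)[OF b' p(1) v] B.cartesian_Comp) simp_all
    ultimately have "cartesian C TZ (m \<cdot>[TZ] lc ?b f)"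
      using m(1-3) f'(1) e(4,6) by - (rule Z.cartesian_Comp_cancel[OF c(1)], simp_all add: Z.over_simps)
    then show ?thesis using m f' e Cov_facts[OF b f'(1)] C.Comp_Ident_left[of f] by (simp add: Z.over_simps)
  qed
  have al: "hA (al ?b f e) \<in> hom TZ (hO (pa ?b (f \<cdot>[C] e))) (hO (pa ?b f))" "fst (hA (al ?b f e)) = e"
    "lc ?b f \<cdot>[TZ] hA (al ?b f e) = lc ?b (f \<cdot>[C] e)"
    if "f \<in> Cov ?b" "e \<in> Arr C" "Cod C e = Dom C f" for f e
    using al_facts[OF b that] ext_facts(8)[OF b that] by (simp_all add: h.map_simps hom_def)
  have Re: "f \<cdot>[C] e \<in> ?R" if "f \<in> ?R" "e \<in> Arr C" "Cod C e = Dom C f" for f e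
    using sieveD(3)[OF J.covers_sieve[OF Uo R] that] .
  \<comment> \<open>The legs \<open>m \<cdot> lc f\<close> exhibit the domain of c as a glueing of
    the same local objects as \<open>lz\<close>. Arrows out of it are thus determined by values on
    legs: r equal to an identity yields the inverse n, and r equal to m the uniqueness used for
    \<open>m \<cdot> n\<close>.\<close>
  have G: "\<exists>!t. t \<in> hom TZ (Dom TZ c) z \<and> fst t = Ident C (fst ?b) \<and> (\<forall>f\<in>?R. t \<cdot>[TZ] (m \<cdot>[TZ] lc ?b f) =
    r \<cdot>[TZ] lc ?b f)"
    if r: "r \<in> hom TZ (lz ?b) z" "fst r = Ident C (fst ?b)" for r z
  proof (rule glue[where k = "\<lambda>f e. hA (al ?b f e)"])
    note r' = homD[OF r(1)]
    show "Dom TZ c \<in> Obj TZ" "?R \<in> J (fst (Dom TZ c))" "z \<in> Obj TZ" using cA fU R r' by (auto simp: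
      Z.over_simps)
    show "Ident C (fst ?b) \<in> hom C (fst (Dom TZ c)) (fst z)"
      using fU r Z.fst_Cod[OF r'(1)] r' Uo by (simp add: hom_def B.over_simps)
    show "cartesian C TZ (m \<cdot>[TZ] lc ?b f) \<and> Cod TZ (m \<cdot>[TZ] lc ?b f) = Dom TZ c \<and> fst (m \<cdot>[TZ] lc ?b f) = f" if
      "f \<in> ?R" for f
      using mc[OF that] by simp
    show "r \<cdot>[TZ] lc ?b f \<in> hom TZ (Dom TZ (m \<cdot>[TZ] lc ?b f)) z \<and> fst (r \<cdot>[TZ] lc ?b f) =
      Ident C (fst ?b) \<cdot>[C] f" if "f \<in> ?R" for f
      using mc[OF that] r r' e Rf[OF that] by (simp add: hom_def Z.over_simps)
    fix f e assume f: "f \<in> ?R" "e \<in> Arr C" "Cod C e = Dom C f"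
    show "hA (al ?b f e) \<in> hom TZ (Dom TZ (m \<cdot>[TZ] lc ?b (f \<cdot>[C] e))) (Dom TZ (m \<cdot>[TZ] lc ?b f)) \<and>
      fst (hA (al ?b f e)) = e \<and>
       (m \<cdot>[TZ] lc ?b f) \<cdot>[TZ] hA (al ?b f e) = m \<cdot>[TZ] lc ?b (f \<cdot>[C] e) \<and> (r \<cdot>[TZ] lc ?b f) \<cdot>[TZ] hA (al ?b f
         e) = r \<cdot>[TZ] lc ?b (f \<cdot>[C] e)"
      using mc[OF f(1)] mc[OF Re[OF f]] al[OF Rf(1)[OF f(1)] f(2,3)] e(4-6)[OF Rf(1)[OF f(1)]] m(1,2) r'
      by (simp add: Z.T.Comp_assoc hom_def)
  qed
  have I: "Ident TZ (lz ?b) \<in> hom TZ (lz ?b) (lz ?b)" "fst (Ident TZ (lz ?b)) = Ident C (fst ?b)"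
    using e by (simp_all add: hom_def Z.over_simps)
  obtain n where n: "n \<in> hom TZ (Dom TZ c) (lz ?b)" "fst n = Ident C (fst ?b)"
    "\<And>f. f \<in> ?R \<Longrightarrow> n \<cdot>[TZ] (m \<cdot>[TZ] lc ?b f) = Ident TZ (lz ?b) \<cdot>[TZ] lc ?b f"
    using G[OF I] by blast
  note n' = homD[OF n(1)]
  have II: "Ident C (fst ?b) \<cdot>[C] Ident C (fst ?b) = Ident C (fst ?b)" using C.Ident_Comp_Ident[OF Uo] .
  have nm: "n \<cdot>[TZ] m = Ident TZ (lz ?b)"
  proof (rule lc_jointly_epic[OF b R])
    show "?R \<subseteq> Cov ?b" using Rf by blast
    show "(n \<cdot>[TZ] m) \<cdot>[TZ] lc ?b f = Ident TZ (lz ?b) \<cdot>[TZ] lc ?b f" if "f \<in> ?R" for f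
      using n(3)[OF that] n' m e Rf[OF that] by (simp add: Z.T.Comp_assoc)
  qed (use n n' m I e II in \<open>simp_all add: Z.over_simps hom_def\<close>)
  have M: "m \<in> hom TZ (lz ?b) (Dom TZ c)" using m by (simp add: hom_def)
  \<comment> \<open>Both \<open>m \<cdot> n\<close> and the identity have the values
    \<open>m \<cdot> lc f\<close> on the legs, so the uniqueness in \<open>G\<close>
    applies.\<close>
  have mn: "m \<cdot>[TZ] n = Ident TZ (Dom TZ c)"
  proof -
    have "m \<cdot>[TZ] n \<in> hom TZ (Dom TZ c) (Dom TZ c) \<and> fst (m \<cdot>[TZ] n) = Ident C (fst ?b) \<and>
      (\<forall>f\<in>?R. (m \<cdot>[TZ] n) \<cdot>[TZ] (m \<cdot>[TZ] lc ?b f) = m \<cdot>[TZ] lc ?b f)"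
    proof (intro conjI ballI)
      fix f assume f: "f \<in> ?R"
      have "(m \<cdot>[TZ] n) \<cdot>[TZ] (m \<cdot>[TZ] lc ?b f) = m \<cdot>[TZ] ((n \<cdot>[TZ] m) \<cdot>[TZ] lc ?b f)"
        using n' m e Rf[OF f] by (simp add: Z.over_simps Z.T.Comp_assoc)
      then show "(m \<cdot>[TZ] n) \<cdot>[TZ] (m \<cdot>[TZ] lc ?b f) = m \<cdot>[TZ] lc ?b f"
        unfolding nm using Z.T.Comp_Ident_left[of "lc ?b f"] e Rf[OF f] by simp
    qed (use n n' m II in \<open>simp_all add: Z.over_simps hom_def\<close>)
    moreover have "Ident TZ (Dom TZ c) \<in> hom TZ (Dom TZ c) (Dom TZ c) \<and> fst (Ident TZ (Dom TZ c)) =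
      Ident C (fst ?b) \<and>
      (\<forall>f\<in>?R. Ident TZ (Dom TZ c) \<cdot>[TZ] (m \<cdot>[TZ] lc ?b f) = m \<cdot>[TZ] lc ?b f)"
      using cA fU mc Z.T.comp_id_left[of _ _ "Dom TZ c"] c(3) g by (simp add: hom_def Z.over_simps)
    ultimately show ?thesis using G[OF M m(4)] by blast
  qed
  have "inverse_arrs TZ m n" using nm mn m n' by (simp add: inverse_arrs_def hom_def)
  then have "cartesian C TZ (c \<cdot>[TZ] m)" using Z.cartesian_inverse c m by (intro Z.cartesian_Comp) simp_all
  then show ?thesis using m by simp
qed

text \<open>The comparison from h to the extension after w. The identity of \<open>wO a\<close> lies
  over an identity of \<open>C\<close>, which belongs to \<open>Cov (wO a)\<close> by
  \<open>Cov_image\<close>, so \<open>psi\<close> may be evaluated there.\<close>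

definition eta where "eta a = psi (wO a) a (Ident TB (wO a))"

text \<open>For naturality of \<open>eta\<close>, both composites equal \<open>psi\<close> at
  \<open>wA \<alpha>\<close>: one by \<open>lam_psi\<close>, the other by
  \<open>psi_natural\<close>.\<close>

theorem extension:
  shows "functor_over C TB TZ lz lam"
    and "a \<in> Obj TA \<Longrightarrow> eta a \<in> hom TZ (hO a) (lz (wO a)) \<and> fst (eta a) = Ident C (fst a) \<and>
      cartesian C TZ (eta a)"
    and "\<alpha> \<in> Arr TA \<Longrightarrow> lam (wA \<alpha>) \<cdot>[TZ] eta (Dom TA \<alpha>) = eta (Cod TA \<alpha>) \<cdot>[TZ] hA \<alpha>"
proof -
  show "functor_over C TB TZ lz lam"
    by unfold_locales (auto simp: ext_facts lam_facts lam_Ident lam_Comp lam_cartesian)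
  have i: "wO a \<in> Obj TB" "Ident TB (wO a) \<in> hom TB (wO a) (wO a)" "fst (Ident TB (wO a)) \<in> Cov (wO a)"
    "fst (Ident TB (wO a)) = Ident C (fst a)"
    if "a \<in> Obj TA" for a
    using that by (auto simp: w.map_simps B.over_simps A.over_simps hom_def intro!: Cov_image)
  show "eta a \<in> hom TZ (hO a) (lz (wO a)) \<and> fst (eta a) = Ident C (fst a) \<and> cartesian C TZ (eta a)" if a:
    "a \<in> Obj TA" for a
    using psi_facts[OF i(1)[OF a] a i(2,3)[OF a]] i[OF a] B.cartesian_Ident[of "wO a"] by (simp add: eta_def
      hom_def)
  assume \<alpha>: "\<alpha> \<in> Arr TA"
  let ?a = "Dom TA \<alpha>" and ?a' = "Cod TA \<alpha>"
  have a: "?a \<in> Obj TA" "?a' \<in> Obj TA" using \<alpha> by (simp_all add: A.over_simps)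
  have w: "wA \<alpha> \<in> Arr TB" "Dom TB (wA \<alpha>) = wO ?a" "Cod TB (wA \<alpha>) = wO ?a'" "fst (wA \<alpha>) = fst \<alpha>" using \<alpha> by
    (simp_all add: w.map_simps)
  have f: "fst \<alpha> \<cdot>[C] fst (Ident TB (wO ?a)) \<in> Cov (wO ?a')"
    using \<alpha> a i(4)[OF a(1)] by (intro Cov_image) (simp_all add: A.over_simps)
  have "lam (wA \<alpha>) \<cdot>[TZ] eta ?a = psi (wO ?a') ?a (wA \<alpha> \<cdot>[TB] Ident TB (wO ?a))"
    unfolding eta_def using lam_psi[OF w(1) a(1)] i[OF a(1)] f w by simp
  also have "wA \<alpha> \<cdot>[TB] Ident TB (wO ?a) = Ident TB (wO ?a') \<cdot>[TB] wA \<alpha>"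
    using B.T.Comp_Ident_left[OF w(1)] B.T.Comp_Ident_right[OF w(1)] w by simp
  finally show "lam (wA \<alpha>) \<cdot>[TZ] eta ?a = eta ?a' \<cdot>[TZ] hA \<alpha>"
    unfolding eta_def using psi_natural[OF i(1-3)[OF a(2)] \<alpha> refl] by simp
qed

end

section \<open>Prestacks and stacks in elementary terms\<close>

lemma slice_simps:
  "f \<in> Obj (slice C U) \<longleftrightarrow> f \<in> Arr C \<and> Cod C f = U"
  "(f, g) \<in> Arr (slice C U) \<longleftrightarrow> f \<in> Arr C \<and> g \<in> Arr C \<and> Cod C f = U \<and> Cod C g = Dom C f"
  "Dom (slice C U) (f, g) = f \<cdot>[C] g" "Cod (slice C U) (f, g) = f" "Ident (slice C U) f =
    (f, Ident C (Dom C f))"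
  "(f, g) \<cdot>[slice C U] (f', g') = (f, g \<cdot>[C] g')"
  by (simp_all add: slice_def)

section \<open>The sheaf condition on hom presheaves\<close>

locale indexed_site = site C J + indexed_category C small F
  for C :: "('o, 'm) cat" and J :: "'o \<Rightarrow> 'm set set" and small :: "'u set \<Rightarrow> bool"
    and F :: "('o, 'm, 'u, 'u) cat_psfun"
begin

text \<open>The matching condition of \<open>hom_presheaf\<close> with the inverse of
  \<open>res_comp f g a\<close> moved to the other side, for sieves on U itself and no longer for
  sieves in a slice.\<close>

definition compatible :: "'m set \<Rightarrow> 'u \<Rightarrow> 'u \<Rightarrow> ('m \<Rightarrow> 'u) \<Rightarrow> bool" where
  "compatible S a b s \<longleftrightarrow>
     (\<forall>f\<in>S. s f \<in> hom (PObj F (Dom C f)) (res_obj F f a) (res_obj F f b)) \<and>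
     (\<forall>f\<in>S. \<forall>g\<in>Arr C. Cod C g = Dom C f \<longrightarrow>
       s (f \<cdot>[C] g) \<cdot>[PObj F (Dom C g)] res_comp F f g a = res_comp F f g b \<cdot>[PObj F (Dom C g)] res_arr F g (s
         f))"

definition glues :: bool where
  "glues \<longleftrightarrow> (\<forall>U\<in>Obj C. \<forall>S\<in>J U. \<forall>a\<in>Obj (PObj F U). \<forall>b\<in>Obj (PObj F U). \<forall>s. compatible S a b s \<longrightarrow>
     (\<exists>!t. t \<in> hom (PObj F U) a b \<and> (\<forall>f\<in>S. res_arr F f t = s f)))"

text \<open>Characterises the restriction of an arrow by an equation without inverses; the presheaf
  laws and all comparisons with \<open>compatible\<close> use this form.\<close>

lemma res_presheaf:
  assumes "f \<in> Arr C" "g \<in> Arr C" "Cod C g = Dom C f" "a \<in> Obj (PObj F (Cod C f))" "b \<in> Obj (PObj F (Cod C f))"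
    and s: "s \<in> hom (PObj F (Dom C f)) (res_obj F f a) (res_obj F f b)"
  shows "Res (hom_presheaf C F a b) (f, g) s \<in> hom (PObj F (Dom C g)) (res_obj F (f \<cdot>[C] g) a) (res_obj F
    (f \<cdot>[C] g) b)"
    "Res (hom_presheaf C F a b) (f, g) s \<cdot>[PObj F (Dom C g)] res_comp F f g a =
      res_comp F f g b \<cdot>[PObj F (Dom C g)] res_arr F g s"
    "\<lbrakk>r \<in> hom (PObj F (Dom C g)) (res_obj F (f \<cdot>[C] g) a) (res_obj F (f \<cdot>[C] g) b);
      r \<cdot>[PObj F (Dom C g)] res_comp F f g a = res_comp F f g b \<cdot>[PObj F (Dom C g)] res_arr F g s\<rbrakk> \<Longrightarrow>
      Res (hom_presheaf C F a b) (f, g) s = r"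
proof -
  let ?A = "PObj F (Dom C g)" and ?H = "hom_presheaf C F a b"
  interpret D: category ?A using assms by (simp add: category_PObj idx_simps)
  note [simp] = assms(1-5) homD[OF s]
  have i: "iso_arr ?A (res_comp F f g a)" by (simp add: idx_simps)
  note ii = D.inv_arr_simps[OF i] D.inv_comp_cancel[OF i]
  have H: "Res ?H (f, g) s = res_comp F f g b \<cdot>[?A] res_arr F g s \<cdot>[?A] inv_arr ?A (res_comp F f g a)"
    by (simp add: hom_presheaf_def Let_def)
  show h: "Res ?H (f, g) s \<in> hom ?A (res_obj F (f \<cdot>[C] g) a) (res_obj F (f \<cdot>[C] g) b)"
    by (simp add: H hom_def idx_simps ii)
  show c: "Res ?H (f, g) s \<cdot>[?A] res_comp F f g a = res_comp F f g b \<cdot>[?A] res_arr F g s"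
    using ii(9)[of "res_comp F f g b \<cdot>[?A] res_arr F g s"] by (simp add: H idx_simps)
  show "Res ?H (f, g) s = r" if "r \<in> hom ?A (res_obj F (f \<cdot>[C] g) a) (res_obj F (f \<cdot>[C] g) b)"
      "r \<cdot>[?A] res_comp F f g a = res_comp F f g b \<cdot>[?A] res_arr F g s"
    by (rule D.iso_cancel_right[OF i]) (use that c homD[OF h] in \<open>auto simp: hom_def idx_simps\<close>)
qed

text \<open>Both laws are checked after composing with an invertible comparison arrow on the right:
  a unit isomorphism for identities, \<open>res_comp g h\<close> at the restriction of a for
  composites. Coherence of F then finishes them.\<close>

lemma is_presheaf_hom:
  assumes U: "U \<in> Obj C" and ab [simp]: "a \<in> Obj (PObj F U)" "b \<in> Obj (PObj F U)"
  shows "is_presheaf (slice C U) (hom_presheaf C F a b)"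
  unfolding is_presheaf_def
proof (intro conjI ballI impI)
  let ?H = "hom_presheaf C F a b"
  have V: "Val ?H f = hom (PObj F (Dom C f)) (res_obj F f a) (res_obj F f b)" for f by (simp add:
    hom_presheaf_def)
  show "Res ?H p \<in> Val ?H (Cod (slice C U) p) \<rightarrow> Val ?H (Dom (slice C U) p)" if "p \<in> Arr (slice C U)" for p
  proof -
    obtain f g where p: "p = (f, g)" by (cases p)
    then have [simp]: "f \<in> Arr C" "g \<in> Arr C" "Cod C f = U" "Cod C g = Dom C f" using that by (simp_all add:
      slice_simps)
    show ?thesis unfolding p slice_simps V using res_presheaf(1)[of f g a b] by (simp add: base_cat_simps)
  qed
  show "Res ?H (Ident (slice C U) f) s = s" if f: "f \<in> Obj (slice C U)" and s: "s \<in> Val ?H f" for f s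
  proof -
    have f' [simp]: "f \<in> Arr C" "Cod C f = U" using f by (simp_all add: slice_simps)
    let ?A = "PObj F (Dom C f)" and ?i = "Ident C (Dom C f)"
    interpret D: category ?A by (simp add: category_PObj base_cat_simps)
    have s' [simp]: "s \<in> Arr ?A" "Dom ?A s = res_obj F f a" "Cod ?A s = res_obj F f b" using s by (simp_all add:
      V hom_def)
    have u: "res_unit F (Dom C f) (res_obj F f b) \<cdot>[?A] s = res_arr F ?i s \<cdot>[?A] res_unit F (Dom C f) (res_obj F
      f a)"
      using res_unit_natural[of "Dom C f" s] by (simp add: base_cat_simps)
    have "s \<cdot>[?A] res_comp F f ?i a = res_comp F f ?i b \<cdot>[?A] res_arr F ?i s"
    proof (rule D.iso_cancel_right)
      show "iso_arr ?A (res_unit F (Dom C f) (res_obj F f a))" by (simp add: idx_simps)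
      have "(res_comp F f ?i b \<cdot>[?A] res_arr F ?i s) \<cdot>[?A] res_unit F (Dom C f) (res_obj F f a) =
        (res_comp F f ?i b \<cdot>[?A] res_unit F (Dom C f) (res_obj F f b)) \<cdot>[?A] s"
        using u by (simp add: D.Comp_assoc idx_simps)
      also have "\<dots> = s" using res_unit_right[of f b] D.Comp_Ident_left[of s] by simp
      also have "\<dots> = s \<cdot>[?A] (res_comp F f ?i a \<cdot>[?A] res_unit F (Dom C f) (res_obj F f a))"
        using res_unit_right[of f a] D.Comp_Ident_right[of s] by simp
      finally show "(s \<cdot>[?A] res_comp F f ?i a) \<cdot>[?A] res_unit F (Dom C f) (res_obj F f a) =
         (res_comp F f ?i b \<cdot>[?A] res_arr F ?i s) \<cdot>[?A] res_unit F (Dom C f) (res_obj F f a)"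
        by (simp add: D.Comp_assoc idx_simps C.Comp_Ident_right)
    qed (simp_all add: idx_simps C.Comp_Ident_right)
    then show ?thesis
      unfolding slice_simps using s by (intro res_presheaf(3)) (simp_all add: V base_cat_simps
        C.Comp_Ident_right)
  qed
  show "Res ?H (p \<cdot>[slice C U] q) s = Res ?H q (Res ?H p s)"
    if p: "p \<in> Arr (slice C U)" and q: "q \<in> Arr (slice C U)" and pq: "Cod (slice C U) q = Dom (slice C U) p"
      and s: "s \<in> Val ?H (Cod (slice C U) p)" for p q s
  proof -
    obtain f g h where e: "p = (f, g)" "q = (f \<cdot>[C] g, h)" using pq by (cases p; cases q) (auto simp:
      slice_simps)
    have f' [simp]: "f \<in> Arr C" "Cod C f = U" "g \<in> Arr C" "Cod C g = Dom C f" "h \<in> Arr C" "Cod C h = Dom C g"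
      using p q by (auto simp: e slice_simps base_cat_simps)
    let ?A = "PObj F (Dom C h)"
    interpret D: category ?A by (simp add: category_PObj base_cat_simps)
    have s': "s \<in> hom (PObj F (Dom C f)) (res_obj F f a) (res_obj F f b)" using s by (simp add: e slice_simps V)
    note [simp] = homD[OF s']
    let ?t = "Res ?H (f, g) s" and ?r = "Res ?H (f \<cdot>[C] g, h) (Res ?H (f, g) s)"
    have t: "?t \<in> hom (PObj F (Dom C (f \<cdot>[C] g))) (res_obj F (f \<cdot>[C] g) a) (res_obj F (f \<cdot>[C] g) b)"
      using res_presheaf(1)[OF _ _ _ _ _ s', of g] by (simp add: base_cat_simps)
    have r: "?r \<in> hom ?A (res_obj F (f \<cdot>[C] g \<cdot>[C] h) a) (res_obj F (f \<cdot>[C] g \<cdot>[C] h) b)"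
      "?r \<cdot>[?A] res_comp F (f \<cdot>[C] g) h a = res_comp F (f \<cdot>[C] g) h b \<cdot>[?A] res_arr F h ?t"
      using res_presheaf(1,2)[OF _ _ _ _ _ t, of h] by (simp_all add: base_cat_simps)
    note [simp] = homD[OF r(1)] homD[OF t, simplified base_cat_simps f']
    have [simp]: "?t \<in> Arr (PObj F (Dom C g))" "Dom (PObj F (Dom C g)) ?t = res_obj F (f \<cdot>[C] g) a"
      "Cod (PObj F (Dom C g)) ?t = res_obj F (f \<cdot>[C] g) b"
      using t by (simp_all add: hom_def base_cat_simps)
    have *: "?r \<cdot>[?A] res_comp F f (g \<cdot>[C] h) a = res_comp F f (g \<cdot>[C] h) b \<cdot>[?A] res_arr F (g \<cdot>[C] h) s"
    proof (rule D.iso_cancel_right)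
      show "iso_arr ?A (res_comp F g h (res_obj F f a))" by (simp add: idx_simps)
      have "(?r \<cdot>[?A] res_comp F f (g \<cdot>[C] h) a) \<cdot>[?A] res_comp F g h (res_obj F f a) =
         (?r \<cdot>[?A] res_comp F (f \<cdot>[C] g) h a) \<cdot>[?A] res_arr F h (res_comp F f g a)"
        using res_comp_assoc[of f g h a] by (simp add: idx_simps D.Comp_assoc C.Comp_assoc)
      also have "\<dots> = res_comp F (f \<cdot>[C] g) h b \<cdot>[?A] res_arr F h (?t \<cdot>[PObj F (Dom C g)] res_comp F f g a)"
        unfolding r(2) by (simp add: idx_simps D.Comp_assoc C.Comp_assoc)
      also have "\<dots> = (res_comp F (f \<cdot>[C] g) h b \<cdot>[?A] res_arr F h (res_comp F f g b)) \<cdot>[?A] res_arr F h (res_arr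
        F g s)"
        using res_presheaf(2)[OF _ _ _ _ _ s', of g] by (simp add: idx_simps D.Comp_assoc C.Comp_assoc)
      also have "\<dots> = res_comp F f (g \<cdot>[C] h) b \<cdot>[?A] (res_comp F g h (res_obj F f b) \<cdot>[?A] res_arr F h (res_arr
        F g s))"
        using res_comp_assoc[of f g h b] by (simp add: idx_simps D.Comp_assoc C.Comp_assoc)
      also have "\<dots> = (res_comp F f (g \<cdot>[C] h) b \<cdot>[?A] res_arr F (g \<cdot>[C] h) s) \<cdot>[?A] res_comp F g h (res_obj F f
        a)"
        using res_comp_natural[of g h s] by (simp add: idx_simps D.Comp_assoc C.Comp_assoc)
      finally show "(?r \<cdot>[?A] res_comp F f (g \<cdot>[C] h) a) \<cdot>[?A] res_comp F g h (res_obj F f a) =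
        (res_comp F f (g \<cdot>[C] h) b \<cdot>[?A] res_arr F (g \<cdot>[C] h) s) \<cdot>[?A] res_comp F g h (res_obj F f a)" .
    qed (simp_all add: idx_simps C.Comp_assoc)
    show ?thesis
      unfolding e slice_simps
      by (rule res_presheaf(3)) (use s' r(1) * in \<open>simp_all add: base_cat_simps C.Comp_assoc\<close>)
  qed
qed

text \<open>A covering sieve on f in the slice consists of pairs with first component f, so its
  second components form a covering sieve on the domain of f. The family is moved along
  \<open>res_comp\<close> and glued between the restrictions of a and b along f.\<close>

lemma prestack_if_glues:
  assumes glues
  shows "prestack_condition C J F"
  unfolding prestack_condition_def is_sheaf_def
proof (intro ballI conjI allI impI)
  fix U a b assume U: "U \<in> Obj C" and ab [simp]: "a \<in> Obj (PObj F U)" "b \<in> Obj (PObj F U)"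
  let ?H = "hom_presheaf C F a b"
  have V: "Val ?H f = hom (PObj F (Dom C f)) (res_obj F f a) (res_obj F f b)" for f by (simp add:
    hom_presheaf_def)
  show "is_presheaf (slice C U) ?H" by (rule is_presheaf_hom[OF U ab])
  fix f T s assume f: "f \<in> Obj (slice C U)" and T: "T \<in> slice_topology C J U f" and m:
    "matching_family (slice C U) ?H T s"
  have f' [simp]: "f \<in> Arr C" "Cod C f = U" using f by (simp_all add: slice_simps)
  have TS: "sieve (slice C U) f T" and S: "snd ` T \<in> J (Dom C f)" using T by (auto simp: slice_topology_def)
  let ?S = "snd ` T" and ?A = "\<lambda>g. PObj F (Dom C g)"
  have DV: "Dom C f \<in> Obj C" by (simp add: base_cat_simps)
  have g: "g \<in> Arr C" "Cod C g = Dom C f" "(f, g) \<in> T" if "g \<in> ?S" for g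
  proof -
    from that obtain f0 where t: "(f0, g) \<in> T" by auto
    then have "(f0, g) \<in> Arr (slice C U)" "f0 = f" using TS by (auto simp: sieve_def slice_simps)
    then show "g \<in> Arr C" "Cod C g = Dom C f" "(f, g) \<in> T" using t by (auto simp: slice_simps)
  qed
  have Tg: "p \<in> T \<longleftrightarrow> (\<exists>g\<in>?S. p = (f, g))" for p
  proof -
    have "fst p = f" if "p \<in> T" using TS that by (cases p) (auto simp: sieve_def slice_simps)
    then show ?thesis using g(3) by (metis imageI prod.collapse snd_conv)
  qed
  have sf: "s (f, g) \<in> hom (?A g) (res_obj F (f \<cdot>[C] g) a) (res_obj F (f \<cdot>[C] g) b)" if "g \<in> ?S" for g
    using m g[OF that] unfolding matching_family_def by (force simp: slice_simps V base_cat_simps)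
  have sc: "s (f, g \<cdot>[C] h) = Res ?H (f \<cdot>[C] g, h) (s (f, g))" if gS: "g \<in> ?S" and h: "h \<in> Arr C" "Cod C h =
    Dom C g" for g h
  proof -
    have "(f \<cdot>[C] g, h) \<in> Arr (slice C U)" "Cod (slice C U) (f \<cdot>[C] g, h) = Dom (slice C U) (f, g)"
      using h g[OF gS] by (simp_all add: slice_simps base_cat_simps)
    then have "s ((f, g) \<cdot>[slice C U] (f \<cdot>[C] g, h)) = Res ?H (f \<cdot>[C] g, h) (s (f, g))"
      using m g(3)[OF gS] unfolding matching_family_def by blast
    then show ?thesis by (simp add: slice_simps)
  qed
  \<comment> \<open>\<open>s (f, g)\<close> relates restrictions along \<open>f \<cdot> g\<close>;
    conjugation with \<open>res_comp\<close> turns it into an arrow between iterated restrictions,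
    as \<open>glues\<close> requires.\<close>
  define s' where "s' g = inv_arr (?A g) (res_comp F f g b) \<cdot>[?A g] (s (f, g) \<cdot>[?A g] res_comp F f g a)" for g
  have s': "s' g \<in> hom (?A g) (res_obj F g (res_obj F f a)) (res_obj F g (res_obj F f b))"
    "r = s' g \<longleftrightarrow> res_comp F f g b \<cdot>[?A g] r = s (f, g) \<cdot>[?A g] res_comp F f g a"
    if gS: "g \<in> ?S" and r: "r \<in> hom (?A g) (res_obj F g (res_obj F f a)) (res_obj F g (res_obj F f b))" for g r
  proof -
    note [simp] = g[OF gS] homD[OF sf[OF gS]] homD[OF r]
    interpret D: category "?A g" by (simp add: category_PObj base_cat_simps)
    have i: "iso_arr (?A g) (res_comp F f g b)" by (simp add: idx_simps)
    note ii = D.inv_arr_simps[OF i] D.inv_comp_cancel[OF i]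
    show 1: "s' g \<in> hom (?A g) (res_obj F g (res_obj F f a)) (res_obj F g (res_obj F f b))"
      by (simp add: s'_def hom_def idx_simps ii)
    show "r = s' g \<longleftrightarrow> res_comp F f g b \<cdot>[?A g] r = s (f, g) \<cdot>[?A g] res_comp F f g a"
      using ii(7)[of r] ii(8)[of "s (f, g) \<cdot>[?A g] res_comp F f g a"] by (auto simp: s'_def idx_simps)
  qed
  have s'h: "s' g \<in> hom (?A g) (res_obj F g (res_obj F f a)) (res_obj F g (res_obj F f b))"
    "res_comp F f g b \<cdot>[?A g] s' g = s (f, g) \<cdot>[?A g] res_comp F f g a" if gS: "g \<in> ?S" for g
  proof -
    have "\<exists>r. r \<in> hom (?A g) (res_obj F g (res_obj F f a)) (res_obj F g (res_obj F f b))"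
    proof
      note [simp] = g[OF gS] homD[OF sf[OF gS]]
      interpret D: category "?A g" by (simp add: category_PObj base_cat_simps)
      have i: "iso_arr (?A g) (res_comp F f g b)" by (simp add: idx_simps)
      show "s' g \<in> hom (?A g) (res_obj F g (res_obj F f a)) (res_obj F g (res_obj F f b))"
        by (simp add: s'_def hom_def idx_simps D.inv_arr_simps[OF i])
    qed
    then show 1: "s' g \<in> hom (?A g) (res_obj F g (res_obj F f a)) (res_obj F g (res_obj F f b))" using s'(1)[OF
      gS] by blast
    show "res_comp F f g b \<cdot>[?A g] s' g = s (f, g) \<cdot>[?A g] res_comp F f g a" using s'(2)[OF gS 1] by simp
  qed
  have "compatible ?S (res_obj F f a) (res_obj F f b) s'"
    unfolding compatible_def
  proof (intro conjI ballI impI)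
    show "s' g \<in> hom (?A g) (res_obj F g (res_obj F f a)) (res_obj F g (res_obj F f b))" if "g \<in> ?S" for g using
      s'h(1)[OF that] .
    fix g h assume gS: "g \<in> ?S" and h [simp]: "h \<in> Arr C" "Cod C h = Dom C g"
    note [simp] = g[OF gS] homD[OF sf[OF gS]] homD[OF s'h(1)[OF gS]]
    have gh: "g \<cdot>[C] h \<in> ?S" using sieveD(3)[OF J.covers_sieve[OF DV S] gS] h by blast
    let ?B = "PObj F (Dom C h)"
    interpret D: category ?B by (simp add: category_PObj base_cat_simps)
    have "Dom C (g \<cdot>[C] h) = Dom C h" by (simp add: base_cat_simps)
    note q = homD[OF sf[OF gh], unfolded this] homD[OF s'h(1)[OF gh], unfolded this] and q' = s'h(2)[OF gh,
      unfolded this]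
    note [simp] = q
    have sgh: "s (f, g \<cdot>[C] h) \<cdot>[?B] res_comp F (f \<cdot>[C] g) h a = res_comp F (f \<cdot>[C] g) h b \<cdot>[?B] res_arr F h (s
      (f, g))"
      unfolding sc[OF gS h] using res_presheaf(2)[of "f \<cdot>[C] g" h a b "s (f, g)"] sf[OF gS] by (simp add:
        base_cat_simps)
    show "s' (g \<cdot>[C] h) \<cdot>[?B] res_comp F g h (res_obj F f a) = res_comp F g h (res_obj F f b) \<cdot>[?B] res_arr F h
      (s' g)"
    proof (rule D.iso_cancel_left)
      show "iso_arr ?B (res_comp F f (g \<cdot>[C] h) b)" by (simp add: idx_simps)
      have "res_comp F f (g \<cdot>[C] h) b \<cdot>[?B] (s' (g \<cdot>[C] h) \<cdot>[?B] res_comp F g h (res_obj F f a)) =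
        (res_comp F f (g \<cdot>[C] h) b \<cdot>[?B] s' (g \<cdot>[C] h)) \<cdot>[?B] res_comp F g h (res_obj F f a)"
        by (simp add: idx_simps D.Comp_assoc)
      also have "\<dots> = s (f, g \<cdot>[C] h) \<cdot>[?B] (res_comp F (f \<cdot>[C] g) h a \<cdot>[?B] res_arr F h (res_comp F f g a))"
        unfolding q' using res_comp_assoc[of f g h a] by (simp add: idx_simps D.Comp_assoc C.Comp_assoc)
      also have "\<dots> = (s (f, g \<cdot>[C] h) \<cdot>[?B] res_comp F (f \<cdot>[C] g) h a) \<cdot>[?B] res_arr F h (res_comp F f g a)"
        by (simp add: idx_simps D.Comp_assoc C.Comp_assoc)
      also have "\<dots> = res_comp F (f \<cdot>[C] g) h b \<cdot>[?B] res_arr F h (s (f, g) \<cdot>[?A g] res_comp F f g a)"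
        unfolding sgh by (simp add: idx_simps D.Comp_assoc C.Comp_assoc)
      also have "\<dots> = (res_comp F (f \<cdot>[C] g) h b \<cdot>[?B] res_arr F h (res_comp F f g b)) \<cdot>[?B] res_arr F h (s' g)"
        unfolding s'h(2)[OF gS, symmetric] by (simp add: idx_simps D.Comp_assoc C.Comp_assoc)
      also have "\<dots> = res_comp F f (g \<cdot>[C] h) b \<cdot>[?B] (res_comp F g h (res_obj F f b) \<cdot>[?B] res_arr F h (s' g))"
        using res_comp_assoc[of f g h b] by (simp add: idx_simps D.Comp_assoc C.Comp_assoc)
      finally show "res_comp F f (g \<cdot>[C] h) b \<cdot>[?B] (s' (g \<cdot>[C] h) \<cdot>[?B] res_comp F g h (res_obj F f a)) =
        res_comp F f (g \<cdot>[C] h) b \<cdot>[?B] (res_comp F g h (res_obj F f b) \<cdot>[?B] res_arr F h (s' g))" .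
    qed (simp_all add: idx_simps)
  qed
  then have ex: "\<exists>!t. t \<in> hom (PObj F (Dom C f)) (res_obj F f a) (res_obj F f b) \<and> (\<forall>g\<in>?S. res_arr F g t =
    s' g)"
    by (intro assms[unfolded glues_def, rule_format] S DV) (simp_all add: res_simps)
  have iff: "(\<forall>p\<in>T. Res ?H p t = s p) \<longleftrightarrow> (\<forall>g\<in>?S. res_arr F g t = s' g)"
    if t: "t \<in> hom (PObj F (Dom C f)) (res_obj F f a) (res_obj F f b)" for t
  proof -
    note [simp] = homD[OF t]
    have "Res ?H (f, g) t = s (f, g) \<longleftrightarrow> res_arr F g t = s' g" if gS: "g \<in> ?S" for g
    proof -
      note [simp] = g[OF gS]
      have "res_arr F g t \<in> hom (?A g) (res_obj F g (res_obj F f a)) (res_obj F g (res_obj F f b))" by (simp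
        add: hom_def res_simps)
      then show ?thesis
        using s'(2)[OF gS, of "res_arr F g t"] res_presheaf(2,3)[of f g a b t] sf[OF gS] t
        by (metis f' g(1,2)[OF gS] ab)
    qed
    then show ?thesis by (metis Tg)
  qed
  show "\<exists>!t. t \<in> Val ?H f \<and> (\<forall>p\<in>T. Res ?H p t = s p)"
    unfolding V using ex iff by (metis (no_types, lifting))
qed

text \<open>The sheaf condition is applied at the terminal object of the slice, the identity of U,
  to the sieve of pairs of this identity with the elements of S.\<close>

lemma glues_if_prestack:
  assumes "prestack_condition C J F"
  shows glues
  unfolding glues_def
proof (intro ballI allI impI)
  fix U S a b s assume U [simp]: "U \<in> Obj C" and S: "S \<in> J U" and ab [simp]: "a \<in> Obj (PObj F U)"
    "b \<in> Obj (PObj F U)"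
    and c: "compatible S a b s"
  let ?H = "hom_presheaf C F a b" and ?i = "Ident C U" and ?A = "PObj F U"
  let ?T = "Pair ?i ` S"
  note Sv = sieveD[OF J.covers_sieve[OF U S]]
  have ig: "?i \<cdot>[C] g = g" if "g \<in> S" for g using Sv[OF that] C.Comp_Ident_left[of g] by simp
  have V: "Val ?H f = hom (PObj F (Dom C f)) (res_obj F f a) (res_obj F f b)" for f by (simp add:
    hom_presheaf_def)
  have i: "?i \<in> Obj (slice C U)" "Dom C ?i = U" "Cod C ?i = U" "?i \<in> Arr C" by (simp_all add: slice_simps
    base_cat_simps)
  have "sieve (slice C U) ?i ?T"
    unfolding sieve_def
  proof (intro conjI subsetI ballI impI)
    fix p assume "p \<in> ?T" then show "p \<in> {f \<in> Arr (slice C U). Cod (slice C U) f = ?i}"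
      using Sv i by (auto simp: slice_simps)
  next
    fix p q assume p: "p \<in> ?T" and q: "q \<in> Arr (slice C U)" "Cod (slice C U) q = Dom (slice C U) p"
    then obtain g where g: "g \<in> S" "p = (?i, g)" by auto
    obtain h where h: "q = (?i \<cdot>[C] g, h)" using q g by (cases q) (auto simp: slice_simps)
    then have "g \<cdot>[C] h \<in> S" using q g Sv[OF g(1)] ig[OF g(1)] by (auto simp: slice_simps)
    then show "p \<cdot>[slice C U] q \<in> ?T" by (simp add: g h slice_simps)
  qed
  moreover have "snd ` ?T = S" by (auto simp: image_image)
  ultimately have T: "?T \<in> slice_topology C J U ?i" using S i by (simp add: slice_topology_def)
  have sh: "s g \<in> hom (PObj F (Dom C g)) (res_obj F g a) (res_obj F g b)" if "g \<in> S" for g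
    using c that by (simp add: compatible_def)
  have "matching_family (slice C U) ?H ?T (s \<circ> snd)"
    unfolding matching_family_def
  proof (intro conjI ballI impI)
    fix p assume "p \<in> ?T" then show "(s \<circ> snd) p \<in> Val ?H (Dom (slice C U) p)"
      using sh ig by (auto simp: slice_simps V)
  next
    fix p q assume p: "p \<in> ?T" and q: "q \<in> Arr (slice C U)" "Cod (slice C U) q = Dom (slice C U) p"
    then obtain g where g: "g \<in> S" "p = (?i, g)" by auto
    obtain h where h: "q = (g, h)" using q g ig[OF g(1)] by (cases q) (auto simp: slice_simps)
    have h': "h \<in> Arr C" "Cod C h = Dom C g" using q h by (auto simp: slice_simps)
    have gh: "g \<cdot>[C] h \<in> S" using Sv(3)[OF g(1)] h' by simp
    have "Res ?H (g, h) (s g) = s (g \<cdot>[C] h)"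
      by (rule res_presheaf(3)) (use Sv[OF g(1)] h' sh[OF g(1)] sh[OF gh] c g in \<open>simp_all add: compatible_def
        base_cat_simps\<close>)
    then show "(s \<circ> snd) (p \<cdot>[slice C U] q) = Res ?H q ((s \<circ> snd) p)" by (simp add: g h slice_simps)
  qed
  then have ex: "\<exists>!t. t \<in> Val ?H ?i \<and> (\<forall>p\<in>?T. Res ?H p t = (s \<circ> snd) p)"
    by (intro assms[unfolded prestack_condition_def, rule_format, OF U ab, unfolded is_sheaf_def, THEN
      conjunct2, rule_format] i T)
  interpret D: category ?A by (simp add: category_PObj)
  let ?ua = "res_unit F U a" and ?ub = "res_unit F U b"
  have ub: "iso_arr ?A ?ub" by (simp add: idx_simps)
  have R: "(\<forall>p\<in>?T. Res ?H p (res_arr F ?i t) = (s \<circ> snd) p) \<longleftrightarrow> (\<forall>g\<in>S. res_arr F g t = s g)" (is "?l \<longleftrightarrow> ?r")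
    and Rh: "res_arr F ?i t \<in> Val ?H ?i" if t: "t \<in> hom ?A a b" for t
  proof -
    note [simp] = homD[OF t]
    show Rh: "res_arr F ?i t \<in> Val ?H ?i" using i by (simp add: V hom_def res_simps)
    have "Res ?H (?i, g) (res_arr F ?i t) = res_arr F g t" if g: "g \<in> S" for g
      by (rule res_presheaf(3))
        (use Sv[OF g] i ig[OF g] Rh res_comp_natural[of ?i g t] in \<open>simp_all add: V hom_def res_simps\<close>)
    then show "?l \<longleftrightarrow> ?r" by auto
  qed
  obtain t where t: "t \<in> Val ?H ?i" "\<forall>p\<in>?T. Res ?H p t = (s \<circ> snd) p" using ex by blast
  have t' [simp]: "t \<in> Arr ?A" "Dom ?A t = res_obj F ?i a" "Cod ?A t = res_obj F ?i b"
    using t(1) i by (simp_all add: V hom_def)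
  note ii = D.inv_arr_simps[OF ub] D.inv_comp_cancel[OF ub]
  \<comment> \<open>t runs between the restrictions of a and b along the identity of U; conjugation
    with the unit isomorphisms makes it an arrow from a to b.\<close>
  let ?t = "inv_arr ?A ?ub \<cdot>[?A] (t \<cdot>[?A] ?ua)"
  have th: "?t \<in> hom ?A a b" by (simp add: hom_def idx_simps ii)
  have "res_arr F ?i ?t = t"
  proof (rule D.iso_cancel_right[of ?ua])
    show "res_arr F ?i ?t \<cdot>[?A] ?ua = t \<cdot>[?A] ?ua"
      using res_unit_natural[of U ?t] homD[OF th] ii(8)[of "t \<cdot>[?A] ?ua"] by (simp add: idx_simps)
  qed (use homD[OF th] in \<open>simp_all add: idx_simps\<close>)
  then have ts: "\<forall>g\<in>S. res_arr F g ?t = s g" using t(2) R[OF th] by simp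
  show "\<exists>!t. t \<in> hom ?A a b \<and> (\<forall>f\<in>S. res_arr F f t = s f)"
  proof (rule ex1I[of _ ?t])
    show "?t \<in> hom ?A a b \<and> (\<forall>f\<in>S. res_arr F f ?t = s f)" using th ts by blast
    fix r assume r: "r \<in> hom ?A a b \<and> (\<forall>f\<in>S. res_arr F f r = s f)"
    then have e: "res_arr F ?i r = res_arr F ?i ?t" using R[of r] R[OF th] Rh[of r] Rh[OF th] ts ex by blast
    have r': "r \<in> Arr ?A" "Dom ?A r = a" "Cod ?A r = b" using r by (auto simp: hom_def)
    show "r = ?t"
    proof (rule D.iso_cancel_left[OF ub])
      show "?ub \<cdot>[?A] r = ?ub \<cdot>[?A] ?t"
        using res_unit_natural[of U ?t] res_unit_natural[of U r] homD[OF th] r' e by simp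
    qed (use r' homD[OF th] in \<open>simp_all add: idx_simps\<close>)
  qed
qed

end

subsection \<open>Equivalences of categories\<close>

lemma bij_betw_iff_ex1:
  assumes "\<And>x. x \<in> A \<Longrightarrow> f x \<in> B"
  shows "bij_betw f A B \<longleftrightarrow> (\<forall>y\<in>B. \<exists>!x. x \<in> A \<and> f x = y)"
proof
  assume "bij_betw f A B"
  then show "\<forall>y\<in>B. \<exists>!x. x \<in> A \<and> f x = y"
    unfolding bij_betw_def inj_on_def by (metis image_iff)
next
  assume R: "\<forall>y\<in>B. \<exists>!x. x \<in> A \<and> f x = y"
  have "inj_on f A" using R assms by (intro inj_onI) metis
  moreover have "f ` A = B" using R assms by auto
  ultimately show "bij_betw f A B" by (simp add: bij_betw_def)
qed

definition essentially_surjective :: "('o, 'm, 'p, 'n) func \<Rightarrow> bool" where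
  "essentially_surjective F \<longleftrightarrow>
     (\<forall>y\<in>Obj (FCod F). \<exists>x\<in>Obj (FDom F). \<exists>u\<in>hom (FCod F) (FObj F x) y. iso_arr (FCod F) u)"

text \<open>Naturality of \<eta> recovers u from its image under G after F, because \<eta> is
  invertible.\<close>

lemma faithful_if_iso_id:
  assumes F: "is_functor F" and G: "is_functor G" "FDom G = FCod F" "FCod G = FDom F"
    and \<eta>: "\<And>x. x \<in> Obj (FDom F) \<Longrightarrow> iso_arr (FDom F) (\<eta> x) \<and> \<eta> x \<in> hom (FDom F) x (FObj G (FObj F x))"
    and nat: "\<And>f. f \<in> Arr (FDom F) \<Longrightarrow> \<eta> (Cod (FDom F) f) \<cdot>[FDom F] f = FArr G (FArr F f) \<cdot>[FDom F] \<eta> (Dom (FDom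
      F) f)"
    and u: "u \<in> hom (FDom F) x y" "u' \<in> hom (FDom F) x y" "FArr F u = FArr F u'"
  shows "u = u'"
proof -
  interpret A: category "FDom F" by (rule is_functorD[OF F])
  have y: "y \<in> Obj (FDom F)" using A.hom_Obj[OF u(1)] by simp
  show ?thesis
    by (rule A.iso_cancel_left[OF conjunct1[OF \<eta>[OF y]]])
      (use nat[of u] nat[of u'] u \<eta>[OF y] in \<open>auto simp: hom_def\<close>)
qed

text \<open>For the converse, a quasi-inverse is built by choosing preimages of objects up to
  isomorphism and transporting arrows along these isomorphisms.\<close>

lemma equivalence_functor_iff:
  assumes F: "is_functor F"
  shows "equivalence_functor F \<longleftrightarrow> fully_faithful F \<and> essentially_surjective F"
proof
  let ?A = "FDom F" and ?B = "FCod F"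
  interpret A: category ?A by (rule is_functorD[OF F])
  interpret B: category ?B by (rule is_functorD[OF F])
  note FD = is_functorD(5-)[OF F]
  assume "equivalence_functor F"
  then obtain G \<eta> \<epsilon> where G: "is_functor G" "FDom G = ?B" "FCod G = ?A"
    and \<eta>: "is_ntrans \<eta>" "NDom \<eta> = id_func ?A" "NCod \<eta> = comp_func G F" "\<forall>x\<in>Obj ?A. iso_arr ?A (NAt \<eta> x)"
    and \<epsilon>: "is_ntrans \<epsilon>" "NDom \<epsilon> = comp_func F G" "NCod \<epsilon> = id_func ?B" "\<forall>y\<in>Obj ?B. iso_arr ?B (NAt \<epsilon> y)"
    unfolding equivalence_functor_def nat_isomorphic_def by (auto simp: id_func_simps comp_func_simps)
  note GD = is_functorD(5-)[OF G(1), unfolded G(2,3)]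
  have \<eta>h: "iso_arr ?A (NAt \<eta> x) \<and> NAt \<eta> x \<in> hom ?A x (FObj G (FObj F x))" if "x \<in> Obj ?A" for x
    using is_ntransD(6-8)[OF \<eta>(1)] \<eta>(2-4) that by (simp add: id_func_simps comp_func_simps hom_def)
  have \<eta>n: "NAt \<eta> (Cod ?A f) \<cdot>[?A] f = FArr G (FArr F f) \<cdot>[?A] NAt \<eta> (Dom ?A f)" if "f \<in> Arr ?A" for f
    using is_ntransD(9)[OF \<eta>(1)] \<eta>(2-4) that by (simp add: id_func_simps comp_func_simps)
  have \<epsilon>h: "iso_arr ?B (NAt \<epsilon> y)" "NAt \<epsilon> y \<in> Arr ?B" "Dom ?B (NAt \<epsilon> y) = FObj F (FObj G y)" "Cod ?B (NAt \<epsilon> y) =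
    y"
     if "y \<in> Obj ?B" for y
    using is_ntransD(6-8)[OF \<epsilon>(1)] \<epsilon>(2-4) that G by (simp_all add: id_func_simps comp_func_simps hom_def)
  have \<epsilon>n: "NAt \<epsilon> (Cod ?B f) \<cdot>[?B] FArr F (FArr G f) = f \<cdot>[?B] NAt \<epsilon> (Dom ?B f)" if "f \<in> Arr ?B" for f
    using is_ntransD(9)[OF \<epsilon>(1)] \<epsilon>(2-4) that G by (simp add: id_func_simps comp_func_simps)
  \<comment> \<open>The counit plays for G the part that the unit plays for F.\<close>
  have G_faithful: "v = v'" if v: "v \<in> hom ?B x y" "v' \<in> hom ?B x y" "FArr G v = FArr G v'" for v v' x y
  proof -
    have x: "x \<in> Obj ?B" using B.hom_Obj[OF v(1)] by simp
    show ?thesis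
      by (rule B.iso_cancel_right[OF \<epsilon>h(1)[OF x]])
        (use \<epsilon>n[of v] \<epsilon>n[of v'] v \<epsilon>h(2-4)[OF x] in \<open>auto simp: hom_def\<close>)
  qed
  have "bij_betw (FArr F) (hom ?A x y) (hom ?B (FObj F x) (FObj F y))" if x: "x \<in> Obj ?A" "y \<in> Obj ?A" for x y
    unfolding bij_betw_def
  proof (intro conjI equalityI subsetI)
    show "inj_on (FArr F) (hom ?A x y)"
      using faithful_if_iso_id[OF F G \<eta>h \<eta>n] by (auto intro!: inj_onI)
    show "v \<in> hom ?B (FObj F x) (FObj F y)" if "v \<in> FArr F ` hom ?A x y" for v
      using that FD by (auto simp: hom_def)
    fix v assume v: "v \<in> hom ?B (FObj F x) (FObj F y)"
    \<comment> \<open>G v conjugated with the unit. Its image under F is v because both have the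
      same image under the faithful functor G.\<close>
    let ?u = "inv_arr ?A (NAt \<eta> y) \<cdot>[?A] (FArr G v \<cdot>[?A] NAt \<eta> x)"
    note ii = A.inv_arr_simps[OF conjunct1[OF \<eta>h[OF x(2)]]] A.inv_comp_cancel[OF conjunct1[OF \<eta>h[OF x(2)]]]
    note ex = \<eta>h[OF x(1), THEN conjunct2, THEN homD(1)] \<eta>h[OF x(1), THEN conjunct2, THEN homD(2)] \<eta>h[OF x(1),
      THEN conjunct2, THEN homD(3)]
    note ey = \<eta>h[OF x(2), THEN conjunct2, THEN homD(1)] \<eta>h[OF x(2), THEN conjunct2, THEN homD(2)] \<eta>h[OF x(2),
      THEN conjunct2, THEN homD(3)]
    note Gv = GD(2-4)[OF homD(1)[OF v]]
    have u: "?u \<in> hom ?A x y" using ii ex ey Gv v by (simp add: hom_def A.Comp_in A.Dom_Comp A.Cod_Comp)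
    have Gu: "FArr G (FArr F ?u) \<in> Arr ?A" "Dom ?A (FArr G (FArr F ?u)) = FObj G (FObj F x)"
      "Cod ?A (FArr G (FArr F ?u)) = FObj G (FObj F y)"
      using GD FD homD[OF u] by simp_all
    have "FArr G (FArr F ?u) = FArr G v"
    proof (rule A.iso_cancel_right[OF conjunct1[OF \<eta>h[OF x(1)]]])
      have "FArr G (FArr F ?u) \<cdot>[?A] NAt \<eta> x = NAt \<eta> y \<cdot>[?A] ?u"
        using \<eta>n[of ?u] homD[OF u] by simp
      also have "\<dots> = FArr G v \<cdot>[?A] NAt \<eta> x"
        using ii(8)[of "FArr G v \<cdot>[?A] NAt \<eta> x"] ex ey Gv v by (simp add: hom_def A.Comp_in A.Dom_Comp
          A.Cod_Comp)
      finally show "FArr G (FArr F ?u) \<cdot>[?A] NAt \<eta> x = FArr G v \<cdot>[?A] NAt \<eta> x" .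
    qed (use Gu Gv ex v in \<open>auto simp: hom_def\<close>)
    then have Fu: "FArr F ?u = v"
      by (rule G_faithful[rotated 2]) (use v FD homD[OF u] in \<open>auto simp: hom_def\<close>)
    show "v \<in> FArr F ` hom ?A x y" by (rule image_eqI[where x = ?u]) (use Fu u in simp_all)
  qed
  then show "fully_faithful F \<and> essentially_surjective F"
    unfolding fully_faithful_def essentially_surjective_def using F \<epsilon>h GD(1)
    by (metis homI)
next
  let ?A = "FDom F" and ?B = "FCod F"
  interpret A: category ?A by (rule is_functorD[OF F])
  interpret B: category ?B by (rule is_functorD[OF F])
  note FD = is_functorD(5-)[OF F]
  assume R: "fully_faithful F \<and> essentially_surjective F"
  \<comment> \<open>The Axiom of Choice enters here, turning essential surjectivity into functions g
    and e.\<close>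
  then have "\<forall>y\<in>Obj ?B. \<exists>x u. x \<in> Obj ?A \<and> u \<in> hom ?B (FObj F x) y \<and> iso_arr ?B u"
    unfolding essentially_surjective_def by blast
  then obtain g e where ge: "\<And>y. y \<in> Obj ?B \<Longrightarrow> g y \<in> Obj ?A \<and> e y \<in> hom ?B (FObj F (g y)) y \<and> iso_arr ?B (e y)"
    by metis
  have g: "g y \<in> Obj ?A" and e: "e y \<in> Arr ?B" "Dom ?B (e y) = FObj F (g y)" "Cod ?B (e y) = y"
    "iso_arr ?B (e y)" if "y \<in> Obj ?B" for y
    using ge[OF that] by (auto simp: hom_def)
  note ei = B.inv_arr_simps[OF e(4)] and ec = B.inv_comp_cancel[OF e(4)]
  have bij: "bij_betw (FArr F) (hom ?A x y) (hom ?B (FObj F x) (FObj F y))" if "x \<in> Obj ?A" "y \<in> Obj ?A" for x y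
    using R that by (simp add: fully_faithful_def)
  define p where "p x y v = the_inv_into (hom ?A x y) (FArr F) v" for x y v
  have p: "p x y v \<in> hom ?A x y" "FArr F (p x y v) = v" if "x \<in> Obj ?A" "y \<in> Obj ?A" "v \<in> Arr ?B" "Dom ?B v =
    FObj F x" "Cod ?B v = FObj F y" for x y v
    using the_inv_into_into[of "FArr F" "hom ?A x y" v "hom ?A x y"] f_the_inv_into_f_bij_betw[OF bij[OF
      that(1,2)], of v]
      bij[OF that(1,2)] that by (auto simp: p_def hom_def bij_betw_def)
  have F_faithful: "u = u'" if "u \<in> Arr ?A" "u' \<in> Arr ?A" "Dom ?A u = Dom ?A u'" "Cod ?A u = Cod ?A u'"
    "FArr F u = FArr F u'" for u u'
  proof -
    have "inj_on (FArr F) (hom ?A (Dom ?A u) (Cod ?A u))" using bij[of "Dom ?A u" "Cod ?A u"] that A.Dom_in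
      A.Cod_in by (simp add: bij_betw_def)
    then show ?thesis using that by (auto simp: inj_on_def hom_def)
  qed
  \<comment> \<open>Conjugation with the chosen isomorphisms e, pulled back through the full and
    faithful F. By construction e becomes natural and serves as the counit; the preimages of its
    inverses form the unit.\<close>
  define ga where "ga v = p (g (Dom ?B v)) (g (Cod ?B v)) (inv_arr ?B (e (Cod ?B v)) \<cdot>[?B] (v \<cdot>[?B] e (Dom ?B
    v)))" for v
  note Bs = B.Comp_in B.Dom_Comp B.Cod_Comp B.Dom_in B.Cod_in B.Ident_in B.Dom_Ident B.Cod_Ident
  note As = A.Comp_in A.Dom_Comp A.Cod_Comp A.Dom_in A.Cod_in A.Ident_in A.Dom_Ident A.Cod_Ident
  have ga: "ga v \<in> hom ?A (g (Dom ?B v)) (g (Cod ?B v))"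
    "FArr F (ga v) = inv_arr ?B (e (Cod ?B v)) \<cdot>[?B] (v \<cdot>[?B] e (Dom ?B v))" if v: "v \<in> Arr ?B" for v
    using p[of "g (Dom ?B v)" "g (Cod ?B v)" "inv_arr ?B (e (Cod ?B v)) \<cdot>[?B] (v \<cdot>[?B] e (Dom ?B v))"] v
      e[of "Dom ?B v"] e[of "Cod ?B v"] ei[of "Cod ?B v"] g[of "Dom ?B v"] g[of "Cod ?B v"]
    by (simp_all add: ga_def Bs)
  note ga' = homD[OF ga(1)]
  have ga_nat: "e (Cod ?B v) \<cdot>[?B] FArr F (ga v) = v \<cdot>[?B] e (Dom ?B v)" if v: "v \<in> Arr ?B" for v
    using v ec(2)[of "Cod ?B v" "v \<cdot>[?B] e (Dom ?B v)"] e[of "Dom ?B v"] e[of "Cod ?B v"] by (simp add: ga(2)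
      Bs)
  let ?G = "\<lparr>FDom = ?B, FCod = ?A, FObj = restrict g (Obj ?B), FArr = restrict ga (Arr ?B)\<rparr>"
  have G: "is_functor ?G"
  proof (rule is_functorI[OF B.category_axioms A.category_axioms])
    fix x assume x: "x \<in> Obj ?B"
    have "ga (Ident ?B x) = Ident ?A (g x)"
      by (rule F_faithful) (use x ga'[of "Ident ?B x"] ga(2)[of "Ident ?B x"] g[OF x] e[OF x] ei[OF x]
        B.Comp_Ident_left[of "e x"] in \<open>simp_all add: Bs As FD\<close>)
    then show "FArr ?G (Ident ?B x) = Ident ?A (FObj ?G x)" using x by (simp add: Bs)
  next
    fix f h assume f: "f \<in> Arr ?B" "h \<in> Arr ?B" "Cod ?B f = Dom ?B h"
    have "ga (h \<cdot>[?B] f) = ga h \<cdot>[?A] ga f"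
    proof (rule F_faithful)
      have i: "Cod ?B h \<in> Obj ?B" "Dom ?B h \<in> Obj ?B" "Dom ?B f \<in> Obj ?B" using f by (simp_all add: Bs)
      have hf: "h \<cdot>[?B] f \<in> Arr ?B" "Dom ?B (h \<cdot>[?B] f) = Dom ?B f" "Cod ?B (h \<cdot>[?B] f) = Cod ?B h" using f by
        (simp_all add: Bs)
      have Fg: "FArr F (ga h) \<in> Arr ?B" "Dom ?B (FArr F (ga h)) = FObj F (g (Dom ?B h))"
        "Cod ?B (FArr F (ga h)) = FObj F (g (Cod ?B h))"
        "FArr F (ga f) \<in> Arr ?B" "Dom ?B (FArr F (ga f)) = FObj F (g (Dom ?B f))" "Cod ?B (FArr F (ga f)) =
          FObj F (g (Dom ?B h))"
        "FArr F (ga (h \<cdot>[?B] f)) \<in> Arr ?B" "Dom ?B (FArr F (ga (h \<cdot>[?B] f))) = FObj F (g (Dom ?B f))"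
          "Cod ?B (FArr F (ga (h \<cdot>[?B] f))) = FObj F (g (Cod ?B h))"
        using FD(2-4) ga'[OF f(1)] ga'[OF f(2)] ga'[OF hf(1)] hf f(3) by simp_all
      have "e (Cod ?B h) \<cdot>[?B] FArr F (ga (h \<cdot>[?B] f)) = h \<cdot>[?B] (f \<cdot>[?B] e (Dom ?B f))"
        using ga_nat[OF hf(1)] hf f e[OF i(3)] by (simp add: B.Comp_assoc)
      also have "\<dots> = (h \<cdot>[?B] e (Dom ?B h)) \<cdot>[?B] FArr F (ga f)"
        using ga_nat[OF f(1)] f e[OF i(2)] Fg by (simp add: B.Comp_assoc)
      also have "\<dots> = e (Cod ?B h) \<cdot>[?B] (FArr F (ga h) \<cdot>[?B] FArr F (ga f))"
        using ga_nat[OF f(2)] e[OF i(1)] Fg by (simp flip: B.Comp_assoc)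
      finally have *: "e (Cod ?B h) \<cdot>[?B] FArr F (ga (h \<cdot>[?B] f)) = e (Cod ?B h) \<cdot>[?B] (FArr F (ga h) \<cdot>[?B] FArr
        F (ga f))" .
      have "FArr F (ga (h \<cdot>[?B] f)) = FArr F (ga h) \<cdot>[?B] FArr F (ga f)"
        by (rule B.iso_cancel_left[OF e(4)[OF i(1)] *]) (use Fg e[OF i(1)] in \<open>simp_all add: Bs\<close>)
      then show "FArr F (ga (h \<cdot>[?B] f)) = FArr F (ga h \<cdot>[?A] ga f)"
        using FD(6)[of "ga f" "ga h"] ga'[OF f(1)] ga'[OF f(2)] f(3) by simp
      show "ga (h \<cdot>[?B] f) \<in> Arr ?A" "ga h \<cdot>[?A] ga f \<in> Arr ?A" "Dom ?A (ga (h \<cdot>[?B] f)) =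
        Dom ?A (ga h \<cdot>[?A] ga f)"
        "Cod ?A (ga (h \<cdot>[?B] f)) = Cod ?A (ga h \<cdot>[?A] ga f)"
        using ga'[OF f(1)] ga'[OF f(2)] ga'[OF hf(1)] hf f(3) by (simp_all add: As)
    qed
    then show "FArr ?G (h \<cdot>[?B] f) = FArr ?G h \<cdot>[?A] FArr ?G f" using f by (simp add: Bs)
  qed (use g ga in \<open>simp_all add: Bs\<close>)
  have FF: "FObj F x \<in> Obj ?B" if "x \<in> Obj ?A" for x using FD(1) that by simp
  let ?eta = "\<lparr>NDom = id_func ?A, NCod = comp_func ?G F, NAt = restrict (\<lambda>x. p x (g (FObj F x)) (inv_arr ?B (e
    (FObj F x)))) (Obj ?A)\<rparr>"
  have h: "p x (g (FObj F x)) (inv_arr ?B (e (FObj F x))) \<in> hom ?A x (g (FObj F x))"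
    "FArr F (p x (g (FObj F x)) (inv_arr ?B (e (FObj F x)))) = inv_arr ?B (e (FObj F x))" if x: "x \<in> Obj ?A" for
      x
    using p[of x "g (FObj F x)" "inv_arr ?B (e (FObj F x))"] x g[OF FF[OF x]] ei[OF FF[OF x]] e[OF FF[OF x]] by
      simp_all
  have h_iso: "iso_arr ?A (p x (g (FObj F x)) (inv_arr ?B (e (FObj F x))))" (is "iso_arr ?A ?h") if x:
    "x \<in> Obj ?A" for x
  proof -
    let ?y = "FObj F x"
    note [simp] = g[OF FF[OF x]] ei[OF FF[OF x]] e[OF FF[OF x]] x FF[OF x] h(2)[OF x] homD[OF h(1)[OF x]]
    let ?k = "p (g ?y) x (e ?y)"
    have k: "?k \<in> hom ?A (g ?y) x" "FArr F ?k = e ?y" using p[of "g ?y" x "e ?y"] by simp_all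
    note [simp] = homD[OF k(1)] k(2)
    have "?k \<cdot>[?A] ?h = Ident ?A x" by (rule F_faithful) (simp_all add: As FD)
    moreover have "?h \<cdot>[?A] ?k = Ident ?A (g ?y)" by (rule F_faithful) (simp_all add: As FD)
    ultimately have "inverse_arrs ?A ?h ?k" by (simp add: inverse_arrs_def hom_def)
    then show ?thesis unfolding iso_arr_def by blast
  qed
  have "is_ntrans ?eta"
  proof (rule is_ntransI[of "id_func ?A" "comp_func ?G F" ?A ?A])
    show "is_functor (comp_func ?G F)" using is_functor_comp_func[OF F G] by simp
    show "is_functor (id_func ?A)" by (rule is_functor_id_func) (rule A.category_axioms)
    show "NAt ?eta x \<in> hom ?A (FObj (id_func ?A) x) (FObj (comp_func ?G F) x)" if "x \<in> Obj ?A" for x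
      using h(1)[OF that] that FF[OF that] by (simp add: id_func_simps comp_func_simps)
    fix f assume f: "f \<in> Arr ?A"
    let ?x = "Dom ?A f" and ?y = "Cod ?A f"
    have xy: "?x \<in> Obj ?A" "?y \<in> Obj ?A" using f by (simp_all add: As)
    let ?h = "\<lambda>x. p x (g (FObj F x)) (inv_arr ?B (e (FObj F x)))"
    have Ff: "FArr F f \<in> Arr ?B" "Dom ?B (FArr F f) = FObj F ?x" "Cod ?B (FArr F f) = FObj F ?y" using FD f by
      simp_all
    have "?h ?y \<cdot>[?A] f = ga (FArr F f) \<cdot>[?A] ?h ?x"
    proof (rule F_faithful)
      have "FArr F (ga (FArr F f)) \<cdot>[?B] inv_arr ?B (e (FObj F ?x)) =
         inv_arr ?B (e (FObj F ?y)) \<cdot>[?B] (FArr F f \<cdot>[?B] (e (FObj F ?x) \<cdot>[?B] inv_arr ?B (e (FObj F ?x))))"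
        using ga(2)[OF Ff(1)] Ff e[OF FF[OF xy(1)]] e[OF FF[OF xy(2)]] ei(1-4)[OF FF[OF xy(1)]] ei(1-4)[OF FF[OF
          xy(2)]]
        by (simp add: Bs B.Comp_assoc)
      also have "\<dots> = inv_arr ?B (e (FObj F ?y)) \<cdot>[?B] FArr F f"
        using B.Comp_Ident_right[OF Ff(1)] Ff ei[OF FF[OF xy(1)]] e[OF FF[OF xy(1)]] by simp
      finally show "FArr F (?h ?y \<cdot>[?A] f) = FArr F (ga (FArr F f) \<cdot>[?A] ?h ?x)"
        using FD(6) f homD[OF h(1)[OF xy(1)]] homD[OF h(1)[OF xy(2)]] h(2)[OF xy(1)] h(2)[OF xy(2)] ga'[OF
          Ff(1)] Ff by simp
    qed (use f homD[OF h(1)[OF xy(1)]] homD[OF h(1)[OF xy(2)]] ga'[OF Ff(1)] Ff in \<open>simp_all add: As\<close>)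
    then show "NAt ?eta ?y \<cdot>[?A] FArr (id_func ?A) f = FArr (comp_func ?G F) f \<cdot>[?A] NAt ?eta ?x"
      using f xy Ff by (simp add: id_func_simps comp_func_simps)
  qed (simp_all add: id_func_simps comp_func_simps)
  then have "nat_isomorphic (id_func ?A) (comp_func ?G F)"
    unfolding nat_isomorphic_def using h_iso by (intro exI[of _ ?eta]) (simp add: id_func_simps)
  moreover
  let ?eps = "\<lparr>NDom = comp_func F ?G, NCod = id_func ?B, NAt = restrict e (Obj ?B)\<rparr>"
  have "is_ntrans ?eps"
  proof (rule is_ntransI[of "comp_func F ?G" "id_func ?B" ?B ?B])
    show "is_functor (comp_func F ?G)" using is_functor_comp_func[OF G F] by simp
    show "is_functor (id_func ?B)" by (rule is_functor_id_func) (rule B.category_axioms)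
  qed (use ge ga_nat in \<open>simp_all add: id_func_simps comp_func_simps Bs\<close>)
  then have "nat_isomorphic (comp_func F ?G) (id_func ?B)"
    unfolding nat_isomorphic_def using e by (intro exI[of _ ?eps]) (simp add: comp_func_simps)
  ultimately show "equivalence_functor F"
    unfolding equivalence_functor_def using F G by (intro conjI exI[of _ ?G]) simp_all
qed

subsection \<open>Descent data\<close>

context indexed_site
begin

lemma descentD:
  assumes "is_descent C F S d"
  shows "f \<in> S \<Longrightarrow> DObj d f \<in> Obj (PObj F (Dom C f))"
    "\<lbrakk>f \<in> S; g \<in> Arr C; Cod C g = Dom C f; Dom C g = W\<rbrakk> \<Longrightarrow> DIso d f g \<in> Arr (PObj F W)"
    "\<lbrakk>f \<in> S; g \<in> Arr C; Cod C g = Dom C f; Dom C g = W\<rbrakk> \<Longrightarrow> Dom (PObj F W) (DIso d f g) = res_obj F g (DObj d f)"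
    "\<lbrakk>f \<in> S; g \<in> Arr C; Cod C g = Dom C f; Dom C g = W\<rbrakk> \<Longrightarrow> Cod (PObj F W) (DIso d f g) = DObj d (f \<cdot>[C] g)"
    "\<lbrakk>f \<in> S; g \<in> Arr C; Cod C g = Dom C f; Dom C g = W\<rbrakk> \<Longrightarrow> iso_arr (PObj F W) (DIso d f g)"
    "\<lbrakk>f \<in> S; g \<in> Arr C; h \<in> Arr C; Cod C g = Dom C f; Cod C h = Dom C g\<rbrakk> \<Longrightarrow>
        DIso d f (g \<cdot>[C] h) \<cdot>[PObj F (Dom C h)] res_comp F g h (DObj d f) =
        DIso d (f \<cdot>[C] g) h \<cdot>[PObj F (Dom C h)] res_arr F h (DIso d f g)"
    "f \<in> S \<Longrightarrow> DIso d f (Ident C (Dom C f)) \<cdot>[PObj F (Dom C f)] res_unit F (Dom C f) (DObj d f) =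
        Ident (PObj F (Dom C f)) (DObj d f)"
  using assms unfolding is_descent_def Let_def by (auto simp: hom_def)

lemma descent_morD:
  assumes "is_descent_mor C F S u"
  shows "is_descent C F S (DDom u)" "is_descent C F S (DCod u)" "DAt u \<in> extensional S"
    "\<lbrakk>f \<in> S; Dom C f = V\<rbrakk> \<Longrightarrow> DAt u f \<in> Arr (PObj F V)"
    "\<lbrakk>f \<in> S; Dom C f = V\<rbrakk> \<Longrightarrow> Dom (PObj F V) (DAt u f) = DObj (DDom u) f"
    "\<lbrakk>f \<in> S; Dom C f = V\<rbrakk> \<Longrightarrow> Cod (PObj F V) (DAt u f) = DObj (DCod u) f"
    "\<lbrakk>f \<in> S; g \<in> Arr C; Cod C g = Dom C f\<rbrakk> \<Longrightarrow>
        DAt u (f \<cdot>[C] g) \<cdot>[PObj F (Dom C g)] DIso (DDom u) f g =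
        DIso (DCod u) f g \<cdot>[PObj F (Dom C g)] res_arr F g (DAt u f)"
  using assms unfolding is_descent_mor_def Let_def by (auto simp: hom_def)

lemma descent_cat_simps:
  "d \<in> Obj (descent_cat C F S) \<longleftrightarrow> is_descent C F S d"
  "u \<in> Arr (descent_cat C F S) \<longleftrightarrow> is_descent_mor C F S u"
  "Dom (descent_cat C F S) = DDom" "Cod (descent_cat C F S) = DCod"
  "DDom (Ident (descent_cat C F S) d) = d" "DCod (Ident (descent_cat C F S) d) = d"
  "DAt (Ident (descent_cat C F S) d) = restrict (\<lambda>f. Ident (PObj F (Dom C f)) (DObj d f)) S"
  "DDom (v \<cdot>[descent_cat C F S] u) = DDom u" "DCod (v \<cdot>[descent_cat C F S] u) = DCod v"
  "DAt (v \<cdot>[descent_cat C F S] u) = restrict (\<lambda>f. DAt v f \<cdot>[PObj F (Dom C f)] DAt u f) S"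
  by (simp_all add: descent_cat_def)

lemma descent_mor_eqI:
  fixes u v :: "('m, 'u, 'u) descent_mor"
  assumes "DDom u = DDom v" "DCod u = DCod v" "DAt u \<in> extensional S" "DAt v \<in> extensional S"
    "\<And>f. f \<in> S \<Longrightarrow> DAt u f = DAt v f"
  shows "u = v"
proof -
  have "DAt u = DAt v" using assms by (auto intro: extensionalityI)
  then show ?thesis using assms by simp
qed

context
  fixes U S
  assumes U: "U \<in> Obj C" and S: "sieve C U S"
begin

lemma category_descent: "category (descent_cat C F S)"
proof -
  have sv: "f \<in> Arr C" "Cod C f = U" "\<lbrakk>e \<in> Arr C; Cod C e = Dom C f\<rbrakk> \<Longrightarrow> f \<cdot>[C] e \<in> S" if "f \<in> S" for f e
    using sieveD[OF S that] by auto
  show ?thesis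
  proof (rule category.intro, unfold descent_cat_simps, goal_cases)
    case (3 d)
    note d = descentD[OF 3]
    show ?case
      unfolding is_descent_mor_def Let_def descent_cat_simps
    proof (intro conjI ballI impI)
      fix f g assume f: "f \<in> S" "g \<in> Arr C" "Cod C g = Dom C f"
      interpret D: category "PObj F (Dom C g)" using f by (simp add: category_PObj base_cat_simps)
      show "restrict (\<lambda>f. Ident (PObj F (Dom C f)) (DObj d f)) S (f \<cdot>[C] g) \<cdot>[PObj F (Dom C g)] DIso d f g =
        DIso d f g \<cdot>[PObj F (Dom C g)] res_arr F g (restrict (\<lambda>f. Ident (PObj F (Dom C f)) (DObj d f)) S f)"
        using f sv[OF f(1)] d(1-4)[OF f(1)] D.Comp_Ident_left[of "DIso d f g"] D.Comp_Ident_right[of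
          "DIso d f g"]
        by (simp add: idx_simps)
    qed (use 3 d sv in \<open>auto simp: hom_def idx_simps\<close>)
  next
    case (6 u v)
    note u = descent_morD[OF 6(1)] and v = descent_morD[OF 6(2)]
    show ?case
      unfolding is_descent_mor_def Let_def descent_cat_simps
    proof (intro conjI ballI impI)
      fix f g assume f: "f \<in> S" "g \<in> Arr C" "Cod C g = Dom C f"
      interpret D: category "PObj F (Dom C g)" using f by (simp add: category_PObj base_cat_simps)
      note [simp] = f sv[OF f(1)] 6(3) descentD(1-4)[OF u(1)] descentD(1-4)[OF v(1)] descentD(1-4)[OF v(2)]
        u(4-6) v(4-6)
      have "(DAt v (f \<cdot>[C] g) \<cdot>[PObj F (Dom C g)] DAt u (f \<cdot>[C] g)) \<cdot>[PObj F (Dom C g)] DIso (DDom u) f g =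
         (DAt v (f \<cdot>[C] g) \<cdot>[PObj F (Dom C g)] DIso (DDom v) f g) \<cdot>[PObj F (Dom C g)] res_arr F g (DAt u f)"
        using u(7)[OF f] by (simp add: D.Comp_assoc idx_simps)
      also have "\<dots> = DIso (DCod v) f g \<cdot>[PObj F (Dom C g)] res_arr F g (DAt v f \<cdot>[PObj F (Dom C f)] DAt u f)"
        unfolding v(7)[OF f] by (simp add: D.Comp_assoc idx_simps)
      finally show "restrict (\<lambda>f. DAt v f \<cdot>[PObj F (Dom C f)] DAt u f) S (f \<cdot>[C] g) \<cdot>[PObj F (Dom C g)] DIso
        (DDom u) f g =
        DIso (DCod v) f g \<cdot>[PObj F (Dom C g)] res_arr F g (restrict (\<lambda>f. DAt v f \<cdot>[PObj F (Dom C f)] DAt u f) S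
          f)"
        by (simp add: idx_simps)
    qed (use 6 u v sv in \<open>auto simp: hom_def idx_simps\<close>)
  next
    case (9 u)
    note u = descent_morD[OF 9]
    show ?case
      by (rule descent_mor_eqI) (use u sv category.id_left[OF category_PObj] in \<open>auto simp: descent_cat_simps
        base_cat_simps\<close>)
  next
    case (10 u)
    note u = descent_morD[OF 10]
    show ?case
      by (rule descent_mor_eqI) (use u sv category.id_right[OF category_PObj] in \<open>auto simp: descent_cat_simps
        base_cat_simps\<close>)
  next
    case (11 u v w)
    note u = descent_morD[OF 11(1)] and v = descent_morD[OF 11(2)] and w = descent_morD[OF 11(3)]
    show ?case
      by (rule descent_mor_eqI) (use 11(4,5) u v w sv category.Comp_assoc[OF category_PObj] in \<open>auto simp:
        descent_cat_simps base_cat_simps\<close>)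
  qed (simp_all add: descent_morD)
qed

text \<open>Componentwise inverses satisfy the compatibility with \<open>DIso\<close> automatically,
  by cancelling the invertible component at \<open>f \<cdot> g\<close>.\<close>

lemma iso_descent_iff:
  assumes u: "is_descent_mor C F S u"
  shows "iso_arr (descent_cat C F S) u \<longleftrightarrow> (\<forall>f\<in>S. iso_arr (PObj F (Dom C f)) (DAt u f))"
proof
  assume "iso_arr (descent_cat C F S) u"
  then obtain v where v: "is_descent_mor C F S v" "DDom v = DCod u" "DCod v = DDom u"
    "v \<cdot>[descent_cat C F S] u = Ident (descent_cat C F S) (DDom u)" "u \<cdot>[descent_cat C F S] v =
      Ident (descent_cat C F S) (DCod u)"
    unfolding iso_arr_def inverse_arrs_def hom_def by (auto simp: descent_cat_simps)
  have "inverse_arrs (PObj F (Dom C f)) (DAt u f) (DAt v f)" if f: "f \<in> S" for f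
    using arg_cong[OF v(4), of "\<lambda>w. DAt w f"] arg_cong[OF v(5), of "\<lambda>w. DAt w f"] f v(2,3) descent_morD(4-6)[OF
      u f refl] descent_morD(4-6)[OF v(1) f refl]
    by (simp add: inverse_arrs_def hom_def descent_cat_simps)
  then show "\<forall>f\<in>S. iso_arr (PObj F (Dom C f)) (DAt u f)" unfolding iso_arr_def by blast
next
  assume i: "\<forall>f\<in>S. iso_arr (PObj F (Dom C f)) (DAt u f)"
  note sv = sieveD[OF S]
  let ?v = "\<lparr>DDom = DCod u, DCod = DDom u, DAt = restrict (\<lambda>f. inv_arr (PObj F (Dom C f)) (DAt u f)) S\<rparr>"
  have ii: "inv_arr (PObj F V) (DAt u f) \<in> Arr (PObj F V)" "Dom (PObj F V) (inv_arr (PObj F V) (DAt u f)) =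
    DObj (DCod u) f"
    "Cod (PObj F V) (inv_arr (PObj F V) (DAt u f)) = DObj (DDom u) f"
    "inv_arr (PObj F V) (DAt u f) \<cdot>[PObj F V] DAt u f = Ident (PObj F V) (DObj (DDom u) f)"
    "DAt u f \<cdot>[PObj F V] inv_arr (PObj F V) (DAt u f) = Ident (PObj F V) (DObj (DCod u) f)" if f: "f \<in> S"
      "Dom C f = V" for f V
    using category.inv_arr_simps[OF category_PObj, of V "DAt u f"] i descent_morD(4-6)[OF u f] f sv[OF f(1)] by
      (auto simp: base_cat_simps)
  have v: "is_descent_mor C F S ?v"
    unfolding is_descent_mor_def Let_def descent_mor.simps
  proof (intro conjI ballI impI)
    fix f g assume f: "f \<in> S" "g \<in> Arr C" "Cod C g = Dom C f"
    let ?A = "PObj F (Dom C g)"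
    interpret D: category ?A using f by (simp add: category_PObj base_cat_simps)
    note [simp] = f sv[OF f(1)] descentD(1-4)[OF descent_morD(1)[OF u]] descentD(1-4)[OF descent_morD(2)[OF u]]
      descent_morD(4-6)[OF u] ii(1-3)
    have fg: "f \<cdot>[C] g \<in> S" "Dom C (f \<cdot>[C] g) = Dom C g" by (simp_all add: base_cat_simps)
    have ig: "iso_arr ?A (DAt u (f \<cdot>[C] g))" using i fg by metis
    have r: "res_arr F g (DAt u f) \<cdot>[?A] res_arr F g (inv_arr (PObj F (Dom C f)) (DAt u f)) =
      Ident ?A (res_obj F g (DObj (DCod u) f))"
      using res_simps(6)[of g "Dom C f" "inv_arr (PObj F (Dom C f)) (DAt u f)" "DAt u f"] ii(5)[OF f(1) refl] by
        (simp add: idx_simps)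
    have "inv_arr ?A (DAt u (f \<cdot>[C] g)) \<cdot>[?A] DIso (DCod u) f g = DIso (DDom u) f g \<cdot>[?A] res_arr F g (inv_arr
      (PObj F (Dom C f)) (DAt u f))"
    proof (rule D.iso_cancel_left[OF ig])
      have "DAt u (f \<cdot>[C] g) \<cdot>[?A] (DIso (DDom u) f g \<cdot>[?A] res_arr F g (inv_arr (PObj F (Dom C f)) (DAt u
        f))) =
        DIso (DCod u) f g \<cdot>[?A] (res_arr F g (DAt u f) \<cdot>[?A] res_arr F g (inv_arr (PObj F (Dom C f)) (DAt u
          f)))"
        using descent_morD(7)[OF u f] fg by (simp add: idx_simps flip: D.Comp_assoc)
      also have "\<dots> = DIso (DCod u) f g"
        unfolding r using D.Comp_Ident_right[of "DIso (DCod u) f g"] by simp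
      finally show "DAt u (f \<cdot>[C] g) \<cdot>[?A] (inv_arr ?A (DAt u (f \<cdot>[C] g)) \<cdot>[?A] DIso (DCod u) f g) =
        DAt u (f \<cdot>[C] g) \<cdot>[?A] (DIso (DDom u) f g \<cdot>[?A] res_arr F g (inv_arr (PObj F (Dom C f)) (DAt u f)))"
        using D.inv_comp_cancel(2)[OF ig, of "DIso (DCod u) f g"] fg by simp
    qed (use fg in \<open>simp_all add: idx_simps\<close>)
    then show "restrict (\<lambda>f. inv_arr (PObj F (Dom C f)) (DAt u f)) S (f \<cdot>[C] g) \<cdot>[?A] DIso (DCod u) f g =
      DIso (DDom u) f g \<cdot>[?A] res_arr F g (restrict (\<lambda>f. inv_arr (PObj F (Dom C f)) (DAt u f)) S f)"
      using fg by simp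
  qed (use descent_morD(1,2)[OF u] ii in \<open>auto simp: hom_def\<close>)
  have "?v \<cdot>[descent_cat C F S] u = Ident (descent_cat C F S) (DDom u)"
    by (rule descent_mor_eqI) (use ii in \<open>auto simp: descent_cat_simps\<close>)
  moreover have "u \<cdot>[descent_cat C F S] ?v = Ident (descent_cat C F S) (DCod u)"
    by (rule descent_mor_eqI) (use ii in \<open>auto simp: descent_cat_simps\<close>)
  ultimately show "iso_arr (descent_cat C F S) u"
    unfolding iso_arr_def inverse_arrs_def using u v by (intro exI[of _ ?v]) (simp add: descent_cat_simps
      hom_def)
qed

lemma canonical_descent_simps:
  "f \<in> S \<Longrightarrow> DObj (canonical_descent C F S x) f = res_obj F f x"
  "\<lbrakk>f \<in> S; g \<in> Arr C; Cod C g = Dom C f\<rbrakk> \<Longrightarrow> DIso (canonical_descent C F S x) f g = res_comp F f g x"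
  by (simp_all add: canonical_descent_def)

text \<open>The cocycle condition is \<open>res_comp_assoc\<close> and the unit condition is
  \<open>res_unit_right\<close>.\<close>

lemma is_descent_canonical:
  assumes x: "x \<in> Obj (PObj F U)"
  shows "is_descent C F S (canonical_descent C F S x)"
  unfolding is_descent_def Let_def
proof (intro conjI ballI impI)
  show "DObj (canonical_descent C F S x) \<in> extensional S" by (simp add: canonical_descent_def)
  show "\<forall>f g. \<not> (f \<in> S \<and> g \<in> Arr C \<and> Cod C g = Dom C f) \<longrightarrow> DIso (canonical_descent C F S x) f g = undefined"
    by (simp add: canonical_descent_def)
qed (use x sieveD[OF S] res_comp_assoc[of _ _ _ x] res_unit_right[of _ x] in
    \<open>auto simp: canonical_descent_simps hom_def idx_simps\<close>)

lemma canonical_functor_simps: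
  "FDom (canonical_functor C F U S) = PObj F U" "FCod (canonical_functor C F U S) = descent_cat C F S"
  "x \<in> Obj (PObj F U) \<Longrightarrow> FObj (canonical_functor C F U S) x = canonical_descent C F S x"
  "u \<in> Arr (PObj F U) \<Longrightarrow> FArr (canonical_functor C F U S) u =
    \<lparr>DDom = canonical_descent C F S (Dom (PObj F U) u), DCod = canonical_descent C F S (Cod (PObj F U) u),
       DAt = restrict (\<lambda>f. res_arr F f u) S\<rparr>"
  by (simp_all add: canonical_functor_def)

text \<open>Links the two definitions: it turns full faithfulness of the canonical functor into
  unique gluing of compatible families, which is the prestack condition.\<close>

lemma hom_canonical:
  assumes ab: "a \<in> Obj (PObj F U)" "b \<in> Obj (PObj F U)"
  shows "hom (descent_cat C F S) (canonical_descent C F S a) (canonical_descent C F S b) =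
    {\<lparr>DDom = canonical_descent C F S a, DCod = canonical_descent C F S b, DAt = restrict s S\<rparr> | s. compatible S
      a b s}"
    (is "?l = ?r")
proof (intro equalityI subsetI)
  note sv = sieveD[OF S] and ca = is_descent_canonical[OF ab(1)] and cb = is_descent_canonical[OF ab(2)]
  fix u assume "u \<in> ?l"
  then have u: "is_descent_mor C F S u" "DDom u = canonical_descent C F S a" "DCod u =
    canonical_descent C F S b"
    by (simp_all add: hom_def descent_cat_simps)
  have "compatible S a b (DAt u)"
    unfolding compatible_def using descent_morD(4-7)[OF u(1)] u by (auto simp: hom_def canonical_descent_simps)
  moreover have "u = \<lparr>DDom = canonical_descent C F S a, DCod = canonical_descent C F S b, DAt =
    restrict (DAt u) S\<rparr>"
    by (rule descent_mor_eqI) (use u descent_morD(3)[OF u(1)] in auto)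
  ultimately show "u \<in> ?r" by blast
next
  note sv = sieveD[OF S] and ca = is_descent_canonical[OF ab(1)] and cb = is_descent_canonical[OF ab(2)]
  fix u assume "u \<in> ?r"
  then obtain s where s: "compatible S a b s" and u: "u = \<lparr>DDom = canonical_descent C F S a, DCod =
    canonical_descent C F S b, DAt = restrict s S\<rparr>"
    by blast
  show "u \<in> ?l"
    using s ca cb sv unfolding u hom_def descent_cat_simps compatible_def
    by (auto simp: is_descent_mor_def canonical_descent_simps hom_def)
qed

lemma compatible_res_arr:
  assumes u: "u \<in> Arr (PObj F U)"
  shows "compatible S (Dom (PObj F U) u) (Cod (PObj F U) u) (\<lambda>f. res_arr F f u)"
  unfolding compatible_def
proof (intro conjI ballI impI)
  fix f assume f: "f \<in> S"
  note sv = sieveD[OF S f]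
  show "res_arr F f u \<in> hom (PObj F (Dom C f)) (res_obj F f (Dom (PObj F U) u)) (res_obj F f (Cod (PObj F U)
    u))"
    using u sv by (simp add: hom_def res_simps)
  fix g assume "g \<in> Arr C" "Cod C g = Dom C f"
  then show "res_arr F (f \<cdot>[C] g) u \<cdot>[PObj F (Dom C g)] res_comp F f g (Dom (PObj F U) u) =
      res_comp F f g (Cod (PObj F U) u) \<cdot>[PObj F (Dom C g)] res_arr F g (res_arr F f u)"
    using res_comp_natural[of f g u] u sv by simp
qed

lemma is_functor_canonical: "is_functor (canonical_functor C F U S)"
proof (rule is_functorI[OF category_PObj[OF U] category_descent])
  note sv = sieveD[OF S]
  interpret A: category "PObj F U" by (rule category_PObj[OF U])
  show "FArr (canonical_functor C F U S) u \<in> hom (descent_cat C F S) (FObj (canonical_functor C F U S) (Dom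
    (PObj F U) u))
      (FObj (canonical_functor C F U S) (Cod (PObj F U) u))" if u: "u \<in> Arr (PObj F U)" for u
  proof -
    show ?thesis using compatible_res_arr[OF u] hom_canonical[OF A.Dom_in[OF u] A.Cod_in[OF u]] u by (auto simp:
      canonical_functor_simps A.Dom_in A.Cod_in)
  qed
  show "FArr (canonical_functor C F U S) (Ident (PObj F U) x) =
    Ident (descent_cat C F S) (FObj (canonical_functor C F U S) x)"
    if "x \<in> Obj (PObj F U)" for x
    by (rule descent_mor_eqI) (use that sv in \<open>auto simp: canonical_functor_simps descent_cat_simps
      canonical_descent_simps
      A.Ident_in A.Dom_Ident A.Cod_Ident res_simps\<close>)
  show "FArr (canonical_functor C F U S) (v \<cdot>[PObj F U] u) = FArr (canonical_functor C F U S) v \<cdot>[descent_cat C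
    F S] FArr (canonical_functor C F U S) u"
    if "u \<in> Arr (PObj F U)" "v \<in> Arr (PObj F U)" "Cod (PObj F U) u = Dom (PObj F U) v" for u v
    by (rule descent_mor_eqI) (use that sv in \<open>auto simp: canonical_functor_simps descent_cat_simps
      canonical_descent_simps
      A.Comp_in A.Dom_Comp A.Cod_Comp res_simps\<close>)
  show "FObj (canonical_functor C F U S) x \<in> Obj (descent_cat C F S)" if "x \<in> Obj (PObj F U)" for x
    using that is_descent_canonical by (simp add: canonical_functor_simps descent_cat_simps)
qed (simp_all add: canonical_functor_def)

lemma fully_faithful_canonical_iff:
  "fully_faithful (canonical_functor C F U S) \<longleftrightarrow>
    (\<forall>a\<in>Obj (PObj F U). \<forall>b\<in>Obj (PObj F U). \<forall>s. compatible S a b s \<longrightarrow>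
     (\<exists>!t. t \<in> hom (PObj F U) a b \<and> (\<forall>f\<in>S. res_arr F f t = s f)))"
proof -
  let ?K = "canonical_functor C F U S" and ?A = "PObj F U"
  have "bij_betw (FArr ?K) (hom ?A a b) (hom (descent_cat C F S) (canonical_descent C F S a) (canonical_descent
    C F S b)) \<longleftrightarrow>
    (\<forall>s. compatible S a b s \<longrightarrow> (\<exists>!t. t \<in> hom ?A a b \<and> (\<forall>f\<in>S. res_arr F f t = s f)))" (is "?l \<longleftrightarrow> ?r")
    if ab: "a \<in> Obj ?A" "b \<in> Obj ?A" for a b
  proof -
    let ?m = "\<lambda>s. \<lparr>DDom = canonical_descent C F S a, DCod = canonical_descent C F S b, DAt = restrict s S\<rparr>"
    have K: "FArr ?K t = ?m (\<lambda>f. res_arr F f t)" if "t \<in> hom ?A a b" for t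
      using that by (auto simp: canonical_functor_simps hom_def)
    have m: "?m s = ?m s' \<longleftrightarrow> (\<forall>f\<in>S. s f = s' f)" for s s' by (auto simp: restrict_def fun_eq_iff)
    have into: "FArr ?K t \<in> hom (descent_cat C F S) (canonical_descent C F S a) (canonical_descent C F S b)" if
      "t \<in> hom ?A a b" for t
      using is_functorD(6-8)[OF is_functor_canonical, unfolded canonical_functor_simps(1,2)] that ab
      by (auto simp: hom_def canonical_functor_simps)
    have "?l \<longleftrightarrow> (\<forall>w\<in>hom (descent_cat C F S) (canonical_descent C F S a) (canonical_descent C F S b). \<exists>!t. t \<in> hom
      ?A a b \<and> FArr ?K t = w)"
      using into by (rule bij_betw_iff_ex1)
    also have "\<dots> \<longleftrightarrow> (\<forall>s. compatible S a b s \<longrightarrow> (\<exists>!t. t \<in> hom ?A a b \<and> FArr ?K t = ?m s))"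
      unfolding hom_canonical[OF ab] by (simp only: setcompr_eq_image ball_simps)
    also have "\<dots> \<longleftrightarrow> ?r"
    proof -
      have "t \<in> hom ?A a b \<and> FArr ?K t = ?m s \<longleftrightarrow> t \<in> hom ?A a b \<and> (\<forall>f\<in>S. res_arr F f t = s f)" for t s
        using K[of t] m[of "\<lambda>f. res_arr F f t" s] by auto
      then show ?thesis by (simp only:)
    qed
    finally show ?thesis .
  qed
  then show ?thesis
    unfolding fully_faithful_def canonical_functor_simps(1,2) using is_functor_canonical
    by (simp add: canonical_functor_simps(3))
qed

lemma essentially_surjective_canonical_iff:
  "essentially_surjective (canonical_functor C F U S) \<longleftrightarrow>
    (\<forall>d. is_descent C F S d \<longrightarrow> (\<exists>x\<in>Obj (PObj F U). \<exists>\<phi>. \<forall>f\<in>S.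
       \<phi> f \<in> hom (PObj F (Dom C f)) (res_obj F f x) (DObj d f) \<and> iso_arr (PObj F (Dom C f)) (\<phi> f) \<and>
       (\<forall>g\<in>Arr C. Cod C g = Dom C f \<longrightarrow> \<phi> (f \<cdot>[C] g) \<cdot>[PObj F (Dom C g)] res_comp F f g x =
         DIso d f g \<cdot>[PObj F (Dom C g)] res_arr F g (\<phi> f))))"
proof -
  note sv = sieveD[OF S]
  have obj: "Obj (descent_cat C F S) = {d. is_descent C F S d}" by (simp add: descent_cat_def)
  have "(\<exists>u\<in>hom (descent_cat C F S) (canonical_descent C F S x) d. iso_arr (descent_cat C F S) u) \<longleftrightarrow>
     (\<exists>\<phi>. \<forall>f\<in>S. \<phi> f \<in> hom (PObj F (Dom C f)) (res_obj F f x) (DObj d f) \<and> iso_arr (PObj F (Dom C f)) (\<phi> f) \<and>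
       (\<forall>g\<in>Arr C. Cod C g = Dom C f \<longrightarrow> \<phi> (f \<cdot>[C] g) \<cdot>[PObj F (Dom C g)] res_comp F f g x =
         DIso d f g \<cdot>[PObj F (Dom C g)] res_arr F g (\<phi> f)))" (is "?l \<longleftrightarrow> ?r")
    if x: "x \<in> Obj (PObj F U)" and d: "is_descent C F S d" for x d
  proof
    assume ?l
    then obtain u where u: "is_descent_mor C F S u" "DDom u = canonical_descent C F S x" "DCod u = d"
      "iso_arr (descent_cat C F S) u"
      by (auto simp: hom_def descent_cat_simps)
    then show ?r
      using iso_descent_iff[OF u(1)] descent_morD(4-7)[OF u(1)] by (intro exI[of _ "DAt u"]) (auto simp: hom_def
        canonical_descent_simps)
  next
    assume ?r
    then obtain \<phi> where \<phi>: "\<forall>f\<in>S. \<phi> f \<in> hom (PObj F (Dom C f)) (res_obj F f x) (DObj d f) \<and>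
      iso_arr (PObj F (Dom C f)) (\<phi> f) \<and>
       (\<forall>g\<in>Arr C. Cod C g = Dom C f \<longrightarrow> \<phi> (f \<cdot>[C] g) \<cdot>[PObj F (Dom C g)] res_comp F f g x =
         DIso d f g \<cdot>[PObj F (Dom C g)] res_arr F g (\<phi> f))" by blast
    let ?u = "\<lparr>DDom = canonical_descent C F S x, DCod = d, DAt = restrict \<phi> S\<rparr>"
    have u: "is_descent_mor C F S ?u"
      unfolding is_descent_mor_def using \<phi> d is_descent_canonical[OF x] sv by (auto simp:
        canonical_descent_simps)
    then show ?l
      using iso_descent_iff[OF u] \<phi> by (intro bexI[of _ ?u]) (auto simp: hom_def descent_cat_simps)
  qed
  then show ?thesis
    unfolding essentially_surjective_def canonical_functor_simps(1,2)
    by (simp add: canonical_functor_simps(3) obj)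
qed

end

text \<open>Essential surjectivity of the canonical functors of all covering sieves, with
  isomorphisms of descent data written out componentwise.\<close>

definition effective :: bool where
  "effective \<longleftrightarrow> (\<forall>U\<in>Obj C. \<forall>S\<in>J U. \<forall>d. is_descent C F S d \<longrightarrow> (\<exists>x\<in>Obj (PObj F U). \<exists>\<phi>. \<forall>f\<in>S.
       \<phi> f \<in> hom (PObj F (Dom C f)) (res_obj F f x) (DObj d f) \<and> iso_arr (PObj F (Dom C f)) (\<phi> f) \<and>
       (\<forall>g\<in>Arr C. Cod C g = Dom C f \<longrightarrow> \<phi> (f \<cdot>[C] g) \<cdot>[PObj F (Dom C g)] res_comp F f g x =
         DIso d f g \<cdot>[PObj F (Dom C g)] res_arr F g (\<phi> f))))"

lemma prestack_iff_glues: "prestack_condition C J F \<longleftrightarrow> glues"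
  using prestack_if_glues glues_if_prestack by blast

text \<open>An equivalence is a functor that is full, faithful and essentially surjective; for the
  canonical functors the first two properties form \<open>glues\<close> and the third is
  \<open>effective\<close>.\<close>

lemma stack_iff: "stack_condition C J F \<longleftrightarrow> glues \<and> effective"
proof -
  have "equivalence_functor (canonical_functor C F U S) \<longleftrightarrow>
    fully_faithful (canonical_functor C F U S) \<and> essentially_surjective (canonical_functor C F U S)"
    if "U \<in> Obj C" "S \<in> J U" for U S
    using that J.covers_sieve equivalence_functor_iff is_functor_canonical by blast
  then show ?thesis
    unfolding stack_condition_def glues_def effective_def
    using fully_faithful_canonical_iff essentially_surjective_canonical_iff J.covers_sieve by (simp add:
      ball_conj_distrib)
qed

end

section \<open>Gluing and descent in the Grothendieck construction\<close>

context indexed_category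
begin

text \<open>Naturality of the chosen lifts: both composites are the arrow over g with fibre
  component \<open>res_arr F g m\<close>.\<close>

lemma lift_vertical_res:
  assumes [simp]: "g \<in> Arr C" "m \<in> Arr (PObj F (Cod C g))"
  shows "lift g (Cod (PObj F (Cod C g)) m) \<cdot>[total] vertical (Dom C g) (res_arr F g m) =
    vertical (Cod C g) m \<cdot>[total] lift g (Dom (PObj F (Cod C g)) m)"
proof -
  let ?y = "Cod (PObj F (Cod C g)) m" and ?V = "Dom C g"
  interpret D: category "PObj F ?V" by (simp add: category_PObj idx_simps)
  have "(g, res_arr F g m, ?y) \<in> Arr total" by (simp add: total_simps idx_simps)
  then have "lift g ?y \<cdot>[total] vertical ?V (res_arr F g m) = (g, res_arr F g m, ?y)" by (rule lift_vertical)
  moreover have "res_comp F (Ident C (Cod C g)) g ?y \<cdot>[PObj F ?V] (res_arr F g (res_unit F (Cod C g) ?y) \<cdot>[PObj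
    F ?V] res_arr F g m) = res_arr F g m"
    using res_unit_left[of g ?y] D.id_left[of "res_arr F g m"] by (simp add: idx_simps flip: D.Comp_assoc)
  ultimately show ?thesis
    by (simp add: vertical_def lift_def total_simps idx_simps C.Comp_Ident_left D.id_right D.Comp_assoc)
qed

text \<open>Identifies \<open>res_comp\<close> as the vertical comparison between a composite of
  chosen lifts and the chosen lift of the composite.\<close>

lemma lift_comp:
  assumes [simp]: "f \<in> Arr C" "g \<in> Arr C" "Cod C g = Dom C f" "x \<in> Obj (PObj F (Cod C f))"
  shows "lift (f \<cdot>[C] g) x \<cdot>[total] vertical (Dom C g) (res_comp F f g x) = lift f x \<cdot>[total] lift g (res_obj F
    f x)"
proof -
  interpret D: category "PObj F (Dom C g)" by (simp add: category_PObj idx_simps)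
  have "(f \<cdot>[C] g, res_comp F f g x, x) \<in> Arr total" by (simp add: total_simps idx_simps)
  from lift_vertical[OF this] show ?thesis
    by (simp add: lift_def total_simps idx_simps D.id_left D.id_right)
qed

lemma lift_unit:
  assumes "U \<in> Obj C" "x \<in> Obj (PObj F U)"
  shows "lift (Ident C U) x \<cdot>[total] vertical U (res_unit F U x) = Ident total (U, x)"
proof -
  have "(Ident C U, res_unit F U x, x) \<in> Arr total" using assms by (simp add: total_simps idx_simps)
  from lift_vertical[OF this] show ?thesis using assms by (simp add: total_simps idx_simps)
qed

end

context indexed_site
begin

text \<open>With \<open>c f\<close> written as \<open>(f, \<gamma> f, x)\<close> and
  \<open>s f\<close> as \<open>(g \<cdot> f, \<rho> f, y)\<close>, an arrow \<open>(g, t, y)\<close>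
  is a solution iff t restricts to a certain \<open>r f\<close> along each f. The problem thus
  becomes gluing in one fibre, from x to the restriction of y along g.\<close>

lemma total_glue:
  assumes "glues" and z: "z \<in> Obj total" and z': "z' \<in> Obj total" and S: "S \<in> J (fst z)" and g:
    "g \<in> hom C (fst z) (fst z')"
    and c: "\<And>f. f \<in> S \<Longrightarrow> cartesian C total (c f) \<and> Cod total (c f) = z \<and> fst (c f) = f"
    and s: "\<And>f. f \<in> S \<Longrightarrow> s f \<in> hom total (Dom total (c f)) z' \<and> fst (s f) = g \<cdot>[C] f"
    and k: "\<And>f e. \<lbrakk>f \<in> S; e \<in> Arr C; Cod C e = Dom C f\<rbrakk> \<Longrightarrow>
         k f e \<in> hom total (Dom total (c (f \<cdot>[C] e))) (Dom total (c f)) \<and> fst (k f e) = e \<and>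
         c f \<cdot>[total] k f e = c (f \<cdot>[C] e) \<and> s f \<cdot>[total] k f e = s (f \<cdot>[C] e)"
  shows "\<exists>!t. t \<in> hom total z z' \<and> fst t = g \<and> (\<forall>f\<in>S. t \<cdot>[total] c f = s f)"
proof -
  obtain U x U' y where e: "z = (U, x)" "z' = (U', y)" by (cases z, cases z')
  have [simp]: "U \<in> Obj C" "x \<in> Obj (PObj F U)" "U' \<in> Obj C" "y \<in> Obj (PObj F U')" "g \<in> Arr C" "Dom C g = U"
    "Cod C g = U'"
    using z z' g by (auto simp: e total_simps hom_def)
  let ?A = "\<lambda>f. PObj F (Dom C f)" and ?yg = "res_obj F g y"
  have Sv: "f \<in> Arr C" "Cod C f = U" "\<lbrakk>e \<in> Arr C; Cod C e = Dom C f\<rbrakk> \<Longrightarrow> f \<cdot>[C] e \<in> S" if "f \<in> S" for f e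
    using sieveD[OF J.covers_sieve[of U S] that] S by (auto simp: e)
  define \<gamma> where "\<gamma> f = fst (snd (c f))" for f
  define \<rho> where "\<rho> f = fst (snd (s f))" for f
  define p where "p f = Dom (?A f) (\<gamma> f)" for f
  have c': "c f = (f, \<gamma> f, x)" "\<gamma> f \<in> Arr (?A f)" "Cod (?A f) (\<gamma> f) = res_obj F f x" "iso_arr (?A f) (\<gamma> f)"
    "Dom total (c f) = (Dom C f, p f)" if f: "f \<in> S" for f
  proof -
    have ca: "c f \<in> Arr total" using c[OF f] by (simp add: cartesian_def)
    show 1: "c f = (f, \<gamma> f, x)" using c[OF f] by (cases "c f") (auto simp: \<gamma>_def e total_simps)
    show "\<gamma> f \<in> Arr (?A f)" "Cod (?A f) (\<gamma> f) = res_obj F f x" "Dom total (c f) = (Dom C f, p f)"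
      using ca unfolding 1 by (auto simp: total_simps p_def)
    show "iso_arr (?A f) (\<gamma> f)" using c[OF f] ca cartesian_iff[of f "\<gamma> f" x] by (simp add: 1)
  qed
  have s': "s f = (g \<cdot>[C] f, \<rho> f, y)" "\<rho> f \<in> Arr (?A f)" "Cod (?A f) (\<rho> f) = res_obj F (g \<cdot>[C] f) y"
    "Dom (?A f) (\<rho> f) = p f" if f: "f \<in> S" for f
  proof -
    show 1: "s f = (g \<cdot>[C] f, \<rho> f, y)" using s[OF f] by (cases "s f") (auto simp: \<rho>_def e total_simps hom_def)
    show "\<rho> f \<in> Arr (?A f)" "Cod (?A f) (\<rho> f) = res_obj F (g \<cdot>[C] f) y" "Dom (?A f) (\<rho> f) = p f"
      using s[OF f] Sv[OF f] unfolding 1 c'(5)[OF f] by (auto simp: total_simps hom_def base_cat_simps)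
  qed
  have rc: "iso_arr (?A f) (res_comp F g f y)" "res_comp F g f y \<in> Arr (?A f)" "Dom (?A f) (res_comp F g f y) =
    res_obj F f ?yg"
    "Cod (?A f) (res_comp F g f y) = res_obj F (g \<cdot>[C] f) y" if f: "f \<in> S" for f
    using Sv[OF f] by (simp_all add: idx_simps)
  \<comment> \<open>The solution of
    \<open>res_comp g f y \<cdot> (r f \<cdot> \<gamma> f) = \<rho> f\<close>. It exists because
    \<open>\<gamma> f\<close> is invertible, \<open>c f\<close> being cartesian.\<close>
  define r where "r f = inv_arr (?A f) (res_comp F g f y) \<cdot>[?A f] (\<rho> f \<cdot>[?A f] inv_arr (?A f) (\<gamma> f))" for f
  have r: "r f \<in> Arr (?A f)" "Dom (?A f) (r f) = res_obj F f x" "Cod (?A f) (r f) = res_obj F f ?yg"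
    "res_comp F g f y \<cdot>[?A f] (r f \<cdot>[?A f] \<gamma> f) = \<rho> f"
    "\<lbrakk>q \<in> Arr (?A f); Dom (?A f) q = res_obj F f x; Cod (?A f) q = res_obj F f ?yg;
      res_comp F g f y \<cdot>[?A f] (q \<cdot>[?A f] \<gamma> f) = \<rho> f\<rbrakk> \<Longrightarrow> q = r f" if f: "f \<in> S" for f q
  proof -
    interpret D: category "?A f" using Sv[OF f] by (simp add: category_PObj base_cat_simps)
    note i = D.inv_arr_simps[OF rc(1)[OF f]] and j = D.inv_arr_simps[OF c'(4)[OF f]]
    note [simp] = i j rc[OF f] c'(2,3)[OF f] s'(2-4)[OF f]
    have pf: "Dom (?A f) (\<gamma> f) = p f" by (simp add: p_def)
    show r: "r f \<in> Arr (?A f)" "Dom (?A f) (r f) = res_obj F f x" "Cod (?A f) (r f) = res_obj F f ?yg"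
      by (simp_all add: r_def pf D.Comp_in D.Dom_Comp D.Cod_Comp)
    have "r f \<cdot>[?A f] \<gamma> f = inv_arr (?A f) (res_comp F g f y) \<cdot>[?A f] \<rho> f"
      using D.inv_comp_cancel(3)[OF c'(4)[OF f], of "\<rho> f"] by (simp add: r_def pf D.Comp_in D.Dom_Comp
        D.Cod_Comp D.Comp_assoc D.id_right)
    then show r4: "res_comp F g f y \<cdot>[?A f] (r f \<cdot>[?A f] \<gamma> f) = \<rho> f"
      using D.inv_comp_cancel(2)[OF rc(1)[OF f], of "\<rho> f"] by simp
    assume q: "q \<in> Arr (?A f)" "Dom (?A f) q = res_obj F f x" "Cod (?A f) q = res_obj F f ?yg"
      "res_comp F g f y \<cdot>[?A f] (q \<cdot>[?A f] \<gamma> f) = \<rho> f"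
    have "q \<cdot>[?A f] \<gamma> f = r f \<cdot>[?A f] \<gamma> f"
      by (rule D.iso_cancel_left[OF rc(1)[OF f]]) (use q r r4 in \<open>simp_all add: D.Comp_in D.Cod_Comp\<close>)
    then show "q = r f"
      by (rule D.iso_cancel_right[OF c'(4)[OF f]]) (use q r in simp_all)
  qed
  have "compatible S x ?yg r"
    unfolding compatible_def
  proof (intro conjI ballI impI)
    show "r f \<in> hom (?A f) (res_obj F f x) (res_obj F f ?yg)" if "f \<in> S" for f using r(1-3)[OF that] by (simp
      add: hom_def)
    fix f h assume f: "f \<in> S" and h [simp]: "h \<in> Arr C" "Cod C h = Dom C f"
    note fh = Sv(3)[OF f h]
    have D: "Dom C (f \<cdot>[C] h) = Dom C h" using Sv[OF f] by (simp add: base_cat_simps)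
    let ?B = "?A h"
    interpret D: category ?B by (simp add: category_PObj base_cat_simps)
    note [simp] = Sv(1,2)[OF f] r(1-3)[OF f] r(1-3)[OF fh, unfolded D] c'(2-4)[OF f] c'(2,3)[OF fh, unfolded D]
      s'(2,3)[OF f] rc(2-4)[OF f]
    \<comment> \<open>The fibre component of the transition arrow. \<open>E1\<close> and
      \<open>E2\<close> below are its compatibility with c and with s, written in the fibre.\<close>
    define \<kappa> where "\<kappa> = fst (snd (k f h))"
    have k': "k f h = (h, \<kappa>, p f)" "\<kappa> \<in> Arr ?B" "Dom ?B \<kappa> = p (f \<cdot>[C] h)" "Cod ?B \<kappa> = res_obj F h (p f)"
    proof -
      have kf: "k f h \<in> hom total (Dom C h, p (f \<cdot>[C] h)) (Dom C f, p f)" "fst (k f h) = h"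
        using k[OF f h] c'(5)[OF f] c'(5)[OF fh] D by auto
      then show 1: "k f h = (h, \<kappa>, p f)" by (cases "k f h") (auto simp: \<kappa>_def hom_def total_simps)
      show "\<kappa> \<in> Arr ?B" "Dom ?B \<kappa> = p (f \<cdot>[C] h)" "Cod ?B \<kappa> = res_obj F h (p f)"
        using kf unfolding 1 by (auto simp: hom_def total_simps)
    qed
    note [simp] = k'(2-4)
    have pf [simp]: "Dom (?A f) (\<gamma> f) = p f" "Dom (?A f) (\<rho> f) = p f" using s'(4)[OF f] by (simp_all add: p_def)
    have E1: "\<gamma> (f \<cdot>[C] h) = res_comp F f h x \<cdot>[?B] (res_arr F h (\<gamma> f) \<cdot>[?B] \<kappa>)"
      using k[OF f h] unfolding c'(1)[OF f] c'(1)[OF fh] k'(1) total_simps by simp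
    have E2: "\<rho> (f \<cdot>[C] h) = res_comp F (g \<cdot>[C] f) h y \<cdot>[?B] (res_arr F h (\<rho> f) \<cdot>[?B] \<kappa>)"
      using k[OF f h] unfolding s'(1)[OF f] s'(1)[OF fh] k'(1) total_simps by simp
    have "res_comp F g (f \<cdot>[C] h) y \<cdot>[?B] (r (f \<cdot>[C] h) \<cdot>[?B] \<gamma> (f \<cdot>[C] h)) = \<rho> (f \<cdot>[C] h)"
      using r(4)[OF fh] D by simp
    also have "\<dots> = res_comp F (g \<cdot>[C] f) h y \<cdot>[?B] (res_arr F h (res_comp F g f y \<cdot>[?A f] (r f \<cdot>[?A f] \<gamma>
      f)) \<cdot>[?B] \<kappa>)"
      unfolding E2 r(4)[OF f] ..
    also have "\<dots> = (res_comp F (g \<cdot>[C] f) h y \<cdot>[?B] res_arr F h (res_comp F g f y)) \<cdot>[?B] (res_arr F h (r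
      f) \<cdot>[?B] (res_arr F h (\<gamma> f) \<cdot>[?B] \<kappa>))"
      by (simp add: idx_simps D.Comp_assoc)
    also have "\<dots> = res_comp F g (f \<cdot>[C] h) y \<cdot>[?B] ((res_comp F f h ?yg \<cdot>[?B] res_arr F h (r f)) \<cdot>[?B] (res_arr
      F h (\<gamma> f) \<cdot>[?B] \<kappa>))"
      using res_comp_assoc[of g f h y] by (simp add: idx_simps D.Comp_assoc C.Comp_assoc)
    finally have "r (f \<cdot>[C] h) \<cdot>[?B] \<gamma> (f \<cdot>[C] h) = (res_comp F f h ?yg \<cdot>[?B] res_arr F h (r f)) \<cdot>[?B] (res_arr
      F h (\<gamma> f) \<cdot>[?B] \<kappa>)"
      by (rule D.iso_cancel_left[rotated]) (use rc[OF fh, unfolded D] in \<open>simp_all add: idx_simps D.Comp_in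
        D.Cod_Comp\<close>)
    then have eq: "(r (f \<cdot>[C] h) \<cdot>[?B] res_comp F f h x) \<cdot>[?B] (res_arr F h (\<gamma> f) \<cdot>[?B] \<kappa>) =
        (res_comp F f h ?yg \<cdot>[?B] res_arr F h (r f)) \<cdot>[?B] (res_arr F h (\<gamma> f) \<cdot>[?B] \<kappa>)"
      unfolding E1 by (simp add: idx_simps D.Comp_assoc)
    \<comment> \<open>Invertibility of \<open>\<kappa>\<close> itself is not given. The arrow to be
      cancelled is nevertheless invertible: by \<open>E1\<close> it is the inverse of
      \<open>res_comp f h x\<close> composed with \<open>\<gamma> (f \<cdot> h)\<close>.\<close>
    have irc: "iso_arr ?B (res_comp F f h x)" by (simp add: idx_simps)
    have "iso_arr ?B (inv_arr ?B (res_comp F f h x) \<cdot>[?B] \<gamma> (f \<cdot>[C] h))"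
      using c'(4)[OF fh] D D.iso_arr_inv_arr[OF irc] by (intro D.iso_arr_comp) (simp_all add: D.inv_arr_simps[OF
        irc] idx_simps)
    then have iso: "iso_arr ?B (res_arr F h (\<gamma> f) \<cdot>[?B] \<kappa>)"
      unfolding E1 using D.inv_comp_cancel(1)[OF irc, of "res_arr F h (\<gamma> f) \<cdot>[?B] \<kappa>"] by (simp add: idx_simps)
    show "r (f \<cdot>[C] h) \<cdot>[?B] res_comp F f h x = res_comp F f h ?yg \<cdot>[?B] res_arr F h (r f)"
      by (rule D.iso_cancel_right[OF iso eq]) (simp_all add: idx_simps)
  qed
  then have ex: "\<exists>!t. t \<in> hom (PObj F U) x ?yg \<and> (\<forall>f\<in>S. res_arr F f t = r f)"
    using S by (intro \<open>glues\<close>[unfolded glues_def, rule_format, of U S]) (simp_all add: e res_simps)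
  have iff: "(\<forall>f\<in>S. (g, t, y) \<cdot>[total] c f = s f) \<longleftrightarrow> (\<forall>f\<in>S. res_arr F f t = r f)" if t:
    "t \<in> hom (PObj F U) x ?yg" for t
  proof -
    have "(g, t, y) \<cdot>[total] c f = s f \<longleftrightarrow> res_arr F f t = r f" if f: "f \<in> S" for f
      unfolding c'(1)[OF f] s'(1)[OF f] total_simps
      using r(4)[OF f] r(5)[OF f, of "res_arr F f t"] homD[OF t] Sv[OF f] by (auto simp: res_simps)
    then show ?thesis by auto
  qed
  have mem: "q \<in> hom total z z' \<and> fst q = g \<longleftrightarrow> (\<exists>t. t \<in> hom (PObj F U) x ?yg \<and> q = (g, t, y))" for q
    by (cases q) (auto simp: e hom_def total_simps)
  obtain t where t: "t \<in> hom (PObj F U) x ?yg" "\<forall>f\<in>S. res_arr F f t = r f" and u: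
    "\<And>t'. \<lbrakk>t' \<in> hom (PObj F U) x ?yg; \<forall>f\<in>S. res_arr F f t' = r f\<rbrakk> \<Longrightarrow> t' = t"
    using ex by blast
  show ?thesis
  proof (rule ex1I[of _ "(g, t, y)"])
    show "(g, t, y) \<in> hom total z z' \<and> fst (g, t, y) = g \<and> (\<forall>f\<in>S. (g, t, y) \<cdot>[total] c f = s f)"
      using mem[of "(g, t, y)"] t iff by auto
    fix q assume q: "q \<in> hom total z z' \<and> fst q = g \<and> (\<forall>f\<in>S. q \<cdot>[total] c f = s f)"
    then obtain t' where t': "t' \<in> hom (PObj F U) x ?yg" "q = (g, t', y)" using mem[of q] by blast
    then show "q = (g, t, y)" using q iff[OF t'(1)] u by blast
  qed
qed

text \<open>The fibre components of the cartesian transition arrows are isomorphisms whose inverses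
  form a descent datum; inverting the isomorphisms of an effective solution gives the legs.\<close>

lemma total_descent:
  assumes "effective" and U [simp]: "U \<in> Obj C" and S: "S \<in> J U"
    and y: "\<And>f. f \<in> S \<Longrightarrow> y f \<in> Obj total \<and> fst (y f) = Dom C f"
    and k: "\<And>f e. \<lbrakk>f \<in> S; e \<in> Arr C; Cod C e = Dom C f\<rbrakk> \<Longrightarrow>
         cartesian C total (k f e) \<and> k f e \<in> hom total (y (f \<cdot>[C] e)) (y f) \<and> fst (k f e) = e"
    and kc: "\<And>f e e'. \<lbrakk>f \<in> S; e \<in> Arr C; Cod C e = Dom C f; e' \<in> Arr C; Cod C e' = Dom C e\<rbrakk> \<Longrightarrow>
         k f (e \<cdot>[C] e') = k f e \<cdot>[total] k (f \<cdot>[C] e) e'"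
  shows "\<exists>z c. z \<in> Obj total \<and> fst z = U \<and>
         (\<forall>f\<in>S. cartesian C total (c f) \<and> c f \<in> hom total (y f) z \<and> fst (c f) = f \<and>
           (\<forall>e\<in>Arr C. Cod C e = Dom C f \<longrightarrow> c f \<cdot>[total] k f e = c (f \<cdot>[C] e)))"
proof -
  have Sv: "f \<in> Arr C" "Cod C f = U" "\<lbrakk>e \<in> Arr C; Cod C e = Dom C f\<rbrakk> \<Longrightarrow> f \<cdot>[C] e \<in> S" if "f \<in> S" for f e
    using sieveD[OF J.covers_sieve[OF U S] that] by auto
  let ?A = "\<lambda>f. PObj F (Dom C f)"
  define p where "p f = snd (y f)" for f
  define \<kappa> where "\<kappa> f e = fst (snd (k f e))" for f e
  have y': "y f = (Dom C f, p f)" "p f \<in> Obj (?A f)" if f: "f \<in> S" for f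
    using y[OF f] by (cases "y f"; auto simp: p_def total_simps)+
  have k': "k f e = (e, \<kappa> f e, p f)" "\<kappa> f e \<in> Arr (?A e)" "Dom (?A e) (\<kappa> f e) = p (f \<cdot>[C] e)"
    "Cod (?A e) (\<kappa> f e) = res_obj F e (p f)"
    "iso_arr (?A e) (\<kappa> f e)" if f: "f \<in> S" "e \<in> Arr C" "Cod C e = Dom C f" for f e
  proof -
    note fe = Sv(3)[OF f]
    have ka: "k f e \<in> Arr total" using k[OF f] by (simp add: cartesian_def)
    show 1: "k f e = (e, \<kappa> f e, p f)" using k[OF f] y'[OF f(1)] by (cases "k f e") (auto simp: \<kappa>_def hom_def
      total_simps)
    show "\<kappa> f e \<in> Arr (?A e)" "Dom (?A e) (\<kappa> f e) = p (f \<cdot>[C] e)" "Cod (?A e) (\<kappa> f e) = res_obj F e (p f)"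
      using k[OF f] ka y'[OF fe] unfolding 1 by (auto simp: hom_def total_simps)
    show "iso_arr (?A e) (\<kappa> f e)" using k[OF f] ka cartesian_iff[of e "\<kappa> f e" "p f"] by (simp add: 1)
  qed
  \<comment> \<open>\<open>\<kappa> f e\<close> ends at the restriction of \<open>p f\<close>, where
    \<open>DIso\<close> has to start; hence the inverse.\<close>
  define d where "d = \<lparr>DObj = restrict p S, DIso = (\<lambda>f e. if f \<in> S \<and> e \<in> Arr C \<and> Cod C e =
    Dom C f then inv_arr (?A e) (\<kappa> f e) else undefined)\<rparr>"
  have d: "DObj d f = p f" "\<lbrakk>e \<in> Arr C; Cod C e = Dom C f\<rbrakk> \<Longrightarrow> DIso d f e = inv_arr (?A e) (\<kappa> f e)" if "f \<in> S" for
    f e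
    using that by (simp_all add: d_def)
  have ki: "inv_arr (?A e) (\<kappa> f e) \<in> Arr (?A e)" "Dom (?A e) (inv_arr (?A e) (\<kappa> f e)) = res_obj F e (p f)"
     "Cod (?A e) (inv_arr (?A e) (\<kappa> f e)) = p (f \<cdot>[C] e)" "iso_arr (?A e) (inv_arr (?A e) (\<kappa> f e))"
     "\<kappa> f e \<cdot>[?A e] inv_arr (?A e) (\<kappa> f e) = Ident (?A e) (res_obj F e (p f))"
     "inv_arr (?A e) (\<kappa> f e) \<cdot>[?A e] \<kappa> f e = Ident (?A e) (p (f \<cdot>[C] e))" if f: "f \<in> S" "e \<in> Arr C" "Cod C e =
       Dom C f" for f e
  proof -
    interpret D: category "?A e" using f by (simp add: category_PObj base_cat_simps)
    show "inv_arr (?A e) (\<kappa> f e) \<in> Arr (?A e)" "Dom (?A e) (inv_arr (?A e) (\<kappa> f e)) = res_obj F e (p f)"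
     "Cod (?A e) (inv_arr (?A e) (\<kappa> f e)) = p (f \<cdot>[C] e)" "iso_arr (?A e) (inv_arr (?A e) (\<kappa> f e))"
     "\<kappa> f e \<cdot>[?A e] inv_arr (?A e) (\<kappa> f e) = Ident (?A e) (res_obj F e (p f))"
     "inv_arr (?A e) (\<kappa> f e) \<cdot>[?A e] \<kappa> f e = Ident (?A e) (p (f \<cdot>[C] e))"
      using D.inv_arr_simps[OF k'(5)[OF f]] D.iso_arr_inv_arr[OF k'(5)[OF f]] k'(3,4)[OF f] by simp_all
  qed
  have desc: "is_descent C F S d"
    unfolding is_descent_def Let_def
  proof (intro conjI ballI impI)
    show "DObj d \<in> extensional S" "\<forall>f g. \<not> (f \<in> S \<and> g \<in> Arr C \<and> Cod C g = Dom C f) \<longrightarrow> DIso d f g = undefined"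
      by (simp_all add: d_def)
    show "DObj d f \<in> Obj (?A f)" if "f \<in> S" for f using y'(2) that by (simp add: d)
    show "DIso d f g \<in> hom (?A g) (res_obj F g (DObj d f)) (DObj d (f \<cdot>[C] g))" "iso_arr (?A g) (DIso d f g)"
      if "f \<in> S" "g \<in> Arr C" "Cod C g = Dom C f" for f g using ki[OF that] that Sv(3)[OF that] by (simp_all add:
        d hom_def)
  next
    fix f g h assume f: "f \<in> S" "g \<in> Arr C" "h \<in> Arr C" "Cod C g = Dom C f \<and> Cod C h = Dom C g"
    then have g [simp]: "g \<in> Arr C" "h \<in> Arr C" "Cod C g = Dom C f" "Cod C h = Dom C g" by auto
    note fg = Sv(3)[OF f(1) g(1,3)]
    have hc: "Cod C h = Dom C (f \<cdot>[C] g)" "g \<cdot>[C] h \<in> Arr C" "Cod C (g \<cdot>[C] h) = Dom C f" "Dom C (g \<cdot>[C] h) =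
      Dom C h"
      using Sv[OF f(1)] by (simp_all add: base_cat_simps)
    let ?B = "?A h"
    interpret D: category ?B by (simp add: category_PObj base_cat_simps)
    have as: "f \<cdot>[C] g \<cdot>[C] h = f \<cdot>[C] (g \<cdot>[C] h)" using Sv[OF f(1)] by (simp add: C.Comp_assoc)
    note k1 = k'[OF f(1) g(1,3)] and k2 = k'[OF fg g(2) hc(1)] and k3 = k'[OF f(1) hc(2,3), unfolded hc(4)]
    note i1 = ki[OF f(1) g(1,3)] and i2 = ki[OF fg g(2) hc(1)] and i3 = ki[OF f(1) hc(2,3), unfolded hc(4)]
    note [simp] = k1(2-4) k2(2-4) k3(2-4) i1(1-3) i2(1-3) i3(1-3) y'(2)[OF f(1)] y'(2)[OF fg] as
    have rg: "res_arr F h (\<kappa> f g) \<cdot>[?B] res_arr F h (inv_arr (?A g) (\<kappa> f g)) =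
      Ident ?B (res_obj F h (res_obj F g (p f)))"
      using res_simps(6)[of h "Dom C g" "inv_arr (?A g) (\<kappa> f g)" "\<kappa> f g"] i1(5) by (simp add: res_simps)
    have K: "\<kappa> f (g \<cdot>[C] h) = res_comp F g h (p f) \<cdot>[?B] (res_arr F h (\<kappa> f g) \<cdot>[?B] \<kappa> (f \<cdot>[C] g) h)"
      using kc[OF f(1) g(1,3,2,4)] unfolding k1(1) k2(1) k3(1) total_simps by simp
    have "inv_arr ?B (\<kappa> f (g \<cdot>[C] h)) \<cdot>[?B] res_comp F g h (p f) = inv_arr ?B (\<kappa> (f \<cdot>[C] g) h) \<cdot>[?B] res_arr F h
      (inv_arr (?A g) (\<kappa> f g))"
    proof (rule D.iso_cancel_left[OF k3(5)])
      have "\<kappa> f (g \<cdot>[C] h) \<cdot>[?B] (inv_arr ?B (\<kappa> (f \<cdot>[C] g) h) \<cdot>[?B] res_arr F h (inv_arr (?A g) (\<kappa> f g))) =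
        res_comp F g h (p f) \<cdot>[?B] (res_arr F h (\<kappa> f g) \<cdot>[?B] ((\<kappa> (f \<cdot>[C] g) h \<cdot>[?B] inv_arr ?B (\<kappa> (f \<cdot>[C] g)
          h)) \<cdot>[?B] res_arr F h (inv_arr (?A g) (\<kappa> f g))))"
        unfolding K by (simp add: idx_simps D.Comp_assoc)
      also have "\<dots> = res_comp F g h (p f)"
        unfolding i2(5) by (simp add: idx_simps D.id_left rg D.id_right)
      finally show "\<kappa> f (g \<cdot>[C] h) \<cdot>[?B] (inv_arr ?B (\<kappa> f (g \<cdot>[C] h)) \<cdot>[?B] res_comp F g h (p f)) =
        \<kappa> f (g \<cdot>[C] h) \<cdot>[?B] (inv_arr ?B (\<kappa> (f \<cdot>[C] g) h) \<cdot>[?B] res_arr F h (inv_arr (?A g) (\<kappa> f g)))"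
        using D.inv_comp_cancel(2)[OF k3(5), of "res_comp F g h (p f)"] by (simp add: idx_simps)
    qed (simp_all add: idx_simps)
    then show "DIso d f (g \<cdot>[C] h) \<cdot>[?B] res_comp F g h (DObj d f) = DIso d (f \<cdot>[C] g) h \<cdot>[?B] res_arr F h (DIso
      d f g)"
      using f(1) fg hc by (simp add: d)
  next
    fix f assume f: "f \<in> S"
    let ?i = "Ident C (Dom C f)" and ?A = "PObj F (Dom C f)"
    note [simp] = Sv(1,2)[OF f]
    have i: "?i \<in> Arr C" "Cod C ?i = Dom C f" "Dom C ?i = Dom C f" "f \<cdot>[C] ?i = f" "?i \<cdot>[C] ?i = ?i"
      by (simp_all add: base_cat_simps C.Comp_Ident_right C.Ident_Comp_Ident)
    interpret D: category ?A by (simp add: category_PObj base_cat_simps)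
    note k1 = k'[OF f i(1,2), unfolded i(3,4)] and i1 = ki[OF f i(1,2), unfolded i(3,4)]
    have yo: "y f \<in> Obj total" using y[OF f] by simp
    \<comment> \<open>The cocycle law at two identities makes this transition arrow idempotent.
      Being cartesian it can be cancelled, so it is an identity; this is the unit law of the
      datum.\<close>
    have kk: "k f ?i \<cdot>[total] k f ?i = k f ?i \<cdot>[total] Ident total (y f)"
      using kc[OF f i(1,2) i(1)] k[OF f i(1,2)] i total.T.id_right[of "k f ?i" "y f"] by (simp add: hom_def)
    have "k f ?i = Ident total (y f)"
      by (rule total.cartesian_cancel[OF conjunct1[OF k[OF f i(1,2)]] kk])
        (use k[OF f i(1,2)] y'(1)[OF f] yo i in \<open>simp_all add: hom_def total.over_simps\<close>)
    then have "\<kappa> f ?i = res_unit F (Dom C f) (p f)" unfolding k1(1) y'(1)[OF f] total_simps by simp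
    then show "DIso d f ?i \<cdot>[?A] res_unit F (Dom C f) (DObj d f) = Ident ?A (DObj d f)"
      using i1(6) f i by (simp add: d)
  qed
  obtain x \<phi> where x [simp]: "x \<in> Obj (PObj F U)" and "\<forall>f\<in>S. \<phi> f \<in> hom (?A f) (res_obj F f x) (DObj d f) \<and>
      iso_arr (?A f) (\<phi> f) \<and> (\<forall>g\<in>Arr C. Cod C g = Dom C f \<longrightarrow>
        \<phi> (f \<cdot>[C] g) \<cdot>[?A g] res_comp F f g x = DIso d f g \<cdot>[?A g] res_arr F g (\<phi> f))"
    using \<open>effective\<close>[unfolded effective_def, rule_format, OF U S desc] by (elim bexE exE)
  then have \<phi>: "\<And>f. f \<in> S \<Longrightarrow> \<phi> f \<in> hom (?A f) (res_obj F f x) (DObj d f) \<and> iso_arr (?A f) (\<phi> f)"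
    and \<phi>c: "\<And>f g. \<lbrakk>f \<in> S; g \<in> Arr C; Cod C g = Dom C f\<rbrakk> \<Longrightarrow> \<phi> (f \<cdot>[C] g) \<cdot>[?A g] res_comp F f g x =
      DIso d f g \<cdot>[?A g] res_arr F g (\<phi> f)"
    by simp_all
  have ph: "\<phi> f \<in> Arr (?A f)" "Dom (?A f) (\<phi> f) = res_obj F f x" "Cod (?A f) (\<phi> f) = p f" "iso_arr (?A f) (\<phi> f)"
    if "f \<in> S" for f
    using \<phi>[OF that] that by (auto simp: hom_def d)
  \<comment> \<open>A leg leads from the datum to the restriction of x, against the direction of
    \<open>\<phi> f\<close>.\<close>
  define c where "c f = (f, inv_arr (?A f) (\<phi> f), x)" for f
  have phi: "inv_arr (?A f) (\<phi> f) \<in> Arr (?A f)" "Dom (?A f) (inv_arr (?A f) (\<phi> f)) = p f"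
    "Cod (?A f) (inv_arr (?A f) (\<phi> f)) = res_obj F f x"
    "iso_arr (?A f) (inv_arr (?A f) (\<phi> f))" "\<phi> f \<cdot>[?A f] inv_arr (?A f) (\<phi> f) = Ident (?A f) (p f)" if f:
      "f \<in> S" for f
    using category.inv_arr_simps[OF category_PObj ph(4)[OF f]] category.iso_arr_inv_arr[OF category_PObj
      ph(4)[OF f]] ph[OF f] Sv[OF f]
    by (simp_all add: base_cat_simps)
  have cA: "c f \<in> Arr total" if "f \<in> S" for f using phi[OF that] Sv[OF that] by (simp add: c_def total_simps)
  show ?thesis
  proof (intro exI[of _ "(U, x)"] exI[of _ c] conjI ballI impI)
    fix f assume f: "f \<in> S"
    show "cartesian C total (c f)" using cA[OF f] cartesian_iff[of f _ x] phi[OF f] by (simp add: c_def)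
    show "c f \<in> hom total (y f) (U, x)" using cA[OF f] phi[OF f] Sv[OF f] y'[OF f] by (simp add: c_def hom_def
      total_simps)
    show "fst (c f) = f" by (simp add: c_def)
    fix e assume e [simp]: "e \<in> Arr C" "Cod C e = Dom C f"
    note fe = Sv(3)[OF f e]
    have De: "Dom C (f \<cdot>[C] e) = Dom C e" using Sv[OF f] by (simp add: base_cat_simps)
    let ?B = "?A e"
    interpret D: category ?B by (simp add: category_PObj base_cat_simps)
    note k1 = k'[OF f e] and i1 = ki[OF f e] and pe = ph[OF fe, unfolded De] and pie = phi[OF fe, unfolded De]
    note [simp] = k1(2-4) i1(1-3) pe(1-3) pie(1-3) ph(1-3)[OF f] phi(1-3)[OF f] Sv(1,2)[OF f]
    have rg: "res_arr F e (\<phi> f) \<cdot>[?B] res_arr F e (inv_arr (?A f) (\<phi> f)) = Ident ?B (res_obj F e (p f))"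
      using res_simps(6)[of e "Dom C f" "inv_arr (?A f) (\<phi> f)" "\<phi> f"] phi(5)[OF f] y'(2)[OF f] by (simp add:
        res_simps)
    have "res_comp F f e x \<cdot>[?B] (res_arr F e (inv_arr (?A f) (\<phi> f)) \<cdot>[?B] \<kappa> f e) = inv_arr ?B (\<phi> (f \<cdot>[C] e))"
    proof (rule D.iso_cancel_left[OF pe(4)])
      have "\<phi> (f \<cdot>[C] e) \<cdot>[?B] (res_comp F f e x \<cdot>[?B] (res_arr F e (inv_arr (?A f) (\<phi> f)) \<cdot>[?B] \<kappa> f e)) =
        (\<phi> (f \<cdot>[C] e) \<cdot>[?B] res_comp F f e x) \<cdot>[?B] (res_arr F e (inv_arr (?A f) (\<phi> f)) \<cdot>[?B] \<kappa> f e)"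
        by (simp add: idx_simps D.Comp_assoc)
      also have "\<dots> = inv_arr ?B (\<kappa> f e) \<cdot>[?B] ((res_arr F e (\<phi> f) \<cdot>[?B] res_arr F e (inv_arr (?A f) (\<phi>
        f))) \<cdot>[?B] \<kappa> f e)"
        unfolding \<phi>c[OF f e] using d(2)[OF f e] by (simp add: idx_simps D.Comp_assoc)
      also have "\<dots> = Ident ?B (p (f \<cdot>[C] e))"
        unfolding rg using D.id_left[of "\<kappa> f e"] i1(6) by simp
      finally show "\<phi> (f \<cdot>[C] e) \<cdot>[?B] (res_comp F f e x \<cdot>[?B] (res_arr F e (inv_arr (?A f) (\<phi> f)) \<cdot>[?B] \<kappa> f
        e)) =
         \<phi> (f \<cdot>[C] e) \<cdot>[?B] inv_arr ?B (\<phi> (f \<cdot>[C] e))" using pie by simp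
    qed (simp_all add: idx_simps)
    then show "c f \<cdot>[total] k f e = c (f \<cdot>[C] e)"
      unfolding k1(1) by (simp add: c_def total_simps De)
  qed (simp_all add: total_simps)
qed

end

section \<open>From functors of total categories to pseudonatural transformations\<close>

text \<open>The passage back from total categories: a functor over \<open>C\<close> that preserves
  cartesian arrows determines a pseudonatural transformation, obtained on fibres by restricting to
  arrows over identities.\<close>

locale functor_total = P: indexed_category C small F\<^sub>1 + Q: indexed_category C small F\<^sub>2 +
  L: functor_over C P.total Q.total lo la
  for C :: "('o, 'm) cat" and small :: "'u set \<Rightarrow> bool" and F\<^sub>1 F\<^sub>2 :: "('o, 'm, 'u, 'u) cat_psfun"
    and lo :: "'o \<times> 'u \<Rightarrow> 'o \<times> 'u" and la :: "'m \<times> 'u \<times> 'u \<Rightarrow> 'm \<times> 'u \<times> 'u"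
begin

definition fibre_obj where "fibre_obj U x = snd (lo (U, x))"
definition fibre_arr where
  "fibre_arr U m = (THE n. n \<in> Arr (PObj F\<^sub>2 U) \<and> la (P.vertical U m) = Q.vertical U n)"
text \<open>The vertical comparison from the chosen lift of the image to the image of the chosen
  lift. Both are cartesian over g with the same end, so it exists, is unique and is
  invertible.\<close>

definition fibre_cell where
  "fibre_cell g y = (THE n. n \<in> Arr (PObj F\<^sub>2 (Dom C g)) \<and>
     Cod (PObj F\<^sub>2 (Dom C g)) n = fibre_obj (Dom C g) (res_obj F\<^sub>1 g y) \<and>
     la (P.lift g y) \<cdot>[Q.total] Q.vertical (Dom C g) n = Q.lift g (fibre_obj (Cod C g) y))"

lemma fibre_obj:
  assumes "U \<in> Obj C" "x \<in> Obj (PObj F\<^sub>1 U)"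
  shows "lo (U, x) = (U, fibre_obj U x)" "fibre_obj U x \<in> Obj (PObj F\<^sub>2 U)"
proof -
  have x: "(U, x) \<in> Obj P.total" using assms by (simp add: P.total_simps)
  show 1: "lo (U, x) = (U, fibre_obj U x)" using L.fst_map_Obj[OF x] by (simp add: fibre_obj_def prod_eq_iff)
  show "fibre_obj U x \<in> Obj (PObj F\<^sub>2 U)" using L.map_Obj[OF x] by (simp add: 1 Q.total_simps)
qed

lemma fibre_arr:
  assumes "U \<in> Obj C" "m \<in> Arr (PObj F\<^sub>1 U)"
  shows "fibre_arr U m \<in> Arr (PObj F\<^sub>2 U)" "la (P.vertical U m) = Q.vertical U (fibre_arr U m)"
    "Dom (PObj F\<^sub>2 U) (fibre_arr U m) = fibre_obj U (Dom (PObj F\<^sub>1 U) m)"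
    "Cod (PObj F\<^sub>2 U) (fibre_arr U m) = fibre_obj U (Cod (PObj F\<^sub>1 U) m)"
proof -
  note v = P.vertical_simps[OF assms]
  obtain n where n: "n \<in> Arr (PObj F\<^sub>2 U)" "la (P.vertical U m) = Q.vertical U n"
    using Q.vertical_exists[OF assms(1) L.map_Arr[OF v(1)]] L.fst_map[OF v(1)] v by auto
  have e: "fibre_arr U m = n"
    unfolding fibre_arr_def using n Q.vertical_inject[OF assms(1)] by (intro the_equality) auto
  show "fibre_arr U m \<in> Arr (PObj F\<^sub>2 U)" "la (P.vertical U m) = Q.vertical U (fibre_arr U m)" using n e by
    simp_all
  show "Dom (PObj F\<^sub>2 U) (fibre_arr U m) = fibre_obj U (Dom (PObj F\<^sub>1 U) m)"
    "Cod (PObj F\<^sub>2 U) (fibre_arr U m) = fibre_obj U (Cod (PObj F\<^sub>1 U) m)"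
    using L.Dom_map[OF v(1)] L.Cod_map[OF v(1)] n Q.vertical_simps[OF assms(1) n(1)] v assms
    by (simp_all add: e fibre_obj P.fibre_simps)
qed

lemma fibre_arr_eqI:
  "\<lbrakk>U \<in> Obj C; m \<in> Arr (PObj F\<^sub>1 U); n \<in> Arr (PObj F\<^sub>2 U); la (P.vertical U m) = Q.vertical U n\<rbrakk> \<Longrightarrow>
    fibre_arr U m = n"
  using fibre_arr[of U m] Q.vertical_inject by metis

lemma la_lift:
  assumes "g \<in> Arr C" "y \<in> Obj (PObj F\<^sub>1 (Cod C g))"
  shows "la (P.lift g y) \<in> Arr Q.total" "Dom Q.total (la (P.lift g y)) = (Dom C g, fibre_obj (Dom C g) (res_obj
    F\<^sub>1 g y))"
    "Cod Q.total (la (P.lift g y)) = (Cod C g, fibre_obj (Cod C g) y)" "fst (la (P.lift g y)) = g"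
    "cartesian C Q.total (la (P.lift g y))"
  using P.lift_simps[OF assms] P.cartesian_lift[OF assms] assms
  by (simp_all add: L.map_simps L.map_cartesian fibre_obj P.idx_simps)

lemma fibre_cell:
  assumes g: "g \<in> Arr C" "y \<in> Obj (PObj F\<^sub>1 (Cod C g))" and V: "Dom C g = V"
  shows "fibre_cell g y \<in> Arr (PObj F\<^sub>2 V)"
    "Dom (PObj F\<^sub>2 V) (fibre_cell g y) = res_obj F\<^sub>2 g (fibre_obj (Cod C g) y)"
    "Cod (PObj F\<^sub>2 V) (fibre_cell g y) = fibre_obj V (res_obj F\<^sub>1 g y)"
    "iso_arr (PObj F\<^sub>2 V) (fibre_cell g y)"
    "la (P.lift g y) \<cdot>[Q.total] Q.vertical V (fibre_cell g y) = Q.lift g (fibre_obj (Cod C g) y)"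
proof -
  note l = la_lift[OF g]
  have U: "Cod C g \<in> Obj C" and Vo: "V \<in> Obj C" using g V by (auto simp: P.base_cat_simps)
  note ly = fibre_obj(2)[OF U g(2)]
  note q = Q.lift_simps[OF g(1) ly] Q.cartesian_lift[OF g(1) ly]
  obtain t where t: "t \<in> Arr Q.total" "Dom Q.total t = Dom Q.total (Q.lift g (fibre_obj (Cod C g) y))"
     "Cod Q.total t = Dom Q.total (la (P.lift g y))" "fst t = Ident C V" "la (P.lift g y) \<cdot>[Q.total] t =
       Q.lift g (fibre_obj (Cod C g) y)"
    by (rule Q.total.cartesianD[OF l(5) q(1), of "Ident C V"]) (use l q V Vo g in \<open>auto simp: P.base_cat_simps
      P.C.Comp_Ident_right\<close>)
  obtain n where n: "n \<in> Arr (PObj F\<^sub>2 V)" "t = Q.vertical V n" using Q.vertical_exists[OF Vo t(1,4)] by blast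
  note v = Q.vertical_simps[OF Vo n(1)]
  have nd: "Dom (PObj F\<^sub>2 V) n = res_obj F\<^sub>2 g (fibre_obj (Cod C g) y)" "Cod (PObj F\<^sub>2 V) n =
    fibre_obj V (res_obj F\<^sub>1 g y)"
    using t n v q l V by auto
  have e: "fibre_cell g y = n"
    unfolding fibre_cell_def V
  proof (rule the_equality)
    show "n \<in> Arr (PObj F\<^sub>2 V) \<and> Cod (PObj F\<^sub>2 V) n = fibre_obj V (res_obj F\<^sub>1 g y) \<and>
      la (P.lift g y) \<cdot>[Q.total] Q.vertical V n = Q.lift g (fibre_obj (Cod C g) y)" using n nd t by simp
    fix n' assume n': "n' \<in> Arr (PObj F\<^sub>2 V) \<and> Cod (PObj F\<^sub>2 V) n' = fibre_obj V (res_obj F\<^sub>1 g y) \<and>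
      la (P.lift g y) \<cdot>[Q.total] Q.vertical V n' = Q.lift g (fibre_obj (Cod C g) y)"
    then have v': "Q.vertical V n' \<in> Arr Q.total" "Cod Q.total (Q.vertical V n') =
      Dom Q.total (la (P.lift g y))" "fst (Q.vertical V n') = Ident C V"
      using Q.vertical_simps[OF Vo, of n'] l V by auto
    have "Q.vertical V n' = Q.vertical V n"
      by (rule Q.total.cartesian_cancel[OF l(5)]) (use n' v' t n v in simp_all)
    then show "n' = n" using Q.vertical_inject[OF Vo] n n' by blast
  qed
  show "fibre_cell g y \<in> Arr (PObj F\<^sub>2 V)"
    "Dom (PObj F\<^sub>2 V) (fibre_cell g y) = res_obj F\<^sub>2 g (fibre_obj (Cod C g) y)"
    "Cod (PObj F\<^sub>2 V) (fibre_cell g y) = fibre_obj V (res_obj F\<^sub>1 g y)"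
    "la (P.lift g y) \<cdot>[Q.total] Q.vertical V (fibre_cell g y) = Q.lift g (fibre_obj (Cod C g) y)"
    using e n nd t by simp_all
  have "cartesian C Q.total t" using Q.total.cartesian_Comp_cancel[OF l(5), of t] t q by simp
  then show "iso_arr (PObj F\<^sub>2 V) (fibre_cell g y)" using Q.cartesian_vertical_iff[OF Vo n(1)] n e by simp
qed

text \<open>Cancels the image of a chosen lift, which is cartesian. Every law for the cells of
  \<open>psn\<close> is proved through this rule, as an equation in the total category.\<close>

lemma fibre_eqI:
  assumes g: "g \<in> Arr C" "y \<in> Obj (PObj F\<^sub>1 (Cod C g))" "Dom C g = V"
    and n: "n \<in> Arr (PObj F\<^sub>2 V)" "n' \<in> Arr (PObj F\<^sub>2 V)" "Cod (PObj F\<^sub>2 V) n = fibre_obj V (res_obj F\<^sub>1 g y)"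
      "Cod (PObj F\<^sub>2 V) n' = fibre_obj V (res_obj F\<^sub>1 g y)"
    and e: "la (P.lift g y) \<cdot>[Q.total] Q.vertical V n = la (P.lift g y) \<cdot>[Q.total] Q.vertical V n'"
  shows "n = n'"
proof -
  have V: "V \<in> Obj C" using g by (auto simp: P.base_cat_simps)
  have "Q.vertical V n = Q.vertical V n'"
    by (rule Q.total.cartesian_cancel[OF la_lift(5)[OF g(1,2)] e])
      (use n Q.vertical_simps[OF V] la_lift[OF g(1,2)] g(3) in simp_all)
  then show ?thesis using Q.vertical_inject[OF V n(1,2)] by simp
qed

definition psn :: "('o, 'm, 'u, 'u) cat_psnat" where
  "psn = \<lparr>TDom = F\<^sub>1, TCod = F\<^sub>2,
     TAt = restrict (\<lambda>U. \<lparr>FDom = PObj F\<^sub>1 U, FCod = PObj F\<^sub>2 U,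
       FObj = restrict (fibre_obj U) (Obj (PObj F\<^sub>1 U)), FArr = restrict (fibre_arr U) (Arr (PObj F\<^sub>1 U))\<rparr>) (Obj
         C),
     TCell = restrict (\<lambda>g. \<lparr>
       NDom = comp_func (PMor F\<^sub>2 g) \<lparr>FDom = PObj F\<^sub>1 (Cod C g), FCod = PObj F\<^sub>2 (Cod C g),
         FObj = restrict (fibre_obj (Cod C g)) (Obj (PObj F\<^sub>1 (Cod C g))),
         FArr = restrict (fibre_arr (Cod C g)) (Arr (PObj F\<^sub>1 (Cod C g)))\<rparr>,
       NCod = comp_func \<lparr>FDom = PObj F\<^sub>1 (Dom C g), FCod = PObj F\<^sub>2 (Dom C g),
         FObj = restrict (fibre_obj (Dom C g)) (Obj (PObj F\<^sub>1 (Dom C g))),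
         FArr = restrict (fibre_arr (Dom C g)) (Arr (PObj F\<^sub>1 (Dom C g)))\<rparr> (PMor F\<^sub>1 g),
       NAt = restrict (fibre_cell g) (Obj (PObj F\<^sub>1 (Cod C g)))\<rparr>) (Arr C)\<rparr>"

lemma psn_simps:
  "TDom psn = F\<^sub>1" "TCod psn = F\<^sub>2"
  "\<lbrakk>U \<in> Obj C; x \<in> Obj (PObj F\<^sub>1 U)\<rbrakk> \<Longrightarrow> FObj (TAt psn U) x = fibre_obj U x"
  "\<lbrakk>U \<in> Obj C; m \<in> Arr (PObj F\<^sub>1 U)\<rbrakk> \<Longrightarrow> FArr (TAt psn U) m = fibre_arr U m"
  "\<lbrakk>g \<in> Arr C; x \<in> Obj (PObj F\<^sub>1 (Cod C g))\<rbrakk> \<Longrightarrow> NAt (TCell psn g) x = fibre_cell g x"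
  by (simp_all add: psn_def)

lemmas fibre_map_simps = fibre_obj(2) fibre_arr(1,3,4) fibre_cell(1-4) psn_simps

lemma functor_TAt_psn:
  assumes U: "U \<in> Obj C"
  shows "is_functor (TAt psn U)" "FDom (TAt psn U) = PObj F\<^sub>1 U" "FCod (TAt psn U) = PObj F\<^sub>2 U"
proof -
  show "FDom (TAt psn U) = PObj F\<^sub>1 U" "FCod (TAt psn U) = PObj F\<^sub>2 U" using U by (simp_all add: psn_def)
  note v = P.vertical_simps[OF U]
  show "is_functor (TAt psn U)"
  proof (rule is_functorI[OF P.category_PObj[OF U] Q.category_PObj[OF U]])
    fix x assume x: "x \<in> Obj (PObj F\<^sub>1 U)"
    have "fibre_arr U (Ident (PObj F\<^sub>1 U) x) = Ident (PObj F\<^sub>2 U) (fibre_obj U x)"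
      by (rule fibre_arr_eqI[OF U]) (use U x fibre_obj[OF U x] L.map_Ident[of "(U, x)"] in
          \<open>simp_all add: P.fibre_simps Q.fibre_simps P.vertical_Ident Q.vertical_Ident P.total_simps(1)\<close>)
    then show "FArr (TAt psn U) (Ident (PObj F\<^sub>1 U) x) = Ident (PObj F\<^sub>2 U) (FObj (TAt psn U) x)"
      using U x by (simp add: psn_simps P.fibre_simps)
  next
    fix m n assume m: "m \<in> Arr (PObj F\<^sub>1 U)" "n \<in> Arr (PObj F\<^sub>1 U)" "Cod (PObj F\<^sub>1 U) m = Dom (PObj F\<^sub>1 U) n"
    have "fibre_arr U (n \<cdot>[PObj F\<^sub>1 U] m) = fibre_arr U n \<cdot>[PObj F\<^sub>2 U] fibre_arr U m"
    proof (rule fibre_arr_eqI[OF U])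
      have "la (P.vertical U (n \<cdot>[PObj F\<^sub>1 U] m)) = la (P.vertical U n) \<cdot>[Q.total] la (P.vertical U m)"
        using U m v by (simp add: P.vertical_vertical[symmetric] L.map_Comp)
      then show "la (P.vertical U (n \<cdot>[PObj F\<^sub>1 U] m)) = Q.vertical U (fibre_arr U n \<cdot>[PObj F\<^sub>2 U] fibre_arr U
        m)"
        using U m by (simp add: fibre_arr Q.vertical_vertical)
    qed (use U m in \<open>simp_all add: fibre_arr P.fibre_simps Q.fibre_simps\<close>)
    then show "FArr (TAt psn U) (n \<cdot>[PObj F\<^sub>1 U] m) = FArr (TAt psn U) n \<cdot>[PObj F\<^sub>2 U] FArr (TAt psn U) m"
      using U m by (simp add: psn_simps P.fibre_simps)
  qed (use U in \<open>simp_all add: psn_def fibre_obj fibre_arr hom_def P.fibre_simps\<close>)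
qed

text \<open>After composition with the image of the lift, the defining equation of
  \<open>fibre_cell\<close> reduces the claim to naturality of lifts in both total
  categories.\<close>

lemma fibre_cell_natural:
  assumes g: "g \<in> Arr C" and m: "m \<in> Arr (PObj F\<^sub>1 (Cod C g))"
  shows "fibre_cell g (Cod (PObj F\<^sub>1 (Cod C g)) m) \<cdot>[PObj F\<^sub>2 (Dom C g)] res_arr F\<^sub>2 g (fibre_arr (Cod C g) m) =
    fibre_arr (Dom C g) (res_arr F\<^sub>1 g m) \<cdot>[PObj F\<^sub>2 (Dom C g)] fibre_cell g (Dom (PObj F\<^sub>1 (Cod C g)) m)"
proof (rule fibre_eqI[OF g _ refl])
  let ?x = "Dom (PObj F\<^sub>1 (Cod C g)) m" and ?y = "Cod (PObj F\<^sub>1 (Cod C g)) m" and ?U = "Cod C g" and ?V =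
    "Dom C g"
  have U: "?U \<in> Obj C" and V: "?V \<in> Obj C" using g by (auto simp: P.base_cat_simps)
  show y: "?y \<in> Obj (PObj F\<^sub>1 ?U)" using U m by (simp add: P.fibre_simps)
  have x: "?x \<in> Obj (PObj F\<^sub>1 ?U)" using U m by (simp add: P.fibre_simps)
  note [simp] = g m U V x y
  note ss = fibre_map_simps P.res_simps Q.res_simps Q.fibre_simps P.fibre_simps Q.vertical_simps
    P.vertical_simps P.lift_simps Q.lift_simps la_lift
  have "la (P.lift g ?y) \<cdot>[Q.total] (Q.vertical ?V (fibre_cell g ?y) \<cdot>[Q.total] Q.vertical ?V (res_arr F\<^sub>2 g
    (fibre_arr ?U m))) =
    (la (P.lift g ?y) \<cdot>[Q.total] Q.vertical ?V (fibre_cell g ?y)) \<cdot>[Q.total] Q.vertical ?V (res_arr F\<^sub>2 g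
      (fibre_arr ?U m))"
    by (simp add: ss Q.total.T.Comp_assoc)
  also have "\<dots> = Q.vertical ?U (fibre_arr ?U m) \<cdot>[Q.total] Q.lift g (fibre_obj ?U ?x)"
    using Q.lift_vertical_res[of g "fibre_arr ?U m"] by (simp add: fibre_cell(5) ss)
  also have "\<dots> = (la (P.vertical ?U m) \<cdot>[Q.total] la (P.lift g ?x)) \<cdot>[Q.total] Q.vertical ?V (fibre_cell g ?x)"
    using fibre_cell(5)[of g ?x ?V] by (simp add: fibre_arr(2) ss Q.total.T.Comp_assoc)
  also have "la (P.vertical ?U m) \<cdot>[Q.total] la (P.lift g ?x) = la (P.lift g ?y) \<cdot>[Q.total] la (P.vertical ?V
    (res_arr F\<^sub>1 g m))"
    using P.lift_vertical_res[of g m] L.map_Comp[of "P.lift g ?x" "P.vertical ?U m"] L.map_Comp[of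
      "P.vertical ?V (res_arr F\<^sub>1 g m)" "P.lift g ?y"]
    by (simp add: ss)
  also have "(la (P.lift g ?y) \<cdot>[Q.total] la (P.vertical ?V (res_arr F\<^sub>1 g m))) \<cdot>[Q.total] Q.vertical ?V
    (fibre_cell g ?x) =
    la (P.lift g ?y) \<cdot>[Q.total] (Q.vertical ?V (fibre_arr ?V (res_arr F\<^sub>1 g m)) \<cdot>[Q.total] Q.vertical ?V
      (fibre_cell g ?x))"
    by (simp add: ss fibre_arr(2) Q.total.T.Comp_assoc)
  finally show "la (P.lift g ?y) \<cdot>[Q.total] Q.vertical ?V (fibre_cell g ?y \<cdot>[PObj F\<^sub>2 ?V] res_arr F\<^sub>2 g
    (fibre_arr ?U m)) =
    la (P.lift g ?y) \<cdot>[Q.total] Q.vertical ?V (fibre_arr ?V (res_arr F\<^sub>1 g m) \<cdot>[PObj F\<^sub>2 ?V] fibre_cell g ?x)"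
    by (simp add: Q.vertical_vertical ss)
  show "fibre_cell g ?y \<cdot>[PObj F\<^sub>2 ?V] res_arr F\<^sub>2 g (fibre_arr ?U m) \<in> Arr (PObj F\<^sub>2 ?V)"
    "fibre_arr ?V (res_arr F\<^sub>1 g m) \<cdot>[PObj F\<^sub>2 ?V] fibre_cell g ?x \<in> Arr (PObj F\<^sub>2 ?V)"
    "Cod (PObj F\<^sub>2 ?V) (fibre_cell g ?y \<cdot>[PObj F\<^sub>2 ?V] res_arr F\<^sub>2 g (fibre_arr ?U m)) =
      fibre_obj ?V (res_obj F\<^sub>1 g ?y)"
    "Cod (PObj F\<^sub>2 ?V) (fibre_arr ?V (res_arr F\<^sub>1 g m) \<cdot>[PObj F\<^sub>2 ?V] fibre_cell g ?x) =
      fibre_obj ?V (res_obj F\<^sub>1 g ?y)"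
    by (simp_all add: ss)
qed

lemma data_psn: "indexed_functor_data C small psn"
proof (intro indexed_functor_data.intro indexed_functor_data_axioms.intro)
  show "indexed_category C small (TDom psn)" "indexed_category C small (TCod psn)"
    unfolding psn_simps by (rule P.indexed_category_axioms Q.indexed_category_axioms)+
  show "is_functor (TAt psn U) \<and> FDom (TAt psn U) = PObj (TDom psn) U \<and> FCod (TAt psn U) = PObj (TCod psn) U" if
    "U \<in> Obj C" for U
    using functor_TAt_psn[OF that] by (simp add: psn_simps)
  fix g assume g: "g \<in> Arr C"
  have UV: "Cod C g \<in> Obj C" "Dom C g \<in> Obj C" using g by (auto simp: P.base_cat_simps)
  note fU = functor_TAt_psn[OF UV(1)] and fV = functor_TAt_psn[OF UV(2)]
  have n: "NDom (TCell psn g) = comp_func (PMor F\<^sub>2 g) (TAt psn (Cod C g))" "NCod (TCell psn g) =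
    comp_func (TAt psn (Dom C g)) (PMor F\<^sub>1 g)"
    "NAt (TCell psn g) \<in> extensional (Obj (PObj F\<^sub>1 (Cod C g)))"
    using g UV by (simp_all add: psn_def)
  have "is_ntrans (TCell psn g)"
  proof (rule is_ntransI[OF _ _ _ _ _ _ n(1,2), of "PObj F\<^sub>1 (Cod C g)" "PObj F\<^sub>2 (Dom C g)"])
    show "is_functor (comp_func (PMor F\<^sub>2 g) (TAt psn (Cod C g)))" "is_functor (comp_func (TAt psn (Dom C g))
      (PMor F\<^sub>1 g))"
      using fU fV P.PMor_facts[OF g] Q.PMor_facts[OF g] by (auto intro!: is_functor_comp_func)
  qed (use g UV n(3) fU fV fibre_cell_natural[OF g] in \<open>simp_all add: comp_func_simps P.PMor_facts Q.PMor_facts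
    fibre_map_simps hom_def P.fibre_simps P.res_simps\<close>)
  then show "is_ntrans (TCell psn g) \<and> NDom (TCell psn g) = comp_func (PMor (TCod psn) g) (TAt psn (Cod C g)) \<and>
      NCod (TCell psn g) = comp_func (TAt psn (Dom C g)) (PMor (TDom psn) g)"
    using n by (simp add: psn_simps)
qed

text \<open>Tested against the image of a lift, the two coherence laws become
  \<open>lift_comp\<close> and \<open>lift_unit\<close> in the target and, through functoriality of
  \<open>la\<close>, in the source.\<close>

lemma pseudonatural_psn: "pseudonatural (base C) (CAT small) psn"
proof (rule indexed_functor_data.pseudonaturalI[OF data_psn], unfold psn_simps(1,2))
  show "TAt psn \<in> extensional (Obj C)" "TCell psn \<in> extensional (Arr C)" by (simp_all add: psn_def)
  show "iso_arr (PObj F\<^sub>2 (Dom C f)) (NAt (TCell psn f) x)" if "f \<in> Arr C" "x \<in> Obj (PObj F\<^sub>1 (Cod C f))" for f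
    x
    using that by (simp add: fibre_map_simps)
next
  fix f g x assume f [simp]: "f \<in> Arr C" "g \<in> Arr C" "Cod C g = Dom C f" "x \<in> Obj (PObj F\<^sub>1 (Cod C f))"
  let ?W = "Dom C g" and ?V = "Dom C f" and ?h = "f \<cdot>[C] g"
  have [simp]: "?W \<in> Obj C" "?V \<in> Obj C" "Cod C f \<in> Obj C" "?h \<in> Arr C" "Dom C ?h = ?W" "Cod C ?h = Cod C f"
    by (simp_all add: P.base_cat_simps)
  let ?x = "fibre_obj (Cod C f) x" and ?rP = "res_comp F\<^sub>1 f g x" and ?t = "fibre_cell f x" and ?t' =
    "fibre_cell g (res_obj F\<^sub>1 f x)"
  note ss = fibre_map_simps P.res_simps Q.res_simps P.res_comp_simps Q.res_comp_simps Q.fibre_simps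
    P.fibre_simps Q.vertical_simps P.vertical_simps P.lift_simps Q.lift_simps la_lift
  let ?T = "Q.total" and ?v = "Q.vertical ?W"
  have "fibre_cell ?h x \<cdot>[PObj F\<^sub>2 ?W] res_comp F\<^sub>2 f g ?x = fibre_arr ?W ?rP \<cdot>[PObj F\<^sub>2 ?W] (?t' \<cdot>[PObj F\<^sub>2 ?W]
    res_arr F\<^sub>2 g ?t)"
  proof (rule fibre_eqI[of ?h x])
    have "la (P.lift ?h x) \<cdot>[?T] ?v (fibre_cell ?h x \<cdot>[PObj F\<^sub>2 ?W] res_comp F\<^sub>2 f g ?x) =
      (la (P.lift ?h x) \<cdot>[?T] ?v (fibre_cell ?h x)) \<cdot>[?T] ?v (res_comp F\<^sub>2 f g ?x)"
      by (simp add: ss Q.vertical_vertical[symmetric] Q.total.T.Comp_assoc)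
    also have "\<dots> = Q.lift f ?x \<cdot>[?T] Q.lift g (res_obj F\<^sub>2 f ?x)"
      using Q.lift_comp[of f g ?x] by (simp add: ss fibre_cell(5))
    also have "\<dots> = la (P.lift f x) \<cdot>[?T] (Q.vertical ?V ?t \<cdot>[?T] Q.lift g (res_obj F\<^sub>2 f ?x))"
      using fibre_cell(5)[of f x ?V] by (simp add: ss flip: Q.total.T.Comp_assoc)
    also have "Q.vertical ?V ?t \<cdot>[?T] Q.lift g (res_obj F\<^sub>2 f ?x) = Q.lift g (fibre_obj ?V (res_obj F\<^sub>1 f
      x)) \<cdot>[?T] ?v (res_arr F\<^sub>2 g ?t)"
      using Q.lift_vertical_res[of g ?t] by (simp add: ss)
    also have "\<dots> = la (P.lift g (res_obj F\<^sub>1 f x)) \<cdot>[?T] (?v ?t' \<cdot>[?T] ?v (res_arr F\<^sub>2 g ?t))"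
      using fibre_cell(5)[of g "res_obj F\<^sub>1 f x" ?W] by (simp add: ss flip: Q.total.T.Comp_assoc)
    also have "la (P.lift f x) \<cdot>[?T] (la (P.lift g (res_obj F\<^sub>1 f x)) \<cdot>[?T] (?v ?t' \<cdot>[?T] ?v (res_arr F\<^sub>2 g
      ?t))) =
      (la (P.lift f x) \<cdot>[?T] la (P.lift g (res_obj F\<^sub>1 f x))) \<cdot>[?T] (?v ?t' \<cdot>[?T] ?v (res_arr F\<^sub>2 g ?t))"
      by (simp add: ss Q.total.T.Comp_assoc Q.total.over_simps)
    also have "la (P.lift f x) \<cdot>[?T] la (P.lift g (res_obj F\<^sub>1 f x)) = la (P.lift ?h x) \<cdot>[?T] ?v (fibre_arr ?W
      ?rP)"
      using P.lift_comp[of f g x] L.map_Comp[of "P.lift g (res_obj F\<^sub>1 f x)" "P.lift f x"] L.map_Comp[of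
        "P.vertical ?W ?rP" "P.lift ?h x"]
      by (simp add: ss fibre_arr(2))
    finally show "la (P.lift ?h x) \<cdot>[?T] ?v (fibre_cell ?h x \<cdot>[PObj F\<^sub>2 ?W] res_comp F\<^sub>2 f g ?x) =
      la (P.lift ?h x) \<cdot>[?T] ?v (fibre_arr ?W ?rP \<cdot>[PObj F\<^sub>2 ?W] (?t' \<cdot>[PObj F\<^sub>2 ?W] res_arr F\<^sub>2 g ?t))"
      by (simp add: ss Q.vertical_vertical[symmetric] Q.total.T.Comp_assoc Q.total.over_simps)
  qed (simp_all add: ss)
  then show "NAt (TCell psn ?h) x \<cdot>[PObj F\<^sub>2 ?W] res_comp F\<^sub>2 f g (FObj (TAt psn (Cod C f)) x) =
      FArr (TAt psn ?W) ?rP \<cdot>[PObj F\<^sub>2 ?W] (NAt (TCell psn g) (res_obj F\<^sub>1 f x) \<cdot>[PObj F\<^sub>2 ?W] res_arr F\<^sub>2 g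
        (NAt (TCell psn f) x))"
    by (simp add: ss)
next
  fix U x assume U [simp]: "U \<in> Obj C" "x \<in> Obj (PObj F\<^sub>1 U)"
  have [simp]: "Ident C U \<in> Arr C" "Dom C (Ident C U) = U" "Cod C (Ident C U) = U" by (simp_all add:
    P.base_cat_simps)
  note ss = fibre_map_simps P.res_simps Q.res_simps P.res_unit_simps Q.res_unit_simps Q.fibre_simps
    P.fibre_simps Q.vertical_simps P.vertical_simps P.lift_simps Q.lift_simps la_lift
  let ?T = "Q.total" and ?i = "Ident C U"
  have "fibre_cell ?i x \<cdot>[PObj F\<^sub>2 U] res_unit F\<^sub>2 U (fibre_obj U x) = fibre_arr U (res_unit F\<^sub>1 U x)"
  proof (rule fibre_eqI[of ?i x])
    have "la (P.lift ?i x) \<cdot>[?T] Q.vertical U (fibre_cell ?i x \<cdot>[PObj F\<^sub>2 U] res_unit F\<^sub>2 U (fibre_obj U x)) =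
      (la (P.lift ?i x) \<cdot>[?T] Q.vertical U (fibre_cell ?i x)) \<cdot>[?T] Q.vertical U (res_unit F\<^sub>2 U (fibre_obj U
        x))"
      by (simp add: ss Q.vertical_vertical[symmetric] Q.total.T.Comp_assoc)
    also have "\<dots> = Ident ?T (U, fibre_obj U x)"
      using Q.lift_unit[of U "fibre_obj U x"] by (simp add: ss fibre_cell(5))
    also have "\<dots> = la (P.lift ?i x \<cdot>[P.total] P.vertical U (res_unit F\<^sub>1 U x))"
      using L.map_Ident[of "(U, x)"] fibre_obj(1)[of U x] by (simp add: P.lift_unit P.total_simps(1))
    also have "\<dots> = la (P.lift ?i x) \<cdot>[?T] Q.vertical U (fibre_arr U (res_unit F\<^sub>1 U x))"
      using L.map_Comp[of "P.vertical U (res_unit F\<^sub>1 U x)" "P.lift ?i x"] by (simp add: ss fibre_arr(2))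
    finally show "la (P.lift ?i x) \<cdot>[?T] Q.vertical U (fibre_cell ?i x \<cdot>[PObj F\<^sub>2 U] res_unit F\<^sub>2 U (fibre_obj U
      x)) =
      la (P.lift ?i x) \<cdot>[?T] Q.vertical U (fibre_arr U (res_unit F\<^sub>1 U x))" .
  qed (simp_all add: ss)
  then show "NAt (TCell psn ?i) x \<cdot>[PObj F\<^sub>2 U] res_unit F\<^sub>2 U (FObj (TAt psn U) x) =
    FArr (TAt psn U) (res_unit F\<^sub>1 U x)"
    by (simp add: ss)
qed

end

section \<open>Modifications\<close>

text \<open>The inverses of the components are natural: insert a component of \<Gamma> with its
  inverse and use naturality of \<Gamma>.\<close>

lemma (in two_category_pair) invertible_modification:
  assumes \<Gamma>: "modification K L \<Gamma>" and inv: "\<And>x. x \<in> Ob K \<Longrightarrow> invertible_cell L (MAt \<Gamma> x)"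
  shows "invertible_cell ps \<Gamma>"
proof -
  interpret ps: two_category ps by (rule two_category_ps)
  interpret modification K L \<Gamma> by (rule \<Gamma>)
  have "\<forall>x\<in>Ob K. \<exists>\<beta>. \<beta> \<in> Cell L \<and> dom2 L \<beta> = TAt (MCod \<Gamma>) x \<and> cod2 L \<beta> = TAt (MDom \<Gamma>) x \<and>
    \<beta> \<bullet>[L] MAt \<Gamma> x = id2 L (TAt (MDom \<Gamma>) x) \<and> MAt \<Gamma> x \<bullet>[L] \<beta> = id2 L (TAt (MCod \<Gamma>) x)"
    using inv modif_simps[OF \<Gamma>] unfolding L.invertible_cell_iff by metis
  from bchoice[OF this] obtain b where b: "\<And>x. x \<in> Ob K \<Longrightarrow> b x \<in> Cell L \<and> dom2 L (b x) = TAt (MCod \<Gamma>) x \<and>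
    cod2 L (b x) = TAt (MDom \<Gamma>) x \<and>
    b x \<bullet>[L] MAt \<Gamma> x = id2 L (TAt (MDom \<Gamma>) x) \<and> MAt \<Gamma> x \<bullet>[L] b x = id2 L (TAt (MCod \<Gamma>) x)" by blast
  let ?D = "\<lparr>MDom = MCod \<Gamma>, MCod = MDom \<Gamma>, MAt = restrict b (Ob K)\<rparr>"
  note [simp] = psfun_simps[OF psnat_simps(1)[OF modif_simps(1)[OF \<Gamma>]]] psfun_simps[OF psnat_simps(2)[OF
    modif_simps(1)[OF \<Gamma>]]]
    psnat_simps(3-)[OF modif_simps(1)[OF \<Gamma>]] psnat_simps(3-)[OF modif_simps(2)[OF \<Gamma>]] modif_simps(3-)[OF \<Gamma>]
      K.two_cat_simps
  have D: "modification K L ?D"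
  proof (rule modification.intro)
    fix f assume f [simp]: "f \<in> Mor K"
    let ?x = "src K f" and ?y = "tgt K f" and ?P = "id2 L (PMor (TDom (MDom \<Gamma>)) f)" and ?Q =
      "id2 L (PMor (TCod (MDom \<Gamma>)) f)"
      and ?T = "TCell (MDom \<Gamma>) f" and ?T' = "TCell (MCod \<Gamma>) f"
    have xy [simp]: "?x \<in> Ob K" "?y \<in> Ob K" by simp_all
    note bx [simp] = b[OF xy(1)] and by' [simp] = b[OF xy(2)]
    have "(b ?y \<star>[L] ?P) \<bullet>[L] ?T' = (b ?y \<star>[L] ?P) \<bullet>[L] (?T' \<bullet>[L] (?Q \<star>[L] (MAt \<Gamma> ?x \<bullet>[L] b ?x)))"
      using L.two_cat_simps(21)[of ?T'] by (simp add: L.two_cat_simps)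
    also have "\<dots> = (b ?y \<star>[L] ?P) \<bullet>[L] ((?T' \<bullet>[L] (?Q \<star>[L] MAt \<Gamma> ?x)) \<bullet>[L] (?Q \<star>[L] b ?x))"
      using L.whisker_left_vcomp[of "b ?x" "MAt \<Gamma> ?x" "PMor (TCod (MDom \<Gamma>)) f"] by (simp add: L.two_cat_simps)
    also have "\<dots> = ((b ?y \<bullet>[L] MAt \<Gamma> ?y) \<star>[L] ?P) \<bullet>[L] (?T \<bullet>[L] (?Q \<star>[L] b ?x))"
      unfolding MAt_natural[OF f, symmetric]
      using L.whisker_right_vcomp[of "MAt \<Gamma> ?y" "b ?y" "PMor (TDom (MDom \<Gamma>)) f"] by (simp add: L.two_cat_simps)
    also have "\<dots> = ?T \<bullet>[L] (?Q \<star>[L] b ?x)"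
      using L.two_cat_simps(20)[of "?T \<bullet>[L] (?Q \<star>[L] b ?x)"] by (simp add: L.two_cat_simps)
    finally show "(MAt ?D ?y \<star>[L] id2 L (PMor (TDom (MDom ?D)) f)) \<bullet>[L] TCell (MDom ?D) f =
      TCell (MCod ?D) f \<bullet>[L] (id2 L (PMor (TCod (MDom ?D)) f) \<star>[L] MAt ?D ?x)" by simp
  qed (use b modif_simps(1,2)[OF \<Gamma>] in \<open>simp_all add: hom_def vcat_def\<close>)
  have "?D \<bullet>[ps] \<Gamma> = id2 ps (MDom \<Gamma>)"
    by (rule modif_eqI[where K=K and L=L]) (use D \<Gamma> b modif_simps(1,2)[OF \<Gamma>] in \<open>simp_all add: ps_simps
      modification_vcomp modification_id2\<close>)
  moreover have "\<Gamma> \<bullet>[ps] ?D = id2 ps (MCod \<Gamma>)"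
    by (rule modif_eqI[where K=K and L=L]) (use D \<Gamma> b modif_simps(1,2)[OF \<Gamma>] in \<open>simp_all add: ps_simps
      modification_vcomp modification_id2\<close>)
  ultimately show ?thesis
    unfolding ps.invertible_cell_iff using D \<Gamma> by (intro conjI bexI[of _ ?D]) (simp_all add: ps_simps)
qed

lemma (in two_category_pair) invertible_modificationD:
  assumes "invertible_cell ps \<Gamma>" "x \<in> Ob K"
  shows "invertible_cell L (MAt \<Gamma> x)"
proof -
  interpret ps: two_category ps by (rule two_category_ps)
  obtain \<Delta> where d: "modification K L \<Gamma>" "modification K L \<Delta>" "MDom \<Delta> = MCod \<Gamma>" "MCod \<Delta> = MDom \<Gamma>"
    "\<Delta> \<bullet>[ps] \<Gamma> = id2 ps (MDom \<Gamma>)" "\<Gamma> \<bullet>[ps] \<Delta> = id2 ps (MCod \<Gamma>)"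
    using assms(1) unfolding ps.invertible_cell_iff by (auto simp: ps_simps)
  have "MAt \<Delta> x \<bullet>[L] MAt \<Gamma> x = id2 L (TAt (MDom \<Gamma>) x)" "MAt \<Gamma> x \<bullet>[L] MAt \<Delta> x = id2 L (TAt (MCod \<Gamma>) x)"
    using arg_cong[OF d(5), of "\<lambda>a. MAt a x"] arg_cong[OF d(6), of "\<lambda>a. MAt a x"] assms(2) by (simp_all add:
      ps_simps)
  then show ?thesis
    unfolding L.invertible_cell_iff using modif_simps(5-)[OF d(1) assms(2)] modif_simps(5-)[OF d(2) assms(2)]
      d(3,4)
    by (intro conjI bexI[of _ "MAt \<Delta> x"]) simp_all
qed

text \<open>An inverse cell has the same source and target objects, so it stays in the full
  sub-2-category.\<close>

lemma invertible_cell_full_sub: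
  assumes "two_category K"
  shows "invertible_cell (full_sub K X) \<alpha> \<longleftrightarrow> \<alpha> \<in> Cell (full_sub K X) \<and> invertible_cell K \<alpha>"
proof -
  interpret K: two_category K by (rule assms)
  interpret S: two_category "full_sub K X" by (rule two_category_full_sub[OF assms])
  show ?thesis
    unfolding K.invertible_cell_iff S.invertible_cell_iff
    using K.src_cod2 K.tgt_cod2 by (auto simp: full_sub_def)
qed

section \<open>Modifications and composite transformations in components\<close>

locale indexed_functor_pair = s: indexed_functor C small \<sigma> + t: indexed_functor C small \<tau>
  for C :: "('o, 'm) cat" and small :: "'u set \<Rightarrow> bool" and \<sigma> \<tau> :: "('o, 'm, 'u, 'u) cat_psnat" +
  assumes TDom_eq: "TDom \<tau> = TDom \<sigma>" and TCod_eq: "TCod \<tau> = TCod \<sigma>"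
begin

text \<open>Whiskering with the identity of a functor leaves one factor in each component, so the
  modification law becomes a commuting square in a fibre.\<close>

lemma natural_components:
  assumes "MDom \<Gamma> = \<sigma>" "MCod \<Gamma> = \<tau>"
    and M: "\<And>U. U \<in> Obj C \<Longrightarrow> is_ntrans (MAt \<Gamma> U) \<and> NDom (MAt \<Gamma> U) = TAt \<sigma> U \<and> NCod (MAt \<Gamma> U) = TAt \<tau> U"
    and f: "f \<in> Arr C"
  shows "(MAt \<Gamma> (Dom C f) \<star>[CAT small] id2 (CAT small) (PMor (TDom (MDom \<Gamma>)) f)) \<bullet>[CAT small] TCell (MDom \<Gamma>) f =
      TCell (MCod \<Gamma>) f \<bullet>[CAT small] (id2 (CAT small) (PMor (TCod (MDom \<Gamma>)) f) \<star>[CAT small] MAt \<Gamma> (Cod C f)) \<longleftrightarrow>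
    (\<forall>x\<in>Obj (s.P (Cod C f)). NAt (MAt \<Gamma> (Dom C f)) (res_obj (TDom \<sigma>) f x) \<cdot>[s.Q (Dom C f)] s.tcell f x =
      t.tcell f x \<cdot>[s.Q (Dom C f)] res_arr (TCod \<sigma>) f (NAt (MAt \<Gamma> (Cod C f)) x))"
    (is "?l = ?r \<longleftrightarrow> _")
proof -
  let ?V = "Dom C f" and ?U = "Cod C f"
  have V: "?V \<in> Obj C" and U: "?U \<in> Obj C" using f by (auto simp: s.C.Dom_in s.C.Cod_in)
  interpret D: category "s.Q ?V" using V s.Q.category_PObj by blast
  note [simp] = assms(1,2) TDom_eq TCod_eq
  note sf = s.TCell_facts[OF f] and tf = t.TCell_facts[OF f, simplified]
  note MV = M[OF V] and MU = M[OF U]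
  note [simp] = s.TAt_facts[OF V] s.TAt_facts[OF U] t.TAt_facts[OF V, simplified] t.TAt_facts[OF U, simplified]
    s.P.PMor_facts[OF f] s.Q.PMor_facts[OF f]
  have cP: "is_ntrans (nt_id (PMor (TDom \<sigma>) f))" "is_ntrans (nt_id (PMor (TCod \<sigma>) f))"
    by (rule is_ntrans_nt_id, simp)+
  have l: "is_ntrans ?l" "NDom ?l = comp_func (PMor (TCod \<sigma>) f) (TAt \<sigma> ?U)" "NCod ?l =
    comp_func (TAt \<tau> ?V) (PMor (TDom \<sigma>) f)"
    using MV cP sf by (auto simp: CAT_simps nt_vcomp_simps nt_hcomp_simps nt_id_simps intro!: is_ntrans_nt_vcomp
      is_ntrans_nt_hcomp)
  have r: "is_ntrans ?r" "NDom ?r = comp_func (PMor (TCod \<sigma>) f) (TAt \<sigma> ?U)" "NCod ?r =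
    comp_func (TAt \<tau> ?V) (PMor (TDom \<sigma>) f)"
    using MU cP tf by (auto simp: CAT_simps nt_vcomp_simps nt_hcomp_simps nt_id_simps intro!: is_ntrans_nt_vcomp
      is_ntrans_nt_hcomp)
  have mt: "NAt (MAt \<Gamma> W) y \<in> Arr (s.Q W)" "Dom (s.Q W) (NAt (MAt \<Gamma> W) y) = s.app W y"
    "Cod (s.Q W) (NAt (MAt \<Gamma> W) y) = t.app W y"
    if "W \<in> Obj C" "y \<in> Obj (s.P W)" for W y
    using is_ntransD(6-8)[of "MAt \<Gamma> W"] M[OF that(1)] that s.TAt_facts[OF that(1)] by auto
  have lx: "NAt ?l x = NAt (MAt \<Gamma> ?V) (res_obj (TDom \<sigma>) f x) \<cdot>[s.Q ?V] s.tcell f x"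
    and rx: "NAt ?r x = t.tcell f x \<cdot>[s.Q ?V] res_arr (TCod \<sigma>) f (NAt (MAt \<Gamma> ?U) x)" if x [simp]:
      "x \<in> Obj (s.P ?U)" for x
  proof -
    have xf: "res_obj (TDom \<sigma>) f x \<in> Obj (s.P ?V)" using f by (simp add: s.P.res_simps)
    have i: "FArr (TAt \<sigma> ?V) (Ident (s.P ?V) (res_obj (TDom \<sigma>) f x)) = Ident (s.Q ?V) (s.app ?V (res_obj (TDom
      \<sigma>) f x))"
      using s.app_simps(5)[OF V xf] .
    show "NAt ?l x = NAt (MAt \<Gamma> ?V) (res_obj (TDom \<sigma>) f x) \<cdot>[s.Q ?V] s.tcell f x"
      using MV sf xf f mt[OF V xf] i D.id_right[OF mt(1,2)[OF V xf]]
      by (simp add: CAT_simps nt_vcomp_simps nt_hcomp_simps nt_id_simps comp_func_simps)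
    have "res_arr (TCod \<sigma>) f (NAt (MAt \<Gamma> ?U) x) \<in> Arr (s.Q ?V)" "Cod (s.Q ?V) (res_arr (TCod \<sigma>) f (NAt (MAt \<Gamma>
      ?U) x)) = res_obj (TCod \<sigma>) f (t.app ?U x)"
      using f mt[OF U x] by (simp_all add: s.Q.res_simps)
    then show "NAt ?r x = t.tcell f x \<cdot>[s.Q ?V] res_arr (TCod \<sigma>) f (NAt (MAt \<Gamma> ?U) x)"
      using MU tf f mt[OF U x] t.app_simps(1)[OF U, simplified, of x] D.id_left
      by (simp add: CAT_simps nt_vcomp_simps nt_hcomp_simps nt_id_simps comp_func_simps)
  qed
  have "?l = ?r \<longleftrightarrow> (\<forall>x\<in>Obj (s.P ?U). NAt ?l x = NAt ?r x)"
    using l r by (auto intro!: ntrans_eqI simp: comp_func_simps)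
  then show ?thesis using lx rx by simp
qed

lemma modificationI:
  assumes "MDom \<Gamma> = \<sigma>" "MCod \<Gamma> = \<tau>" "MAt \<Gamma> \<in> extensional (Obj C)"
    and M: "\<And>U. U \<in> Obj C \<Longrightarrow> is_ntrans (MAt \<Gamma> U) \<and> NDom (MAt \<Gamma> U) = TAt \<sigma> U \<and> NCod (MAt \<Gamma> U) = TAt \<tau> U"
    and nat: "\<And>f x. \<lbrakk>f \<in> Arr C; x \<in> Obj (s.P (Cod C f))\<rbrakk> \<Longrightarrow> NAt (MAt \<Gamma> (Dom C f)) (res_obj (TDom \<sigma>) f x) \<cdot>[s.Q
      (Dom C f)] s.tcell f x =
      t.tcell f x \<cdot>[s.Q (Dom C f)] res_arr (TCod \<sigma>) f (NAt (MAt \<Gamma> (Cod C f)) x)"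
  shows "modification (base C) (CAT small) \<Gamma>"
proof (rule modification.intro, unfold base_simps)
  show "MAt \<Gamma> U \<in> hom (vcat (CAT small)) (TAt (MDom \<Gamma>) U) (TAt (MCod \<Gamma>) U)" if "U \<in> Obj C" for U
    using M[OF that] s.TAt_facts[OF that] s.P.small_category_PObj[OF that] s.Q.small_category_PObj[OF that]
      assms(1,2)
    by (simp add: hom_def vcat_def CAT_simps)
  fix f assume f: "f \<in> Arr C"
  show "(MAt \<Gamma> (Dom C f) \<star>[CAT small] id2 (CAT small) (PMor (TDom (MDom \<Gamma>)) f)) \<bullet>[CAT small] TCell (MDom \<Gamma>) f =
      TCell (MCod \<Gamma>) f \<bullet>[CAT small] (id2 (CAT small) (PMor (TCod (MDom \<Gamma>)) f) \<star>[CAT small] MAt \<Gamma> (Cod C f))"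
    using natural_components[OF assms(1,2) M f] nat[OF f] by blast
qed (use assms s.psnat t.psnat TDom_eq TCod_eq in simp_all)

end

locale composable = s: indexed_functor C small \<sigma> + t: indexed_functor C small \<tau>
  for C :: "('o, 'm) cat" and small :: "'u set \<Rightarrow> bool" and \<sigma> \<tau> :: "('o, 'm, 'u, 'u) cat_psnat" +
  assumes TDom_TCod: "TDom \<tau> = TCod \<sigma>"
begin

lemma pair: "two_category_pair (base C) (CAT small)"
  by (intro two_category_pair.intro two_category_locally_discrete category_op_cat s.C.category_axioms
    two_category_CAT)

abbreviation comp where "comp \<equiv> comp_psnat (base C) (CAT small) \<tau> \<sigma>"

lemma indexed_functor_comp: "indexed_functor C small comp"
  using two_category_pair.pseudonatural_comp_psnat[OF pair s.psnat t.psnat] TDom_TCod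
  by (simp add: indexed_functor_def indexed_functor_axioms_def s.C.category_axioms)

lemma comp_at:
  assumes "U \<in> Obj C"
  shows "TAt comp U = comp_func (TAt \<tau> U) (TAt \<sigma> U)"
  using assms by (simp add: comp_psnat_def base_simps CAT_simps)

lemma comp_tcell:
  assumes f: "f \<in> Arr C" and x: "x \<in> Obj (s.P (Cod C f))"
  shows "NAt (TCell comp f) x = t.app_arr (Dom C f) (s.tcell f x) \<cdot>[t.Q (Dom C f)] t.tcell f (s.app (Cod C f)
    x)"
proof -
  let ?V = "Dom C f" and ?U = "Cod C f"
  have V: "?V \<in> Obj C" and U: "?U \<in> Obj C" using f by (auto simp: s.C.Dom_in s.C.Cod_in)
  interpret D: category "t.Q ?V" using V t.Q.category_PObj by blast
  note [simp] = TDom_TCod f x U V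
  note [simp] = s.TAt_facts[OF V] s.TAt_facts[OF U] t.TAt_facts[OF V] t.TAt_facts[OF U] s.P.PMor_facts[OF f]
    s.Q.PMor_facts[OF f] t.Q.PMor_facts[OF f]
    s.TCell_facts[OF f] t.TCell_facts[OF f]
  have a: "s.tcell f x \<in> Arr (s.Q ?V)" "Cod (s.Q ?V) (s.tcell f x) = s.app ?V (res_obj (TDom \<sigma>) f x)"
    "s.app ?U x \<in> Obj (s.Q ?U)"
    "s.app ?V (res_obj (TDom \<sigma>) f x) \<in> Obj (s.Q ?V)"
    by (simp_all add: s.ifun_simps)
  have b: "t.app_arr ?V (s.tcell f x) \<in> Arr (t.Q ?V)" "Cod (t.Q ?V) (t.app_arr ?V (s.tcell f x)) =
    t.app ?V (s.app ?V (res_obj (TDom \<sigma>) f x))"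
    "t.tcell f (s.app ?U x) \<in> Arr (t.Q ?V)" "Dom (t.Q ?V) (t.tcell f (s.app ?U x)) =
      res_obj (TCod \<tau>) f (t.app ?U (s.app ?U x))"
    using t.app_simps[OF V] a t.tcell_simps[OF f refl] by simp_all
  have c: "res_arr (TCod \<tau>) f (FArr (TAt \<tau> ?U) (Ident (s.Q ?U) (s.app ?U x))) =
    Ident (t.Q ?V) (res_obj (TCod \<tau>) f (t.app ?U (s.app ?U x)))"
    using t.app_simps[OF U] a t.Q.res_simps[OF f] by simp
  show ?thesis
    using D.id_left[OF b(1,2)] D.id_right[OF b(3,4)] c
    by (simp add: comp_psnat_def base_simps CAT_simps nt_vcomp_simps nt_hcomp_simps nt_id_simps comp_func_simps
      s.ifun_simps)
qed

end

section \<open>Stacks are fibrant\<close>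

locale extension_problem = site C J + w: indexed_functor C small w + h: indexed_functor C small h
  for C :: "('o, 'm) cat" and J :: "'o \<Rightarrow> 'm set set" and small :: "'u set \<Rightarrow> bool"
    and w h :: "('o, 'm, 'u, 'u) cat_psnat" +
  assumes TDom_h: "TDom h = TDom w" and stack: "stack_condition C J (TCod h)"
    and ff: "U \<in> Obj C \<Longrightarrow> fully_faithful (TAt w U)"
    and local_surj: "\<lbrakk>U \<in> Obj C; b \<in> Obj (w.Q U)\<rbrakk> \<Longrightarrow> \<exists>S\<in>J U. \<forall>f\<in>S. \<exists>a\<in>Obj (w.P (Dom C f)).
      \<exists>u\<in>hom (w.Q (Dom C f)) (w.app (Dom C f) a) (res_obj (TCod w) f b). iso_arr (w.Q (Dom C f)) u"
begin

sublocale Z: indexed_site C J small "TCod h"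
  by (intro indexed_site.intro site_axioms h.Q.indexed_category_axioms)

text \<open>An isomorphism u from \<open>w.app a\<close> to the restriction of x along f is the same
  as a cartesian arrow \<open>(f, u, x)\<close> of the total category.\<close>

lemma dense:
  assumes "b \<in> Obj w.Q.total"
  shows "\<exists>S\<in>J (fst b). \<forall>f\<in>S. \<exists>a\<in>Obj w.P.total. \<exists>u.
      cartesian C w.Q.total u \<and> Dom w.Q.total u = w.tot_obj a \<and> Cod w.Q.total u = b \<and> fst u = f"
proof -
  obtain U x where b: "b = (U, x)" by (cases b)
  have U: "U \<in> Obj C" "x \<in> Obj (w.Q U)" using assms by (auto simp: b w.Q.total_simps)
  obtain S where S: "S \<in> J U" and s: "\<And>f. f \<in> S \<Longrightarrow> \<exists>a\<in>Obj (w.P (Dom C f)).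
      \<exists>u\<in>hom (w.Q (Dom C f)) (w.app (Dom C f) a) (res_obj (TCod w) f x). iso_arr (w.Q (Dom C f)) u"
    using local_surj[OF U] by blast
  have "\<exists>a\<in>Obj w.P.total. \<exists>u. cartesian C w.Q.total u \<and> Dom w.Q.total u = w.tot_obj a \<and> Cod w.Q.total u = b \<and>
    fst u = f"
    if f: "f \<in> S" for f
  proof -
    note Sf = sieveD[OF J.covers_sieve[OF U(1) S] f]
    obtain a u where a: "a \<in> Obj (w.P (Dom C f))" "u \<in> hom (w.Q (Dom C f)) (w.app (Dom C f) a) (res_obj (TCod w)
      f x)"
      "iso_arr (w.Q (Dom C f)) u" using s[OF f] by blast
    have "(f, u, x) \<in> Arr w.Q.total" using a(2) Sf U by (simp add: w.Q.total_simps hom_def)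
    then show ?thesis
      using a Sf by (intro bexI[of _ "(Dom C f, a)"] exI[of _ "(f, u, x)"])
        (simp_all add: w.Q.cartesian_iff w.Q.total_simps w.P.total_simps w.tot_obj_simps b hom_def C.Dom_in)
  qed
  then show ?thesis by (intro bexI[of _ S] ballI) (simp_all add: S b del: split_paired_Ex)
qed

sublocale E: dense_extension C J w.P.total w.Q.total h.Q.total w.tot_obj w.tot_arr h.tot_obj h.tot_arr
proof (intro dense_extension.intro dense_extension_axioms.intro)
  show "functor_over C w.P.total w.Q.total w.tot_obj w.tot_arr" by (rule w.functor_over)
  show "functor_over C w.P.total h.Q.total h.tot_obj h.tot_arr" using h.functor_over by (simp add: TDom_h)
  show "\<exists>u. cartesian C w.P.total u \<and> Cod w.P.total u = a \<and> fst u = g"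
    if "a \<in> Obj w.P.total" "g \<in> Arr C" "Cod C g = fst a" for a g
    using that w.P.cartesian_lift[of g "snd a"] w.P.lift_simps[of g "snd a"]
    by (intro exI[of _ "w.P.lift g (snd a)"]; cases a) (simp add: w.P.total_simps)
  show "\<exists>u. cartesian C h.Q.total u \<and> Cod h.Q.total u = a \<and> fst u = g"
    if "a \<in> Obj h.Q.total" "g \<in> Arr C" "Cod C g = fst a" for a g
    using that h.Q.cartesian_lift[of g "snd a"] h.Q.lift_simps[of g "snd a"]
    by (intro exI[of _ "h.Q.lift g (snd a)"]; cases a) (simp add: h.Q.total_simps)
qed (rule site_axioms w.P.total.category_over_axioms w.Q.total.category_over_axioms
  h.Q.total.category_over_axioms
    w.tot_arr_full_faithful[OF ff] dense Z.total_glue[OF Z.stack_iff[THEN iffD1, OF stack, THEN conjunct1]]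
    Z.total_descent[OF Z.stack_iff[THEN iffD1, OF stack, THEN conjunct2]]; assumption)+

sublocale L: functor_total C small "TCod w" "TCod h" E.lz E.lam
  by (intro functor_total.intro w.Q.indexed_category_axioms h.Q.indexed_category_axioms E.extension(1))

sublocale l: indexed_functor C small L.psn
  using L.pseudonatural_psn by (simp add: indexed_functor_def indexed_functor_axioms_def C.category_axioms)

sublocale composable C small w L.psn
  by (intro composable.intro composable_axioms.intro w.indexed_functor_axioms l.indexed_functor_axioms) (rule
    L.psn_simps(1))

sublocale indexed_functor_pair C small h comp
  by (intro indexed_functor_pair.intro indexed_functor_pair_axioms.intro h.indexed_functor_axioms
    indexed_functor_comp)
    (simp_all add: comp_psnat_def TDom_h L.psn_simps)

text \<open>The fibre arrow underlying \<open>eta\<close>. Since \<open>eta\<close> is cartesian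
  over an identity, this arrow is invertible; these arrows are the components of the 2-cell that
  fibrancy asks for.\<close>

definition mate where "mate U x = (SOME m. m \<in> Arr (h.Q U) \<and> E.eta (U, x) = h.Q.vertical U m)"

lemma mate:
  assumes "U \<in> Obj C" "x \<in> Obj (w.P U)"
  shows "mate U x \<in> Arr (h.Q U)" "E.eta (U, x) = h.Q.vertical U (mate U x)" "Dom (h.Q U) (mate U x) = h.app U x"
    "Cod (h.Q U) (mate U x) = L.fibre_obj U (w.app U x)" "iso_arr (h.Q U) (mate U x)"
proof -
  have "(U, x) \<in> Obj w.P.total" using assms by (simp add: w.P.total_simps)
  note e = E.extension(2)[OF this, unfolded w.tot_obj_simps h.tot_obj_simps hom_def]
  have "\<exists>m. m \<in> Arr (h.Q U) \<and> E.eta (U, x) = h.Q.vertical U m"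
    using h.Q.vertical_exists[OF assms(1), of "E.eta (U, x)"] e by auto
  from someI_ex[OF this] show m: "mate U x \<in> Arr (h.Q U)" "E.eta (U, x) = h.Q.vertical U (mate U x)"
    unfolding mate_def by auto
  show "Dom (h.Q U) (mate U x) = h.app U x" "Cod (h.Q U) (mate U x) = L.fibre_obj U (w.app U x)"
    "iso_arr (h.Q U) (mate U x)"
    using e h.Q.vertical_simps[OF assms(1) m(1)] h.Q.cartesian_vertical_iff[OF assms(1) m(1)] L.fibre_obj(1)[OF
      assms(1), of "w.app U x"]
      w.app_simps(1)[OF assms] by (simp_all add: m(2))
qed

text \<open>Naturality of \<open>eta\<close> at a vertical arrow, read in the fibre.\<close>

lemma mate_natural:
  assumes U: "U \<in> Obj C" and u: "u \<in> Arr (w.P U)"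
  shows "mate U (Cod (w.P U) u) \<cdot>[h.Q U] h.app_arr U u = L.fibre_arr U (w.app_arr U u) \<cdot>[h.Q U] mate U (Dom (w.P
    U) u)"
proof -
  have o: "Dom (w.P U) u \<in> Obj (w.P U)" "Cod (w.P U) u \<in> Obj (w.P U)" using U u by (simp_all add:
    w.P.fibre_simps)
  note v = w.P.vertical_simps[OF U u]
  note hs = h.app_simps[OF U, unfolded TDom_h] w.app_simps[OF U]
  note ss = U u o hs mate[OF U o(1)] mate[OF U o(2)] h.Q.fibre_simps L.fibre_arr L.fibre_obj
  have hv: "h.tot_arr (w.P.vertical U u) = h.Q.vertical U (h.app_arr U u)" using h.tot_arr_vertical[of U u] U u
    by (simp add: TDom_h)
  have "E.lam (w.tot_arr (w.P.vertical U u)) = h.Q.vertical U (L.fibre_arr U (w.app_arr U u))"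
    using w.tot_arr_vertical[OF U u] L.fibre_arr(2)[OF U, of "w.app_arr U u"] by (simp add: ss)
  then have "h.Q.vertical U (L.fibre_arr U (w.app_arr U u)) \<cdot>[h.Q.total] h.Q.vertical U (mate U (Dom (w.P U)
    u)) =
      h.Q.vertical U (mate U (Cod (w.P U) u)) \<cdot>[h.Q.total] h.Q.vertical U (h.app_arr U u)"
    using E.extension(3)[OF v(1)] hv mate(2)[OF U o(1)] mate(2)[OF U o(2)] by (simp add: v)
  then show ?thesis
    by - (rule h.Q.vertical_inject[OF U], simp_all add: ss h.Q.vertical_vertical)
qed

text \<open>Naturality of \<open>eta\<close> at the chosen lift of f, with lifts of images expressed
  through images of lifts by \<open>tot_arr_lift\<close>. Cancelling the cartesian arrow
  \<open>E.lam (w.tot_arr (w.P.lift f x))\<close> leaves the claim.\<close>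

lemma mate_tcell:
  assumes f: "f \<in> Arr C" and x: "x \<in> Obj (w.P (Cod C f))"
  shows "mate (Dom C f) (res_obj (TDom w) f x) \<cdot>[h.Q (Dom C f)] h.tcell f x =
    (L.fibre_arr (Dom C f) (w.tcell f x) \<cdot>[h.Q (Dom C f)] L.fibre_cell f (w.app (Cod C f) x)) \<cdot>[h.Q (Dom C f)]
      res_arr (TCod h) f (mate (Cod C f) x)"
proof -
  let ?V = "Dom C f" and ?U = "Cod C f" and ?y = "res_obj (TDom w) f x" and ?T = "h.Q.total" and ?b =
    "w.app (Cod C f) x"
  have V: "?V \<in> Obj C" and U: "?U \<in> Obj C" using f by (auto simp: C.Dom_in C.Cod_in)
  have y: "?y \<in> Obj (w.P ?V)" using f x by (simp add: w.P.res_simps)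
  have b: "?b \<in> Obj (w.Q ?U)" using U x by (simp add: w.app_simps)
  note [simp] = f x U V y b
  note mU = mate[OF U x] and mV = mate[OF V y]
  note l = w.P.lift_simps[OF f x]
  have kc: "cartesian C ?T (E.lam (w.tot_arr (w.P.lift f x)))"
    by (intro L.L.map_cartesian w.tot_arr_simps(5) l w.P.cartesian_lift f x)
  have k: "E.lam (w.tot_arr (w.P.lift f x)) \<in> Arr ?T" "Dom ?T (E.lam (w.tot_arr (w.P.lift f x))) =
    (?V, L.fibre_obj ?V (w.app ?V ?y))"
    using l w.tot_arr_simps[OF l(1)] by (simp_all add: L.L.map_simps w.tot_obj_simps L.fibre_obj w.app_simps)
  have hl: "h.Q.lift f (h.app ?U x) = h.tot_arr (w.P.lift f x) \<cdot>[?T] h.Q.vertical ?V (h.tcell f x)"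
    using h.tot_arr_lift[of f x] by (simp add: TDom_h)
  have hc: "h.tcell f x \<in> Arr (h.Q ?V)" "Dom (h.Q ?V) (h.tcell f x) = res_obj (TCod h) f (h.app ?U x)"
    "Cod (h.Q ?V) (h.tcell f x) = h.app ?V ?y"
    using h.tcell_simps[of f ?V x] by (simp_all add: TDom_h)
  have ht: "h.tot_arr (w.P.lift f x) \<in> Arr ?T" "Dom ?T (h.tot_arr (w.P.lift f x)) = (?V, h.app ?V ?y)"
    "Cod ?T (h.tot_arr (w.P.lift f x)) = (?U, h.app ?U x)"
    using h.tot_arr_simps[of "w.P.lift f x"] l by (simp_all add: TDom_h h.tot_obj_simps)
  have fc: "L.fibre_cell f ?b \<in> Arr (h.Q ?V)" "Dom (h.Q ?V) (L.fibre_cell f ?b) =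
    res_obj (TCod h) f (L.fibre_obj ?U ?b)"
    "Cod (h.Q ?V) (L.fibre_cell f ?b) = L.fibre_obj ?V (res_obj (TCod w) f ?b)" by (rule L.fibre_cell; simp)+
  have wc: "w.tcell f x \<in> Arr (w.Q ?V)" "Dom (w.Q ?V) (w.tcell f x) = res_obj (TCod w) f ?b"
    "Cod (w.Q ?V) (w.tcell f x) = w.app ?V ?y"
    by (simp_all add: w.ifun_simps)
  note wa = L.fibre_arr[OF V wc(1), unfolded wc(2,3)]
  have m: "res_arr (TCod h) f (mate ?U x) \<in> Arr (h.Q ?V)" "Dom (h.Q ?V) (res_arr (TCod h) f (mate ?U x)) =
    res_obj (TCod h) f (h.app ?U x)"
    "Cod (h.Q ?V) (res_arr (TCod h) f (mate ?U x)) = res_obj (TCod h) f (L.fibre_obj ?U ?b)"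
    using mU by (simp_all add: h.Q.res_simps)
  note ss = h.Q.vertical_simps[OF V] mV hc ht k fc wa m h.Q.total.T.Comp_assoc h.Q.vertical_simps[OF U] mU
    h.Q.fibre_simps h.Q.total.over_simps
  let ?v = "h.Q.vertical ?V" and ?K = "E.lam (w.tot_arr (w.P.lift f x))"
  have "?K \<cdot>[?T] (?v (mate ?V ?y) \<cdot>[?T] ?v (h.tcell f x)) = (?K \<cdot>[?T] ?v (mate ?V ?y)) \<cdot>[?T] ?v (h.tcell f x)"
    by (simp add: ss)
  also have "\<dots> = h.Q.vertical ?U (mate ?U x) \<cdot>[?T] h.Q.lift f (h.app ?U x)"
    using E.extension(3)[OF l(1)] mU(2) mV(2) by (simp add: l hl ss)
  also have "\<dots> = h.Q.lift f (L.fibre_obj ?U ?b) \<cdot>[?T] ?v (res_arr (TCod h) f (mate ?U x))"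
    using h.Q.lift_vertical_res[of f "mate ?U x"] mU by simp
  also have "h.Q.lift f (L.fibre_obj ?U ?b) = E.lam (w.Q.lift f ?b) \<cdot>[?T] ?v (L.fibre_cell f ?b)"
    using L.fibre_cell(5)[of f ?b ?V] by simp
  also have "E.lam (w.Q.lift f ?b) = ?K \<cdot>[?T] ?v (L.fibre_arr ?V (w.tcell f x))"
    using w.tot_arr_lift[OF f x] L.L.map_Comp[of "w.Q.vertical ?V (w.tcell f x)" "w.tot_arr (w.P.lift f x)"]
      wa(2)
      w.tot_arr_simps[OF l(1)] l w.Q.vertical_simps[OF V wc(1)] wc by (simp add: w.tot_obj_simps)
  finally have "?K \<cdot>[?T] ?v (mate ?V ?y \<cdot>[h.Q ?V] h.tcell f x) =
      ?K \<cdot>[?T] ?v ((L.fibre_arr ?V (w.tcell f x) \<cdot>[h.Q ?V] L.fibre_cell f ?b) \<cdot>[h.Q ?V] res_arr (TCod h) f (mate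
        ?U x))"
    by (simp add: ss h.Q.vertical_vertical[symmetric])
  then have "?v (mate ?V ?y \<cdot>[h.Q ?V] h.tcell f x) =
      ?v ((L.fibre_arr ?V (w.tcell f x) \<cdot>[h.Q ?V] L.fibre_cell f ?b) \<cdot>[h.Q ?V] res_arr (TCod h) f (mate ?U x))"
    by (rule h.Q.total.cartesian_cancel[OF kc]) (simp_all add: ss)
  then show ?thesis
    by (rule h.Q.vertical_inject[OF V, rotated 2]) (simp_all add: ss)
qed

lemma extension_exists:
  obtains l \<Gamma> where "pseudonatural (base C) (CAT small) l" "TDom l = TCod w" "TCod l = TCod h"
    "modification (base C) (CAT small) \<Gamma>" "MDom \<Gamma> = h" "MCod \<Gamma> = comp_psnat (base C) (CAT small) l w"
    "\<forall>U\<in>Obj C. invertible_cell (CAT small) (MAt \<Gamma> U)"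
proof
  let ?M = "\<lambda>U. \<lparr>NDom = TAt h U, NCod = TAt comp U, NAt = restrict (mate U) (Obj (w.P U))\<rparr>"
  let ?G = "\<lparr>MDom = h, MCod = comp, MAt = restrict ?M (Obj C)\<rparr>"
  have nt: "is_ntrans (?M U)" if U: "U \<in> Obj C" for U
    by (rule is_ntransI[of "TAt h U" "TAt comp U" "w.P U" "h.Q U"])
      (use h.TAt_facts[OF U] w.TAt_facts[OF U] l.TAt_facts[OF U] mate[OF U] mate_natural[OF U] w.app_simps[OF U]
        in
      \<open>simp_all add: TDom_h U comp_at L.psn_simps comp_func_simps is_functor_comp_func hom_def w.P.fibre_simps\<close>)
  show "modification (base C) (CAT small) ?G"
    by (rule modificationI)
      (use nt mate_tcell in \<open>simp_all add: TDom_h C.Dom_in C.Cod_in w.P.res_simps comp_tcell L.psn_simps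
        w.app_simps w.tcell_simps\<close>)
  have "invertible_cell (CAT small) (MAt ?G U)" if U: "U \<in> Obj C" for U
    using nt[OF U] U h.TAt_facts[OF U] mate(5)[OF U] w.P.small_category_PObj[OF U] h.Q.small_category_PObj[OF U]
    by (simp add: invertible_cell_CAT CAT_simps TDom_h)
  then show "\<forall>U\<in>Obj C. invertible_cell (CAT small) (MAt ?G U)" by blast
qed (simp_all add: L.pseudonatural_psn L.psn_simps)

end

text \<open>Invertibility of a modification is componentwise, and passing to a full sub-2-category
  adds only the condition that both ends lie in X.\<close>

lemma isomorphic_mors_ps:
  assumes "category C"
  shows "isomorphic_mors (full_sub (ps_presheaves small C) X) \<sigma> \<tau> \<longleftrightarrow>
    (\<exists>\<Gamma>. modification (base C) (CAT small) \<Gamma> \<and> MDom \<Gamma> = \<sigma> \<and> MCod \<Gamma> = \<tau> \<and> TDom \<sigma> \<in> X \<and> TCod \<sigma> \<in> X \<and>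
      (\<forall>U\<in>Obj C. invertible_cell (CAT small) (MAt \<Gamma> U)))"
proof -
  interpret two_category_pair "base C" "CAT small"
    by (intro two_category_pair.intro two_category_locally_discrete category_op_cat assms two_category_CAT)
  have "invertible_cell ps \<Gamma> \<longleftrightarrow> (\<forall>U\<in>Obj C. invertible_cell (CAT small) (MAt \<Gamma> U))"
    if "modification (base C) (CAT small) \<Gamma>" for \<Gamma>
    using invertible_modification[OF that] invertible_modificationD[of \<Gamma>] by (auto simp: base_simps)
  then show ?thesis
    unfolding isomorphic_mors_def ps_presheaves_def invertible_cell_full_sub[OF two_category_ps]
    by (auto simp: full_sub_def ps_simps)
qed

lemma PreSt_simps:
  "F \<in> Ob (PreSt small C J) \<longleftrightarrow> pseudofunctor (base C) (CAT small) F \<and> prestack_condition C J F"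
  "\<sigma> \<in> Mor (PreSt small C J) \<longleftrightarrow> pseudonatural (base C) (CAT small) \<sigma> \<and>
    prestack_condition C J (TDom \<sigma>) \<and> prestack_condition C J (TCod \<sigma>)"
  "src (PreSt small C J) = TDom" "tgt (PreSt small C J) = TCod"
  "comp1 (PreSt small C J) = comp_psnat (base C) (CAT small)"
  by (simp_all add: PreSt_def full_sub_def ps_presheaves_def ps_twocat_def)

lemma (in indexed_site) fibrant_if_stack:
  assumes st: "stack_condition C J F"
  shows "fibrant (PreSt small C J) (local_weak_equivalences small C J) F"
proof -
  have pre: "prestack_condition C J F" using st stack_iff prestack_iff_glues by simp
  have "\<exists>l\<in>hom (cat1 (PreSt small C J)) (TCod w) F. isomorphic_mors (PreSt small C J) h (l \<odot>[PreSt small C J]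
    w)"
    if w: "w \<in> local_weak_equivalences small C J" and h: "h \<in> hom (cat1 (PreSt small C J)) (TDom w) F" for w h
  proof -
    have h': "pseudonatural (base C) (CAT small) h" "TDom h = TDom w" "TCod h = F"
      "prestack_condition C J (TDom h)"
      using h by (auto simp: hom_def cat1_def PreSt_simps)
    have w': "pseudonatural (base C) (CAT small) w" "prestack_condition C J (TCod w)"
      using w by (auto simp: local_weak_equivalences_def PreSt_simps)
    interpret extension_problem C J small w h
      by (intro extension_problem.intro extension_problem_axioms.intro site_axioms indexed_functor.intro
        indexed_functor_axioms.intro C.category_axioms)
        (use w h' w' st in \<open>auto simp: local_weak_equivalences_def\<close>)
    obtain l \<Gamma> where l: "pseudonatural (base C) (CAT small) l" "TDom l = TCod w" "TCod l = TCod h"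
      "modification (base C) (CAT small) \<Gamma>" "MDom \<Gamma> = h" "MCod \<Gamma> = comp_psnat (base C) (CAT small) l w"
      "\<forall>U\<in>Obj C. invertible_cell (CAT small) (MAt \<Gamma> U)"
      by (rule extension_exists)
    have "l \<in> hom (cat1 (PreSt small C J)) (TCod w) F"
      using l h' w' pre by (simp add: hom_def cat1_def PreSt_simps)
    moreover have "isomorphic_mors (PreSt small C J) h (l \<odot>[PreSt small C J] w)"
      unfolding PreSt_simps(5) unfolding PreSt_def isomorphic_mors_ps[OF C.category_axioms] using l h' pre by
        auto
    ultimately show ?thesis by blast
  qed
  then show ?thesis using psfun pre by (simp add: fibrant_def PreSt_simps)
qed

section \<open>Fibrant prestacks are stacks\<close>

subsection \<open>Sieves as pseudofunctors\<close>

text \<open>An element serves both as an object and as its identity arrow, which fits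
  \<open>CAT\<close>, where objects and arrows have the same type.\<close>

definition discrete_cat :: "'x set \<Rightarrow> ('x, 'x) cat" where
  "discrete_cat X = \<lparr>Obj = X, Arr = X, Dom = (\<lambda>x. x), Cod = (\<lambda>x. x), Ident = (\<lambda>x. x), Comp = (\<lambda>y x. x)\<rparr>"

lemma discrete_cat_simps:
  "Obj (discrete_cat X) = X" "Arr (discrete_cat X) = X" "Dom (discrete_cat X) x = x" "Cod (discrete_cat X) x =
    x"
  "Ident (discrete_cat X) x = x" "y \<cdot>[discrete_cat X] x = x"
  by (simp_all add: discrete_cat_def)

lemma category_discrete_cat: "category (discrete_cat X)"
  by (rule category.intro) (simp_all add: discrete_cat_simps)

lemma iso_discrete_cat: "iso_arr (discrete_cat X) x \<longleftrightarrow> x \<in> X"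
  by (auto simp: iso_arr_def inverse_arrs_def hom_def discrete_cat_simps)

lemma hom_discrete_cat: "hom (discrete_cat X) x y = {z. z \<in> X \<and> z = x \<and> z = y}"
  by (auto simp: hom_def discrete_cat_simps)

text \<open>The value at V of the sieve, regarded as a subfunctor of a representable.\<close>

definition sections :: "('o, 'm) cat \<Rightarrow> 'm set \<Rightarrow> 'o \<Rightarrow> 'm set" where
  "sections C S V = {f \<in> S. Dom C f = V}"

definition sieve_res :: "('o, 'm) cat \<Rightarrow> 'm set \<Rightarrow> 'm \<Rightarrow> ('m, 'm, 'm, 'm) func" where
  "sieve_res C S g = \<lparr>FDom = discrete_cat (sections C S (Cod C g)), FCod =
    discrete_cat (sections C S (Dom C g)),
     FObj = restrict (\<lambda>f. f \<cdot>[C] g) (sections C S (Cod C g)), FArr = restrict (\<lambda>f. f \<cdot>[C] g) (sections C S (Cod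
       C g))\<rparr>"

lemma sieve_res_simps:
  "FDom (sieve_res C S g) = discrete_cat (sections C S (Cod C g))" "FCod (sieve_res C S g) =
    discrete_cat (sections C S (Dom C g))"
  "f \<in> sections C S (Cod C g) \<Longrightarrow> FObj (sieve_res C S g) f = f \<cdot>[C] g"
  "f \<in> sections C S (Cod C g) \<Longrightarrow> FArr (sieve_res C S g) f = f \<cdot>[C] g"
  by (simp_all add: sieve_res_def)

text \<open>A presheaf of sets is a strict functor to discrete categories, so all comparison cells
  are identities; \<open>sieve_res_Comp\<close> and \<open>sieve_res_Ident\<close> ensure that these
  have the required boundaries.\<close>

definition sieve_psfun :: "('o, 'm) cat \<Rightarrow> 'm set \<Rightarrow> ('o, 'm, 'm, 'm) cat_psfun" where
  "sieve_psfun C S = \<lparr>PObj = (\<lambda>V. discrete_cat (sections C S V)), PMor = sieve_res C S,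
     PCell = (\<lambda>g. nt_id (sieve_res C S g)), PComp = (\<lambda>g f. nt_id (sieve_res C S (f \<cdot>[C] g))),
     PUnit = (\<lambda>V. nt_id (sieve_res C S (Ident C V)))\<rparr>"

text \<open>The fibres are sets of arrows of \<open>C\<close>, so these arrows live in the type
  \<open>'u\<close> over which \<open>CAT\<close> is formed.\<close>

locale sieve_on = category C for C :: "('o, 'u) cat" +
  fixes small :: "'u set \<Rightarrow> bool" and U :: 'o and S :: "'u set"
  assumes small: "smallness small" "small (Arr C)" and sieve: "sieve C U S"
begin

abbreviation Y where "Y \<equiv> sieve_psfun C S"

lemma sieve_arr: "f \<in> S \<Longrightarrow> f \<in> Arr C" "f \<in> S \<Longrightarrow> Cod C f = U" "\<lbrakk>f \<in> S; e \<in> Arr C; Cod C e = Dom C f\<rbrakk> \<Longrightarrow>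
  f \<cdot>[C] e \<in> S"
  using sieve by (auto simp: sieve_def)

lemmas cat_simps = Dom_in Cod_in Ident_in Dom_Ident Cod_Ident Comp_in Dom_Comp Cod_Comp

lemma functor_sieve_res:
  assumes "g \<in> Arr C"
  shows "is_functor (sieve_res C S g)"
  by (rule is_functorI[OF category_discrete_cat category_discrete_cat])
    (use assms sieve_arr in \<open>auto simp: sieve_res_def discrete_cat_simps sections_def hom_def cat_simps\<close>)

lemma sieve_res_Comp:
  assumes "f \<in> Arr C" "g \<in> Arr C" "Cod C g = Dom C f"
  shows "sieve_res C S (f \<cdot>[C] g) = comp_func (sieve_res C S g) (sieve_res C S f)"
  by (rule func_eqI)
    (use assms sieve_arr in \<open>auto simp: is_functor_comp_func functor_sieve_res cat_simps comp_func_simps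
      sieve_res_simps
      discrete_cat_simps sections_def Comp_assoc\<close>)

lemma sieve_res_Ident:
  assumes "V \<in> Obj C"
  shows "sieve_res C S (Ident C V) = id_func (discrete_cat (sections C S V))"
  by (rule func_eqI)
    (use assms sieve_arr Comp_Ident_right in \<open>auto simp: functor_sieve_res is_functor_id_func
      category_discrete_cat cat_simps id_func_simps
      sieve_res_simps discrete_cat_simps sections_def\<close>)

lemma pseudofunctor_sieve: "pseudofunctor (base C) (CAT small) Y"
proof -
  interpret L: two_category "CAT small" by (rule two_category_CAT)
  have s: "small_category small (discrete_cat (sections C S V))" for V
  proof -
    \<comment> \<open>A fibre is a subset of the small set of arrows of \<open>C\<close>, and
      smallness passes to subsets.\<close>
    have "sections C S V \<lesssim> Arr C" using sieve_arr by (intro subset_imp_lepoll) (auto simp: sections_def)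
    then have "small (sections C S V)" using small unfolding smallness_def by blast
    then show ?thesis by (simp add: small_category_def category_discrete_cat discrete_cat_simps)
  qed
  have m: "sieve_res C S g \<in> Mor (CAT small)" "src (CAT small) (sieve_res C S g) =
    discrete_cat (sections C S (Cod C g))"
    "tgt (CAT small) (sieve_res C S g) = discrete_cat (sections C S (Dom C g))" if "g \<in> Arr C" for g
    using functor_sieve_res[OF that] s by (simp_all add: CAT_simps sieve_res_def)
  have i: "nt_id F = id2 (CAT small) F" for F :: "('u, 'u, 'u, 'u) func" by (simp add: CAT_simps)
  have c: "sieve_res C S (f \<cdot>[C] g) = sieve_res C S g \<odot>[CAT small] sieve_res C S f"
    if "f \<in> Arr C" "g \<in> Arr C" "Cod C g = Dom C f" for f g
    using sieve_res_Comp[OF that] by (simp add: CAT_simps)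
  have u: "sieve_res C S (Ident C V) = id1 (CAT small) (discrete_cat (sections C S V))" if "V \<in> Obj C" for V
    using sieve_res_Ident[OF that] by (simp add: CAT_simps)
  have ob: "discrete_cat (sections C S V) \<in> Ob (CAT small)" for V using s by (simp add: CAT_simps)
  have ii: "id2 (CAT small) F \<bullet>[CAT small] id2 (CAT small) F = id2 (CAT small) F" if "F \<in> Mor (CAT small)" for F
    using L.two_cat_simps(20)[of "id2 (CAT small) F"] that by (simp add: L.two_cat_simps)
  have un: "sieve_res C S g \<odot>[CAT small] id1 (CAT small) (discrete_cat (sections C S (Cod C g))) =
    sieve_res C S g"
    "id1 (CAT small) (discrete_cat (sections C S (Dom C g))) \<odot>[CAT small] sieve_res C S g = sieve_res C S g" if
      "g \<in> Arr C" for g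
    using L.two_cat_simps(9,10)[of "sieve_res C S g"] m[OF that] by simp_all
  show ?thesis
    by (rule pseudofunctor.intro)
      (use ob un in \<open>simp_all add: base_simps sieve_psfun_def i m c u ii L.two_cat_simps L.invertible_id2
        hom_def cat1_def vcat_def cat_simps Comp_assoc\<close>)
qed

sublocale indexed_category C small Y
  by (intro indexed_category.intro indexed_category_axioms.intro category_axioms pseudofunctor_sieve)

lemma sieve_psfun_simps:
  "PObj Y V = discrete_cat (sections C S V)"
  "\<lbrakk>f \<in> S; Cod C g = Dom C f\<rbrakk> \<Longrightarrow> res_obj Y g f = f \<cdot>[C] g"
  "\<lbrakk>f \<in> S; Cod C g = Dom C f\<rbrakk> \<Longrightarrow> res_arr Y g f = f \<cdot>[C] g"
  "\<lbrakk>h \<in> S; f \<in> Arr C; g \<in> Arr C; Cod C f = Dom C h; Cod C g = Dom C f\<rbrakk> \<Longrightarrow> res_comp Y f g h = h \<cdot>[C] (f \<cdot>[C] g)"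
  "f \<in> S \<Longrightarrow> res_unit Y (Dom C f) f = f"
  using Comp_Ident_right[of f] sieve_arr(1)[of f]
  by (simp_all add: sieve_psfun_def sieve_res_def nt_id_simps sections_def discrete_cat_simps cat_simps
    nt_id_def)

end

text \<open>In a discrete fibre an arrow from a to b exists only if they are equal, so
  \<open>a = b\<close> has to be shown. A compatible family says that a and b agree along the cover
  R. Both then amalgamate the same matching family in the representable of U, where amalgamations
  are unique.\<close>

lemma glues_sieve:
  assumes "sieve_on C small U S" "site C J" "precanonical C J" "U \<in> Obj C"
  shows "indexed_site.glues C J (sieve_psfun C S)"
proof -
  interpret sieve_on C small U S by fact
  interpret site C J by fact
  interpret indexed_site C J small Y ..
  show ?thesis
    unfolding glues_def
  proof (intro ballI allI impI)
    fix V R a b s assume V: "V \<in> Obj C" and R: "R \<in> J V" and "a \<in> Obj (PObj Y V)" "b \<in> Obj (PObj Y V)" and c: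
      "compatible R a b s"
    then have ab: "a \<in> S" "b \<in> S" "Dom C a = V" "Dom C b = V" by (auto simp: sieve_psfun_simps
      discrete_cat_simps sections_def)
    note Rv = J.covers_sieve[OF V R, unfolded sieve_def]
    then have Rc: "Cod C f = V" if "f \<in> R" for f using that by auto
    have s: "s f = a \<cdot>[C] f" "s f = b \<cdot>[C] f" if "f \<in> R" for f
    proof -
      have "s f = res_obj Y f a" "s f = res_obj Y f b"
        using c that unfolding compatible_def hom_discrete_cat sieve_psfun_simps(1) by blast+
      then show "s f = a \<cdot>[C] f" "s f = b \<cdot>[C] f"
        using ab Rc[OF that] by (simp_all add: sieve_psfun_simps)
    qed
    have "matching_family C (representable C U) R (\<lambda>f. a \<cdot>[C] f)"
      using Rv sieve_arr[OF ab(1)] ab by (auto simp: matching_family_def representable_def hom_def cat_simps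
        Comp_assoc)
    then have "\<exists>!t. t \<in> hom C V U \<and> (\<forall>f\<in>R. t \<cdot>[C] f = a \<cdot>[C] f)"
      using assms(3,4) V R by (force simp: precanonical_def is_sheaf_def representable_def)
    moreover have "a \<in> hom C V U" "b \<in> hom C V U" using sieve_arr ab by (auto simp: hom_def)
    moreover have "\<forall>f\<in>R. b \<cdot>[C] f = a \<cdot>[C] f" using s by metis
    ultimately have "a = b" by blast
    then show "\<exists>!t. t \<in> hom (PObj Y V) a b \<and> (\<forall>f\<in>R. res_arr Y f t = s f)"
      using s Rc ab by (auto simp: sieve_psfun_simps hom_discrete_cat sections_def)
  qed
qed

subsection \<open>Descent data as pseudonatural transformations\<close>

text \<open>Reads a datum as a map out of the sieve: f goes to \<open>DObj d f\<close>, and the cell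
  at g has the components \<open>DIso d f g\<close>. The laws of descent data are the coherence laws
  of this map.\<close>

definition descent_psnat ::
  "('o, 'm) cat \<Rightarrow> ('o, 'm, 'm, 'm) cat_psfun \<Rightarrow> 'm set \<Rightarrow> ('m, 'm, 'm) descent \<Rightarrow> ('o, 'm, 'm, 'm) cat_psnat" where
  "descent_psnat C F S d = (let t = \<lambda>V. \<lparr>FDom = discrete_cat (sections C S V), FCod = PObj F V,
       FObj = restrict (DObj d) (sections C S V), FArr = restrict (\<lambda>f. Ident (PObj F V) (DObj d f)) (sections C
         S V)\<rparr> in
     \<lparr>TDom = sieve_psfun C S, TCod = F, TAt = restrict t (Obj C),
      TCell = restrict (\<lambda>g. \<lparr>NDom = comp_func (PMor F g) (t (Cod C g)), NCod = comp_func (t (Dom C g))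
        (sieve_res C S g),
        NAt = restrict (\<lambda>f. DIso d f g) (sections C S (Cod C g))\<rparr>) (Arr C)\<rparr>)"

locale descent_on = sieve_on C small U S + F: indexed_category C small F
  for C :: "('o, 'u) cat" and small :: "'u set \<Rightarrow> bool" and U :: 'o and S :: "'u set" and F ::
    "('o, 'u, 'u, 'u) cat_psfun" +
  fixes d :: "('u, 'u, 'u) descent"
  assumes descent: "is_descent C F S d"
begin

abbreviation \<sigma> where "\<sigma> \<equiv> descent_psnat C F S d"

lemma descent_simps:
  "f \<in> S \<Longrightarrow> DObj d f \<in> Obj (PObj F (Dom C f))"
  "\<lbrakk>f \<in> S; g \<in> Arr C; Cod C g = Dom C f\<rbrakk> \<Longrightarrow> DIso d f g \<in> hom (PObj F (Dom C g)) (res_obj F g (DObj d f)) (DObj d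
    (f \<cdot>[C] g))"
  "\<lbrakk>f \<in> S; g \<in> Arr C; Cod C g = Dom C f\<rbrakk> \<Longrightarrow> iso_arr (PObj F (Dom C g)) (DIso d f g)"
  "\<lbrakk>f \<in> S; g \<in> Arr C; h \<in> Arr C; Cod C g = Dom C f; Cod C h = Dom C g\<rbrakk> \<Longrightarrow>
    DIso d f (g \<cdot>[C] h) \<cdot>[PObj F (Dom C h)] res_comp F g h (DObj d f) = DIso d (f \<cdot>[C] g) h \<cdot>[PObj F (Dom C h)]
      res_arr F h (DIso d f g)"
  "f \<in> S \<Longrightarrow> DIso d f (Ident C (Dom C f)) \<cdot>[PObj F (Dom C f)] res_unit F (Dom C f) (DObj d f) =
    Ident (PObj F (Dom C f)) (DObj d f)"
  using descent by (auto simp: is_descent_def Let_def)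

lemma psnat_simps:
  "TDom \<sigma> = Y" "TCod \<sigma> = F"
  "V \<in> Obj C \<Longrightarrow> FDom (TAt \<sigma> V) = discrete_cat (sections C S V)" "V \<in> Obj C \<Longrightarrow> FCod (TAt \<sigma> V) = PObj F V"
  "\<lbrakk>f \<in> S; Dom C f = V\<rbrakk> \<Longrightarrow> FObj (TAt \<sigma> V) f = DObj d f"
  "\<lbrakk>f \<in> S; Dom C f = V\<rbrakk> \<Longrightarrow> FArr (TAt \<sigma> V) f = Ident (PObj F V) (DObj d f)"
  "\<lbrakk>f \<in> S; g \<in> Arr C; Cod C g = Dom C f\<rbrakk> \<Longrightarrow> NAt (TCell \<sigma> g) f = DIso d f g"
  using sieve_arr(1)[of f] by (auto simp: descent_psnat_def Let_def sections_def cat_simps)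

lemma functor_TAt:
  assumes V: "V \<in> Obj C"
  shows "is_functor (TAt \<sigma> V)"
proof -
  interpret D: category "PObj F V" using V F.category_PObj by blast
  have e: "DObj d f \<in> Obj (PObj F V)" "FObj (TAt \<sigma> V) f = DObj d f" "FArr (TAt \<sigma> V) f =
    Ident (PObj F V) (DObj d f)"
    if "f \<in> sections C S V" for f
    using that descent_simps(1)[of f] by (auto simp: sections_def psnat_simps)
  have "FObj (TAt \<sigma> V) \<in> extensional (sections C S V)" "FArr (TAt \<sigma> V) \<in> extensional (sections C S V)"
    using V by (simp_all add: descent_psnat_def Let_def)
  then show ?thesis
    using V
    by - (rule is_functorI[OF category_discrete_cat D.category_axioms],
      auto simp: psnat_simps(3,4) discrete_cat_simps hom_def D.Dom_Ident D.Cod_Ident D.Ident_in D.id_left e)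
qed

lemma data: "indexed_functor_data C small \<sigma>"
proof (intro indexed_functor_data.intro indexed_functor_data_axioms.intro)
  show "indexed_category C small (TDom \<sigma>)" "indexed_category C small (TCod \<sigma>)"
    unfolding psnat_simps by (rule indexed_category_axioms F.indexed_category_axioms)+
  show "is_functor (TAt \<sigma> V) \<and> FDom (TAt \<sigma> V) = PObj (TDom \<sigma>) V \<and> FCod (TAt \<sigma> V) = PObj (TCod \<sigma>) V" if
    "V \<in> Obj C" for V
    using functor_TAt[OF that] that by (simp add: psnat_simps sieve_psfun_simps)
  fix g assume g: "g \<in> Arr C"
  have UV: "Cod C g \<in> Obj C" "Dom C g \<in> Obj C" using g by (auto simp: cat_simps)
  interpret D: category "PObj F (Dom C g)" using UV F.category_PObj by blast
  have n: "NDom (TCell \<sigma> g) = comp_func (PMor F g) (TAt \<sigma> (Cod C g))" "NCod (TCell \<sigma> g) =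
    comp_func (TAt \<sigma> (Dom C g)) (sieve_res C S g)"
    "NAt (TCell \<sigma> g) \<in> extensional (sections C S (Cod C g))"
    using g UV by (simp_all add: descent_psnat_def Let_def)
  have nat: "DIso d f g \<cdot>[PObj F (Dom C g)] res_arr F g (Ident (PObj F (Cod C g)) (DObj d f)) =
    Ident (PObj F (Dom C g)) (DObj d (f \<cdot>[C] g)) \<cdot>[PObj F (Dom C g)] DIso d f g" if "f \<in> S" "Dom C f = Cod C
      g" for f
    using descent_simps(1)[OF that(1)] homD[OF descent_simps(2)[OF that(1) g that(2)[symmetric]]] that g
    by (simp add: F.res_simps D.id_left D.id_right)
  have "is_ntrans (TCell \<sigma> g)"
    by (rule is_ntransI[OF _ _ _ _ _ _ n(1,2), of "discrete_cat (sections C S (Cod C g))" "PObj F (Dom C g)"])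
      (use g UV n(3) nat sieve_arr descent_simps(2) in \<open>auto simp: is_functor_comp_func functor_TAt
        functor_sieve_res F.PMor_facts comp_func_simps
        psnat_simps discrete_cat_simps sections_def cat_simps sieve_res_simps\<close>)
  then show "is_ntrans (TCell \<sigma> g) \<and> NDom (TCell \<sigma> g) = comp_func (PMor (TCod \<sigma>) g) (TAt \<sigma> (Cod C g)) \<and>
      NCod (TCell \<sigma> g) = comp_func (TAt \<sigma> (Dom C g)) (PMor (TDom \<sigma>) g)"
    using n by (simp add: psnat_simps sieve_psfun_def)
qed

lemma pseudonatural: "pseudonatural (base C) (CAT small) \<sigma>"
proof (rule indexed_functor_data.pseudonaturalI[OF data], unfold psnat_simps(1,2) sieve_psfun_simps(1)
  discrete_cat_simps(1))
  show "TAt \<sigma> \<in> extensional (Obj C)" "TCell \<sigma> \<in> extensional (Arr C)" by (simp_all add: descent_psnat_def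
    Let_def)
  show "iso_arr (PObj F (Dom C g)) (NAt (TCell \<sigma> g) f)" if "g \<in> Arr C" "f \<in> sections C S (Cod C g)" for g f
    using that by (simp add: psnat_simps descent_simps sections_def)
next
  fix f g x assume [simp]: "f \<in> Arr C" "g \<in> Arr C" "Cod C g = Dom C f" and x: "x \<in> sections C S (Cod C f)"
  then have [simp]: "x \<in> S" "Cod C f = Dom C x" "x \<in> Arr C" by (auto simp: sections_def sieve_arr)
  have [simp]: "x \<cdot>[C] f \<in> S" "x \<cdot>[C] (f \<cdot>[C] g) \<in> S" by (simp_all add: sieve_arr cat_simps)
  interpret D: category "PObj F (Dom C g)" by (simp add: F.category_PObj cat_simps)
  note t = homD[OF descent_simps(2), of x f] homD[OF descent_simps(2), of "x \<cdot>[C] f" g]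
  \<comment> \<open>The comparison arrow of the sieve is an identity and is sent to an identity;
    composing with it gives the cocycle law the shape of the composition law.\<close>
  have "DIso d (x \<cdot>[C] f) g \<cdot>[PObj F (Dom C g)] res_arr F g (DIso d x f) =
    Ident (PObj F (Dom C g)) (DObj d (x \<cdot>[C] (f \<cdot>[C] g))) \<cdot>[PObj F (Dom C g)] (DIso d (x \<cdot>[C] f) g \<cdot>[PObj F (Dom
      C g)] res_arr F g (DIso d x f))"
    using t by (intro D.id_left[symmetric]) (simp_all add: F.res_simps F.fibre_simps cat_simps Comp_assoc)
  then show "NAt (TCell \<sigma> (f \<cdot>[C] g)) x \<cdot>[PObj F (Dom C g)] res_comp F f g (FObj (TAt \<sigma> (Cod C f)) x) =
      FArr (TAt \<sigma> (Dom C g)) (res_comp Y f g x) \<cdot>[PObj F (Dom C g)]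
      (NAt (TCell \<sigma> g) (res_obj Y f x) \<cdot>[PObj F (Dom C g)] res_arr F g (NAt (TCell \<sigma> f) x))"
    using descent_simps(4)[of x f g] by (simp add: psnat_simps sieve_psfun_simps cat_simps)
next
  fix V x assume "V \<in> Obj C" "x \<in> sections C S V"
  then show "NAt (TCell \<sigma> (Ident C V)) x \<cdot>[PObj F V] res_unit F V (FObj (TAt \<sigma> V) x) =
    FArr (TAt \<sigma> V) (res_unit Y V x)"
    using descent_simps(5)[of x] by (auto simp: psnat_simps sieve_psfun_simps sections_def cat_simps)
qed

end

section \<open>Fibrant prestacks over a precanonical site\<close>

locale representable_site = site C J for C :: "('o, 'u) cat" and J :: "'o \<Rightarrow> 'u set set" +
  fixes small :: "'u set \<Rightarrow> bool"
  assumes small: "smallness small" "small (Arr C)" and precanonical: "precanonical C J"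
begin

lemma sieve_on: "sieve C U S \<Longrightarrow> sieve_on C small U S"
  by (intro sieve_on.intro sieve_on_axioms.intro C.category_axioms small)

lemma prestack_sieve:
  assumes "U \<in> Obj C" "sieve C U S"
  shows "prestack_condition C J (sieve_psfun C S)"
proof -
  interpret sieve_on C small U S by (rule sieve_on[OF assms(2)])
  interpret indexed_site C J small Y ..
  show ?thesis
    unfolding prestack_iff_glues by (rule glues_sieve[OF sieve_on_axioms site_axioms precanonical assms(1)])
qed

text \<open>The representable of U enters as the pseudofunctor of this sieve, so that it and its
  subfunctors share one construction.\<close>

abbreviation maximal_sieve where "maximal_sieve U \<equiv> {f \<in> Arr C. Cod C f = U}"

text \<open>The inclusion of \<open>S\<close> into the maximal sieve, as a descent datum of the latter.\<close>

definition inclusion where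
  "inclusion S = \<lparr>DObj = restrict (\<lambda>f. f) S, DIso = (\<lambda>f g. if f \<in> S \<and> g \<in> Arr C \<and> Cod C g =
    Dom C f then f \<cdot>[C] g else undefined)\<rparr>"

lemma sieve_maximal: "sieve C U (maximal_sieve U)"
  by (auto simp: sieve_def C.Comp_in C.Cod_Comp)

lemma descent_inclusion:
  assumes S: "sieve C U S"
  shows "descent_on C small U S (sieve_psfun C (maximal_sieve U)) (inclusion S)"
proof -
  interpret S: sieve_on C small U S by (rule sieve_on[OF S])
  interpret M: sieve_on C small U "maximal_sieve U" by (rule sieve_on[OF sieve_maximal])
  have "is_descent C M.Y S (inclusion S)"
    using S.sieve_arr unfolding is_descent_def Let_def
    by (auto simp: inclusion_def M.sieve_psfun_simps hom_discrete_cat iso_discrete_cat discrete_cat_simps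
      sections_def
        S.cat_simps C.Comp_assoc C.Comp_Ident_right)
  then show ?thesis
    by (intro descent_on.intro descent_on_axioms.intro S.sieve_on_axioms M.indexed_category_axioms)
qed

text \<open>For b in the maximal sieve the pullback of S along b covers, and each f in it satisfies
  \<open>b \<cdot> f \<in> S\<close>; the local isomorphisms are then identities. Full faithfulness
  comes from discreteness of the fibres.\<close>

lemma weak_equivalence_inclusion:
  assumes U: "U \<in> Obj C" and S: "S \<in> J U"
  shows "descent_psnat C (sieve_psfun C (maximal_sieve U)) S (inclusion S) \<in> local_weak_equivalences small C J"
proof -
  note sv = J.covers_sieve[OF U S]
  interpret descent_on C small U S "sieve_psfun C (maximal_sieve U)" "inclusion S" by (rule descent_inclusion[OF
    sv])
  interpret M: sieve_on C small U "maximal_sieve U" by (rule sieve_on[OF sieve_maximal])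
  have o: "DObj (inclusion S) f = f" if "f \<in> S" for f using that by (simp add: inclusion_def)
  have "fully_faithful (TAt \<sigma> V)" if V: "V \<in> Obj C" for V
    using functor_TAt[OF V] V o unfolding fully_faithful_def
    by (auto simp: psnat_simps discrete_cat_simps hom_discrete_cat sections_def M.sieve_psfun_simps(1)
      bij_betw_def inj_on_def image_def sieve_arr)
  moreover have "\<exists>R\<in>J V. \<forall>f\<in>R. \<exists>a\<in>Obj (PObj (TDom \<sigma>) (Dom C f)).
        \<exists>u\<in>hom (PObj (TCod \<sigma>) (Dom C f)) (FObj (TAt \<sigma> (Dom C f)) a) (res_obj (TCod \<sigma>) f b).
          iso_arr (PObj (TCod \<sigma>) (Dom C f)) u" if V: "V \<in> Obj C" and b: "b \<in> Obj (PObj (TCod \<sigma>) V)" for V b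
  proof (rule bexI ballI)+
    have b': "b \<in> Arr C" "Cod C b = U" "Dom C b = V"
      using b by (auto simp: psnat_simps M.sieve_psfun_simps(1) discrete_cat_simps sections_def)
    show "pullback_sieve C b S \<in> J V" using J.covers_stable[of b S] S b' by simp
    fix f assume "f \<in> pullback_sieve C b S"
    then have f: "f \<in> Arr C" "Cod C f = V" "b \<cdot>[C] f \<in> S" using b' by (auto simp: pullback_sieve_def)
    show "b \<cdot>[C] f \<in> Obj (PObj (TDom \<sigma>) (Dom C f))"
      "b \<cdot>[C] f \<in> hom (PObj (TCod \<sigma>) (Dom C f)) (FObj (TAt \<sigma> (Dom C f)) (b \<cdot>[C] f)) (res_obj (TCod \<sigma>) f b)"
      "iso_arr (PObj (TCod \<sigma>) (Dom C f)) (b \<cdot>[C] f)"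
      using f b' by (simp_all add: psnat_simps sieve_psfun_simps(1) M.sieve_psfun_simps(1,2) discrete_cat_simps
        sections_def cat_simps o
        hom_discrete_cat iso_discrete_cat)
  qed
  ultimately show ?thesis
    unfolding local_weak_equivalences_def
    using pseudonatural prestack_sieve[OF U sv] prestack_sieve[OF U sieve_maximal] by (simp add: PreSt_simps
      psnat_simps(1,2))
qed

text \<open>The invertible modification \<open>\<Gamma>\<close> that accompanies the extension l
  compares the given datum with the values of l on S, and the cells of l compare these values with
  the restrictions of one object.\<close>

lemma effective_if_fibrant:
  assumes fib: "fibrant (PreSt small C J) (local_weak_equivalences small C J) F"
  shows "indexed_site.effective C J F"
proof -
  have F: "pseudofunctor (base C) (CAT small) F" "prestack_condition C J F" using fib by (simp_all add:
    fibrant_def PreSt_simps)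
  interpret F: indexed_site C J small F
    by (intro indexed_site.intro site_axioms indexed_category.intro indexed_category_axioms.intro
      C.category_axioms F(1))
  show ?thesis
    unfolding F.effective_def
  proof (intro ballI allI impI)
    fix U S d assume U: "U \<in> Obj C" and S: "S \<in> J U" and d: "is_descent C F S d"
    note sv = J.covers_sieve[OF U S]
    let ?M = "sieve_psfun C (maximal_sieve U)"
    interpret S: sieve_on C small U S by (rule sieve_on[OF sv])
    interpret M: sieve_on C small U "maximal_sieve U" by (rule sieve_on[OF sieve_maximal])
    interpret D: descent_on C small U S F d
      by (intro descent_on.intro descent_on_axioms.intro S.sieve_on_axioms F.indexed_category_axioms d)
    interpret I: descent_on C small U S ?M "inclusion S" by (rule descent_inclusion[OF sv])
    let ?i = "I.\<sigma>" and ?h = "D.\<sigma>" and ?K = "PreSt small C J"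
    have "?h \<in> hom (cat1 ?K) (TDom ?i) F"
      using D.pseudonatural F(2) prestack_sieve[OF U sv] by (simp add: hom_def cat1_def PreSt_simps
        D.psnat_simps(1,2) I.psnat_simps(1))
    then obtain l where l: "l \<in> hom (cat1 ?K) (TCod ?i) F" "isomorphic_mors ?K ?h (l \<odot>[?K] ?i)"
      using fib weak_equivalence_inclusion[OF U S] unfolding fibrant_def PreSt_simps(3,4) by blast
    then have l': "pseudonatural (base C) (CAT small) l" "TDom l = ?M" "TCod l = F"
      by (simp_all add: hom_def cat1_def PreSt_simps I.psnat_simps(2))
    obtain \<Gamma> where \<Gamma>: "modification (base C) (CAT small) \<Gamma>" "MDom \<Gamma> = ?h" "MCod \<Gamma> =
      comp_psnat (base C) (CAT small) l ?i"
      "\<And>V. V \<in> Obj C \<Longrightarrow> invertible_cell (CAT small) (MAt \<Gamma> V)"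
      using l(2) unfolding PreSt_simps(5) unfolding PreSt_def isomorphic_mors_ps[OF C.category_axioms] by blast
    interpret l: indexed_functor C small l using l'(1) by (simp add: indexed_functor_def
      indexed_functor_axioms_def C.category_axioms)
    interpret i: indexed_functor C small ?i using I.pseudonatural by (simp add: indexed_functor_def
      indexed_functor_axioms_def C.category_axioms)
    interpret h: indexed_functor C small ?h using D.pseudonatural by (simp add: indexed_functor_def
      indexed_functor_axioms_def C.category_axioms)
    interpret li: composable C small ?i l
      by (intro composable.intro composable_axioms.intro i.indexed_functor_axioms l.indexed_functor_axioms)
        (simp add: l' I.psnat_simps(2))
    interpret pr: indexed_functor_pair C small ?h li.comp
      by (intro indexed_functor_pair.intro indexed_functor_pair_axioms.intro h.indexed_functor_axioms
        li.indexed_functor_comp)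
        (simp_all add: comp_psnat_def l' D.psnat_simps(1,2) I.psnat_simps(1))
    interpret m: modification "base C" "CAT small" \<Gamma> by (rule \<Gamma>(1))
    have nt: "is_ntrans (MAt \<Gamma> V) \<and> NDom (MAt \<Gamma> V) = TAt ?h V \<and> NCod (MAt \<Gamma> V) = TAt li.comp V" if "V \<in> Obj C"
      for V
      using m.MAt_in[of V] that \<Gamma>(2,3) by (simp add: base_simps hom_def vcat_def CAT_simps)
    have o: "DObj (inclusion S) f = f" "\<lbrakk>g \<in> Arr C; Cod C g = Dom C f\<rbrakk> \<Longrightarrow> DIso (inclusion S) f g = f \<cdot>[C] g" if
      "f \<in> S" for f g
      using that by (simp_all add: inclusion_def)
    \<comment> \<open>The inclusion maps to a discrete fibre, so its cells are identities and the
      composite with l has the cells of l. The modification law then relates them to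
      \<open>DIso d\<close>.\<close>
    have nat: "NAt (MAt \<Gamma> (Dom C g)) (f \<cdot>[C] g) \<cdot>[PObj F (Dom C g)] DIso d f g =
      l.tcell g f \<cdot>[PObj F (Dom C g)] res_arr F g (NAt (MAt \<Gamma> (Dom C f)) f)" if f: "f \<in> S" and g: "g \<in> Arr
        C" "Cod C g = Dom C f" for f g
    proof -
      have fa: "f \<in> Arr C" "Cod C f = U" and fg: "f \<cdot>[C] g \<in> Arr C" "Dom C (f \<cdot>[C] g) = Dom C g"
        "Cod C (f \<cdot>[C] g) = U"
        using S.sieve_arr[OF f] g by (simp_all add: S.cat_simps)
      have V: "Dom C g \<in> Obj C" using g by (simp add: S.cat_simps)
      interpret B: category "PObj F (Dom C g)" using V F.category_PObj by blast
      have fP: "f \<in> Obj (h.P (Cod C g))" "f \<in> Obj (i.P (Cod C g))"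
        using f g by (simp_all add: D.psnat_simps(1) I.psnat_simps(1) S.sieve_psfun_simps(1) discrete_cat_simps
          sections_def)
      have fM: "f \<in> Obj (l.P (Cod C g))" "f \<cdot>[C] g \<in> Obj (l.P (Dom C g))"
        using fa fg g by (simp_all add: l' M.sieve_psfun_simps(1) discrete_cat_simps sections_def)
      have id: "Ident (l.P (Dom C g)) (f \<cdot>[C] g) = f \<cdot>[C] g" by (simp add: l' M.sieve_psfun_simps(1)
        discrete_cat_simps)
      have r: "res_obj (TDom l) g f = f \<cdot>[C] g" using fa g by (simp add: l' M.sieve_psfun_simps)
      note lt = l.tcell_simps[OF g(1) refl fM(1), unfolded r l'(3)]
      have c: "NAt (TCell li.comp g) f = l.tcell g f"
        using li.comp_tcell[OF g(1) fP(2)] B.id_left[OF lt(1,3)] l.app_simps(5)[OF V fM(2), unfolded id l'(3)] f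
          g
        by (simp add: I.psnat_simps o l' )
      have "NAt (MAt \<Gamma> (Dom C g)) (res_obj (TDom ?h) g f) \<cdot>[h.Q (Dom C g)] h.tcell g f =
        NAt (TCell li.comp g) f \<cdot>[h.Q (Dom C g)] res_arr (TCod ?h) g (NAt (MAt \<Gamma> (Cod C g)) f)"
        using pr.natural_components[OF \<Gamma>(2,3) nt g(1)] m.MAt_natural[of g] g(1) fP(1) by (simp add: base_simps)
      then show ?thesis using f g c by (simp add: D.psnat_simps S.sieve_psfun_simps)
    qed
    let ?m = "\<lambda>f. NAt (MAt \<Gamma> (Dom C f)) f" and ?A = "\<lambda>f. PObj F (Dom C f)" and ?u = "Ident C U"
    have m: "?m f \<in> Arr (?A f)" "Dom (?A f) (?m f) = DObj d f" "Cod (?A f) (?m f) = l.app (Dom C f) f"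
      "iso_arr (?A f) (?m f)" if f: "f \<in> S" for f
    proof -
      have V: "Dom C f \<in> Obj C" using S.sieve_arr[OF f] by (simp add: S.cat_simps)
      note n = nt[OF V]
      have fP: "f \<in> Obj (h.P (Dom C f))" "f \<in> Obj (i.P (Dom C f))"
        using f by (simp_all add: D.psnat_simps(1) I.psnat_simps(1) S.sieve_psfun_simps(1) discrete_cat_simps
          sections_def)
      show "?m f \<in> Arr (?A f)" "Dom (?A f) (?m f) = DObj d f" "Cod (?A f) (?m f) = l.app (Dom C f) f"
        "iso_arr (?A f) (?m f)"
        using is_ntransD(6-8)[of "MAt \<Gamma> (Dom C f)" f] n h.TAt_facts[OF V] fP f \<Gamma>(4)[OF V] i.TAt_facts[OF V]
        by (simp_all add: invertible_cell_CAT li.comp_at[OF V] comp_func_simps D.psnat_simps I.psnat_simps o)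
    qed
    define x where "x = l.app U ?u"
    have uM: "?u \<in> Obj (l.P U)" using U by (simp add: l' M.sieve_psfun_simps(1) discrete_cat_simps sections_def
      S.cat_simps)
    have lt: "l.tcell f ?u \<in> Arr (?A f)" "Dom (?A f) (l.tcell f ?u) = res_obj F f x"
      "Cod (?A f) (l.tcell f ?u) = l.app (Dom C f) f" "iso_arr (?A f) (l.tcell f ?u)"
      if f: "f \<in> Arr C" "Cod C f = U" for f
      using l.tcell_simps[OF f(1) refl, of ?u] l.iso_tcell[OF f(1) refl, of ?u] uM U f C.Comp_Ident_left[OF
        f(1)]
      by (simp_all add: l' x_def M.sieve_psfun_simps S.cat_simps)
    \<comment> \<open>The cell of l at the identity leads from the restriction of x to the value of
      l at f, and the inverse component of \<open>\<Gamma>\<close> from there to the datum.\<close>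
    let ?p = "\<lambda>f. inv_arr (?A f) (?m f) \<cdot>[?A f] l.tcell f ?u"
    have x: "x \<in> Obj (PObj F U)" using l.app_simps(1)[OF U uM] by (simp add: x_def l')
    show "\<exists>x\<in>Obj (PObj F U). \<exists>\<phi>. \<forall>f\<in>S. \<phi> f \<in> hom (?A f) (res_obj F f x) (DObj d f) \<and> iso_arr (?A f) (\<phi> f) \<and>
       (\<forall>g\<in>Arr C. Cod C g = Dom C f \<longrightarrow> \<phi> (f \<cdot>[C] g) \<cdot>[?A g] res_comp F f g x = DIso d f g \<cdot>[?A g] res_arr F g (\<phi>
         f))"
    proof (intro bexI[OF _ x] exI[of _ ?p] ballI conjI impI)
      fix f assume f: "f \<in> S"
      note fa = S.sieve_arr[OF f]
      interpret A: category "?A f" using fa by (simp add: F.category_PObj C.Dom_in)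
      note mf = m[OF f] A.inv_arr_simps[OF m(4)[OF f]] lt[OF fa(1,2)]
      show "?p f \<in> hom (?A f) (res_obj F f x) (DObj d f)" "iso_arr (?A f) (?p f)"
        using mf A.iso_arr_inv_arr A.iso_arr_comp by (simp_all add: hom_def A.Comp_in A.Dom_Comp A.Cod_Comp)
      fix g assume g: "g \<in> Arr C" "Cod C g = Dom C f"
      note fg = fa(3)[OF g]
      have [simp]: "Dom C (f \<cdot>[C] g) = Dom C g" using g fa by (simp add: C.Dom_Comp)
      interpret B: category "?A g" using g by (simp add: F.category_PObj C.Dom_in)
      note th = homD[OF D.descent_simps(2)[OF f g]]
      note mg = m[OF fg, simplified] B.inv_arr_simps[OF m(4)[OF fg, simplified]] lt[OF S.sieve_arr(1,2)[OF fg],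
        simplified]
      have r: "?m f \<cdot>[?A f] ?p f = l.tcell f ?u" using A.inv_comp_cancel[OF m(4)[OF f]] mf by simp
      have fM: "f \<cdot>[C] g \<in> Obj (l.P (Dom C g))"
        using S.sieve_arr[OF fg] by (simp add: l' M.sieve_psfun_simps(1) discrete_cat_simps sections_def)
      have id: "Ident (l.P (Dom C g)) (f \<cdot>[C] g) = f \<cdot>[C] g" by (simp add: l' M.sieve_psfun_simps(1)
        discrete_cat_simps)
      have V: "Dom C g \<in> Obj C" using g by (simp add: S.cat_simps)
      have fl: "f \<in> Obj (l.P (Cod C g))" "res_obj (TDom l) g f = f \<cdot>[C] g" "res_obj (TDom l) f ?u = f"
        using fa g C.Comp_Ident_left[OF fa(1)] U by (simp_all add: l' M.sieve_psfun_simps discrete_cat_simps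
          sections_def S.cat_simps)
      have rc: "res_comp (TDom l) f g ?u = f \<cdot>[C] g"
        using fa g C.Comp_Ident_left[OF S.sieve_arr(1)[OF fg]] S.sieve_arr(2)[OF fg] U by (simp add: l'
          M.sieve_psfun_simps S.cat_simps)
      note lg = l.tcell_simps[OF g(1) refl fl(1), unfolded fl l'(3)]
      have rl: "res_arr F g (l.tcell f ?u) \<in> Arr (?A g)" "Dom (?A g) (res_arr F g (l.tcell f ?u)) =
        res_obj F g (res_obj F f x)"
        "Cod (?A g) (res_arr F g (l.tcell f ?u)) = res_obj F g (l.app (Dom C f) f)"
        using mf g by (simp_all add: F.res_simps)
      have rp: "res_arr F g (?p f) \<in> Arr (?A g)" "Cod (?A g) (res_arr F g (?p f)) = res_obj F g (DObj d f)"
        using mf g by (simp_all add: F.res_simps(2,4) A.Comp_in A.Cod_Comp)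
      have rm: "res_arr F g (?m f) \<in> Arr (?A g)" "Cod (?A g) (res_arr F g (?m f)) =
        res_obj F g (l.app (Dom C f) f)"
        "Dom (?A g) (res_arr F g (?m f)) = res_obj F g (DObj d f)"
        using mf g by (simp_all add: F.res_simps)
      have cx: "res_comp F f g x \<in> Arr (?A g)" "Cod (?A g) (res_comp F f g x) = res_obj F (f \<cdot>[C] g) x"
        using fa g x by (simp_all add: F.res_comp_simps)
      \<comment> \<open>The composition law of l at the identity of U; the comparison arrow of the
        discrete domain is an identity and disappears.\<close>
      have "l.tcell (f \<cdot>[C] g) ?u \<cdot>[?A g] res_comp F f g x = l.tcell g f \<cdot>[?A g] res_arr F g (l.tcell f ?u)"
        using l.tcell_comp[OF fa(1) g, of ?u] uM fa(2) l.app_simps(5)[OF V fM, unfolded id l'(3)] lg rl g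
          B.id_left[of "l.tcell g f \<cdot>[?A g] res_arr F g (l.tcell f ?u)" "l.app (Dom C g) (f \<cdot>[C] g)"]
        by (simp add: l'(3) rc fl x_def B.Comp_in B.Cod_Comp)
      also have "\<dots> = (l.tcell g f \<cdot>[?A g] res_arr F g (?m f)) \<cdot>[?A g] res_arr F g (?p f)"
        using F.res_simps(6)[OF g(1,2), of "?p f" "?m f"] r mf lg rp rm g by (simp add: A.Comp_in A.Cod_Comp
          B.Comp_assoc)
      also have "\<dots> = ?m (f \<cdot>[C] g) \<cdot>[?A g] (DIso d f g \<cdot>[?A g] res_arr F g (?p f))"
        using nat[OF f g, symmetric] mg th rp by (simp add: B.Comp_assoc)
      finally have "inv_arr (?A g) (?m (f \<cdot>[C] g)) \<cdot>[?A g] (l.tcell (f \<cdot>[C] g) ?u \<cdot>[?A g] res_comp F f g x) =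
        DIso d f g \<cdot>[?A g] res_arr F g (?p f)"
        using B.inv_comp_cancel(1)[OF m(4)[OF fg, simplified], of "DIso d f g \<cdot>[?A g] res_arr F g (?p f)"] mg th
          rp
        by (simp add: B.Comp_in B.Cod_Comp)
      then have "?p (f \<cdot>[C] g) \<cdot>[?A g] res_comp F f g x = DIso d f g \<cdot>[?A g] res_arr F g (?p f)"
        using mg cx by (simp add: B.Comp_assoc)
      then show "?p (f \<cdot>[C] g) \<cdot>[?A g] res_comp F f g x = DIso d f g \<cdot>[?A g] res_arr F g (?p f)" .
    qed
  qed
qed

lemma fibrant_iff_stack:
  assumes "pseudofunctor (base C) (CAT small) F"
  shows "prestack_condition C J F \<and> fibrant (PreSt small C J) (local_weak_equivalences small C J) F \<longleftrightarrow>
    stack_condition C J F"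
proof -
  interpret F: indexed_site C J small F
    by (intro indexed_site.intro site_axioms indexed_category.intro indexed_category_axioms.intro
      C.category_axioms assms)
  show ?thesis
    using F.fibrant_if_stack effective_if_fibrant F.stack_iff F.prestack_iff_glues by blast
qed

end

theorem mainTheorem3:
  fixes small :: "'u set \<Rightarrow> bool"
    and C :: "('u, 'u) cat"
    and J :: "'u \<Rightarrow> 'u set set"
  assumes "smallness small"
    and "small_category small C"
    and "has_finite_limits C"
    and "grothendieck_topology C J"
    and "precanonical C J"
  shows "equivalent_twocats (St small C J)
    (Ho (PreSt small C J) (local_weak_equivalences small C J))"
proof -
  have c: "category C" "small (Arr C)" using assms(2) by (simp_all add: small_category_def)
  interpret representable_site C J small
    by (intro representable_site.intro representable_site_axioms.intro site.intro c assms)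
  interpret two_category_pair "base C" "CAT small"
    by (intro two_category_pair.intro two_category_locally_discrete category_op_cat c two_category_CAT)
  have "Ho (PreSt small C J) (local_weak_equivalences small C J) = St small C J"
    unfolding Ho_def St_def
    unfolding PreSt_def[of small C J] full_sub_full_sub ps_presheaves_def
    by (rule full_sub_cong[OF two_category_ps])
      (use fibrant_iff_stack[unfolded PreSt_def ps_presheaves_def] in \<open>auto simp: ps_simps\<close>)
  then show ?thesis
    using equivalent_twocats_refl[of "St small C J"] two_category_full_sub[OF two_category_ps] by (simp add:
      St_def ps_presheaves_def)
qed

end
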